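(* Let the level $u>0$ of random interlacements on $\mathbb{Z}^d$ be fixed, let $d\ge 4$, and let $\varepsilon>0$ be arbitrary. Then for all large enough $\beta>1$ (depending on $d$ and $\varepsilon$) the $\beta$-biased random walk $(X_n)_{n\ge0}$, $X_0=0$, on the interlacement set $\mathcal{I}^u$ satisfies $$\limsup_{n\to\infty}\frac{\ln\|X_n\|}{\ln n}\le\varepsilon\qquad\mathbb{P}\text{-a.s.},$$ where $\mathbb{P}$ is the averaged (annealed) law under the environment conditioned on $0\in\mathcal{I}^u$.
   Context: Random interlacements. For $x\in\mathbb{Z}^d$, $d\ge 3$, let $P^{\mathrm{SRW}}_x$ be the law of simple random walk $(S_k)_{k\ge 0}$ on $\mathbb{Z}^d$ started at $x$. For finite $A\subset\mathbb{Z}^d$ let $T_A=\min\{k\ge 1:S_k\in A\}$ ($\min\emptyset=+\infty$), $e_A(x)=P^{\mathrm{SRW}}_x[T_A=\infty]\mathbf{1}_A(x)$, and $\mathrm{cap}(A)=\sum_{x\in A}e_A(x)$. The interlacement set $\mathcal{I}^u\subset\mathbb{Z}^d$ at level $u>0$ is the random set whose complement $\mathcal{V}^u=\mathbb{Z}^d\setminus\mathcal{I}^u$ (the vacant set) has the law characterized by $\mathbf{P}[A\subset\mathcal{V}^u]=\exp(-u\,\mathrm{cap}(A))$ for all finite $A\subset\mathbb{Z}^d$. Equivalently, for finite $A$, $\mathcal{I}^u\cap A$ has the law of the set of sites of $A$ visited by a Poisson($u\,\mathrm{cap}(A)$) number of independent simple random walks with independent starting points of law $e_A/\mathrm{cap}(A)$.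 The set $\mathcal{I}^u$ is a.s. connected. Write $\mathbf{P}_0[\cdot]=\mathbf{P}[\cdot\mid 0\in\mathcal{I}^u]$. Biased walk. Let $\|\cdot\|$ be the Euclidean norm, $x\cdot y$ the usual scalar product, $e_1,\dots,e_d$ the canonical basis, and $x\sim y$ if $\|x-y\|=1$. Set $c(x,y)=\beta^{\max(x\cdot e_1,\,y\cdot e_1)}$ if $x,y\in\mathcal{I}^u$ and $x\sim y$, and $c(x,y)=0$ otherwise; $\omega=\{c(x,y)\}$ is the environment. Given $\omega$, the walk $(X_n)_{n\ge0}$ is the Markov chain on $\mathcal{I}^u$ with transition probabilities $c(x,y)/\sum_z c(x,z)$; its law started at $x$ is $\mathrm{P}^\omega_x$. The averaged measure is $\mathbb{P}[\cdot]=\int \mathrm{P}^\omega_0[\cdot]\,d\mathbf{P}_0$. Convention on constants: the level $u>0$ is fixed beforehand, so the threshold on $\beta$ may depend on $u$ as well. *)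

theory Defs
  imports "HOL-Probability.Probability"
begin

section \<open>Laws of Markov chains on a countable state space\<close>

definition chain_step :: "('a \<Rightarrow> 'a pmf) \<Rightarrow> 'a \<Rightarrow> nat \<Rightarrow> (nat \<Rightarrow> 'a) \<Rightarrow> 'a measure" where
  "chain_step K x n \<omega> = measure_pmf (case n of 0 \<Rightarrow> return_pmf x | Suc m \<Rightarrow> K (\<omega> m))"

text \<open>The law, on the space of trajectories, of the Markov chain started at \<open>x\<close> with transition
  kernel \<open>K\<close>: the Ionescu-Tulcea measure of the one-step kernels \<^const>\<open>chain_step\<close>, which is
  the limit \<open>PF.lim\<close> of the locale \<^locale>\<open>Ionescu_Tulcea\<close>. Its values on cylinders are given
  by \<open>emeasure_markov_law\<close> below.\<close>

definition markov_law :: "('a \<Rightarrow> 'a pmf) \<Rightarrow> 'a \<Rightarrow> (nat \<Rightarrow> 'a) measure" where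
  "markov_law K x = projective_family.lim UNIV
     (Ionescu_Tulcea.CI (chain_step K x) (\<lambda>_. count_space UNIV)) (\<lambda>_. count_space UNIV)"

lemma Ionescu_Tulcea_chain_step:
  fixes K :: "'a::countable \<Rightarrow> 'a pmf"
  shows "Ionescu_Tulcea (chain_step K x) (\<lambda>_. count_space UNIV)"
proof (rule Ionescu_Tulcea.intro)
  fix n
  show "chain_step K x n \<in> PiM {0..<n} (\<lambda>_. count_space UNIV) \<rightarrow>\<^sub>M subprob_algebra (count_space UNIV)"
  proof (cases n)
    case 0
    then show ?thesis
      by (simp add: chain_step_def[abs_def] space_subprob_algebra measure_pmf.subprob_space_axioms)
  next
    case (Suc m)
    have "(\<lambda>\<omega>. \<omega> m) \<in> PiM {0..<n} (\<lambda>_. count_space (UNIV::'a set)) \<rightarrow>\<^sub>M count_space UNIV"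
      using Suc by (intro measurable_component_singleton) auto
    moreover have "(\<lambda>y. measure_pmf (K y)) \<in> count_space UNIV \<rightarrow>\<^sub>M subprob_algebra (count_space UNIV)"
      by (simp add: space_subprob_algebra measure_pmf.subprob_space_axioms)
    ultimately show ?thesis
      unfolding chain_step_def[abs_def] Suc by simp
  qed
next
  fix n and \<omega> :: "nat \<Rightarrow> 'a"
  assume "\<omega> \<in> space (PiM {0..<n} (\<lambda>_. count_space UNIV))"
  show "prob_space (chain_step K x n \<omega>)"
    by (simp add: chain_step_def prob_space_measure_pmf)
qed

lemma
  fixes K :: "'a::countable \<Rightarrow> 'a pmf"
  shows sets_markov_law: "sets (markov_law K x) = sets (PiM UNIV (\<lambda>_. count_space UNIV))"
    and space_markov_law: "space (markov_law K x) = UNIV"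
    and emeasure_markov_law: "emeasure (markov_law K x) {X. \<forall>i\<le>n. X i = y i} =
      (if y 0 = x then ennreal (\<Prod>i<n. pmf (K (y i)) (y (Suc i))) else 0)"
proof -
  interpret IT: Ionescu_Tulcea "chain_step K x" "\<lambda>_. count_space UNIV"
    by (rule Ionescu_Tulcea_chain_step)
  let ?M = "\<lambda>_::nat. count_space (UNIV::'a set)"
  show "sets (markov_law K x) = sets (PiM UNIV ?M)"
    unfolding markov_law_def by (rule IT.PF.sets_lim)
  show "space (markov_law K x) = UNIV"
    unfolding markov_law_def by (simp add: space_PiM)
  define B where "B n = PiE {0..<n} (\<lambda>i. {y i})" for n
  have B[measurable]: "B n \<in> sets (PiM {0..<n} ?M)" for n
    unfolding B_def by (intro sets_PiM_I_finite) auto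
  define p where "p n = emeasure (IT.C 0 n (\<lambda>_. undefined)) (B n)" for n
  have u: "(\<lambda>_. undefined) \<in> space (PiM {0..<0} ?M)"
    by (simp add: space_PiM)
  have p0: "p 0 = 1"
    using B[of 0] by (simp add: p_def emeasure_return) (simp add: B_def)
  define q where "q n = (case n of 0 \<Rightarrow> pmf (return_pmf x) (y 0) | Suc m \<Rightarrow> pmf (K (y m)) (y n))" for n
  have pS: "p (Suc n) = p n * ennreal (q n)" for n
  proof -
    have spC: "space (IT.C 0 n (\<lambda>_. undefined)) = space (PiM {0..<n} ?M)"
      using IT.space_C[OF u, of n] by simp
    have ne: "space (IT.C 0 n (\<lambda>_. undefined)) \<noteq> {}"
      by (simp add: spC space_PiM PiE_eq_empty_iff)
    have me: "IT.eP n \<in> IT.C 0 n (\<lambda>_. undefined) \<rightarrow>\<^sub>M subprob_algebra (PiM {0..<Suc n} ?M)"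
      using IT.measurable_eP[of n] IT.sets_C[OF u, of n]
      by (subst measurable_cong_sets[OF _ refl, where M' = "PiM {0..<n} ?M"]) simp_all
    have "p (Suc n) = (\<integral>\<^sup>+\<omega>. emeasure (IT.eP n \<omega>) (B (Suc n)) \<partial>IT.C 0 n (\<lambda>_. undefined))"
      unfolding p_def IT.C.simps add_0 by (rule emeasure_bind[OF ne me B])
    also have "\<dots> = (\<integral>\<^sup>+\<omega>. ennreal (q n) * indicator (B n) \<omega> \<partial>IT.C 0 n (\<lambda>_. undefined))"
    proof (rule nn_integral_cong)
      fix \<omega> assume "\<omega> \<in> space (IT.C 0 n (\<lambda>_. undefined))"
      then have \<omega>: "\<omega> \<in> space (PiM {0..<n} ?M)" by (simp add: spC)
      have "emeasure (IT.eP n \<omega>) (B (Suc n)) =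
          emeasure (chain_step K x n \<omega>) (fun_upd \<omega> n -` B (Suc n) \<inter> UNIV)"
        using IT.emeasure_eP[OF \<omega> B[of "Suc n"]] by simp
      also have "fun_upd \<omega> n -` B (Suc n) = (if \<omega> \<in> B n then {y n} else {})"
        using \<omega> by (auto simp: B_def PiE_iff space_PiM extensional_def less_Suc_eq split: if_splits)
      also have "emeasure (chain_step K x n \<omega>) ((if \<omega> \<in> B n then {y n} else {}) \<inter> UNIV) =
          ennreal (q n) * indicator (B n) \<omega>"
        by (auto simp: chain_step_def q_def B_def emeasure_pmf_single PiE_iff split: nat.split)
      finally show "emeasure (IT.eP n \<omega>) (B (Suc n)) = ennreal (q n) * indicator (B n) \<omega>" .
    qed
    also have "\<dots> = ennreal (q n) * p n"
      unfolding p_def using B[of n] IT.sets_C[OF u, of n]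
      by (subst nn_integral_cmult_indicator) auto
    finally show ?thesis by (simp add: mult.commute)
  qed
  have pn: "p (Suc n) = (if y 0 = x then ennreal (\<Prod>i<n. pmf (K (y i)) (y (Suc i))) else 0)" for n
  proof (induction n)
    case 0
    show ?case by (simp add: pS p0 q_def)
  next
    case (Suc n)
    show ?case
      by (subst pS, subst Suc)
         (auto simp: q_def ennreal_mult' mult.commute prod_nonneg)
  qed
  have "{X. \<forall>i\<le>n. X i = y i} = prod_emb UNIV ?M {0..<Suc n} (B (Suc n))"
    by (auto simp: prod_emb_def B_def space_PiM PiE_iff extensional_def less_Suc_eq_le)
  then have "emeasure (markov_law K x) {X. \<forall>i\<le>n. X i = y i} = emeasure (IT.CI {0..<Suc n}) (B (Suc n))"
    unfolding markov_law_def by (simp add: IT.lim B)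
  also have "\<dots> = emeasure (IT.C 0 (Suc n) (\<lambda>_. undefined))
      (prod_emb {0..<Suc n} ?M {0..<Suc n} (B (Suc n)))"
    by (rule IT.emeasure_CI) (simp_all add: B del: IT.C.simps)
  also have "prod_emb {0..<Suc n} ?M {0..<Suc n} (B (Suc n)) = B (Suc n)"
    using sets.sets_into_space[OF B[of "Suc n"]] by (intro prod_emb_id) (simp add: space_PiM)
  finally show "emeasure (markov_law K x) {X. \<forall>i\<le>n. X i = y i} =
      (if y 0 = x then ennreal (\<Prod>i<n. pmf (K (y i)) (y (Suc i))) else 0)"
    using pn by (simp add: p_def del: IT.C.simps)
qed

lemma sets_trajectories_eq_cylinders:
  "sets (PiM UNIV (\<lambda>_::nat. count_space (UNIV::'a::countable set))) =
     sigma_sets UNIV (insert {} (range (\<lambda>(n, y). {X. \<forall>i\<le>n. X i = y i})))"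
  (is "sets ?P = sigma_sets UNIV ?G")
proof
  show "sigma_sets UNIV ?G \<subseteq> sets ?P"
  proof -
    have "{X \<in> space ?P. \<forall>i\<le>n. X i = y i} \<in> sets ?P" for n and y :: "nat \<Rightarrow> 'a"
      by measurable
    then have "?G \<subseteq> sets ?P" by (auto simp: space_PiM)
    then show ?thesis
      using sets.sigma_sets_subset[of ?G ?P] by (simp add: space_PiM)
  qed
  show "sets ?P \<subseteq> sigma_sets UNIV ?G"
    unfolding sets_PiM_single
  proof (simp add: space_PiM, rule sigma_sets_mono, safe)
    fix i and A :: "'a set"
    have "\<exists>xs. xs ! i \<in> A \<and> (\<forall>j\<le>i. X j = xs ! j)" if "X i \<in> A" for X :: "nat \<Rightarrow> 'a"
    proof (intro exI conjI allI impI)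
      have *: "map X [0..<Suc i] ! j = X j" if "j \<le> i" for j
        using that by (subst nth_map) (simp_all del: upt_Suc)
      show "map X [0..<Suc i] ! i \<in> A" using that by (simp only: * le_refl)
      show "X j = map X [0..<Suc i] ! j" if "j \<le> i" for j by (simp only: *[OF that])
    qed
    then have "{X. X i \<in> A} = (\<Union>xs\<in>{xs. xs ! i \<in> A}. {X. \<forall>j\<le>i. X j = xs ! j})"
      by auto
    also have "\<dots> \<in> sigma_sets UNIV ?G"
    proof (rule sigma_sets_UNION)
      fix b assume "b \<in> (\<lambda>xs. {X. \<forall>j\<le>i. X j = xs ! j}) ` {xs. xs ! i \<in> A}"
      then obtain xs where "b = (case (i, (!) xs) of (n, y) \<Rightarrow> {X. \<forall>i\<le>n. X i = y i})" by auto
      then show "b \<in> sigma_sets UNIV ?G" by (blast intro: sigma_sets.Basic)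
    qed auto
    finally show "{f. f i \<in> A} \<in> sigma_sets UNIV ?G" .
  qed
qed

lemma prob_space_markov_law:
  fixes K :: "'a::countable \<Rightarrow> 'a pmf"
  shows "prob_space (markov_law K x)"
proof
  interpret IT: Ionescu_Tulcea "chain_step K x" "\<lambda>_. count_space UNIV"
    by (rule Ionescu_Tulcea_chain_step)
  interpret J: prob_space "IT.CI {}" by (rule IT.PF.prob_space_P) auto
  have "emeasure IT.PF.lim (prod_emb UNIV (\<lambda>_. count_space UNIV) {} (space (IT.CI {}))) = 1"
    using J.emeasure_space_1 by (subst IT.lim) (auto simp: IT.PF.space_P)
  also have "prod_emb UNIV (\<lambda>_. count_space UNIV) {} (space (IT.CI {})) = space (markov_law K x)"
    by (auto simp: IT.PF.space_P prod_emb_def space_PiM space_markov_law)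
  finally show "emeasure (markov_law K x) (space (markov_law K x)) = 1"
    by (simp add: markov_law_def)
qed


section \<open>The lattice and simple random walk\<close>

text \<open>The lattice is \<^typ>\<open>int ^ 'd\<close>; its dimension is \<open>CARD('d)\<close>. As \<open>ln 0 = 0\<close>
  for the logarithm on the reals, \<open>ln (euclid_norm 0) / ln n\<close> is \<open>0\<close> instead of minus infinity;
  upper bounds by a positive number on a limsup of such terms are not affected.\<close>

definition euclid_norm :: "int ^ 'd \<Rightarrow> real" where
  "euclid_norm x = norm (\<chi> i. real_of_int (x $ i))"

definition nbr :: "int ^ 'd \<Rightarrow> int ^ 'd \<Rightarrow> bool" where
  "nbr x y \<longleftrightarrow> euclid_norm (x - y) = 1"

lemma finite_nbr: "finite {y. nbr x y}"
proof -
  have "nbr x y \<Longrightarrow> \<bar>x $ i - y $ i\<bar> \<le> 1" for y i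
    using component_le_norm_cart[of "\<chi> i. real_of_int ((x - y) $ i)" i]
    unfolding nbr_def euclid_norm_def by simp
  then have "y $ i \<in> {x $ i - 1 .. x $ i + 1}" if "nbr x y" for y i
    using \<open>\<And>y i. nbr x y \<Longrightarrow> \<bar>x $ i - y $ i\<bar> \<le> 1\<close>[OF that, of i] by auto
  then have "vec_nth ` {y. nbr x y} \<subseteq> PiE UNIV (\<lambda>i. {x $ i - 1 .. x $ i + 1})"
    by auto
  then have "finite (vec_nth ` {y. nbr x y})"
    by (rule finite_subset) (intro finite_PiE; simp)
  then show ?thesis
    by (rule finite_imageD) (simp add: inj_on_def vec_nth_inject)
qed

lemma nbr_nonempty: "{y. nbr x y} \<noteq> {}"
proof -
  fix i
  have "(\<chi> j. real_of_int ((x - (x - axis i 1)) $ j)) = axis i 1"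
    by (simp add: vec_eq_iff axis_def)
  then have "nbr x (x - axis i 1)"
    unfolding nbr_def euclid_norm_def by (simp only: norm_axis_1)
  then show ?thesis by auto
qed

definition srw_law :: "int ^ 'd \<Rightarrow> (nat \<Rightarrow> int ^ 'd) measure" where
  "srw_law = markov_law (\<lambda>x. pmf_of_set {y. nbr x y})"


section \<open>Capacity and random interlacements\<close>

definition return_time :: "'a set \<Rightarrow> (nat \<Rightarrow> 'a) \<Rightarrow> enat" where
  "return_time A S = Inf {enat k |k. k \<ge> 1 \<and> S k \<in> A}"

definition equilibrium :: "(int ^ 'd) set \<Rightarrow> int ^ 'd \<Rightarrow> real" where
  "equilibrium A x = measure (srw_law x) {S. return_time A S = \<infinity>} * indicator A x"

definition cap :: "(int ^ 'd) set \<Rightarrow> real" where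
  "cap A = (\<Sum>x\<in>A. equilibrium A x)"

definition config_space :: "'a set measure" where
  "config_space = sigma UNIV (range (\<lambda>x. {I. x \<in> I}))"

text \<open>\<open>interlacement_law u Q\<close>: the probability measure \<open>Q\<close> on configurations is the law of the
  interlacement set (not of the vacant set) at level \<open>u\<close>.\<close>

definition interlacement_law :: "real \<Rightarrow> (int ^ 'd) set measure \<Rightarrow> bool" where
  "interlacement_law u Q \<longleftrightarrow> prob_space Q \<and> sets Q = sets config_space \<and>
     (\<forall>A. finite A \<longrightarrow> measure Q {I. A \<subseteq> - I} = exp (- u * cap A))"


section \<open>The biased walk\<close>

text \<open>The index \<open>e\<close> designates the coordinate along which the bias acts, so that \<open>x $ e\<close> is the
  scalar product of \<open>x\<close> with the corresponding vector of the canonical basis.\<close>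

definition conductance :: "'d \<Rightarrow> real \<Rightarrow> (int ^ 'd) set \<Rightarrow> int ^ 'd \<Rightarrow> int ^ 'd \<Rightarrow> real" where
  "conductance e \<beta> I x y =
     (if x \<in> I \<and> y \<in> I \<and> nbr x y then \<beta> powi (max (x $ e) (y $ e)) else 0)"

definition total_conductance :: "'d \<Rightarrow> real \<Rightarrow> (int ^ 'd) set \<Rightarrow> int ^ 'd \<Rightarrow> real" where
  "total_conductance e \<beta> I x = (\<Sum>z | nbr x z. conductance e \<beta> I x z)"

text \<open>Where the total conductance vanishes, i.e. outside \<open>I\<close> and at isolated points of \<open>I\<close>, the
  transition probabilities are undefined; there the walk is declared to stay put. Almost surely
  the interlacement set is infinite and connected, so that it has no isolated points.\<close>

definition biased_step :: "'d \<Rightarrow> real \<Rightarrow> (int ^ 'd) set \<Rightarrow> int ^ 'd \<Rightarrow> (int ^ 'd) pmf" where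
  "biased_step e \<beta> I x =
     (if total_conductance e \<beta> I x = 0 then return_pmf x
      else embed_pmf (\<lambda>y. conductance e \<beta> I x y / total_conductance e \<beta> I x))"

lemma pmf_biased_step:
  assumes "\<beta> > 0" "total_conductance e \<beta> I x \<noteq> 0"
  shows "pmf (biased_step e \<beta> I x) y = conductance e \<beta> I x y / total_conductance e \<beta> I x"
proof -
  let ?c = "conductance e \<beta> I x" and ?t = "total_conductance e \<beta> I x"
  have c: "?c y \<ge> 0" for y
    using assms by (simp add: conductance_def)
  then have t: "?t > 0"
    using assms sum_nonneg[of "{z. nbr x z}" ?c] by (simp add: total_conductance_def less_le)
  have "(\<integral>\<^sup>+y. ennreal (?c y / ?t) \<partial>count_space UNIV) = (\<Sum>y | nbr x y. ennreal (?c y / ?t))"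
    by (rule nn_integral_count_space') (auto simp: conductance_def finite_nbr)
  also have "\<dots> = ennreal (\<Sum>y | nbr x y. ?c y / ?t)"
    using c t by (intro sum_ennreal) simp
  also have "(\<Sum>y | nbr x y. ?c y / ?t) = 1"
    using t by (simp add: sum_divide_distrib[symmetric] total_conductance_def[symmetric])
  finally show ?thesis
    using assms c t unfolding biased_step_def by (simp add: pmf_embed_pmf)
qed

definition quenched_law ::
    "'d \<Rightarrow> real \<Rightarrow> (int ^ 'd) set \<Rightarrow> int ^ 'd \<Rightarrow> (nat \<Rightarrow> int ^ 'd) measure" where
  "quenched_law e \<beta> I = markov_law (biased_step e \<beta> I)"

text \<open>Here \<open>Q\<close> is the unconditioned law of the interlacement set; the averaging is with respect to
  \<open>Q\<close> conditioned on containing the origin.\<close>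

definition annealed_law ::
    "'d \<Rightarrow> real \<Rightarrow> (int ^ 'd) set measure \<Rightarrow> (nat \<Rightarrow> int ^ 'd) measure" where
  "annealed_law e \<beta> Q = uniform_measure Q {I. 0 \<in> I} \<bind> (\<lambda>I. quenched_law e \<beta> I 0)"

text \<open>The quenched law is measurable in the environment, so that the monadic bind above is the
  averaged measure.\<close>

lemma measurable_quenched_law:
  fixes e :: "'d::finite"
  assumes "\<beta> > 0"
  shows "(\<lambda>I. quenched_law e \<beta> I x) \<in> config_space \<rightarrow>\<^sub>M prob_algebra (PiM UNIV (\<lambda>_. count_space UNIV))"
proof (rule measurable_prob_algebra_generated[OF sets_trajectories_eq_cylinders])
  let ?G = "insert {} (range (\<lambda>(n, y). {X::nat \<Rightarrow> int ^ 'd. \<forall>i\<le>n. X i = y i}))"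
  show "Int_stable ?G"
  proof (rule Int_stableI)
    fix a b assume a: "a \<in> ?G" and b: "b \<in> ?G"
    show "a \<inter> b \<in> ?G"
    proof (cases "a \<inter> b = {}")
      case False
      then obtain X where X: "X \<in> a" "X \<in> b" by auto
      with a b obtain n y m z where
        ab: "a = {X. \<forall>i\<le>n. X i = y i}" "b = {X. \<forall>i\<le>m. X i = z i}" by auto
      have "a \<inter> b = (case (max n m, X) of (n, y) \<Rightarrow> {X. \<forall>i\<le>n. X i = y i})"
        using X unfolding ab by (auto simp: le_max_iff_disj)
      then show ?thesis by blast
    qed simp
  qed
  show "?G \<subseteq> Pow UNIV" by simp
  show "prob_space (quenched_law e \<beta> I x)" for I
    by (simp add: quenched_law_def prob_space_markov_law)
  show "sets (quenched_law e \<beta> I x) = sets (PiM UNIV (\<lambda>_. count_space UNIV))" for I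
    by (simp add: quenched_law_def sets_markov_law)
  have mem[measurable]: "Measurable.pred config_space (\<lambda>I. v \<in> I)" for v :: "int ^ 'd"
    by (simp add: pred_def config_space_def)
  have c[measurable]: "(\<lambda>I. conductance e \<beta> I v w) \<in> borel_measurable config_space" for v w
    unfolding conductance_def by measurable
  have t[measurable]: "(\<lambda>I. total_conductance e \<beta> I v) \<in> borel_measurable config_space" for v
    unfolding total_conductance_def by measurable
  have "pmf (biased_step e \<beta> I v) w = (if total_conductance e \<beta> I v = 0 then indicator {v} w
      else conductance e \<beta> I v w / total_conductance e \<beta> I v)" for I v w
    using assms by (auto simp: pmf_biased_step) (simp add: biased_step_def split: split_indicator)
  then have k[measurable]: "(\<lambda>I. pmf (biased_step e \<beta> I v) w) \<in> borel_measurable config_space" for v w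
    by simp
  fix A assume "A \<in> ?G"
  then consider "A = {}" | n y where "A = {X. \<forall>i\<le>n. X i = y i}" by auto
  then show "(\<lambda>I. emeasure (quenched_law e \<beta> I x) A) \<in> borel_measurable config_space"
  proof cases
    case 2
    then show ?thesis by (simp add: quenched_law_def emeasure_markov_law)
  qed simp
qed

lemma emeasure_annealed_law:
  assumes "\<beta> > 0" "sets Q = sets config_space" "B \<in> sets (PiM UNIV (\<lambda>_. count_space UNIV))"
  shows "emeasure (annealed_law e \<beta> Q) B =
    (\<integral>\<^sup>+I. emeasure (quenched_law e \<beta> I 0) B \<partial>uniform_measure Q {I. 0 \<in> I})"
  unfolding annealed_law_def
proof (rule emeasure_bind[OF _ _ assms(3)])
  have "space Q = UNIV"
    using sets_eq_imp_space_eq[OF assms(2)] by (simp add: config_space_def space_measure_of_conv)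
  then show "space (uniform_measure Q {I. 0 \<in> I}) \<noteq> {}" by simp
  show "(\<lambda>I. quenched_law e \<beta> I 0) \<in>
      uniform_measure Q {I. 0 \<in> I} \<rightarrow>\<^sub>M subprob_algebra (PiM UNIV (\<lambda>_. count_space UNIV))"
    using measurable_prob_algebraD[OF measurable_quenched_law[OF assms(1), of e 0]] assms(2)
    by (subst measurable_cong_sets[OF _ refl, where M' = config_space]) simp_all
qed

end

theory Submission
  imports Defs "HOL-Real_Asymp.Real_Asymp"
begin

text \<open>For finite \<open>W\<close> the set \<open>I \<inter> W\<close> is the trace of a Poissonian soup of finite paths: simple random
  walk paths cut off at their last visit of \<open>W\<close>, with the equilibrium measure of \<open>W\<close> as weight at both
  end points.

  A trap at \<open>a\<close> is a short entrance followed by a dead-end corridor of length \<open>L\<close> in the direction of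
  the bias whose walls are vacant. For \<open>L\<close> of order \<open>ln n / ln \<beta>\<close> a walk at \<open>a\<close> enters it and stays
  inside up to time \<open>n\<close> with a probability bounded below. A trap is created by rerouting the paths of the
  soup around the corridor and inserting a loop at \<open>a\<close>. This costs a factor of at least
  \<open>c ^ L * r ^ N\<close>, where \<open>N\<close> is the occupation of a neighbourhood of the corridor by the soup, and it does
  not disturb the past of the biased walk if the trap lies in a zone of which the walk has not seen any
  point, nor any neighbour of a point. As the walk can be trapped at essentially one place only, the
  expected sum over these fresh attempts of \<open>r ^ N\<close> is at most \<open>C * L / c ^ L\<close>, a small power of
  \<open>n\<close> when \<open>\<beta>\<close> is large.

  On the other hand, a walk which travels a distance \<open>n powr (\<epsilon> / 2)\<close> and does not backtrack far against
  the bias makes many fresh attempts. These are grouped into chains of a constant number \<open>J\<close> of attempts at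
  mutual distance a small power of \<open>n\<close>. By a union bound over all possible chains and by exponential
  moments of the occupation of \<open>J\<close> distant sleeves, each chain contains an attempt with \<open>N\<close> at most a small
  multiple of \<open>ln n\<close>. So the displacement \<open>n powr (\<epsilon> / 2)\<close> before time \<open>n\<close> has probability at most
  \<open>C * n powr - (\<epsilon> / 8)\<close>, and Borel-Cantelli along \<open>n = 2 ^ j\<close> concludes.\<close>

section \<open>Simple random walk on the lattice\<close>

text \<open>Two obstacles shape the argument. The soup has no uniform finite energy: the price
  \<open>r ^ N\<close> of moving it out of a corridor is unbounded, and its long-range dependence
  leaves no independent attempts; hence a bound on the expected sum over the attempts instead of an
  estimate of each of them. Secondly, the walk itself selects where it makes attempts, so low
  occupation is needed at all places at once. As \<open>r ^ N\<close> must remain a small power of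
  \<open>n\<close>, the threshold for \<open>N\<close> is a small multiple of \<open>ln n\<close>,
  and the bound for a single sleeve above it is only a small negative power of \<open>n\<close>, too
  weak against the number of lattice points in reach. With \<open>J\<close> distant sleeves the
  exponent is multiplied by \<open>J\<close>, while each further link of a chain costs only a small
  power of \<open>n\<close> in the count. The exponential moments must moreover be uniform in the
  length of the sleeve. Its Green potential is bounded uniformly in \<open>L\<close> because three
  coordinates transversal to the bias remain; this is where \<open>CARD('d) \<ge> 4\<close>
  enters.\<close>

lemma nbr_iff:
  fixes x y :: "int ^ 'd::finite"
  shows "nbr x y \<longleftrightarrow> (\<exists>i. y = x + axis i 1 \<or> y = x - axis i 1)"
proof
  assume "nbr x y"
  define z where "z = x - y"
  have "(\<Sum>i\<in>UNIV. (real_of_int (z $ i))\<^sup>2) = 1"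
    using \<open>nbr x y\<close> by (simp add: nbr_def euclid_norm_def norm_vec_def L2_set_def z_def)
  then have "real_of_int (\<Sum>i\<in>UNIV. (z $ i)\<^sup>2) = real_of_int 1"
    by simp
  then have s: "(\<Sum>i\<in>UNIV. (z $ i)\<^sup>2) = 1"
    unfolding of_int_eq_iff .
  then obtain i where i: "z $ i \<noteq> 0"
    by (metis (mono_tags, lifting) sum.neutral zero_neq_one zero_power2)
  have sp: "(\<Sum>i\<in>UNIV. (z $ i)\<^sup>2) = (z $ i)\<^sup>2 + (\<Sum>j\<in>UNIV - {i}. (z $ j)\<^sup>2)"
    by (rule sum.remove) auto
  have zi: "(z $ i)\<^sup>2 \<ge> 1"
    using i by (metis int_one_le_iff_zero_less zero_less_power2)
  have nn: "(\<Sum>j\<in>UNIV - {i}. (z $ j)\<^sup>2) \<ge> 0"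
    by (simp add: sum_nonneg)
  have z1: "(z $ i)\<^sup>2 = 1" and "(\<Sum>j\<in>UNIV - {i}. (z $ j)\<^sup>2) = 0"
    using s sp zi nn by linarith+
  then have z0: "z $ j = 0" if "j \<noteq> i" for j
    using that by (simp add: sum_nonneg_eq_0_iff)
  have "z $ i = 1 \<or> z $ i = -1"
    using z1 by (simp add: power2_eq_1_iff)
  then have "z = axis i 1 \<or> z = - axis i 1"
    using z0 by (auto simp: vec_eq_iff axis_def)
  then show "\<exists>i. y = x + axis i 1 \<or> y = x - axis i 1"
    unfolding z_def by (metis add_diff_cancel_left' diff_add_cancel diff_diff_eq2 diff_minus_eq_add)
next
  assume "\<exists>i. y = x + axis i 1 \<or> y = x - axis i 1"
  then obtain i where "y = x + axis i 1 \<or> y = x - axis i 1" by auto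
  then have "(\<chi> j. real_of_int ((x - y) $ j)) = axis i 1 \<or> (\<chi> j. real_of_int ((x - y) $ j)) = - axis i 1"
    by (auto simp: vec_eq_iff axis_def)
  then show "nbr x y"
    unfolding nbr_def euclid_norm_def by (metis norm_axis_1 norm_minus_cancel)
qed

lemma nbr_sym: "nbr x y \<longleftrightarrow> nbr y x"
  unfolding nbr_iff by (metis add_diff_cancel_right' diff_add_cancel)

lemma not_nbr_self [simp]: "\<not> nbr x x"
  by (simp add: nbr_def euclid_norm_def norm_vec_def L2_set_def)

lemma nbr_translate [simp]: "nbr (x + v) (y + v) \<longleftrightarrow> nbr x y"
  by (simp add: nbr_def)

lemma nbr_uminus [simp]: "nbr (- x) (- y) \<longleftrightarrow> nbr x y"
  unfolding nbr_sym[of x y] by (simp add: nbr_def)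

lemma sum_nbr:
  fixes f :: "int ^ 'd::finite \<Rightarrow> 'b::comm_monoid_add"
  shows "(\<Sum>y | nbr x y. f y) = (\<Sum>i\<in>UNIV. f (x + axis i 1) + f (x - axis i 1))"
proof -
  let ?g = "\<lambda>(i::'d, b::bool). if b then x + axis i 1 else x - axis i (1::int)"
  have inj: "inj ?g"
  proof (rule injI, clarify)
    fix i j :: 'd and b c :: bool
    assume eq: "(if b then x + axis i 1 else x - axis i 1) = (if c then x + axis j 1 else x - axis j 1)"
    then have "(if b then x + axis i 1 else x - axis i 1) $ i - x $ i
        = (if c then x + axis j 1 else x - axis j 1) $ i - x $ i"
      by simp
    then show "i = j \<and> b = c"
      by (auto simp: axis_def split: if_splits)
  qed
  have "{y. nbr x y} = ?g ` (UNIV \<times> UNIV)"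
  proof (intro set_eqI iffI)
    fix y assume "y \<in> {y. nbr x y}"
    then obtain i where "y = ?g (i, True) \<or> y = ?g (i, False)"
      by (auto simp: nbr_iff)
    then show "y \<in> ?g ` (UNIV \<times> UNIV)" by blast
  qed (auto simp: nbr_iff split: if_splits)
  then have "(\<Sum>y | nbr x y. f y) = (\<Sum>p\<in>UNIV \<times> UNIV. f (?g p))"
    using inj by (simp add: sum.reindex inj_def)
  also have "\<dots> = (\<Sum>i\<in>UNIV. \<Sum>b\<in>UNIV. f (?g (i, b)))"
    unfolding sum.cartesian_product by (intro sum.cong) auto
  also have "\<dots> = (\<Sum>i\<in>UNIV. f (x + axis i 1) + f (x - axis i 1))"
    by (simp add: UNIV_bool add.commute)
  finally show ?thesis .
qed

lemma card_nbr: "card {y. nbr x y} = 2 * CARD('d)" for x :: "int ^ 'd::finite"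
  using sum_nbr[of "\<lambda>_. 1::nat" x] by simp

definition deg :: "(int ^ 'd) itself \<Rightarrow> real" where
  "deg _ = real (2 * CARD('d))"

abbreviation (input) DEG :: "(int ^ 'd) \<Rightarrow> real" where
  "DEG (x :: int ^ 'd) \<equiv> deg TYPE(int ^ 'd)"

lemma deg_ge: "deg TYPE(int ^ 'd::finite) \<ge> 2"
  using zero_less_card_finite[where 'a='d] unfolding deg_def by linarith

lemma deg_pos [simp]: "deg TYPE(int ^ 'd::finite) > 0"
  using deg_ge[where 'd='d] by linarith

definition avgr :: "(int ^ 'd \<Rightarrow> real) \<Rightarrow> int ^ 'd \<Rightarrow> real" where
  "avgr f x = (\<Sum>y | nbr x y. f y) / DEG x"

text \<open>The version with values in \<open>ennreal\<close> is the working one, as path sums and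
  Green potentials then need no summability conditions; \<open>avgr\<close> serves where differences
  are taken.\<close>

definition avg :: "(int ^ 'd \<Rightarrow> ennreal) \<Rightarrow> int ^ 'd \<Rightarrow> ennreal" where
  "avg f x = ennreal (1 / DEG x) * (\<Sum>y | nbr x y. f y)"

lemma avg_ennreal:
  fixes f :: "int ^ 'd::finite \<Rightarrow> real"
  assumes "\<And>y. nbr x y \<Longrightarrow> f y \<ge> 0"
  shows "avg (\<lambda>y. ennreal (f y)) x = ennreal (avgr f x)"
proof -
  have "(\<Sum>y | nbr x y. ennreal (f y)) = ennreal (\<Sum>y | nbr x y. f y)"
    using assms by (intro sum_ennreal) simp
  then show ?thesis
    using deg_pos[where 'd='d] assms
    by (simp add: avg_def avgr_def sum_nonneg less_imp_le flip: ennreal_mult')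
qed

lemma avg_mono: "(\<And>y. nbr x y \<Longrightarrow> f y \<le> g y) \<Longrightarrow> avg f x \<le> avg g x"
  unfolding avg_def by (intro mult_left_mono sum_mono) auto

lemma avg_cong: "(\<And>y. nbr x y \<Longrightarrow> f y = g y) \<Longrightarrow> avg f x = avg g x"
  unfolding avg_def by (intro arg_cong2[where f="(*)"] sum.cong) auto

lemma avgr_mono: "(\<And>y. nbr x y \<Longrightarrow> f y \<le> g y) \<Longrightarrow> avgr f x \<le> avgr g (x :: int ^ 'd::finite)"
  unfolding avgr_def by (intro divide_right_mono sum_mono) (auto intro: less_imp_le)

lemma avgr_const: "avgr (\<lambda>_. a) x = a" for x :: "int ^ 'd::finite"
  using card_nbr[of x] by (simp add: avgr_def deg_def)

lemma avg_const: "avg (\<lambda>_. a) x = a" for x :: "int ^ 'd::finite"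
proof -
  have "avg (\<lambda>_. a) x = ennreal (1 / DEG x) * ennreal (DEG x) * a"
    by (simp only: avg_def sum_constant card_nbr mult.assoc deg_def ennreal_of_nat_eq_real_of_nat)
  also have "\<dots> = ennreal (1 / DEG x * DEG x) * a"
    using deg_pos[where 'd='d] by (subst ennreal_mult') (auto intro: less_imp_le)
  finally show ?thesis using deg_pos[where 'd='d] by simp
qed

lemma avg_add: "avg (\<lambda>y. f y + g y) x = avg f x + avg g x"
  by (simp add: avg_def sum.distrib distrib_left)

lemma avg_cmult: "avg (\<lambda>y. a * f y) x = a * avg f x"
  by (simp add: avg_def sum_distrib_left mult.left_commute)

lemma avg_ge_nbr:
  fixes x :: "int ^ 'd::finite"
  assumes "nbr x y"
  shows "ennreal (1 / DEG x) * f y \<le> avg f x"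
  unfolding avg_def using assms finite_nbr[of x]
  by (intro mult_left_mono member_le_sum) auto

lemma avg_SUP:
  fixes f :: "nat \<Rightarrow> int ^ 'd::finite \<Rightarrow> ennreal"
  assumes "\<And>y. incseq (\<lambda>n. f n y)"
  shows "avg (\<lambda>y. SUP n. f n y) x = (SUP n. avg (f n) x)"
proof -
  have "(\<Sum>y | nbr x y. SUP n. f n y) = (SUP n. \<Sum>y | nbr x y. f n y)"
    by (intro ennreal_SUP_sum[symmetric, OF assms, THEN trans] refl)
  then show ?thesis
    unfolding avg_def by (simp add: SUP_mult_left_ennreal)
qed

text \<open>The expectation of \<open>f\<close> at time \<open>k\<close> of simple random walk
  started at \<open>x\<close>.\<close>

fun iter :: "nat \<Rightarrow> (int ^ 'd \<Rightarrow> ennreal) \<Rightarrow> int ^ 'd \<Rightarrow> ennreal" where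
  "iter 0 f x = f x"
| "iter (Suc k) f x = avg (iter k f) x"

lemma iter_mono: "(\<And>y. f y \<le> g y) \<Longrightarrow> iter k f x \<le> iter k g x"
  by (induction k arbitrary: x) (auto intro: avg_mono)

lemma iter_Suc2: "iter (Suc k) f x = iter k (avg f) x"
  by (induction k arbitrary: x) (auto intro!: avg_cong)

lemma iter_add: "iter k (\<lambda>y. f y + g y) x = iter k f x + iter k g x"
  by (induction k arbitrary: x) (auto simp: avg_add[symmetric] intro!: avg_cong)

lemma iter_cmult: "iter k (\<lambda>y. a * f y) x = a * iter k f x"
  by (induction k arbitrary: x) (auto simp: avg_cmult[symmetric] intro!: avg_cong)

lemma iter_sum: "finite S \<Longrightarrow> iter k (\<lambda>y. \<Sum>i\<in>S. f i y) x = (\<Sum>i\<in>S. iter k (f i) x)"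
proof (induction S rule: finite_induct)
  case empty
  show ?case using iter_cmult[of k 0 "\<lambda>_. 0" x] by simp
qed (simp add: iter_add)

section \<open>Return probabilities\<close>

text \<open>The probability that simple random walk on the integers goes from \<open>z\<close> to
  \<open>0\<close> in \<open>n\<close> steps.\<close>

fun srw1 :: "nat \<Rightarrow> int \<Rightarrow> real" where
  "srw1 0 z = of_bool (z = 0)"
| "srw1 (Suc n) z = (srw1 n (z + 1) + srw1 n (z - 1)) / 2"

lemma srw1_binomial: "srw1 n z = (if even (z + int n) \<and> \<bar>z\<bar> \<le> int n
    then real (n choose (nat ((z + int n) div 2))) / 2 ^ n else 0)"
proof (induction n arbitrary: z)
  case 0
  then show ?case by auto
next
  case (Suc n)
  show ?case
  proof (cases "even (z + int (Suc n)) \<and> \<bar>z\<bar> \<le> int (Suc n)")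
    case False
    then show ?thesis
      by (auto simp: Suc.IH)
  next
    case True
    obtain k where k: "z + int (Suc n) = 2 * k" using True by (elim conjE evenE)
    have zk: "z = 2 * k - int n - 1" using k by simp
    have kr: "0 \<le> k" "k \<le> int n + 1" using True zk by auto
    obtain j where j: "k = int j" using kr by (metis nonneg_int_cases)
    have a: "srw1 n (z + 1) = real (n choose j) / 2 ^ n"
      using kr j unfolding Suc.IH zk by (auto simp: binomial_eq_0)
    have b: "srw1 n (z - 1) = (if j = 0 then 0 else real (n choose (j - 1)) / 2 ^ n)"
      using kr j unfolding Suc.IH zk by (auto simp: nat_diff_distrib)
    have "nat ((z + int (Suc n)) div 2) = j" using k j by simp
    then show ?thesis
      using True a b by (cases j) (auto simp: field_simps)
  qed
qed

text \<open>Wallis: the left-hand side decreases in \<open>m\<close>, the ratio of successive terms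
  being \<open>(2 * m + 1) * (2 * m + 3) / (2 * m + 2)\<^sup>2\<close>.\<close>

lemma central_binomial_bound:
  "(real ((2 * m) choose m) / 4 ^ m)\<^sup>2 * (2 * real m + 1) \<le> 1"
proof (induction m)
  case (Suc m)
  define c where "c = real ((2 * m) choose m) / 4 ^ m"
  have "real (Suc m) * real ((2 * Suc m) choose (Suc m)) = 2 * (2 * real m + 1) * real ((2 * m) choose m)"
  proof -
    have 1: "Suc m * (2 * Suc m choose Suc m) = 2 * Suc m * (Suc (2 * m) choose m)"
      using Suc_times_binomial_eq[of "Suc (2*m)" m] by simp
    have 2: "(Suc (2 * m) choose m) * Suc m = Suc (2 * m) * (2 * m choose m)"
      using Suc_times_binomial_add[of m m] binomial_symmetric[of m "Suc (2*m)"]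
      by (metis Suc_times_binomial_eq Suc_diff_le binomial_symmetric diff_add_inverse le_add1 mult.commute mult_2)
    have "Suc m * (Suc m * (2 * Suc m choose Suc m)) = Suc m * (2 * (Suc (2 * m) * (2 * m choose m)))"
      using 1 2 by (metis mult.assoc mult.commute)
    then have "Suc m * (2 * Suc m choose Suc m) = 2 * (Suc (2 * m) * (2 * m choose m))"
      by (metis mult_cancel1 nat.distinct(1))
    then have "real (Suc m * (2 * Suc m choose Suc m)) = real (2 * (Suc (2 * m) * (2 * m choose m)))"
      by (rule arg_cong)
    then show ?thesis by (simp add: algebra_simps)
  qed
  then have "real ((2 * Suc m) choose (Suc m)) = 2 * (2 * real m + 1) * real ((2 * m) choose m) / (real m + 1)"
    by (simp add: field_simps)
  then have e: "real ((2 * Suc m) choose (Suc m)) / 4 ^ Suc m = c * (2 * real m + 1) / (2 * real m + 2)"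
    unfolding c_def by (simp only:) (simp add: divide_simps, simp add: algebra_simps)
  have "(c * (2 * real m + 1) / (2 * real m + 2))\<^sup>2 * (2 * real (Suc m) + 1)
      = (c\<^sup>2 * (2 * real m + 1)) * (((2 * real m + 1) * (2 * real m + 3)) / (2 * real m + 2)\<^sup>2)"
  proof -
    have "c * (2 * real m + 1) / (2 * real m + 2) = c * ((2 * real m + 1) / (2 * real m + 2))" by simp
    then show ?thesis by (simp add: power_mult_distrib power_divide) (simp add: power2_eq_square algebra_simps)
  qed
  also have "\<dots> \<le> 1 * 1"
  proof (rule mult_mono)
    have "(2 * real m + 2)\<^sup>2 > 0" by (auto intro: zero_less_power)
    then show "(2 * real m + 1) * (2 * real m + 3) / (2 * real m + 2)\<^sup>2 \<le> 1"
      by (subst divide_le_eq_1_pos) (simp_all add: power2_eq_square algebra_simps)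
  qed (use Suc.IH in \<open>auto simp: c_def\<close>)
  finally show ?case unfolding e by simp
qed simp

lemma srw1_nonneg: "srw1 n z \<ge> 0"
  by (simp add: srw1_binomial)

lemma srw1_even_le: "srw1 (2 * m) z \<le> real ((2 * m) choose m) / 4 ^ m"
  using binomial_maximum'[of m] by (simp add: srw1_binomial power_mult divide_right_mono)

text \<open>Cubes, because a product of three such kernels will be bounded by the mean of their
  cubes. Each factor is of order \<open>n powr (- 1 / 2)\<close>, and the constant \<open>3\<close>
  bounds \<open>sqrt 2 ^ 3\<close>.\<close>

lemma srw1_cube_le: "srw1 n z ^ 3 \<le> 3 * (real n + 1) powr (- 3 / 2)"
proof -
  \<comment> \<open>An odd time is reduced to the preceding even one: the kernel at time
    \<open>Suc (2 * m)\<close> is the mean of two values at time \<open>2 * m\<close>.\<close>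
  obtain m where m: "n = 2 * m \<or> n = Suc (2 * m)" by (metis evenE oddE Suc_eq_plus1)
  define c where "c = real ((2 * m) choose m) / 4 ^ m"
  have c0: "c \<ge> 0" by (simp add: c_def)
  have "srw1 n z \<le> c"
    using m srw1_even_le[of m z] srw1_even_le[of m "z + 1"] srw1_even_le[of m "z - 1"]
    by (auto simp: c_def simp del: srw1.simps(1)) (simp_all add: field_simps)
  have "c\<^sup>2 \<le> 1 / (2 * real m + 1)"
    using central_binomial_bound[of m] by (simp add: c_def field_simps)
  also have "\<dots> \<le> 2 / (real n + 1)"
    using m by (auto simp: field_simps)
  finally have c2: "c\<^sup>2 \<le> 2 / (real n + 1)" .
  have "c \<le> sqrt (2 / (real n + 1))"
    using c2 real_le_rsqrt by blast
  then have "srw1 n z \<le> sqrt (2 / (real n + 1))" using \<open>srw1 n z \<le> c\<close> by linarith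
  then have "srw1 n z ^ 3 \<le> sqrt (2 / (real n + 1)) ^ 3"
    using srw1_nonneg by (rule power_mono)
  also have "\<dots> = sqrt 2 ^ 3 * (1 / (sqrt (real n + 1)) ^ 3)"
    by (simp add: real_sqrt_divide power_divide)
  also have "sqrt 2 ^ 3 = 2 * sqrt 2"
    by (simp add: power3_eq_cube)
  also have "2 * sqrt 2 * (1 / sqrt (real n + 1) ^ 3) \<le> 3 * (1 / sqrt (real n + 1) ^ 3)"
  proof (rule mult_right_mono)
    show "2 * sqrt 2 \<le> (3::real)"
      by (rule power2_le_imp_le) (auto simp: power_mult_distrib)
  qed auto
  also have "1 / sqrt (real n + 1) ^ 3 = (real n + 1) powr (- 3 / 2)"
  proof -
    have "sqrt (real n + 1) ^ 3 = (real n + 1) powr (3 / 2)"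
      by (simp add: powr_half_sqrt[symmetric] powr_power)
    then show ?thesis by (simp add: powr_minus_divide)
  qed
  finally show ?thesis by simp
qed

text \<open>\<open>binmean p k j\<close> is the mean of \<open>(j + N + 1) powr (- 3 / 2)\<close> for \<open>N\<close> binomial with parameters \<open>k\<close>
  and \<open>p\<close>: the number of steps that the walk makes along a given coordinate. By AM-GM, three coordinates
  yield a summable bound for the return probabilities.\<close>

fun binmean :: "real \<Rightarrow> nat \<Rightarrow> nat \<Rightarrow> real" where
  "binmean p 0 j = (real j + 1) powr (- 3 / 2)"
| "binmean p (Suc k) j = p * binmean p k (Suc j) + (1 - p) * binmean p k j"

lemma binmean_nonneg: "0 \<le> p \<Longrightarrow> p \<le> 1 \<Longrightarrow> binmean p k j \<ge> 0"
  by (induction k arbitrary: j) auto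

text \<open>The binomial count started at \<open>j\<close>, viewed as a chain in \<open>k\<close>,
  spends a mean time \<open>1 / p\<close> at each value from \<open>j\<close> on. So the sum over
  \<open>k\<close> is at most the tail from \<open>j\<close> of the series of
  \<open>(n + 1) powr (- 3 / 2)\<close>, divided by \<open>p\<close>.\<close>

lemma summable_binmean:
  assumes p: "0 < p" "p \<le> 1"
  shows "summable (\<lambda>k. binmean p k 0)"
proof -
  define a where "a j = (real j + 1) powr (- 3 / 2)" for j
  have a0: "a j \<ge> 0" for j by (simp add: a_def)
  have "summable (\<lambda>n. real n powr (- 3 / 2))"
    using summable_real_powr_iff[of "-3/2"] by simp
  then have sa: "summable a"
    unfolding a_def by (subst (asm) summable_Suc_iff[symmetric]) (simp add: add.commute)
  define H where "H j = (\<Sum>n. a (n + j))" for j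
  have HS: "H j = a j + H (Suc j)" for j
    unfolding H_def using suminf_split_head[of "\<lambda>n. a (n + j)"] sa summable_ignore_initial_segment[of a j]
    by (simp add: add.commute)
  have H0: "H j \<ge> 0" for j
    unfolding H_def using sa a0 by (intro suminf_nonneg) (simp_all add: summable_ignore_initial_segment)
  have *: "(\<Sum>k<N. binmean p k j) \<le> H j / p" for N j
  proof (induction N arbitrary: j)
    case 0
    then show ?case using H0 p by simp
  next
    case (Suc N)
    have "(\<Sum>k<Suc N. binmean p k j) = a j + (\<Sum>k<N. binmean p (Suc k) j)"
      by (simp only: sum.lessThan_Suc_shift) (simp add: a_def)
    also have "\<dots> = a j + (p * (\<Sum>k<N. binmean p k (Suc j)) + (1 - p) * (\<Sum>k<N. binmean p k j))"
      by (simp add: sum.distrib sum_distrib_left)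
    also have "\<dots> \<le> a j + (p * (H (Suc j) / p) + (1 - p) * (H j / p))"
      using p Suc by (intro add_left_mono add_mono mult_left_mono) auto
    also have "\<dots> = H j / p"
      using p HS[of j] by (simp add: field_simps)
    finally show ?case .
  qed
  show ?thesis
    using binmean_nonneg[of p] p *[of 0] by (intro bounded_imp_summable[where B="H 0 / p"]) (auto simp: lessThan_Suc_atMost[symmetric] simp del: sum.lessThan_Suc)
qed

section \<open>Product kernels in three coordinates\<close>

definition line_kernel :: "'d \<times> 'd \<times> 'd \<Rightarrow> int \<times> int \<times> int \<Rightarrow> nat \<Rightarrow> nat \<Rightarrow> nat \<Rightarrow> int ^ 'd \<Rightarrow> real" where
  "line_kernel = (\<lambda>(i1, i2, i3) (a1, a2, a3) n1 n2 n3 x.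
     srw1 n1 (x $ i1 - a1) * srw1 n2 (x $ i2 - a2) * srw1 n3 (x $ i3 - a3))"

lemma line_kernel_nonneg: "line_kernel I a n1 n2 n3 x \<ge> 0"
  by (auto simp: line_kernel_def srw1_nonneg split: prod.split)

text \<open>A step of the walk moves each of the three coordinates with probability
  \<open>1 / CARD('d)\<close>, which advances the clock of that coordinate only, and otherwise
  leaves the kernel unchanged. So the family of kernels is closed under averaging.\<close>

lemma avgr_line_kernel:
  fixes x :: "int ^ 'd::finite"
  assumes "i1 \<noteq> i2" "i1 \<noteq> i3" "i2 \<noteq> i3"
  shows "avgr (line_kernel (i1, i2, i3) a n1 n2 n3) x =
    1 / CARD('d) * (line_kernel (i1, i2, i3) a (Suc n1) n2 n3 x
      + line_kernel (i1, i2, i3) a n1 (Suc n2) n3 x + line_kernel (i1, i2, i3) a n1 n2 (Suc n3) x)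
    + (1 - 3 / CARD('d)) * line_kernel (i1, i2, i3) a n1 n2 n3 x"
proof -
  let ?F = "line_kernel (i1, i2, i3) a n1 n2 n3"
  let ?g = "\<lambda>i. ?F (x + axis i 1) + ?F (x - axis i 1)"
  obtain a1 a2 a3 where a: "a = (a1, a2, a3)" by (cases a) auto
  have ax: "axis i (1::int) $ j = of_bool (i = j)" for i j :: 'd
    by (auto simp: axis_def)
  have 1: "?g i1 = 2 * line_kernel (i1, i2, i3) a (Suc n1) n2 n3 x"
    using assms by (simp add: line_kernel_def a ax algebra_simps)
  have 2: "?g i2 = 2 * line_kernel (i1, i2, i3) a n1 (Suc n2) n3 x"
    using assms by (simp add: line_kernel_def a ax algebra_simps)
  have 3: "?g i3 = 2 * line_kernel (i1, i2, i3) a n1 n2 (Suc n3) x"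
    using assms by (simp add: line_kernel_def a ax algebra_simps)
  have 4: "?g i = 2 * ?F x" if "i \<in> UNIV - {i1, i2, i3}" for i
    using that by (simp add: line_kernel_def a ax)
  have c3: "card {i1, i2, i3} = 3" using assms by simp
  then have "CARD('d) \<ge> 3"
    by (metis card_mono finite subset_UNIV)
  then have c: "real (card (UNIV - {i1, i2, i3})) = real CARD('d) - 3"
    using c3 by (subst card_Diff_subset) auto
  have "(\<Sum>i\<in>UNIV. ?g i) = (\<Sum>i\<in>{i1, i2, i3}. ?g i) + (\<Sum>i\<in>UNIV - {i1, i2, i3}. ?g i)"
    by (subst sum.subset_diff[of "{i1, i2, i3}" UNIV]) (simp_all only: finite subset_UNIV add.commute)
  also have "(\<Sum>i\<in>UNIV - {i1, i2, i3}. ?g i) = (\<Sum>i\<in>UNIV - {i1, i2, i3}. 2 * ?F x)"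
    by (rule sum.cong[OF refl 4])
  also have "\<dots> = (real CARD('d) - 3) * (2 * ?F x)"
    using c by simp
  also have "(\<Sum>i\<in>{i1, i2, i3}. ?g i) = ?g i1 + ?g i2 + ?g i3"
    using assms by simp
  finally have "(\<Sum>i\<in>UNIV. ?g i) = 2 * (line_kernel (i1, i2, i3) a (Suc n1) n2 n3 x
      + line_kernel (i1, i2, i3) a n1 (Suc n2) n3 x + line_kernel (i1, i2, i3) a n1 n2 (Suc n3) x)
      + (real CARD('d) - 3) * (2 * ?F x)"
    unfolding 1 2 3 by simp
  then show ?thesis
    unfolding avgr_def sum_nbr deg_def by (simp only:) (simp add: field_simps)
qed

lemma ennreal_lincomb4:
  assumes "p \<ge> 0" "q \<ge> 0" "x \<ge> 0" "y \<ge> 0" "z \<ge> 0" "w \<ge> (0::real)"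
  shows "ennreal p * (ennreal x + (ennreal y + ennreal z)) + ennreal q * ennreal w
    = ennreal (p * (x + (y + z)) + q * w)"
  using assms by (simp add: ennreal_mult)

lemma iter_line_kernel:
  fixes x :: "int ^ 'd::finite"
  assumes "i1 \<noteq> i2" "i1 \<noteq> i3" "i2 \<noteq> i3"
  defines "p \<equiv> 1 / real CARD('d)"
  shows "iter k (\<lambda>y. ennreal (line_kernel (i1, i2, i3) a n1 n2 n3 y)) x
    \<le> ennreal (binmean p k n1 + binmean p k n2 + binmean p k n3)"
proof (induction k arbitrary: n1 n2 n3)
  case 0
  obtain a1 a2 a3 where a: "a = (a1, a2, a3)" by (cases a) auto
  \<comment> \<open>After AM-GM only the law of each single clock matters, which is binomial, and
    not their joint law. The factor \<open>1 / 3\<close> absorbs the constant of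
    \<open>srw1_cube_le\<close>.\<close>
  have amgm: "u * v * w \<le> (u ^ 3 + v ^ 3 + w ^ 3) / 3" if "u \<ge> 0" "v \<ge> 0" "w \<ge> 0" for u v w :: real
  proof -
    have "0 \<le> (u + v + w) * ((u - v)\<^sup>2 + (v - w)\<^sup>2 + (u - w)\<^sup>2)"
      using that by simp
    then show ?thesis by (simp add: power2_eq_square power3_eq_cube algebra_simps)
  qed
  have "line_kernel (i1, i2, i3) a n1 n2 n3 x \<le> (srw1 n1 (x $ i1 - a1) ^ 3
      + srw1 n2 (x $ i2 - a2) ^ 3 + srw1 n3 (x $ i3 - a3) ^ 3) / 3"
    unfolding line_kernel_def a split by (intro amgm srw1_nonneg)
  also have "\<dots> \<le> binmean p 0 n1 + binmean p 0 n2 + binmean p 0 n3"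
    using srw1_cube_le[of n1 "x $ i1 - a1"] srw1_cube_le[of n2 "x $ i2 - a2"]
      srw1_cube_le[of n3 "x $ i3 - a3"] by simp
  finally show ?case by (simp add: ennreal_leI del: binmean.simps)
next
  case (Suc k)
  let ?F = "\<lambda>n1 n2 n3 y. line_kernel (i1, i2, i3) a n1 n2 n3 y"
  have "card {i1, i2, i3} = 3" using assms by simp
  then have d3: "CARD('d) \<ge> 3"
    by (metis card_mono finite subset_UNIV)
  then have p: "0 < p" "p \<le> 1 / 3" by (auto simp: p_def field_simps)
  define q where "q = 1 - 3 * p"
  have q0: "q \<ge> 0" using p by (simp add: q_def)
  have nn: "?F n1 n2 n3 y \<ge> 0" for n1 n2 n3 y by (rule line_kernel_nonneg)
  have b0: "binmean p k j \<ge> 0" for j using p by (intro binmean_nonneg) auto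
  have "iter (Suc k) (\<lambda>y. ennreal (?F n1 n2 n3 y)) x = iter k (\<lambda>y. avg (\<lambda>z. ennreal (?F n1 n2 n3 z)) y) x"
    unfolding iter_Suc2 by simp
  also have "(\<lambda>y. avg (\<lambda>z. ennreal (?F n1 n2 n3 z)) y) =
     (\<lambda>y. ennreal p * (ennreal (?F (Suc n1) n2 n3 y) + (ennreal (?F n1 (Suc n2) n3 y)
        + ennreal (?F n1 n2 (Suc n3) y))) + ennreal q * ennreal (?F n1 n2 n3 y))"
  proof
    fix y
    have "avg (\<lambda>z. ennreal (?F n1 n2 n3 z)) y = ennreal (avgr (?F n1 n2 n3) y)"
      by (rule avg_ennreal) (rule nn)
    also have "avgr (?F n1 n2 n3) y = p * (?F (Suc n1) n2 n3 y + (?F n1 (Suc n2) n3 y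
        + ?F n1 n2 (Suc n3) y)) + q * ?F n1 n2 n3 y"
      using avgr_line_kernel[OF assms(1-3), of a n1 n2 n3 y] by (simp add: p_def q_def)
    finally show "avg (\<lambda>z. ennreal (?F n1 n2 n3 z)) y =
       ennreal p * (ennreal (?F (Suc n1) n2 n3 y) + (ennreal (?F n1 (Suc n2) n3 y)
        + ennreal (?F n1 n2 (Suc n3) y))) + ennreal q * ennreal (?F n1 n2 n3 y)"
      by (subst ennreal_lincomb4) (use p q0 nn in auto)
  qed
  also have "iter k \<dots> x = ennreal p * (iter k (\<lambda>y. ennreal (?F (Suc n1) n2 n3 y)) x
      + (iter k (\<lambda>y. ennreal (?F n1 (Suc n2) n3 y)) x + iter k (\<lambda>y. ennreal (?F n1 n2 (Suc n3) y)) x))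
      + ennreal q * iter k (\<lambda>y. ennreal (?F n1 n2 n3 y)) x"
    by (simp only: iter_add iter_cmult)
  also have "\<dots> \<le> ennreal p * (ennreal (binmean p k (Suc n1) + binmean p k n2 + binmean p k n3)
      + (ennreal (binmean p k n1 + binmean p k (Suc n2) + binmean p k n3)
      + ennreal (binmean p k n1 + binmean p k n2 + binmean p k (Suc n3))))
      + ennreal q * ennreal (binmean p k n1 + binmean p k n2 + binmean p k n3)"
    by (intro add_mono mult_left_mono Suc.IH) auto
  also have "\<dots> = ennreal (binmean p (Suc k) n1 + binmean p (Suc k) n2 + binmean p (Suc k) n3)"
    by (subst ennreal_lincomb4) (use p q0 b0 in \<open>auto simp: q_def algebra_simps\<close>)
  finally show ?case .
qed

text \<open>The target is a whole affine subspace on which only three coordinates are fixed. This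
  makes the later bounds for sleeves independent of their length.\<close>

lemma iter_line_le:
  fixes x :: "int ^ 'd::finite"
  assumes "i1 \<noteq> i2" "i1 \<noteq> i3" "i2 \<noteq> i3"
  shows "iter k (indicator {y. y $ i1 = a1 \<and> y $ i2 = a2 \<and> y $ i3 = a3}) x
    \<le> ennreal (3 * binmean (1 / real CARD('d)) k 0)"
proof -
  have "indicator {y. y $ i1 = a1 \<and> y $ i2 = a2 \<and> y $ i3 = a3} y =
      ennreal (line_kernel (i1, i2, i3) (a1, a2, a3) 0 0 0 y)" for y :: "int ^ 'd"
    by (auto simp: line_kernel_def split: split_indicator)
  then have "indicator {y. y $ i1 = a1 \<and> y $ i2 = a2 \<and> y $ i3 = a3} =
      (\<lambda>y::int ^ 'd. ennreal (line_kernel (i1, i2, i3) (a1, a2, a3) 0 0 0 y))"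
    by (rule ext)
  then show ?thesis
    using iter_line_kernel[OF assms, of k "(a1, a2, a3)" 0 0 0 x] by simp
qed

section \<open>Symmetry, Green function and transience\<close>

lemma avg_reflect:
  fixes x :: "int ^ 'd::finite"
  shows "avg f (w - x) = avg (\<lambda>y. f (w - y)) x"
proof -
  have n: "nbr (w - x) (w - y) \<longleftrightarrow> nbr x y" for y
    using nbr_translate[of "- x" w "- y"] by (simp add: algebra_simps)
  have "bij_betw (\<lambda>y. w - y) {y. nbr x y} {y. nbr (w - x) y}"
    by (rule bij_betwI[where g="\<lambda>y. w - y"]) (use n n[of "w - _"] in auto)
  then show ?thesis
    unfolding avg_def by (subst sum.reindex_bij_betw[symmetric]) auto
qed

lemma iter_reflect: "iter k f (w - x) = iter k (\<lambda>y. f (w - y)) (x :: int ^ 'd::finite)"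
proof (induction k arbitrary: x)
  case (Suc k)
  then show ?case by (simp add: avg_reflect)
qed simp

lemma iter_symmetric:
  fixes a x :: "int ^ 'd::finite"
  shows "iter k (indicator {a}) x = iter k (indicator {x}) a"
proof -
  have "iter k (indicator {a}) x = iter k (\<lambda>y. indicator {a} ((a + x) - y)) a"
    using iter_reflect[of k "indicator {a}" "a + x" a] by simp
  also have "(\<lambda>y. indicator {a} ((a + x) - y)) = (indicator {x} :: _ \<Rightarrow> ennreal)"
    by (auto simp: fun_eq_iff algebra_simps split: split_indicator)
  finally show ?thesis .
qed

definition green :: "(int ^ 'd \<Rightarrow> ennreal) \<Rightarrow> int ^ 'd \<Rightarrow> ennreal" where
  "green f x = (\<Sum>k. iter k f x)"

lemma green_eq_SUP: "green f x = (SUP n. \<Sum>k<n. iter k f x)"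
  unfolding green_def by (rule suminf_eq_SUP)

lemma green_unfold: "green f x = f x + avg (green f) (x :: int ^ 'd::finite)"
proof -
  have "green f x = (\<Sum>k. iter (Suc k) f x) + (\<Sum>k<1. iter k f x)"
    unfolding green_def by (subst suminf_offset[of _ 1]) auto
  also have "(\<Sum>k. iter (Suc k) f x) = avg (green f) x"
    unfolding green_def avg_def iter.simps
    by (simp add: ennreal_suminf_cmult suminf_sum)
  finally show ?thesis by (simp add: add.commute)
qed

lemma green_mono: "(\<And>y. f y \<le> g y) \<Longrightarrow> green f x \<le> green g x"
  unfolding green_def by (intro suminf_le iter_mono) auto

lemma green_sum: "finite S \<Longrightarrow> green (\<lambda>y. \<Sum>i\<in>S. f i y) x = (\<Sum>i\<in>S. green (f i) x)"
  unfolding green_def by (simp add: iter_sum suminf_sum)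

lemma green_cmult: "green (\<lambda>y. a * f y) x = a * green f x"
  unfolding green_def by (simp add: iter_cmult ennreal_suminf_cmult)

lemma green_symmetric: "green (indicator {a}) x = green (indicator {x}) (a :: int ^ 'd::finite)"
  unfolding green_def by (simp add: iter_symmetric[of _ a x])

lemma iter_green: "iter N (green f) x = (\<Sum>k. iter (k + N) f (x :: int ^ 'd::finite))"
proof (induction N arbitrary: x)
  case 0
  show ?case by (simp add: green_def)
next
  case (Suc N)
  then have "iter (Suc N) (green f) x = avg (\<lambda>y. \<Sum>k. iter (k + N) f y) x"
    by (simp cong: avg_cong)
  also have "\<dots> = (\<Sum>k. iter (k + Suc N) f x)"
    unfolding avg_def iter.simps add_Suc_right
    by (simp add: ennreal_suminf_cmult suminf_sum)
  finally show ?case .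
qed

text \<open>A summable bound for the \<open>k\<close>-step transition probabilities, uniform in both
  end points: the quantitative form of transience.\<close>

definition heat :: "(int ^ 'd) itself \<Rightarrow> nat \<Rightarrow> real" where
  "heat _ k = 3 * binmean (1 / real CARD('d)) k 0"

lemma heat_nonneg: "heat TYPE(int ^ 'd::finite) k \<ge> 0"
  unfolding heat_def by (intro mult_nonneg_nonneg binmean_nonneg) auto

lemma summable_heat: "summable (heat TYPE(int ^ 'd::finite))"
  unfolding heat_def by (intro summable_mult summable_binmean) (auto simp: field_simps)

lemma iter_singleton_le:
  fixes x a :: "int ^ 'd::finite"
  assumes "CARD('d) \<ge> 3"
  shows "iter k (indicator {a}) x \<le> ennreal (heat TYPE(int ^ 'd) k)"
proof -
  obtain S :: "'d set" where "card S = 3"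
    using assms by (meson obtain_subset_with_card_n)
  then obtain i1 i2 i3 :: 'd where i: "i1 \<noteq> i2" "i1 \<noteq> i3" "i2 \<noteq> i3"
    unfolding card_3_iff by blast
  have "iter k (indicator {a}) x \<le> iter k (indicator {y. y $ i1 = a $ i1 \<and> y $ i2 = a $ i2 \<and> y $ i3 = a $ i3}) x"
    by (rule iter_mono) (auto split: split_indicator)
  also have "\<dots> \<le> ennreal (heat TYPE(int ^ 'd) k)"
    using iter_line_le[OF i] by (simp add: heat_def)
  finally show ?thesis .
qed

lemma indicator_eq_sum_singleton:
  "finite W \<Longrightarrow> (indicator W :: 'a \<Rightarrow> ennreal) = (\<lambda>y. \<Sum>a\<in>W. indicator {a} y)"
proof (rule ext)
  fix y :: 'a assume "finite W"
  have "(\<Sum>a\<in>W. indicator {a} y) = (\<Sum>a\<in>W. if y = a then 1 else (0::ennreal))"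
    by (intro sum.cong) auto
  then show "indicator W y = (\<Sum>a\<in>W. indicator {a} y :: ennreal)"
    using \<open>finite W\<close> by (simp add: indicator_def)
qed

lemma iter_finite_le:
  fixes x :: "int ^ 'd::finite"
  assumes "CARD('d) \<ge> 3" "finite W"
  shows "iter k (indicator W) x \<le> ennreal (card W * heat TYPE(int ^ 'd) k)"
proof -
  have "iter k (indicator W) x = (\<Sum>a\<in>W. iter k (indicator {a}) x)"
    by (subst indicator_eq_sum_singleton[OF assms(2)]) (rule iter_sum[OF assms(2)])
  also have "\<dots> \<le> (\<Sum>a\<in>W. ennreal (heat TYPE(int ^ 'd) k))"
    by (intro sum_mono iter_singleton_le assms)
  also have "\<dots> = ennreal (card W * heat TYPE(int ^ 'd) k)"
    by (simp add: ennreal_of_nat_eq_real_of_nat ennreal_mult' heat_nonneg)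
  finally show ?thesis .
qed

lemma suminf_ennreal_tail_le:
  assumes "\<And>k. f k \<le> ennreal (b k)" "\<And>k. b k \<ge> 0" "summable b"
  shows "(\<Sum>k. f (k + N)) \<le> ennreal (\<Sum>k. b (k + N))"
proof -
  have "(\<Sum>k. f (k + N)) \<le> (\<Sum>k. ennreal (b (k + N)))"
    by (intro suminf_le) (auto intro: assms)
  also have "\<dots> = ennreal (\<Sum>k. b (k + N))"
    using assms by (intro suminf_ennreal2) (auto simp: summable_ignore_initial_segment)
  finally show ?thesis .
qed

text \<open>\<open>iter N (green f)\<close> is the tail from \<open>N\<close> on of the convergent
  series \<open>green f\<close>. Through this lemma transience enters the uniqueness argument of
  \<open>paths_avoid\<close>.\<close>

lemma iter_green_null:
  fixes x :: "int ^ 'd::finite"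
  assumes "CARD('d) \<ge> 3" "finite W" "\<And>N. r \<le> iter N (green (indicator W)) x"
  shows "r = 0"
proof -
  define b where "b k = card W * heat TYPE(int ^ 'd) k" for k
  have sb: "summable b" and b0: "\<And>k. b k \<ge> 0"
    unfolding b_def using summable_heat[where 'd='d] heat_nonneg[where 'd='d]
    by (simp_all add: summable_mult)
  have "r \<le> ennreal (\<Sum>k. b (k + N))" for N
  proof -
    have "r \<le> (\<Sum>k. iter (k + N) (indicator W) x)"
      using assms(3)[of N] by (simp add: iter_green)
    also have "\<dots> \<le> ennreal (\<Sum>k. b (k + N))"
      by (rule suminf_ennreal_tail_le[OF _ b0 sb]) (unfold b_def, rule iter_finite_le[OF assms(1,2)])
    finally show ?thesis .
  qed
  moreover have "(\<lambda>N. ennreal (\<Sum>k. b (k + N))) \<longlonglongrightarrow> ennreal 0"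
    using suminf_exist_split2[OF sb] by (intro tendsto_ennrealI)
  ultimately have "r \<le> ennreal 0"
    by (intro LIMSEQ_le_const[of _ _ r]) auto
  then show ?thesis by simp
qed

section \<open>Escape probabilities and path sums\<close>

text \<open>The steps \<open>1\<close> to \<open>n\<close> avoid \<open>W\<close>; the starting
  point is not tested, in accordance with \<open>return_time\<close>. Hence the indicators of
  \<open>- W\<close> that accompany \<open>escape\<close> below.\<close>

fun esc :: "(int ^ 'd) set \<Rightarrow> nat \<Rightarrow> int ^ 'd \<Rightarrow> ennreal" where
  "esc W 0 x = 1"
| "esc W (Suc n) x = avg (\<lambda>y. indicator (- W) y * esc W n y) x"

definition escape :: "(int ^ 'd) set \<Rightarrow> int ^ 'd \<Rightarrow> ennreal" where
  "escape W x = (INF n. esc W n x)"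

lemma esc_le_1: "esc W n x \<le> 1" for x :: "int ^ 'd::finite"
proof (induction n arbitrary: x)
  case (Suc n)
  have "esc W (Suc n) x \<le> avg (\<lambda>_. 1) x"
    unfolding esc.simps by (intro avg_mono) (auto simp: Suc split: split_indicator)
  then show ?case by (simp add: avg_const)
qed simp

lemma esc_Suc_le: "esc W (Suc n) x \<le> esc W n x" for x :: "int ^ 'd::finite"
proof (induction n arbitrary: x)
  case 0
  show ?case using esc_le_1[of W 1 x] by simp
next
  case (Suc n)
  show ?case
    by (subst (1 2) esc.simps) (intro avg_mono mult_left_mono Suc, simp)
qed

lemma decseq_esc: "decseq (\<lambda>n. esc W n x)" for x :: "int ^ 'd::finite"
  by (intro decseq_SucI esc_Suc_le)

lemma tendsto_esc: "(\<lambda>n. esc W n x) \<longlonglongrightarrow> escape W x" for x :: "int ^ 'd::finite"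
  unfolding escape_def by (rule LIMSEQ_INF[OF decseq_esc])

lemma escape_le_1: "escape W x \<le> 1" for x :: "int ^ 'd::finite"
  unfolding escape_def by (rule INF_lower2[of 0]) auto

lemma escape_unfold: "escape W x = avg (\<lambda>y. indicator (- W) y * escape W y) x"
  for x :: "int ^ 'd::finite"
proof (rule LIMSEQ_unique)
  show "(\<lambda>n. esc W (Suc n) x) \<longlonglongrightarrow> escape W x"
    by (rule LIMSEQ_Suc[OF tendsto_esc])
  show "(\<lambda>n. esc W (Suc n) x) \<longlonglongrightarrow> avg (\<lambda>y. indicator (- W) y * escape W y) x"
    unfolding esc.simps avg_def
    by (intro ennreal_tendsto_cmult tendsto_sum tendsto_esc) (auto split: split_indicator)
qed

lemma escape_empty: "escape {} x = 1" for x :: "int ^ 'd::finite"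
proof -
  have "esc {} n x = 1" for n and x :: "int ^ 'd"
    by (induction n arbitrary: x) (simp_all add: avg_const cong: avg_cong)
  then show ?thesis by (simp add: escape_def)
qed

text \<open>A walk that does not escape visits \<open>W\<close> at some time, and
  \<open>green\<close> is the mean number of visits.\<close>

lemma escape_green_ge: "1 \<le> escape W x + green (indicator W) x" for x :: "int ^ 'd::finite"
proof -
  have *: "1 \<le> esc W n x + (\<Sum>k<n. iter (Suc k) (indicator W) x)" for n and x :: "int ^ 'd"
  proof (induction n arbitrary: x)
    case (Suc n)
    have "1 = avg (\<lambda>_. 1) x" by (simp add: avg_const)
    also have "\<dots> \<le> avg (\<lambda>y. indicator (- W) y * esc W n y
        + (indicator W y + (\<Sum>k<n. iter (Suc k) (indicator W) y))) x"
      using Suc by (intro avg_mono) (auto split: split_indicator)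
    also have "\<dots> = esc W (Suc n) x + avg (\<lambda>y. \<Sum>k<Suc n. iter k (indicator W) y) x"
      by (subst avg_add) (simp only: sum.lessThan_Suc_shift iter.simps(1) esc.simps)
    also have "avg (\<lambda>y. \<Sum>k<Suc n. iter k (indicator W) y) x = (\<Sum>k<Suc n. iter (Suc k) (indicator W) x)"
      unfolding avg_def iter.simps by (subst sum.swap) (simp only: sum_distrib_left)
    finally show ?case .
  qed simp
  have "1 \<le> esc W n x + green (indicator W) x" for n
  proof -
    have "(\<Sum>k<n. iter (Suc k) (indicator W) x) \<le> (\<Sum>k<Suc n. iter k (indicator W) x)"
      by (simp only: sum.lessThan_Suc_shift) simp
    also have "\<dots> \<le> green (indicator W) x"
      unfolding green_def by (intro sum_le_suminf) auto
    finally show ?thesis using *[where n=n and x=x] by (meson add_left_mono order_trans)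
  qed
  moreover have "(\<lambda>n. esc W n x + green (indicator W) x) \<longlonglongrightarrow> escape W x + green (indicator W) x"
    by (intro tendsto_add tendsto_esc tendsto_const)
  ultimately show ?thesis
    by (intro LIMSEQ_le_const[of _ _ 1]) auto
qed

text \<open>The sum over the paths from \<open>x\<close>, weighted by their probabilities and by \<open>e\<close> at their end points;
  \<open>pathsum e n\<close> is restricted to paths with at most \<open>n\<close> vertices.\<close>

fun pathsum :: "(int ^ 'd \<Rightarrow> ennreal) \<Rightarrow> nat \<Rightarrow> int ^ 'd \<Rightarrow> ((int ^ 'd) list \<Rightarrow> ennreal) \<Rightarrow> ennreal" where
  "pathsum e 0 x g = 0"
| "pathsum e (Suc n) x g = e x * g [x] + avg (\<lambda>y. pathsum e n y (\<lambda>\<gamma>. g (x # \<gamma>))) x"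

definition paths :: "(int ^ 'd \<Rightarrow> ennreal) \<Rightarrow> int ^ 'd \<Rightarrow> ((int ^ 'd) list \<Rightarrow> ennreal) \<Rightarrow> ennreal" where
  "paths e x g = (SUP n. pathsum e n x g)"

lemma pathsum_mono: "(\<And>\<gamma>. g (x # \<gamma>) \<le> g' (x # \<gamma>)) \<Longrightarrow> pathsum e n x g \<le> pathsum e n x g'"
proof (induction n arbitrary: x g g')
  case (Suc n)
  show ?case unfolding pathsum.simps
    by (intro add_mono mult_left_mono avg_mono Suc) (auto simp: Suc.prems)
qed simp

lemma pathsum_Suc_ge: "pathsum e n x g \<le> pathsum e (Suc n) x g"
proof (induction n arbitrary: x g)
  case (Suc n)
  show ?case
    by (subst (1 2) pathsum.simps) (intro add_mono mult_left_mono avg_mono Suc order_refl)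
qed simp

lemma incseq_pathsum: "incseq (\<lambda>n. pathsum e n x g)"
  by (intro incseq_SucI pathsum_Suc_ge)

lemma pathsum_le_paths: "pathsum e n x g \<le> paths e x g"
  unfolding paths_def by (rule SUP_upper) auto

lemma paths_mono: "(\<And>\<gamma>. g (x # \<gamma>) \<le> g' (x # \<gamma>)) \<Longrightarrow> paths e x g \<le> paths e x g'"
  unfolding paths_def by (intro SUP_mono') (rule pathsum_mono)

lemma paths_unfold:
  "paths e x g = e x * g [x] + avg (\<lambda>y. paths e y (\<lambda>\<gamma>. g (x # \<gamma>))) (x :: int ^ 'd::finite)"
proof -
  have "paths e x g = (SUP n. pathsum e (Suc n) x g)"
    unfolding paths_def
    by (intro LIMSEQ_unique[OF LIMSEQ_Suc[OF LIMSEQ_SUP[OF incseq_pathsum]] LIMSEQ_SUP])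
       (intro incseq_SucI pathsum_Suc_ge)
  also have "\<dots> = e x * g [x] + (SUP n. avg (\<lambda>y. pathsum e n y (\<lambda>\<gamma>. g (x # \<gamma>))) x)"
    unfolding pathsum.simps by (rule ennreal_SUP_add_right[symmetric]) simp
  also have "(SUP n. avg (\<lambda>y. pathsum e n y (\<lambda>\<gamma>. g (x # \<gamma>))) x) = avg (\<lambda>y. paths e y (\<lambda>\<gamma>. g (x # \<gamma>))) x"
    unfolding paths_def by (intro avg_SUP[symmetric] incseq_pathsum)
  finally show ?thesis .
qed

lemma pathsum_add: "pathsum e n x (\<lambda>\<gamma>. g \<gamma> + h \<gamma>) = pathsum e n x g + pathsum e n x h"
proof (induction n arbitrary: x g h)
  case (Suc n)
  show ?case by (simp add: Suc avg_add distrib_left ac_simps)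
qed simp

lemma pathsum_cmult: "pathsum e n x (\<lambda>\<gamma>. a * g \<gamma>) = a * pathsum e n x g"
proof (induction n arbitrary: x g)
  case (Suc n)
  show ?case by (simp add: Suc avg_cmult distrib_left) (simp add: ac_simps)
qed simp

lemma paths_add: "paths e x (\<lambda>\<gamma>. g \<gamma> + h \<gamma>) = paths e x g + paths e x h"
  unfolding paths_def pathsum_add by (intro ennreal_SUP_add incseq_pathsum)

lemma paths_cmult: "paths e x (\<lambda>\<gamma>. a * g \<gamma>) = a * paths e x g"
  unfolding paths_def pathsum_cmult by (rule SUP_mult_left_ennreal[symmetric])

lemma paths_const: "paths e x (\<lambda>_. 1) = green e (x :: int ^ 'd::finite)"
proof -
  have "pathsum e n x (\<lambda>_. 1) = (\<Sum>k<n. iter k e x)" for n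
  proof (induction n arbitrary: x)
    case (Suc n)
    have "pathsum e (Suc n) x (\<lambda>_. 1) = e x + avg (\<lambda>y. \<Sum>k<n. iter k e y) x"
      by (simp add: Suc cong: avg_cong)
    also have "avg (\<lambda>y. \<Sum>k<n. iter k e y) x = (\<Sum>k<n. iter (Suc k) e x)"
      unfolding avg_def iter.simps by (subst sum.swap) (simp add: sum_distrib_left)
    finally show ?case by (simp only: sum.lessThan_Suc_shift iter.simps)
  qed simp
  then show ?thesis by (simp add: paths_def green_eq_SUP)
qed

section \<open>The equilibrium measure and last-exit decompositions\<close>

definition charge :: "(int ^ 'd) set \<Rightarrow> int ^ 'd \<Rightarrow> ennreal" where
  "charge W x = indicator W x * escape W x"

definition avoid :: "'a set \<Rightarrow> 'a list \<Rightarrow> ennreal" where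
  "avoid A \<gamma> = of_bool (set \<gamma> \<inter> A = {})"

lemma charge_le_1: "charge W x \<le> 1" for x :: "int ^ 'd::finite"
  using escape_le_1[of W x] by (auto simp: charge_def split: split_indicator)

lemma charge_add_compl: "charge W x + indicator (- W) x * escape W x = escape W x"
  by (auto simp: charge_def split: split_indicator)

lemma avgr_enn2real:
  fixes f :: "int ^ 'd::finite \<Rightarrow> ennreal"
  assumes "\<And>y. f y < \<top>"
  shows "avgr (\<lambda>y. enn2real (f y)) x = enn2real (avg f x)"
proof -
  have "avg f x = avg (\<lambda>y. ennreal (enn2real (f y))) x"
    using assms by (intro avg_cong) auto
  also have "\<dots> = ennreal (avgr (\<lambda>y. enn2real (f y)) x)"
    by (rule avg_ennreal) auto
  finally have "avg f x = ennreal (avgr (\<lambda>y. enn2real (f y)) x)" .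
  moreover have "avgr (\<lambda>y. enn2real (f y)) x \<ge> 0"
    using avgr_mono[of x "\<lambda>_. 0" "\<lambda>y. enn2real (f y)"] by (simp add: avgr_const)
  ultimately show ?thesis by simp
qed

text \<open>Both sides are bounded solutions of \<open>f = indicator (- A) * avg f\<close>; transience makes such
  a solution unique once the difference is dominated by the Green potential of \<open>W\<close>.\<close>

lemma paths_avoid:
  fixes x :: "int ^ 'd::finite"
  assumes d: "CARD('d) \<ge> 3" and W: "finite W" and A: "A \<subseteq> W"
  shows "paths (charge W) x (avoid A) + indicator (- W) x * escape W x = indicator (- A) x * escape A x"
proof -
  \<comment> \<open>\<open>h\<close> is the probability to hit \<open>W\<close> and to avoid
    \<open>A\<close> for ever, decomposed at the last visit of \<open>W\<close>: what follows this
    visit avoids \<open>W\<close> and hence \<open>A\<close>. The function \<open>k\<close> adds the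
    walks that never hit \<open>W\<close>.\<close>
  define h where "h x = paths (charge W) x (avoid A)" for x
  define k where "k x = h x + indicator (- W) x * escape W x" for x
  define q where "q x = indicator (- A) x * escape A x" for x
  have av: "avoid A (x # \<gamma>) = indicator (- A) x * avoid A \<gamma>" for x \<gamma>
    by (auto simp: avoid_def)
  have hA: "h x = indicator (- A) x * (charge W x + avg h x)" for x
  proof -
    have "h x = charge W x * avoid A [x] + avg (\<lambda>y. paths (charge W) y (\<lambda>\<gamma>. avoid A (x # \<gamma>))) x"
      unfolding h_def by (rule paths_unfold)
    also have "avoid A [x] = indicator (- A) x"
      by (auto simp: avoid_def)
    finally show ?thesis
      unfolding av paths_cmult avg_cmult h_def by (simp add: distrib_left mult.commute)
  qed
  have kA: "k x = indicator (- A) x * avg k x" for x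
  proof (cases "x \<in> A")
    case True
    then show ?thesis using A hA[of x] by (auto simp: k_def)
  next
    case False
    then have "k x = avg h x + (charge W x + indicator (- W) x * escape W x)"
      using hA[of x] by (simp add: k_def ac_simps)
    also have "\<dots> = avg h x + avg (\<lambda>y. indicator (- W) y * escape W y) x"
      unfolding charge_add_compl by (subst escape_unfold) rule
    finally show ?thesis
      using False by (simp add: k_def[abs_def] avg_add)
  qed
  have qA: "q x = indicator (- A) x * avg q x" for x
    using escape_unfold[of A x] by (simp add: q_def[abs_def])
  have k1: "k x \<le> 1" for x
  proof -
    have *: "pathsum (charge W) n x (avoid A) + indicator (- W) x * escape W x \<le> 1" for n x
    proof (induction n arbitrary: x)
      case 0
      then show ?case using escape_le_1[of W x] by (auto split: split_indicator)
    next
      case (Suc n)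
      let ?a = "avg (\<lambda>y. pathsum (charge W) n y (avoid A)) x"
      have "pathsum (charge W) (Suc n) x (avoid A) =
          indicator (- A) x * (charge W x + ?a)"
        unfolding pathsum.simps av pathsum_cmult avg_cmult
        by (auto simp: avoid_def split: split_indicator)
      then have "pathsum (charge W) (Suc n) x (avoid A) + indicator (- W) x * escape W x
          \<le> charge W x + ?a + indicator (- W) x * escape W x"
        by (auto intro!: add_mono split: split_indicator)
      also have "\<dots> = ?a + (charge W x + indicator (- W) x * escape W x)"
        by (simp add: ac_simps)
      also have "\<dots> = ?a + avg (\<lambda>y. indicator (- W) y * escape W y) x"
        unfolding charge_add_compl by (subst escape_unfold) rule
      also have "\<dots> \<le> avg (\<lambda>_. 1) x"
        unfolding avg_add[symmetric] by (intro avg_mono Suc)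
      finally show ?case by (simp add: avg_const)
    qed
    have "k x = (SUP n. pathsum (charge W) n x (avoid A) + indicator (- W) x * escape W x)"
      unfolding k_def h_def paths_def by (rule ennreal_SUP_add_left[symmetric]) simp
    then show ?thesis using * by (simp add: SUP_least)
  qed
  have q1: "q x \<le> 1" for x
    using escape_le_1[of A x] by (auto simp: q_def split: split_indicator)
  have fin: "k x < \<top>" "q x < \<top>" for x
    using k1[of x] q1[of x] by (auto intro: le_less_trans)
  have re: "0 \<le> enn2real (q x)" "0 \<le> enn2real (k x)" "enn2real (q x) \<le> 1" "enn2real (k x) \<le> 1" for x
    using enn2real_mono[OF q1[of x]] enn2real_mono[OF k1[of x]] by auto
  define r where "r x = \<bar>enn2real (q x) - enn2real (k x)\<bar>" for x
  have r_avg: "ennreal (r x) \<le> avg (\<lambda>y. ennreal (r y)) x" for x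
  proof (cases "x \<in> A")
    case True
    then show ?thesis using kA[of x] qA[of x] by (simp add: r_def)
  next
    case False
    then have "enn2real (q x) = avgr (\<lambda>y. enn2real (q y)) x" "enn2real (k x) = avgr (\<lambda>y. enn2real (k y)) x"
      using fin kA[of x] qA[of x] by (auto simp: avgr_enn2real)
    then have "r x = \<bar>avgr (\<lambda>y. enn2real (q y) - enn2real (k y)) x\<bar>"
      by (simp add: r_def avgr_def sum_subtractf diff_divide_distrib)
    also have "\<dots> \<le> avgr r x"
      unfolding avgr_def abs_divide r_def abs_of_pos[OF deg_pos]
      by (intro divide_right_mono sum_abs less_imp_le[OF deg_pos])
    finally show ?thesis
      by (subst avg_ennreal) (auto simp: r_def)
  qed
  have r_iter: "ennreal (r x) \<le> iter N (\<lambda>y. ennreal (r y)) x" for N x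
  proof (induction N arbitrary: x)
    case (Suc N)
    have "ennreal (r x) \<le> avg (\<lambda>y. ennreal (r y)) x" by (rule r_avg)
    also have "\<dots> \<le> avg (iter N (\<lambda>y. ennreal (r y))) x" by (intro avg_mono Suc)
    finally show ?case by simp
  qed simp
  \<comment> \<open>Both functions lie between \<open>0\<close> and \<open>1\<close>, and off
    \<open>W\<close> both are at least \<open>1 - green (indicator W) x\<close>; on \<open>W\<close>
    the potential itself is at least \<open>1\<close>.\<close>
  have r_green: "ennreal (r x) \<le> green (indicator W) x" for x
  proof (cases "x \<in> W")
    case True
    have "r x \<le> 1"
      using re[of x] unfolding r_def abs_le_iff by linarith
    then have "ennreal (r x) \<le> 1" by (simp add: ennreal_le_1)
    also have "1 \<le> green (indicator W) x"
      using True by (subst green_unfold) simp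
    finally show ?thesis .
  next
    case False
    show ?thesis
    proof (cases "green (indicator W) x = \<top>")
      case nt: False
      then obtain g where g: "green (indicator W) x = ennreal g" "g \<ge> 0"
        by (cases "green (indicator W) x") auto
      have "1 \<le> escape W x + green (indicator W) x" by (rule escape_green_ge)
      also have "\<dots> \<le> k x + ennreal g"
        unfolding g(1) using False by (intro add_right_mono) (simp add: k_def)
      finally have kg: "1 \<le> k x + ennreal g" .
      have "1 \<le> escape A x + green (indicator A) x" by (rule escape_green_ge)
      also have "\<dots> \<le> q x + green (indicator W) x"
        using False A by (intro add_mono green_mono) (auto simp: q_def split: split_indicator)
      finally have qg: "1 \<le> q x + ennreal g" unfolding g(1) .
      have "1 \<le> enn2real (k x) + g" "1 \<le> enn2real (q x) + g"
        using enn2real_mono[OF kg] enn2real_mono[OF qg] fin[of x] g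
        by (simp_all add: enn2real_plus)
      then have "r x \<le> g" using re[of x] unfolding r_def abs_le_iff by linarith
      then show ?thesis using g by (simp add: ennreal_leI)
    qed simp
  qed
  have "ennreal (r x) = 0"
  proof (rule iter_green_null[OF d W])
    fix N
    have "ennreal (r x) \<le> iter N (\<lambda>y. ennreal (r y)) x" by (rule r_iter)
    also have "\<dots> \<le> iter N (green (indicator W)) x" by (intro iter_mono r_green)
    finally show "ennreal (r x) \<le> iter N (green (indicator W)) x" .
  qed
  then have "enn2real (q x) = enn2real (k x)" by (simp add: r_def)
  then have "q x = k x" using fin by (metis ennreal_enn2real)
  then show ?thesis by (simp add: q_def k_def h_def)
qed

text \<open>The case \<open>A = {}\<close>: the potential of the equilibrium measure is the
  probability to hit \<open>W\<close>, hence \<open>1\<close> on \<open>W\<close>.\<close>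

lemma green_charge:
  fixes x :: "int ^ 'd::finite"
  assumes "CARD('d) \<ge> 3" "finite W"
  shows "green (charge W) x + indicator (- W) x * escape W x = 1"
proof -
  have av: "avoid {} = (\<lambda>_. 1)" by (simp add: avoid_def fun_eq_iff)
  show ?thesis
    using paths_avoid[OF assms, of "{}" x] unfolding av paths_const by (simp add: escape_empty)
qed

lemma green_charge_le: "CARD('d) \<ge> 3 \<Longrightarrow> finite W \<Longrightarrow> green (charge W) x \<le> 1"
  for x :: "int ^ 'd::finite"
  by (metis green_charge le_iff_add)

lemma green_charge_in: "CARD('d) \<ge> 3 \<Longrightarrow> finite W \<Longrightarrow> x \<in> W \<Longrightarrow> green (charge W) x = 1"
  for x :: "int ^ 'd::finite"
  using green_charge[of W x] by simp

lemma charge_sum: "finite W \<Longrightarrow> charge W = (\<lambda>y. \<Sum>a\<in>W. charge W a * indicator {a} y)"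
proof (rule ext)
  fix y assume "finite W"
  have "(\<Sum>a\<in>W. charge W a * indicator {a} y) = (\<Sum>a\<in>W. if y = a then charge W a else 0)"
    by (intro sum.cong) auto
  then show "charge W y = (\<Sum>a\<in>W. charge W a * indicator {a} y)"
    using \<open>finite W\<close> by (simp add: charge_def)
qed

lemma sum_charge_green:
  fixes W :: "(int ^ 'd::finite) set"
  assumes "finite W"
  shows "(\<Sum>x\<in>W. charge W x * green (indicator {a}) x) = green (charge W) a"
proof -
  have "green (charge W) a = (\<Sum>x\<in>W. charge W x * green (indicator {x}) a)"
    by (subst charge_sum[OF assms]) (simp only: green_sum[OF assms] green_cmult)
  then show ?thesis by (simp add: green_symmetric[of a])
qed

section \<open>The Poisson soup of paths\<close>

definition lam :: "(int ^ 'd) set \<Rightarrow> ((int ^ 'd) list \<Rightarrow> ennreal) \<Rightarrow> ennreal" where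
  "lam W g = (\<Sum>x\<in>W. charge W x * paths (charge W) x g)"

lemma lam_mono: "(\<And>\<gamma>. \<gamma> \<noteq> [] \<Longrightarrow> g \<gamma> \<le> g' \<gamma>) \<Longrightarrow> lam W g \<le> lam W g'"
  unfolding lam_def by (intro sum_mono mult_left_mono paths_mono) auto

lemma lam_add: "lam W (\<lambda>\<gamma>. g \<gamma> + h \<gamma>) = lam W g + lam W h"
  by (simp add: lam_def paths_add distrib_left sum.distrib)

lemma lam_cmult: "lam W (\<lambda>\<gamma>. a * g \<gamma>) = a * lam W g"
  by (simp add: lam_def paths_cmult sum_distrib_left mult.left_commute)

lemma lam_1:
  fixes W :: "(int ^ 'd::finite) set"
  assumes "CARD('d) \<ge> 3" "finite W"
  shows "lam W (\<lambda>_. 1) = (\<Sum>x\<in>W. charge W x)"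
  unfolding lam_def paths_const by (intro sum.cong) (simp_all add: green_charge_in assms)

lemma lam_1_finite: "CARD('d) \<ge> 3 \<Longrightarrow> finite W \<Longrightarrow> lam W (\<lambda>_. 1) < \<top>"
  for W :: "(int ^ 'd::finite) set"
  by (auto simp: lam_1 intro: le_less_trans[OF charge_le_1])

text \<open>Sweeping: by symmetry of the Green function, the capacity of \<open>A\<close> is the
  sum, weighted by the equilibrium measure of \<open>W\<close>, of the probabilities to hit
  \<open>A\<close>. So the avoidance probabilities of the soup do not depend on
  \<open>W\<close>.\<close>

lemma lam_avoid:
  fixes W :: "(int ^ 'd::finite) set"
  assumes d: "CARD('d) \<ge> 3" and W: "finite W" and A: "A \<subseteq> W"
  shows "lam W (avoid A) + (\<Sum>a\<in>A. charge A a) = lam W (\<lambda>_. 1)"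
proof -
  have fA: "finite A" using A W by (rule finite_subset)
  have "(\<Sum>a\<in>A. charge A a) = (\<Sum>a\<in>A. charge A a * (\<Sum>x\<in>W. charge W x * green (indicator {a}) x))"
    using A by (intro sum.cong) (auto simp: sum_charge_green[OF W] green_charge_in[OF d W])
  also have "\<dots> = (\<Sum>x\<in>W. charge W x * (\<Sum>a\<in>A. charge A a * green (indicator {a}) x))"
    unfolding sum_distrib_left by (subst sum.swap) (simp add: mult.left_commute)
  also have "\<dots> = (\<Sum>x\<in>W. charge W x * green (charge A) x)"
    by (subst charge_sum[OF fA]) (simp add: green_sum[OF fA] green_cmult)
  finally have "lam W (avoid A) + (\<Sum>a\<in>A. charge A a)
      = (\<Sum>x\<in>W. charge W x * (paths (charge W) x (avoid A) + green (charge A) x))"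
    by (simp add: lam_def distrib_left sum.distrib)
  also have "\<dots> = (\<Sum>x\<in>W. charge W x)"
  proof (intro sum.cong refl)
    fix x assume "x \<in> W"
    then have "paths (charge W) x (avoid A) = indicator (- A) x * escape A x"
      using paths_avoid[OF d W A, of x] by simp
    then have "paths (charge W) x (avoid A) + green (charge A) x = 1"
      using green_charge[OF d fA, of x] by (simp add: add.commute)
    then show "charge W x * (paths (charge W) x (avoid A) + green (charge A) x) = charge W x" by simp
  qed
  finally show ?thesis by (simp add: lam_1[OF d W])
qed

section \<open>Exponential moments of the number of visits\<close>

definition visits :: "'a set \<Rightarrow> 'a list \<Rightarrow> nat" where
  "visits D \<gamma> = length (filter (\<lambda>x. x \<in> D) \<gamma>)"

lemma visits_Cons: "visits D (x # \<gamma>) = of_bool (x \<in> D) + visits D \<gamma>"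
  by (simp add: visits_def)

text \<open>A form of Khas'minskii's lemma: the function \<open>\<Psi>\<close> in the proof is superharmonic for the walk
  weighted by \<open>z\<close> at each visit of \<open>D\<close>.\<close>

lemma lam_visits:
  fixes W :: "(int ^ 'd::finite) set"
  assumes d: "CARD('d) \<ge> 3" and W: "finite W" and D: "finite D"
    and q: "q \<ge> 1" "\<And>x. green (indicator D) x \<le> ennreal q"
  shows "lam W (\<lambda>\<gamma>. ennreal ((1 + 1 / (2 * q)) ^ visits D \<gamma>)) \<le> lam W (\<lambda>_. 1) + ennreal (card D)"
proof -
  define z where "z = 1 + 1 / (2 * q)"
  \<comment> \<open>With \<open>z * (1 - \<theta>) = 1\<close> and the bound \<open>2\<close> for
    \<open>\<Psi>\<close>, the surplus \<open>2 * \<theta>\<close> of \<open>\<Psi>\<close> at a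
    point of \<open>D\<close> pays for the factor \<open>z\<close> there. The choice of
    \<open>z\<close> ensures \<open>2 * \<theta> * q \<le> 1\<close>, hence that bound.\<close>
  define \<theta> where "\<theta> = 1 - 1 / z"
  have z: "z > 1" using q by (simp add: z_def)
  have \<theta>: "0 < \<theta>" "2 * \<theta> * q \<le> 1" "2 * \<theta> \<le> 1"
    using q by (auto simp: \<theta>_def z_def field_simps)
  have z\<theta>: "z * (1 - \<theta>) = 1" using z by (simp add: \<theta>_def)
  define e where "e = charge W"
  define G where "G = green (indicator D)"
  define \<Psi> where "\<Psi> x = green e x + ennreal (2 * \<theta>) * G x" for x
  have \<Psi>2: "\<Psi> x \<le> 2" for x
  proof -
    have "ennreal (2 * \<theta>) * G x \<le> ennreal (2 * \<theta>) * ennreal q"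
      unfolding G_def by (intro mult_left_mono q) auto
    also have "\<dots> \<le> ennreal 1"
      using \<theta> q by (simp add: ennreal_mult'[symmetric] ennreal_leI del: ennreal_1)
    finally have "\<Psi> x \<le> 1 + 1"
      unfolding \<Psi>_def e_def using green_charge_le[OF d W, of x] by (intro add_mono) auto
    then show ?thesis by simp
  qed
  have \<Psi>_eq: "\<Psi> x = (e x + avg \<Psi> x) + ennreal (2 * \<theta>) * indicator D x" for x
  proof -
    have "\<Psi> x = (e x + avg (green e) x) + ennreal (2 * \<theta>) * (indicator D x + avg G x)"
      unfolding \<Psi>_def G_def by (subst (1 2) green_unfold) rule
    also have "\<dots> = (e x + (avg (green e) x + ennreal (2 * \<theta>) * avg G x)) + ennreal (2 * \<theta>) * indicator D x"
      by (simp add: distrib_left ac_simps)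
    also have "avg (green e) x + ennreal (2 * \<theta>) * avg G x = avg \<Psi> x"
      unfolding \<Psi>_def by (simp add: avg_add avg_cmult)
    finally show ?thesis .
  qed
  have super: "ennreal (z ^ of_bool (x \<in> D)) * (e x + avg \<Psi> x) \<le> \<Psi> x" for x
  proof (cases "x \<in> D")
    case False
    then show ?thesis using \<Psi>_eq[of x] by simp
  next
    case True
    have eq: "\<Psi> x = (e x + avg \<Psi> x) + ennreal (2 * \<theta>)" using \<Psi>_eq[of x] True by simp
    then have "e x + avg \<Psi> x \<noteq> \<top>" using \<Psi>2[of x] by (auto simp: top_unique)
    then obtain t where t: "e x + avg \<Psi> x = ennreal t" "t \<ge> 0"
      by (cases "e x + avg \<Psi> x") auto
    have "ennreal (t + 2 * \<theta>) \<le> ennreal 2"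
      using \<Psi>2[of x] t \<theta> unfolding eq by simp
    then have "t \<le> 2 * (1 - \<theta>)" by (simp add: ennreal_le_iff2 algebra_simps del: ennreal_numeral)
    then have "z * t \<le> z * (2 * (1 - \<theta>))" using z by (intro mult_left_mono) auto
    also have "z * (2 * (1 - \<theta>)) = 2 * (z * (1 - \<theta>))" by (simp only: mult.left_commute)
    finally have "z * t \<le> 2" using z\<theta> by simp
    then have "\<theta> * (z * t) \<le> \<theta> * 2" using \<theta> by (intro mult_left_mono) auto
    moreover have "z * t - \<theta> * (z * t) = (z * (1 - \<theta>)) * t" by (simp add: algebra_simps)
    then have "z * t = t + \<theta> * (z * t)" using z\<theta> by simp
    ultimately have "z * t \<le> t + 2 * \<theta>" by linarith
    then show ?thesis
      unfolding eq t using True t z \<theta> by (simp add: ennreal_mult'[symmetric] ennreal_plus[symmetric] ennreal_leI del: ennreal_plus)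
  qed
  have ps: "pathsum e n x (\<lambda>\<gamma>. ennreal (z ^ visits D \<gamma>)) \<le> \<Psi> x" for n x
  proof (induction n arbitrary: x)
    case (Suc n)
    have c: "ennreal (z ^ visits D (x # \<gamma>)) = ennreal (z ^ of_bool (x \<in> D)) * ennreal (z ^ visits D \<gamma>)" for \<gamma>
      using z by (simp add: visits_Cons power_add ennreal_mult')
    have "pathsum e (Suc n) x (\<lambda>\<gamma>. ennreal (z ^ visits D \<gamma>))
        = ennreal (z ^ of_bool (x \<in> D)) * (e x + avg (\<lambda>y. pathsum e n y (\<lambda>\<gamma>. ennreal (z ^ visits D \<gamma>))) x)"
      unfolding pathsum.simps c pathsum_cmult avg_cmult by (simp add: visits_def distrib_left mult.commute)
    also have "\<dots> \<le> ennreal (z ^ of_bool (x \<in> D)) * (e x + avg \<Psi> x)"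
      by (intro mult_left_mono add_left_mono avg_mono Suc) auto
    also have "\<dots> \<le> \<Psi> x" by (rule super)
    finally show ?case .
  qed simp
  then have p: "paths e x (\<lambda>\<gamma>. ennreal (z ^ visits D \<gamma>)) \<le> 1 + G x" for x
  proof -
    have "paths e x (\<lambda>\<gamma>. ennreal (z ^ visits D \<gamma>)) \<le> \<Psi> x"
      unfolding paths_def by (intro SUP_least ps)
    also have "\<dots> \<le> 1 + 1 * G x"
      unfolding \<Psi>_def e_def using \<theta> green_charge_le[OF d W, of x]
      by (intro add_mono mult_right_mono) (auto simp: ennreal_le_1)
    finally show ?thesis by simp
  qed
  have "lam W (\<lambda>\<gamma>. ennreal (z ^ visits D \<gamma>)) \<le> (\<Sum>x\<in>W. e x * (1 + G x))"
    unfolding lam_def e_def[symmetric] by (intro sum_mono mult_left_mono p) auto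
  also have "\<dots> = lam W (\<lambda>_. 1) + (\<Sum>x\<in>W. e x * G x)"
    by (simp add: lam_1[OF d W] distrib_left sum.distrib e_def)
  \<comment> \<open>By symmetry of the Green function the excess over the total mass is a sum over
    \<open>D\<close> of probabilities to hit \<open>W\<close>, at most \<open>card D\<close>
    whatever \<open>W\<close> is.\<close>
  also have "(\<Sum>x\<in>W. e x * G x) = (\<Sum>x\<in>W. \<Sum>a\<in>D. e x * green (indicator {a}) x)"
    unfolding G_def by (subst indicator_eq_sum_singleton[OF D]) (simp only: green_sum[OF D] sum_distrib_left)
  also have "\<dots> = (\<Sum>a\<in>D. green (charge W) a)"
    by (subst sum.swap) (simp only: e_def sum_charge_green[OF W])
  also have "\<dots> \<le> (\<Sum>a\<in>D. 1)"
    by (intro sum_mono green_charge_le d W)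
  also have "\<dots> = ennreal (card D)" by (simp add: ennreal_of_nat_eq_real_of_nat)
  finally show ?thesis by (simp add: z_def add_left_mono)
qed

section \<open>Poissonian sums over tuples of paths\<close>

fun tuples :: "(int ^ 'd) set \<Rightarrow> nat \<Rightarrow> ((int ^ 'd) list list \<Rightarrow> ennreal) \<Rightarrow> ennreal" where
  "tuples W 0 g = g []"
| "tuples W (Suc N) g = lam W (\<lambda>\<gamma>. tuples W N (\<lambda>\<sigma>. g (\<gamma> # \<sigma>)))"

lemma tuples_mono: "(\<And>\<sigma>. g \<sigma> \<le> g' \<sigma>) \<Longrightarrow> tuples W N g \<le> tuples W N g'"
  by (induction N arbitrary: g g') (auto intro!: lam_mono)

lemma tuples_add: "tuples W N (\<lambda>\<sigma>. g \<sigma> + h \<sigma>) = tuples W N g + tuples W N h"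
  by (induction N arbitrary: g h) (auto simp: lam_add)

lemma tuples_cmult: "tuples W N (\<lambda>\<sigma>. a * g \<sigma>) = a * tuples W N g"
  by (induction N arbitrary: g) (auto simp: lam_cmult)

lemma tuples_prod: "tuples W N (\<lambda>\<sigma>. prod_list (map g \<sigma>)) = lam W g ^ N"
proof (induction N)
  case (Suc N)
  have "tuples W (Suc N) (\<lambda>\<sigma>. prod_list (map g \<sigma>)) = lam W (\<lambda>\<gamma>. lam W g ^ N * g \<gamma>)"
    by (simp add: tuples_cmult Suc mult.commute)
  also have "\<dots> = lam W g ^ N * lam W g" by (rule lam_cmult)
  finally show ?case by (simp add: mult.commute)
qed simp

definition mass :: "(int ^ 'd) set \<Rightarrow> real" where
  "mass W = enn2real (lam W (\<lambda>_. 1))"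

text \<open>The expectation of \<open>g\<close> for a Poisson process of paths with intensity
  \<open>u * lam W\<close>, expanded over the number of paths. Ordered tuples replace the point
  process, so that the surgery can go by induction on a list.\<close>

definition soup :: "(int ^ 'd) set \<Rightarrow> real \<Rightarrow> ((int ^ 'd) list list \<Rightarrow> ennreal) \<Rightarrow> ennreal" where
  "soup W u g = (\<Sum>N. ennreal (exp (- u * mass W) * u ^ N / fact N) * tuples W N g)"

lemma soup_mono: "(\<And>\<sigma>. g \<sigma> \<le> g' \<sigma>) \<Longrightarrow> soup W u g \<le> soup W u g'"
  unfolding soup_def by (intro suminf_le mult_left_mono tuples_mono) auto

lemma soup_add: "soup W u (\<lambda>\<sigma>. g \<sigma> + h \<sigma>) = soup W u g + soup W u h"
  unfolding soup_def by (simp add: tuples_add distrib_left suminf_add)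

lemma soup_cmult: "soup W u (\<lambda>\<sigma>. a * g \<sigma>) = a * soup W u g"
  unfolding soup_def by (simp add: tuples_cmult mult.left_commute[of _ a])

lemma soup_sum: "finite S \<Longrightarrow> soup W u (\<lambda>\<sigma>. \<Sum>i\<in>S. g i \<sigma>) = (\<Sum>i\<in>S. soup W u (g i))"
proof (induction S rule: finite_induct)
  case empty
  show ?case using soup_cmult[of W u 0 "\<lambda>_. 0"] by simp
qed (simp add: soup_add)

text \<open>The Laplace functional of a Poisson process. The avoidance probabilities and the
  exponential moments of the occupation are both of this product form.\<close>

lemma soup_prod:
  assumes "u \<ge> 0" "lam W g = ennreal l" "l \<ge> 0"
  shows "soup W u (\<lambda>\<sigma>. prod_list (map g \<sigma>)) = ennreal (exp (u * (l - mass W)))"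
proof -
  have s: "(\<lambda>N. exp (- u * mass W) * ((u * l) ^ N / fact N)) sums (exp (- u * mass W) * exp (u * l))"
    using exp_converges[of "u * l"] by (intro sums_mult) (simp add: divide_inverse mult.commute)
  have "soup W u (\<lambda>\<sigma>. prod_list (map g \<sigma>)) = (\<Sum>N. ennreal (exp (- u * mass W) * ((u * l) ^ N / fact N)))"
    unfolding soup_def tuples_prod assms(2)
  proof (rule suminf_cong)
    fix N
    have "ennreal (exp (- u * mass W) * u ^ N / fact N) * ennreal l ^ N
        = ennreal ((exp (- u * mass W) * u ^ N / fact N) * l ^ N)"
      unfolding ennreal_power[OF assms(3)] by (rule ennreal_mult''[symmetric]) (use assms in auto)
    then show "ennreal (exp (- u * mass W) * u ^ N / fact N) * ennreal l ^ N
        = ennreal (exp (- u * mass W) * ((u * l) ^ N / fact N))"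
      by (simp add: power_mult_distrib mult.assoc)
  qed
  also have "\<dots> = ennreal (exp (- u * mass W) * exp (u * l))"
    using s assms by (subst suminf_ennreal2) (auto simp: sums_iff)
  finally show ?thesis by (simp add: mult_exp_exp algebra_simps)
qed

lemma prod_list_const_1: "prod_list (map (\<lambda>_. 1) \<sigma>) = (1 :: 'a :: monoid_mult)"
  by (induction \<sigma>) auto

lemma soup_1:
  fixes W :: "(int ^ 'd::finite) set"
  assumes "CARD('d) \<ge> 3" "finite W" "u \<ge> 0"
  shows "soup W u (\<lambda>_. 1) = 1"
  using soup_prod[of u W "\<lambda>_. 1" "mass W"] lam_1_finite[OF assms(1,2)] assms(3)
  by (simp add: prod_list_const_1 mass_def)

definition footprint :: "'a list list \<Rightarrow> 'a set" where
  "footprint \<sigma> = (\<Union>\<gamma>\<in>set \<sigma>. set \<gamma>)"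

lemma footprint_Nil [simp]: "footprint [] = {}" and footprint_Cons [simp]: "footprint (\<gamma> # \<sigma>) = set \<gamma> \<union> footprint \<sigma>"
  by (auto simp: footprint_def)

definition occupation :: "'a set \<Rightarrow> 'a list list \<Rightarrow> nat" where
  "occupation D \<sigma> = sum_list (map (visits D) \<sigma>)"

lemma occupation_Nil [simp]: "occupation D [] = 0"
  and occupation_Cons [simp]: "occupation D (\<gamma> # \<sigma>) = visits D \<gamma> + occupation D \<sigma>"
  by (auto simp: occupation_def)

lemma soup_avoid:
  fixes W :: "(int ^ 'd::finite) set"
  assumes "CARD('d) \<ge> 3" "finite W" "A \<subseteq> W" "u \<ge> 0"
  shows "soup W u (\<lambda>\<sigma>. of_bool (footprint \<sigma> \<inter> A = {})) = ennreal (exp (- u * enn2real (\<Sum>a\<in>A. charge A a)))"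
proof -
  have f: "lam W (\<lambda>_. 1) < \<top>" using assms by (intro lam_1_finite)
  note la = lam_avoid[OF assms(1-3)]
  obtain l where l: "lam W (avoid A) = ennreal l" "l \<ge> 0"
    using la f by (cases "lam W (avoid A)") auto
  obtain c where c: "(\<Sum>a\<in>A. charge A a) = ennreal c" "c \<ge> 0"
    using la f by (cases "(\<Sum>a\<in>A. charge A a)") auto
  have "lam W (\<lambda>_. 1) = ennreal (l + c)" using la l c by simp
  then have m: "mass W = l + c" using l c by (simp add: mass_def del: ennreal_plus)
  have "of_bool (footprint \<sigma> \<inter> A = {}) = prod_list (map (avoid A) \<sigma>)" for \<sigma>
  proof (induction \<sigma>)
    case (Cons \<gamma> \<sigma>)
    then show ?case
      by (simp only: footprint_Cons Int_Un_distrib2 Un_empty of_bool_conj list.map prod_list.Cons avoid_def)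
  qed simp
  then have "soup W u (\<lambda>\<sigma>. of_bool (footprint \<sigma> \<inter> A = {})) = ennreal (exp (u * (l - mass W)))"
    using soup_prod[OF assms(4) l] by simp
  then show ?thesis using c m by (simp add: algebra_simps)
qed

text \<open>The bound does not involve \<open>W\<close>, which later grows with the time
  \<open>n\<close>.\<close>

lemma soup_occupation:
  fixes W :: "(int ^ 'd::finite) set"
  assumes "CARD('d) \<ge> 3" "finite W" "finite D" "u \<ge> 0" "q \<ge> 1" "\<And>x. green (indicator D) x \<le> ennreal q"
  shows "soup W u (\<lambda>\<sigma>. ennreal ((1 + 1 / (2 * q)) ^ occupation D \<sigma>)) \<le> ennreal (exp (u * card D))"
proof -
  define z where "z = 1 + 1 / (2 * q)"
  have z: "z \<ge> 0" using assms by (simp add: z_def)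
  have f: "lam W (\<lambda>_. 1) < \<top>" using assms by (intro lam_1_finite)
  have le: "lam W (\<lambda>\<gamma>. ennreal (z ^ visits D \<gamma>)) \<le> ennreal (mass W + card D)"
    using lam_visits[OF assms(1-3,5,6)] f by (simp add: mass_def z_def)
  then obtain l where l: "lam W (\<lambda>\<gamma>. ennreal (z ^ visits D \<gamma>)) = ennreal l" "l \<ge> 0"
    by (cases "lam W (\<lambda>\<gamma>. ennreal (z ^ visits D \<gamma>))") (auto simp: top_unique)
  have "l \<le> mass W + card D" using le unfolding l(1) by (subst (asm) ennreal_le_iff) (auto simp: mass_def)
  have "ennreal (z ^ occupation D \<sigma>) = prod_list (map (\<lambda>\<gamma>. ennreal (z ^ visits D \<gamma>)) \<sigma>)" for \<sigma>
    using z by (induction \<sigma>) (auto simp: power_add ennreal_mult')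
  then have "soup W u (\<lambda>\<sigma>. ennreal (z ^ occupation D \<sigma>)) = ennreal (exp (u * (l - mass W)))"
    using soup_prod[OF assms(4) l] by simp
  also have "\<dots> \<le> ennreal (exp (u * card D))"
    using \<open>l \<le> mass W + card D\<close> assms by (intro ennreal_leI) (auto intro: mult_left_mono)
  finally show ?thesis by (simp add: z_def)
qed

section \<open>Rerouting paths\<close>

abbreviation step_prob :: "(int ^ 'd) itself \<Rightarrow> real" where
  "step_prob T \<equiv> 1 / deg T"

definition links :: "(int ^ 'd) set \<Rightarrow> ((int ^ 'd) \<times> (int ^ 'd)) set" where
  "links R = {(x, y). x \<in> R \<and> y \<in> R \<and> nbr x y}"

definition linked :: "(int ^ 'd) set \<Rightarrow> nat \<Rightarrow> int ^ 'd \<Rightarrow> int ^ 'd \<Rightarrow> bool" where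
  "linked R l x y \<longleftrightarrow> (\<exists>k\<le>l. (x, y) \<in> links R ^^ k)"

lemma linked_sym: "linked R l x y \<Longrightarrow> linked R l y x" for x y :: "int ^ 'd::finite"
proof -
  have "(x, y) \<in> links R ^^ k \<Longrightarrow> (y, x) \<in> links R ^^ k" for k and x y :: "int ^ 'd"
  proof (induction k arbitrary: x y)
    case (Suc k)
    then obtain z where z: "(x, z) \<in> links R ^^ k" "(z, y) \<in> links R" by auto
    have "(y, z) \<in> links R" using z(2) nbr_sym[of z y] by (simp add: links_def)
    then show ?case by (rule relpow_Suc_I2[OF _ Suc.IH[OF z(1)]])
  qed auto
  then show "linked R l x y \<Longrightarrow> linked R l y x" unfolding linked_def by blast
qed

lemma linked_refl [simp]: "linked R l x x"
  unfolding linked_def by (rule exI[of _ 0]) auto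

lemma linked_trans: "linked R l x y \<Longrightarrow> linked R k y z \<Longrightarrow> linked R (l + k) x z"
proof -
  assume "linked R l x y" "linked R k y z"
  then obtain i j where "i \<le> l" "(x, y) \<in> links R ^^ i" "j \<le> k" "(y, z) \<in> links R ^^ j"
    unfolding linked_def by blast
  then have "i + j \<le> l + k" "(x, z) \<in> links R ^^ (i + j)"
    unfolding relpow_add by auto
  then show ?thesis unfolding linked_def by blast
qed

lemma linked_mono: "linked R l x y \<Longrightarrow> l \<le> k \<Longrightarrow> linked R k x y"
  unfolding linked_def by (meson order_trans)

lemma linked_step: "x \<in> R \<Longrightarrow> y \<in> R \<Longrightarrow> nbr x y \<Longrightarrow> linked R 1 x y"
  unfolding linked_def links_def by (rule exI[of _ 1]) auto

text \<open>\<open>Z\<close> stores the sites visited so far outside of the zone \<open>b\<close>,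
  the only ones that \<open>\<psi>\<close> sees. A step from a point of \<open>b\<close> thus alters
  no weight and costs only its probability.\<close>

definition guided :: "(int ^ 'd \<Rightarrow> ennreal) \<Rightarrow> (int ^ 'd) set \<Rightarrow> (int ^ 'd) set \<Rightarrow> ((int ^ 'd) set \<Rightarrow> ennreal)
    \<Rightarrow> int ^ 'd \<Rightarrow> (int ^ 'd) set \<Rightarrow> ennreal" where
  "guided e b V \<psi> x Z = paths e x (\<lambda>\<gamma>. \<psi> (Z \<union> (set \<gamma> - b)) * avoid V \<gamma>)"

lemma guided_unfold:
  fixes x :: "int ^ 'd::finite"
  assumes "x \<notin> V"
  shows "guided e b V \<psi> x Z = e x * \<psi> (Z \<union> ({x} - b)) + avg (\<lambda>y. guided e b V \<psi> y (Z \<union> ({x} - b))) x"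
proof -
  have "avoid V (x # \<gamma>) = avoid V \<gamma>" for \<gamma> using assms by (simp add: avoid_def)
  moreover have "Z \<union> (set (x # \<gamma>) - b) = (Z \<union> ({x} - b)) \<union> (set \<gamma> - b)" for \<gamma> by auto
  moreover have "avoid V [x] = 1" using assms by (simp add: avoid_def)
  ultimately show ?thesis
    unfolding guided_def by (subst paths_unfold) simp
qed

lemma guided_nbr:
  fixes x :: "int ^ 'd::finite"
  assumes "x \<notin> V" "x \<in> b" "nbr x y"
  shows "ennreal (step_prob TYPE(int ^ 'd)) * guided e b V \<psi> y Z \<le> guided e b V \<psi> x Z"
proof -
  have "{x} - b = {}" using assms by auto
  then have "guided e b V \<psi> x Z = e x * \<psi> Z + avg (\<lambda>y. guided e b V \<psi> y Z) x"
    using guided_unfold[OF assms(1), of e b \<psi> Z] by simp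
  then show ?thesis
    using avg_ge_nbr[OF assms(3), of "\<lambda>y. guided e b V \<psi> y Z"] by (simp add: add_increasing)
qed

lemma guided_linked:
  fixes x :: "int ^ 'd::finite"
  assumes R: "R \<subseteq> b - V" and l: "linked R l x y"
  shows "ennreal (step_prob TYPE(int ^ 'd) ^ l) * guided e b V \<psi> y Z \<le> guided e b V \<psi> x Z"
proof -
  let ?\<kappa> = "step_prob TYPE(int ^ 'd)"
  have \<kappa>: "0 \<le> ?\<kappa>" "?\<kappa> \<le> 1" using deg_ge[where 'd='d] by (auto simp: field_simps)
  obtain k where k: "k \<le> l" "(x, y) \<in> links R ^^ k" using l by (auto simp: linked_def)
  have "ennreal (?\<kappa> ^ k) * guided e b V \<psi> y Z \<le> guided e b V \<psi> x Z"
    using k(2)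
  proof (induction k arbitrary: x)
    case (Suc k)
    then obtain w where w: "(x, w) \<in> links R" "(w, y) \<in> links R ^^ k" by (meson relpow_Suc_D2)
    have "ennreal (?\<kappa> ^ Suc k) * guided e b V \<psi> y Z = ennreal ?\<kappa> * (ennreal (?\<kappa> ^ k) * guided e b V \<psi> y Z)"
      using \<kappa> by (simp only: power_Suc ennreal_mult' mult.assoc)
    also have "\<dots> \<le> ennreal ?\<kappa> * guided e b V \<psi> w Z"
      by (intro mult_left_mono Suc.IH w) auto
    also have "\<dots> \<le> guided e b V \<psi> x Z"
      using w(1) R by (intro guided_nbr) (auto simp: links_def)
    finally show ?case .
  qed simp
  moreover have "ennreal (?\<kappa> ^ l) * guided e b V \<psi> y Z \<le> ennreal (?\<kappa> ^ k) * guided e b V \<psi> y Z"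
    using k(1) \<kappa> by (intro mult_right_mono ennreal_leI power_decreasing) auto
  ultimately show ?thesis by (rule order_trans[rotated])
qed

text \<open>The weighted path sum is a supermartingale for the function \<^const>\<open>guided\<close>, evaluated at the
  detour point \<open>s v\<close> when the path sits at a forbidden point \<open>v\<close>.\<close>

lemma pathsum_reroute:
  fixes x :: "int ^ 'd::finite"
  assumes V: "V \<subseteq> D" "D \<subseteq> b" and e: "\<And>x. x \<in> D \<Longrightarrow> e x = 0"
    and nb: "\<And>v y. v \<in> V \<Longrightarrow> nbr v y \<Longrightarrow> y \<in> D"
    and s1: "\<And>v y. v \<in> V \<Longrightarrow> nbr v y \<Longrightarrow> y \<notin> V \<Longrightarrow> linked (D - V) l y (s v)"
    and s2: "\<And>v y. v \<in> V \<Longrightarrow> nbr v y \<Longrightarrow> y \<in> V \<Longrightarrow> linked (D - V) l (s y) (s v)"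
    and l: "l \<ge> 1"
  shows "pathsum e n x (\<lambda>\<gamma>. \<psi> (Z \<union> (set \<gamma> - b)) * ennreal ((step_prob TYPE(int ^ 'd) ^ l) ^ visits D \<gamma>))
    \<le> guided e b V \<psi> (if x \<in> V then s x else x) Z"
proof (induction n arbitrary: x Z)
  case (Suc n)
  let ?\<kappa> = "step_prob TYPE(int ^ 'd)"
  define c where "c = ?\<kappa> ^ l"
  have \<kappa>: "0 \<le> ?\<kappa>" "?\<kappa> \<le> 1" using deg_ge[where 'd='d] by (auto simp: field_simps)
  have c: "c \<ge> 0" "c \<le> ?\<kappa>"
    using \<kappa> l power_decreasing[of 1 l ?\<kappa>] by (auto simp: c_def)
  define F where "F x Z = guided e b V \<psi> (if x \<in> V then s x else x) Z" for x Z
  let ?Z = "Z \<union> ({x} - b)"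
  let ?g = "\<lambda>Z \<gamma>. \<psi> (Z \<union> (set \<gamma> - b)) * ennreal (c ^ visits D \<gamma>)"
  have g: "?g Z (x # \<gamma>) = ennreal (c ^ of_bool (x \<in> D)) * ?g ?Z \<gamma>" for \<gamma>
  proof -
    have "Z \<union> (set (x # \<gamma>) - b) = ?Z \<union> (set \<gamma> - b)" by auto
    then show ?thesis using c by (simp add: visits_Cons power_add ennreal_mult' mult.left_commute)
  qed
  have step: "pathsum e (Suc n) x (?g Z) \<le> e x * ?g Z [x] + ennreal (c ^ of_bool (x \<in> D)) * avg (\<lambda>y. F y ?Z) x"
    unfolding pathsum.simps g pathsum_cmult avg_cmult F_def
    by (intro add_left_mono mult_left_mono avg_mono Suc[folded c_def]) auto
  show ?case
  proof (cases "x \<in> D")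
    case False
    then have xV: "x \<notin> V" using V by auto
    have "avg (\<lambda>y. F y ?Z) x = avg (\<lambda>y. guided e b V \<psi> y ?Z) x"
      using nb False nbr_sym by (intro avg_cong) (auto simp: F_def)
    moreover have "visits D [x] = 0" using False by (simp add: visits_def)
    ultimately have "pathsum e (Suc n) x (?g Z) \<le> guided e b V \<psi> x Z"
      using step False guided_unfold[OF xV, of e b \<psi> Z] by simp
    then show ?thesis using xV by (simp add: c_def)
  next
    case True
    then have xb: "?Z = Z" using V by auto
    \<comment> \<open>The factor \<open>c\<close> paid for the visit of \<open>D\<close> is the
      price of \<open>l\<close> steps inside \<open>D - V\<close>, enough for the detour in each
      case: leaving \<open>V\<close>, entering it, or moving along it. An ordinary step is covered
      by \<open>l \<ge> 1\<close>.\<close>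
    have *: "ennreal c * F y Z \<le> F x Z" if "nbr x y" for y
    proof -
      have yx: "nbr y x" using that nbr_sym by blast
      have lk: "ennreal c * guided e b V \<psi> y' Z \<le> guided e b V \<psi> x' Z" if "linked (D - V) l x' y'" for x' y'
        unfolding c_def by (rule guided_linked[OF _ that]) (use V in auto)
      show ?thesis
      proof (cases "x \<in> V"; cases "y \<in> V")
        assume "x \<in> V" "y \<in> V"
        then show ?thesis using lk[OF s2[OF \<open>y \<in> V\<close> yx \<open>x \<in> V\<close>]] by (simp add: F_def)
      next
        assume "x \<in> V" "y \<notin> V"
        then show ?thesis using lk[OF linked_sym[OF s1[OF \<open>x \<in> V\<close> that \<open>y \<notin> V\<close>]]] by (simp add: F_def)
      next
        assume "x \<notin> V" "y \<in> V"
        then show ?thesis using lk[OF s1[OF \<open>y \<in> V\<close> yx \<open>x \<notin> V\<close>]] by (simp add: F_def)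
      next
        assume xy: "x \<notin> V" "y \<notin> V"
        have "ennreal c * guided e b V \<psi> y Z \<le> ennreal ?\<kappa> * guided e b V \<psi> y Z"
          using c by (intro mult_right_mono ennreal_leI) auto
        also have "\<dots> \<le> guided e b V \<psi> x Z"
          using xy True V that by (intro guided_nbr) auto
        finally show ?thesis using xy by (simp add: F_def)
      qed
    qed
    have "pathsum e (Suc n) x (?g Z) \<le> ennreal c * avg (\<lambda>y. F y Z) x"
      using step True e unfolding xb by simp
    also have "\<dots> = avg (\<lambda>y. ennreal c * F y Z) x" by (simp add: avg_cmult)
    also have "\<dots> \<le> avg (\<lambda>_. F x Z) x" by (intro avg_mono *)
    finally show ?thesis by (simp add: avg_const F_def c_def)
  qed
qed simp

lemma paths_prefix:
  fixes x :: "int ^ 'd::finite"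
  assumes "successively nbr (p @ [x])"
  shows "ennreal (step_prob TYPE(int ^ 'd) ^ length p) * paths e x (\<lambda>\<gamma>. g (p @ \<gamma>)) \<le> paths e (hd (p @ [x])) g"
  using assms
proof (induction p arbitrary: g)
  case (Cons y p)
  let ?\<kappa> = "step_prob TYPE(int ^ 'd)"
  let ?y = "hd (p @ [x])"
  have \<kappa>: "0 \<le> ?\<kappa>" using deg_ge[where 'd='d] by auto
  have nb: "nbr y ?y" "successively nbr (p @ [x])"
    using Cons.prems by (cases p; simp)+
  have "ennreal (?\<kappa> ^ length (y # p)) * paths e x (\<lambda>\<gamma>. g ((y # p) @ \<gamma>))
      = ennreal ?\<kappa> * (ennreal (?\<kappa> ^ length p) * paths e x (\<lambda>\<gamma>. g (y # (p @ \<gamma>))))"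
    using \<kappa> by (simp only: list.size(4) add_Suc_right add_0_right One_nat_def power_Suc ennreal_mult' mult.assoc append_Cons)
  also have "\<dots> \<le> ennreal ?\<kappa> * paths e ?y (\<lambda>\<gamma>. g (y # \<gamma>))"
    by (intro mult_left_mono Cons.IH[of "\<lambda>\<gamma>. g (y # \<gamma>)"] nb) auto
  also have "\<dots> \<le> avg (\<lambda>z. paths e z (\<lambda>\<gamma>. g (y # \<gamma>))) y"
    by (rule avg_ge_nbr[OF nb(1)])
  also have "\<dots> \<le> paths e y g"
    by (subst (2) paths_unfold) simp
  finally show ?case by simp
qed simp

text \<open>The loop \<open>p\<close> is inserted at the first visit of \<open>a\<close>.\<close>

lemma pathsum_insert_loop:
  fixes x :: "int ^ 'd::finite"
  assumes VV: "V \<subseteq> V'" and a: "a \<notin> b"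
    and p: "successively nbr (p @ [a])" "hd (p @ [a]) = a" "set p - b \<subseteq> {a}" "set p \<inter> V = {}" "T \<subseteq> set p"
  shows "ennreal (step_prob TYPE(int ^ 'd) ^ length p) *
      pathsum e n x (\<lambda>\<gamma>. \<psi> (Z \<union> (set \<gamma> - b)) * avoid V' \<gamma> * of_bool (a \<in> set \<gamma>))
    \<le> paths e x (\<lambda>\<gamma>. \<psi> (Z \<union> (set \<gamma> - b)) * avoid V \<gamma> * of_bool (T \<subseteq> set \<gamma>))"
proof (induction n arbitrary: x Z)
  case (Suc n)
  let ?k = "ennreal (step_prob TYPE(int ^ 'd) ^ length p)"
  let ?g = "\<lambda>Z \<gamma>. \<psi> (Z \<union> (set \<gamma> - b)) * avoid V' \<gamma> * of_bool (a \<in> set \<gamma>)"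
  let ?h = "\<lambda>Z \<gamma>. \<psi> (Z \<union> (set \<gamma> - b)) * avoid V \<gamma> * of_bool (T \<subseteq> set \<gamma>)"
  show ?case
  proof (cases "x = a")
    case True
    have "?k * pathsum e (Suc n) x (?g Z) \<le> ?k * paths e a (?g Z)"
      unfolding True by (intro mult_left_mono pathsum_le_paths) simp
    also have "\<dots> \<le> ?k * paths e a (\<lambda>\<gamma>. ?h Z (p @ \<gamma>))"
    proof (intro mult_left_mono paths_mono)
      fix \<gamma>
      have "Z \<union> (set (p @ a # \<gamma>) - b) = Z \<union> (set (a # \<gamma>) - b)" using p(3) a by auto
      moreover have "avoid V' (a # \<gamma>) \<le> avoid V (p @ a # \<gamma>)" using VV p(4) by (auto simp: avoid_def)
      moreover have "T \<subseteq> set (p @ a # \<gamma>)" using p(5) by auto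
      ultimately show "?g Z (a # \<gamma>) \<le> ?h Z (p @ a # \<gamma>)"
        by (simp add: mult_left_mono)
    qed simp
    also have "\<dots> \<le> paths e a (?h Z)"
      using paths_prefix[OF p(1), of e "?h Z"] unfolding p(2) .
    finally show ?thesis unfolding True .
  next
    case False
    let ?Z = "Z \<union> ({x} - b)"
    have Z: "Z \<union> (set (x # \<gamma>) - b) = ?Z \<union> (set \<gamma> - b)" for \<gamma> by auto
    show ?thesis
    proof (cases "x \<in> V'")
      case True
      then have "?g Z (x # \<gamma>) = 0" for \<gamma> by (simp add: avoid_def)
      then have "pathsum e (Suc n) x (?g Z) \<le> pathsum e (Suc n) x (\<lambda>_. 0 * 0)"
        by (intro pathsum_mono) simp
      also have "\<dots> = 0" by (subst pathsum_cmult) simp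
      finally have "pathsum e (Suc n) x (?g Z) = 0" by (simp only: le_zero_eq)
      then show ?thesis by (simp only: mult_zero_right zero_le)
    next
      case xV: False
      have g: "?g Z (x # \<gamma>) = ?g ?Z \<gamma>" for \<gamma>
        unfolding Z using False xV by (auto simp: avoid_def)
      have h: "?h ?Z \<gamma> \<le> ?h Z (x # \<gamma>)" for \<gamma>
        unfolding Z using xV VV by (auto simp: avoid_def)
      have "?k * pathsum e (Suc n) x (?g Z) = avg (\<lambda>y. ?k * pathsum e n y (?g ?Z)) x"
        unfolding pathsum.simps g avg_cmult using False by (simp del: Un_insert_right)
      also have "\<dots> \<le> avg (\<lambda>y. paths e y (?h ?Z)) x"
        by (intro avg_mono Suc)
      also have "\<dots> \<le> avg (\<lambda>y. paths e y (\<lambda>\<gamma>. ?h Z (x # \<gamma>))) x"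
        by (intro avg_mono paths_mono h)
      also have "\<dots> \<le> paths e x (?h Z)"
        by (subst (2) paths_unfold) simp
      finally show ?thesis .
    qed
  qed
qed simp

text \<open>\<open>V\<close> are the walls, \<open>V'\<close> the corridor together with its walls,
  \<open>D\<close> the sleeve, and \<open>b\<close> the zone in which the environment may change.
  There are two stages: the soup is moved off all of \<open>V'\<close>, and then a loop is inserted
  that meets \<open>V'\<close> in \<open>V' - V\<close> only and covers \<open>T\<close>.\<close>

locale surgery =
  fixes W V V' D b T :: "(int ^ 'd::finite) set" and a :: "int ^ 'd" and p :: "(int ^ 'd) list"
    and s :: "int ^ 'd \<Rightarrow> int ^ 'd" and l :: nat
  assumes VV': "V \<subseteq> V'" and V'D: "V' \<subseteq> D" and Db: "D \<subseteq> b"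
    and charge_D: "\<And>x. x \<in> D \<Longrightarrow> charge W x = 0"
    and nbr_V': "\<And>v y. v \<in> V' \<Longrightarrow> nbr v y \<Longrightarrow> y \<in> D"
    and detour1: "\<And>v y. v \<in> V' \<Longrightarrow> nbr v y \<Longrightarrow> y \<notin> V' \<Longrightarrow> linked (D - V') l y (s v)"
    and detour2: "\<And>v y. v \<in> V' \<Longrightarrow> nbr v y \<Longrightarrow> y \<in> V' \<Longrightarrow> linked (D - V') l (s y) (s v)"
    and l: "l \<ge> 1" and a: "a \<notin> b"
    and loop: "successively nbr (p @ [a])" "hd (p @ [a]) = a" "set p - b \<subseteq> {a}" "set p \<inter> V = {}" "T \<subseteq> set p"
begin

definition reroute_cost :: real where "reroute_cost = step_prob TYPE(int ^ 'd) ^ l"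
definition loop_cost :: real where "loop_cost = step_prob TYPE(int ^ 'd) ^ length p"

lemma reroute_cost_nonneg: "reroute_cost \<ge> 0"
  using deg_ge[where 'd='d] by (simp add: reroute_cost_def)

lemma lam_reroute:
  "lam W (\<lambda>\<gamma>. \<psi> (set \<gamma> - b) * ennreal (reroute_cost ^ visits D \<gamma>)) \<le> lam W (\<lambda>\<gamma>. \<psi> (set \<gamma> - b) * avoid V' \<gamma>)"
  unfolding lam_def
proof (rule sum_mono)
  fix x assume "x \<in> W"
  show "charge W x * paths (charge W) x (\<lambda>\<gamma>. \<psi> (set \<gamma> - b) * ennreal (reroute_cost ^ visits D \<gamma>))
    \<le> charge W x * paths (charge W) x (\<lambda>\<gamma>. \<psi> (set \<gamma> - b) * avoid V' \<gamma>)"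
  proof (cases "x \<in> D")
    case True
    then show ?thesis by (simp add: charge_D)
  next
    case False
    then have "x \<notin> V'" using V'D by auto
    have "pathsum (charge W) n x (\<lambda>\<gamma>. \<psi> ({} \<union> (set \<gamma> - b)) * ennreal (reroute_cost ^ visits D \<gamma>))
        \<le> guided (charge W) b V' \<psi> (if x \<in> V' then s x else x) {}" for n
      unfolding reroute_cost_def
      by (rule pathsum_reroute) (fact V'D Db l | erule charge_D nbr_V' detour1 detour2; assumption)+
    then have "paths (charge W) x (\<lambda>\<gamma>. \<psi> (set \<gamma> - b) * ennreal (reroute_cost ^ visits D \<gamma>))
        \<le> guided (charge W) b V' \<psi> x {}"
      unfolding paths_def using \<open>x \<notin> V'\<close> by (intro SUP_least) simp
    then show ?thesis by (intro mult_left_mono) (auto simp: guided_def)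
  qed
qed

lemma lam_insert_loop:
  "ennreal loop_cost * lam W (\<lambda>\<gamma>. \<psi> (set \<gamma> - b) * avoid V' \<gamma> * of_bool (a \<in> set \<gamma>))
    \<le> lam W (\<lambda>\<gamma>. \<psi> (set \<gamma> - b) * avoid V \<gamma> * of_bool (T \<subseteq> set \<gamma>))"
proof -
  have "ennreal loop_cost * paths (charge W) x (\<lambda>\<gamma>. \<psi> (set \<gamma> - b) * avoid V' \<gamma> * of_bool (a \<in> set \<gamma>))
    \<le> paths (charge W) x (\<lambda>\<gamma>. \<psi> (set \<gamma> - b) * avoid V \<gamma> * of_bool (T \<subseteq> set \<gamma>))" for x
    unfolding loop_cost_def paths_def[of _ x "\<lambda>\<gamma>. \<psi> (set \<gamma> - b) * avoid V' \<gamma> * of_bool (a \<in> set \<gamma>)"]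
    using pathsum_insert_loop[OF VV' a loop, where Z="{}" and \<psi>=\<psi> and e="charge W" and x=x]
    by (subst SUP_mult_left_ennreal) (intro SUP_least, simp)
  then show ?thesis
    unfolding lam_def sum_distrib_left
    by (intro sum_mono) (simp only: mult.left_commute[of "ennreal loop_cost"], intro mult_left_mono, auto)
qed

lemma avoid_mono: "avoid V' \<gamma> \<le> avoid V \<gamma>"
  using VV' by (auto simp: avoid_def)

lemma of_bool_footprint_Cons:
  "of_bool (footprint (\<gamma> # \<sigma>) \<inter> V = {}) = avoid V \<gamma> * (of_bool (footprint \<sigma> \<inter> V = {}) :: ennreal)"
  by (simp only: footprint_Cons Int_Un_distrib2 Un_empty of_bool_conj avoid_def)

lemma tuples_reroute:
  "tuples W N (\<lambda>\<sigma>. \<Psi> (Z \<union> (footprint \<sigma> - b)) * ennreal (reroute_cost ^ occupation D \<sigma>))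
    \<le> tuples W N (\<lambda>\<sigma>. \<Psi> (Z \<union> (footprint \<sigma> - b)) * of_bool (footprint \<sigma> \<inter> V = {}))"
proof (induction N arbitrary: Z)
  case (Suc N)
  let ?L = "\<lambda>Z \<sigma>. \<Psi> (Z \<union> (footprint \<sigma> - b)) * ennreal (reroute_cost ^ occupation D \<sigma>)"
  let ?R = "\<lambda>Z \<sigma>. \<Psi> (Z \<union> (footprint \<sigma> - b)) * of_bool (footprint \<sigma> \<inter> V = {})"
  have Z: "Z \<union> (footprint (\<gamma> # \<sigma>) - b) = (Z \<union> (set \<gamma> - b)) \<union> (footprint \<sigma> - b)" for \<gamma> \<sigma> by auto
  have L: "?L Z (\<gamma> # \<sigma>) = ennreal (reroute_cost ^ visits D \<gamma>) * ?L (Z \<union> (set \<gamma> - b)) \<sigma>" for \<gamma> \<sigma>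
    unfolding Z using reroute_cost_nonneg by (simp add: power_add ennreal_mult' mult.left_commute)
  have R: "?R Z (\<gamma> # \<sigma>) = avoid V \<gamma> * ?R (Z \<union> (set \<gamma> - b)) \<sigma>" for \<gamma> \<sigma>
    unfolding Z of_bool_footprint_Cons by (simp only: mult.left_commute)
  define B where "B X = tuples W N (?R (Z \<union> X))" for X
  have "tuples W (Suc N) (?L Z) = lam W (\<lambda>\<gamma>. ennreal (reroute_cost ^ visits D \<gamma>) * tuples W N (?L (Z \<union> (set \<gamma> - b))))"
    by (simp only: tuples.simps L tuples_cmult)
  also have "\<dots> \<le> lam W (\<lambda>\<gamma>. B (set \<gamma> - b) * ennreal (reroute_cost ^ visits D \<gamma>))"
    unfolding B_def by (subst mult.commute) (intro lam_mono mult_right_mono Suc, simp)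
  also have "\<dots> \<le> lam W (\<lambda>\<gamma>. B (set \<gamma> - b) * avoid V' \<gamma>)"
    by (rule lam_reroute)
  also have "\<dots> \<le> lam W (\<lambda>\<gamma>. avoid V \<gamma> * tuples W N (?R (Z \<union> (set \<gamma> - b))))"
    unfolding B_def by (subst mult.commute) (intro lam_mono mult_right_mono avoid_mono, simp)
  also have "\<dots> = tuples W (Suc N) (?R Z)"
    by (simp only: tuples.simps R tuples_cmult)
  finally show ?case .
qed simp

text \<open>Only the first path of the tuple that visits \<open>a\<close> receives the loop; the
  others are merely rerouted. Rerouting does not affect whether a path visits \<open>a\<close>,
  because \<open>a\<close> lies outside of \<open>b\<close>.\<close>

lemma tuples_surgery:
  "ennreal loop_cost * tuples W N (\<lambda>\<sigma>. \<Psi> (Z \<union> (footprint \<sigma> - b)) * ennreal (reroute_cost ^ occupation D \<sigma>) * of_bool (a \<in> footprint \<sigma>))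
    \<le> tuples W N (\<lambda>\<sigma>. \<Psi> (Z \<union> (footprint \<sigma> - b)) * of_bool (footprint \<sigma> \<inter> V = {}) * of_bool (T \<subseteq> footprint \<sigma>))"
proof (induction N arbitrary: Z)
  case (Suc N)
  let ?L = "\<lambda>Z \<sigma>. \<Psi> (Z \<union> (footprint \<sigma> - b)) * ennreal (reroute_cost ^ occupation D \<sigma>)"
  let ?R = "\<lambda>Z \<sigma>. \<Psi> (Z \<union> (footprint \<sigma> - b)) * of_bool (footprint \<sigma> \<inter> V = {})"
  let ?La = "\<lambda>Z \<sigma>. ?L Z \<sigma> * of_bool (a \<in> footprint \<sigma>)"
  let ?RT = "\<lambda>Z \<sigma>. ?R Z \<sigma> * of_bool (T \<subseteq> footprint \<sigma>)"
  let ?v = "\<lambda>\<gamma>. ennreal (reroute_cost ^ visits D \<gamma>)"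
  let ?Z = "\<lambda>\<gamma>. Z \<union> (set \<gamma> - b)"
  have Z: "Z \<union> (footprint (\<gamma> # \<sigma>) - b) = ?Z \<gamma> \<union> (footprint \<sigma> - b)" for \<gamma> \<sigma> by auto
  have L: "?L Z (\<gamma> # \<sigma>) = ?v \<gamma> * ?L (?Z \<gamma>) \<sigma>" for \<gamma> \<sigma>
    unfolding Z using reroute_cost_nonneg by (simp add: power_add ennreal_mult' mult.left_commute)
  have R: "?R Z (\<gamma> # \<sigma>) = avoid V \<gamma> * ?R (?Z \<gamma>) \<sigma>" for \<gamma> \<sigma>
    unfolding Z of_bool_footprint_Cons by (simp only: mult.left_commute)
  \<comment> \<open>Whether the first path visits \<open>a\<close> is encoded in functions of
    \<open>set \<gamma> - b\<close>, the form to which \<open>lam_reroute\<close> and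
    \<open>lam_insert_loop\<close> apply.\<close>
  define B where "B X = tuples W N (?R (Z \<union> X)) * of_bool (a \<in> X)" for X
  define C where "C X = tuples W N (?RT (Z \<union> X)) * of_bool (a \<notin> X)" for X
  have aX: "a \<in> set \<gamma> - b \<longleftrightarrow> a \<in> set \<gamma>" for \<gamma> using a by auto
  have La: "?La Z (\<gamma> # \<sigma>) = (?v \<gamma> * of_bool (a \<in> set \<gamma>)) * ?L (?Z \<gamma>) \<sigma>
      + (?v \<gamma> * of_bool (a \<notin> set \<gamma>)) * ?La (?Z \<gamma>) \<sigma>" for \<gamma> \<sigma>
    unfolding L by (cases "a \<in> set \<gamma>") (simp_all add: mult.assoc)
  have 1: "ennreal loop_cost * lam W (\<lambda>\<gamma>. (?v \<gamma> * of_bool (a \<in> set \<gamma>)) * tuples W N (?L (?Z \<gamma>)))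
      \<le> lam W (\<lambda>\<gamma>. B (set \<gamma> - b) * avoid V \<gamma> * of_bool (T \<subseteq> set \<gamma>))"
  proof -
    have "lam W (\<lambda>\<gamma>. (?v \<gamma> * of_bool (a \<in> set \<gamma>)) * tuples W N (?L (?Z \<gamma>)))
        \<le> lam W (\<lambda>\<gamma>. B (set \<gamma> - b) * ?v \<gamma>)"
    proof (rule lam_mono)
      fix \<gamma>
      have "tuples W N (?L (?Z \<gamma>)) \<le> tuples W N (?R (?Z \<gamma>))" by (rule tuples_reroute)
      then have "(?v \<gamma> * of_bool (a \<in> set \<gamma>)) * tuples W N (?L (?Z \<gamma>))
          \<le> (?v \<gamma> * of_bool (a \<in> set \<gamma>)) * tuples W N (?R (?Z \<gamma>))" by (intro mult_left_mono) auto
      also have "\<dots> = B (set \<gamma> - b) * ?v \<gamma>" unfolding B_def aX by (simp only: ac_simps)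
      finally show "(?v \<gamma> * of_bool (a \<in> set \<gamma>)) * tuples W N (?L (?Z \<gamma>)) \<le> B (set \<gamma> - b) * ?v \<gamma>" .
    qed
    also have "\<dots> \<le> lam W (\<lambda>\<gamma>. B (set \<gamma> - b) * avoid V' \<gamma>)" by (rule lam_reroute)
    also have "\<dots> = lam W (\<lambda>\<gamma>. B (set \<gamma> - b) * avoid V' \<gamma> * of_bool (a \<in> set \<gamma>))"
      unfolding B_def aX by (intro arg_cong[where f="lam W"] ext) auto
    finally show ?thesis
      using lam_insert_loop[of B] by (meson mult_left_mono order_trans zero_le)
  qed
  have rT1: "ennreal loop_cost \<le> 1"
    using deg_ge[where 'd='d] by (simp add: loop_cost_def ennreal_le_1 power_le_one)
  have 2: "ennreal loop_cost * lam W (\<lambda>\<gamma>. (?v \<gamma> * of_bool (a \<notin> set \<gamma>)) * tuples W N (?La (?Z \<gamma>)))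
      \<le> lam W (\<lambda>\<gamma>. C (set \<gamma> - b) * avoid V \<gamma>)"
  proof -
    have "ennreal loop_cost * lam W (\<lambda>\<gamma>. (?v \<gamma> * of_bool (a \<notin> set \<gamma>)) * tuples W N (?La (?Z \<gamma>)))
        = lam W (\<lambda>\<gamma>. (?v \<gamma> * of_bool (a \<notin> set \<gamma>)) * (ennreal loop_cost * tuples W N (?La (?Z \<gamma>))))"
      unfolding lam_cmult[symmetric] by (simp only: ac_simps)
    also have "\<dots> \<le> lam W (\<lambda>\<gamma>. (?v \<gamma> * of_bool (a \<notin> set \<gamma>)) * tuples W N (?RT (?Z \<gamma>)))"
      by (intro lam_mono mult_left_mono Suc) simp
    also have "\<dots> = lam W (\<lambda>\<gamma>. C (set \<gamma> - b) * ?v \<gamma>)"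
      unfolding C_def aX by (simp only: ac_simps)
    also have "\<dots> \<le> lam W (\<lambda>\<gamma>. C (set \<gamma> - b) * avoid V' \<gamma>)" by (rule lam_reroute)
    also have "\<dots> \<le> lam W (\<lambda>\<gamma>. C (set \<gamma> - b) * avoid V \<gamma>)"
      by (intro lam_mono mult_left_mono avoid_mono) simp
    finally show ?thesis .
  qed
  have RT: "B (set \<gamma> - b) * avoid V \<gamma> * of_bool (T \<subseteq> set \<gamma>) + C (set \<gamma> - b) * avoid V \<gamma>
      \<le> tuples W N (\<lambda>\<sigma>. ?RT Z (\<gamma> # \<sigma>))" for \<gamma>
  proof (cases "a \<in> set \<gamma>")
    case True
    have "B (set \<gamma> - b) * avoid V \<gamma> * of_bool (T \<subseteq> set \<gamma>)
        = tuples W N (\<lambda>\<sigma>. (avoid V \<gamma> * of_bool (T \<subseteq> set \<gamma>)) * ?R (?Z \<gamma>) \<sigma>)"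
      unfolding tuples_cmult B_def using True a by (simp add: ac_simps)
    also have "\<dots> \<le> tuples W N (\<lambda>\<sigma>. ?RT Z (\<gamma> # \<sigma>))"
      unfolding R by (intro tuples_mono) (auto simp: of_bool_def mult_left_mono)
    finally show ?thesis using True a by (simp add: C_def)
  next
    case False
    have "C (set \<gamma> - b) * avoid V \<gamma> = tuples W N (\<lambda>\<sigma>. avoid V \<gamma> * ?RT (?Z \<gamma>) \<sigma>)"
      unfolding tuples_cmult C_def using False by (simp add: ac_simps)
    also have "\<dots> \<le> tuples W N (\<lambda>\<sigma>. ?RT Z (\<gamma> # \<sigma>))"
      unfolding R by (intro tuples_mono) (auto simp: of_bool_def mult.assoc)
    finally show ?thesis using False by (simp add: B_def)
  qed
  have "ennreal loop_cost * tuples W (Suc N) (?La Z) =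
      ennreal loop_cost * lam W (\<lambda>\<gamma>. (?v \<gamma> * of_bool (a \<in> set \<gamma>)) * tuples W N (?L (?Z \<gamma>)))
      + ennreal loop_cost * lam W (\<lambda>\<gamma>. (?v \<gamma> * of_bool (a \<notin> set \<gamma>)) * tuples W N (?La (?Z \<gamma>)))"
    by (simp only: tuples.simps La tuples_add tuples_cmult lam_add distrib_left)
  also have "\<dots> \<le> lam W (\<lambda>\<gamma>. B (set \<gamma> - b) * avoid V \<gamma> * of_bool (T \<subseteq> set \<gamma>) + C (set \<gamma> - b) * avoid V \<gamma>)"
    unfolding lam_add by (intro add_mono 1 2)
  also have "\<dots> \<le> lam W (\<lambda>\<gamma>. tuples W N (\<lambda>\<sigma>. ?RT Z (\<gamma> # \<sigma>)))"
    by (intro lam_mono RT)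
  finally show ?case by (simp only: tuples.simps)
qed simp

lemma soup_surgery:
  assumes "\<And>I. \<Psi> (I - b) = \<Psi> I" "\<And>I. a \<notin> I \<Longrightarrow> \<Psi> I = 0"
  shows "ennreal loop_cost * soup W u (\<lambda>\<sigma>. \<Psi> (footprint \<sigma>) * ennreal (reroute_cost ^ occupation D \<sigma>))
    \<le> soup W u (\<lambda>\<sigma>. \<Psi> (footprint \<sigma>) * of_bool (footprint \<sigma> \<inter> V = {} \<and> T \<subseteq> footprint \<sigma>))"
proof -
  have *: "\<Psi> (footprint \<sigma>) * ennreal (reroute_cost ^ occupation D \<sigma>)
      = \<Psi> ({} \<union> (footprint \<sigma> - b)) * ennreal (reroute_cost ^ occupation D \<sigma>) * of_bool (a \<in> footprint \<sigma>)" for \<sigma>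
    using assms by auto
  have **: "\<Psi> (footprint \<sigma>) * of_bool (footprint \<sigma> \<inter> V = {} \<and> T \<subseteq> footprint \<sigma>)
      = \<Psi> ({} \<union> (footprint \<sigma> - b)) * of_bool (footprint \<sigma> \<inter> V = {}) * of_bool (T \<subseteq> footprint \<sigma>)" for \<sigma>
    using assms by auto
  show ?thesis
    unfolding soup_def ennreal_suminf_cmult[symmetric] * **
    by (subst mult.left_commute) (intro suminf_le mult_left_mono tuples_surgery, auto)
qed

end

section \<open>Trajectories up to a finite time\<close>

fun traj :: "('a \<Rightarrow> 'a pmf) \<Rightarrow> nat \<Rightarrow> 'a \<Rightarrow> 'a list pmf" where
  "traj K 0 x = return_pmf [x]"
| "traj K (Suc n) x = bind_pmf (K x) (\<lambda>y. map_pmf (Cons x) (traj K n y))"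

lemma set_pmf_traj: "\<gamma> \<in> set_pmf (traj K n x) \<Longrightarrow> length \<gamma> = Suc n \<and> hd \<gamma> = x"
  by (induction n arbitrary: x \<gamma>) auto

lemma pmf_traj_Cons:
  "pmf (traj K (Suc n) x) (x # \<gamma>) = (if \<gamma> = [] then 0 else pmf (K x) (hd \<gamma>) * pmf (traj K n (hd \<gamma>)) \<gamma>)"
proof -
  have c: "pmf (map_pmf (Cons x) (traj K n y)) (x # \<gamma>) = pmf (traj K n y) \<gamma>" for y
    by (rule pmf_map_inj') (simp add: inj_def)
  have z: "pmf (traj K n y) \<gamma> = (if \<gamma> \<noteq> [] \<and> y = hd \<gamma> then pmf (traj K n y) \<gamma> else 0)" for y
    using set_pmf_traj[of \<gamma> K n y] by (auto simp: pmf_eq_0_set_pmf)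
  have "ennreal (pmf (traj K (Suc n) x) (x # \<gamma>)) = (\<integral>\<^sup>+y. ennreal (pmf (traj K n y) \<gamma>) \<partial>measure_pmf (K x))"
    unfolding traj.simps ennreal_pmf_bind c ..
  also have "\<dots> = (\<integral>\<^sup>+y. ennreal (if \<gamma> = [] then 0 else pmf (traj K n (hd \<gamma>)) \<gamma>) * indicator {hd \<gamma>} y \<partial>measure_pmf (K x))"
    by (intro nn_integral_cong) (subst z, auto split: split_indicator)
  also have "\<dots> = ennreal (if \<gamma> = [] then 0 else pmf (traj K n (hd \<gamma>)) \<gamma>) * ennreal (pmf (K x) (hd \<gamma>))"
    by (subst nn_integral_cmult_indicator) (auto simp: emeasure_pmf_single)
  also have "\<dots> = ennreal (if \<gamma> = [] then 0 else pmf (K x) (hd \<gamma>) * pmf (traj K n (hd \<gamma>)) \<gamma>)"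
    by (simp add: ennreal_mult' mult.commute)
  finally show ?thesis by (simp split: if_splits)
qed

lemma pmf_traj:
  "pmf (traj K n x) \<gamma> = (if length \<gamma> = Suc n \<and> \<gamma> ! 0 = x then \<Prod>i<n. pmf (K (\<gamma> ! i)) (\<gamma> ! Suc i) else 0)"
proof (induction n arbitrary: x \<gamma>)
  case 0
  then show ?case by (cases \<gamma>) auto
next
  case (Suc n)
  show ?case
  proof (cases "length \<gamma> = Suc (Suc n) \<and> \<gamma> ! 0 = x")
    case False
    then have "\<gamma> \<notin> set_pmf (traj K (Suc n) x)"
      using set_pmf_traj[of \<gamma> K "Suc n" x] by (cases \<gamma>) auto
    then show ?thesis unfolding if_not_P[OF False] by (simp add: pmf_eq_0_set_pmf del: traj.simps)
  next
    case True
    then obtain \<gamma>' where \<gamma>: "\<gamma> = x # \<gamma>'" "length \<gamma>' = Suc n" by (cases \<gamma>) auto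
    then have "\<gamma>' \<noteq> []" by auto
    then show ?thesis
      unfolding \<gamma>(1) pmf_traj_Cons Suc.IH using \<gamma>
      by (simp add: prod.lessThan_Suc_shift hd_conv_nth del: prod.lessThan_Suc)
  qed
qed

text \<open>From here on, events up to a finite time are computed in the discrete law
  \<open>traj\<close> instead of the Ionescu-Tulcea measure.\<close>

lemma distr_markov_law:
  fixes K :: "'a::countable \<Rightarrow> 'a pmf"
  shows "distr (markov_law K x) (count_space UNIV) (\<lambda>X. map X [0..<Suc n]) = measure_pmf (traj K n x)"
    and "(\<lambda>X. map X [0..<Suc n]) \<in> markov_law K x \<rightarrow>\<^sub>M count_space UNIV"
proof -
  have map_eq: "map X [0..<Suc n] = \<gamma> \<longleftrightarrow> length \<gamma> = Suc n \<and> (\<forall>i\<le>n. X i = \<gamma> ! i)" for X :: "nat \<Rightarrow> 'a" and \<gamma>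
    by (auto simp: list_eq_iff_nth_eq less_Suc_eq_le simp del: upt_Suc)
  have vim: "(\<lambda>X. map X [0..<Suc n]) -` {\<gamma>} = (if length \<gamma> = Suc n then {X. \<forall>i\<le>n. X i = \<gamma> ! i} else {})" for \<gamma> :: "'a list"
    using map_eq by (auto simp del: upt_Suc)
  have cyl: "{X. \<forall>i\<le>n. X i = y i} \<in> sets (markov_law K x)" for y
    unfolding sets_markov_law sets_trajectories_eq_cylinders by (intro sigma_sets.Basic) auto
  show m: "(\<lambda>X. map X [0..<Suc n]) \<in> markov_law K x \<rightarrow>\<^sub>M count_space UNIV"
  proof (subst measurable_count_space_eq_countable, simp, intro conjI ballI)
    show "(\<lambda>X. map X [0..<Suc n]) \<in> space (markov_law K x) \<rightarrow> UNIV" by simp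
    fix \<gamma> :: "'a list"
    show "(\<lambda>X. map X [0..<Suc n]) -` {\<gamma>} \<inter> space (markov_law K x) \<in> sets (markov_law K x)"
      unfolding vim space_markov_law using cyl by (simp add: Int_UNIV_right)
  qed
  show "distr (markov_law K x) (count_space UNIV) (\<lambda>X. map X [0..<Suc n]) = measure_pmf (traj K n x)"
  proof (rule measure_eqI_countable[where A=UNIV])
    fix \<gamma> :: "'a list"
    show "emeasure (distr (markov_law K x) (count_space UNIV) (\<lambda>X. map X [0..<Suc n])) {\<gamma>}
        = emeasure (measure_pmf (traj K n x)) {\<gamma>}"
      by (subst emeasure_distr[OF m], simp)
        (auto simp: vim space_markov_law emeasure_markov_law emeasure_pmf_single pmf_traj simp del: upt_Suc)
  qed auto
qed

lemma emeasure_markov_law_prefix: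
  fixes K :: "'a::countable \<Rightarrow> 'a pmf"
  shows "emeasure (markov_law K x) {X. P (map X [0..<Suc n])} = emeasure (measure_pmf (traj K n x)) {\<gamma>. P \<gamma>}"
  unfolding distr_markov_law(1)[symmetric]
  by (subst emeasure_distr[OF distr_markov_law(2)]) (auto simp: space_markov_law vimage_def simp del: upt_Suc)

lemma emeasure_traj_Suc:
  "emeasure (measure_pmf (traj K (Suc n) x)) S
    = (\<integral>\<^sup>+y. emeasure (measure_pmf (traj K n y)) {\<gamma>. x # \<gamma> \<in> S} \<partial>measure_pmf (K x))"
  by (simp add: emeasure_bind_pmf vimage_def)

section \<open>Identification of the soup with the interlacement set\<close>

lemma nn_integral_srw:
  fixes x :: "int ^ 'd::finite"
  shows "(\<integral>\<^sup>+y. f y \<partial>measure_pmf (pmf_of_set {y. nbr x y})) = avg f x"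
proof -
  have "(\<integral>\<^sup>+y. f y \<partial>measure_pmf (pmf_of_set {y. nbr x y})) = (\<Sum>y | nbr x y. f y) / ennreal (DEG x)"
    using nbr_nonempty[of x] finite_nbr[of x]
    by (simp add: nn_integral_pmf_of_set card_nbr deg_def ennreal_of_nat_eq_real_of_nat)
  then show ?thesis
    by (simp add: avg_def divide_ennreal_def inverse_ennreal deg_pos mult.commute inverse_eq_divide)
qed

lemma emeasure_srw_escape:
  fixes x :: "int ^ 'd::finite"
  shows "emeasure (measure_pmf (traj (\<lambda>x. pmf_of_set {y. nbr x y}) n x)) {\<gamma>. set (tl \<gamma>) \<inter> W = {}} = esc W n x"
proof (induction n arbitrary: x)
  case 0
  then show ?case by simp
next
  case (Suc n)
  let ?K = "\<lambda>x. pmf_of_set {y. nbr x y}"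
  have "emeasure (measure_pmf (traj ?K n y)) {\<gamma>. set \<gamma> \<inter> W = {}} = indicator (- W) y * esc W n y" for y
  proof -
    have "emeasure (measure_pmf (traj ?K n y)) {\<gamma>. set \<gamma> \<inter> W = {}}
        = emeasure (measure_pmf (traj ?K n y)) {\<gamma>. y \<notin> W \<and> set (tl \<gamma>) \<inter> W = {}}"
    proof (rule emeasure_eq_AE)
      show "AE \<gamma> in traj ?K n y. (\<gamma> \<in> {\<gamma>. set \<gamma> \<inter> W = {}}) = (\<gamma> \<in> {\<gamma>. y \<notin> W \<and> set (tl \<gamma>) \<inter> W = {}})"
      proof (rule AE_pmfI)
        fix \<gamma> assume "\<gamma> \<in> set_pmf (traj ?K n y)"
        then have "length \<gamma> = Suc n" "hd \<gamma> = y" using set_pmf_traj by metis+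
        then have "\<gamma> = y # tl \<gamma>" by (cases \<gamma>) auto
        then have "set \<gamma> = insert y (set (tl \<gamma>))" by (metis list.simps(15))
        then show "(\<gamma> \<in> {\<gamma>. set \<gamma> \<inter> W = {}}) = (\<gamma> \<in> {\<gamma>. y \<notin> W \<and> set (tl \<gamma>) \<inter> W = {}})" by auto
      qed
    qed auto
    also have "\<dots> = indicator (- W) y * esc W n y"
      by (cases "y \<in> W") (simp_all add: Suc)
    finally show ?thesis .
  qed
  then show ?case
    unfolding emeasure_traj_Suc by (simp add: nn_integral_srw)
qed

lemma equilibrium_eq_charge:
  fixes x :: "int ^ 'd::finite"
  shows "equilibrium A x = enn2real (charge A x)"
proof -
  let ?K = "\<lambda>x. pmf_of_set {y. nbr x y} :: (int ^ 'd) pmf"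
  let ?E = "\<lambda>n. {S. set (tl (map S [0..<Suc n])) \<inter> A = {}}"
  have tl: "tl (map S [0..<Suc n]) = map S [1..<Suc n]" for S :: "nat \<Rightarrow> int ^ 'd" and n
    by (simp add: map_tl[symmetric] del: upt_Suc)
  have E: "?E n = {S. \<forall>k\<in>{1..n}. S k \<notin> A}" for n
    unfolding tl set_map set_upt atLeastLessThanSuc_atLeastAtMost by auto
  have rt: "return_time A S = \<infinity> \<longleftrightarrow> (\<forall>k\<ge>1. S k \<notin> A)" for S
  proof
    assume *: "return_time A S = \<infinity>"
    show "\<forall>k\<ge>1. S k \<notin> A"
    proof (intro allI impI notI)
      fix k :: nat assume "k \<ge> 1" "S k \<in> A"
      then have "Inf {enat k |k. k \<ge> 1 \<and> S k \<in> A} \<le> enat k" by (intro Inf_lower) auto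
      then show False using * by (simp add: return_time_def)
    qed
  next
    assume "\<forall>k\<ge>1. S k \<notin> A"
    then have "{enat k |k. k \<ge> 1 \<and> S k \<in> A} = {}" by auto
    then show "return_time A S = \<infinity>" by (simp add: return_time_def Inf_enat_def)
  qed
  have sets: "?E n \<in> sets (srw_law x)" for n
  proof -
    have "(\<lambda>X. map X [0..<Suc n]) -` {\<gamma>. set (tl \<gamma>) \<inter> A = {}} \<inter> space (markov_law ?K x) \<in> sets (markov_law ?K x)"
      by (rule measurable_sets[OF distr_markov_law(2)]) simp
    then show ?thesis by (simp add: srw_law_def space_markov_law vimage_def del: upt_Suc)
  qed
  have "{S. return_time A S = \<infinity>} = (\<Inter>n. ?E n)"
    unfolding E rt
  proof (intro set_eqI iffI)
    fix S :: "nat \<Rightarrow> int ^ 'd" assume S: "S \<in> (\<Inter>n. {S. \<forall>k\<in>{1..n}. S k \<notin> A})"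
    have "S k \<notin> A" if "k \<ge> 1" for k
    proof -
      have "\<forall>i\<in>{1..k}. S i \<notin> A" using S by blast
      then show ?thesis by (rule bspec) (use that in simp)
    qed
    then show "S \<in> {S. \<forall>k\<ge>1. S k \<notin> A}" by auto
  qed auto
  moreover have "emeasure (srw_law x) (\<Inter>n. ?E n) = (INF n. emeasure (srw_law x) (?E n))"
  proof (rule INF_emeasure_decseq[symmetric])
    show "range ?E \<subseteq> sets (srw_law x)" using sets by auto
    show "decseq ?E" unfolding E decseq_def by auto
    show "emeasure (srw_law x) (?E i) \<noteq> \<infinity>" for i
      unfolding srw_law_def using prob_space.emeasure_le_1[OF prob_space_markov_law]
      by (metis ennreal_one_less_top infinity_ennreal_def leD)
  qed
  moreover have "emeasure (srw_law x) (?E n) = esc A n x" for n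
    unfolding srw_law_def by (subst emeasure_markov_law_prefix) (rule emeasure_srw_escape)
  ultimately have "emeasure (srw_law x) {S. return_time A S = \<infinity>} = escape A x"
    by (simp add: escape_def)
  then show ?thesis
    by (auto simp: equilibrium_def measure_def charge_def split: split_indicator)
qed

lemma cap_eq_charge:
  fixes A :: "(int ^ 'd::finite) set"
  shows "cap A = enn2real (\<Sum>a\<in>A. charge A a)"
proof -
  have "(\<Sum>a\<in>A. charge A a) = (\<Sum>a\<in>A. ennreal (enn2real (charge A a)))"
    by (intro sum.cong refl ennreal_enn2real[symmetric] le_less_trans[OF charge_le_1 ennreal_one_less_top])
  also have "\<dots> = ennreal (\<Sum>a\<in>A. enn2real (charge A a))"
    by (rule sum_ennreal) simp
  finally show ?thesis
    by (simp add: cap_def equilibrium_eq_charge sum_nonneg)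
qed

text \<open>Inclusion-exclusion, organised as an induction over subsets: cancellation in
  \<open>ennreal\<close> is possible for finite terms only, whence the last assumption.\<close>

lemma eq_on_subsets:
  fixes p q :: "'a set \<Rightarrow> ennreal"
  assumes "finite \<eta>" "\<And>\<zeta>. \<zeta> \<subseteq> \<eta> \<Longrightarrow> (\<Sum>\<xi>\<in>Pow \<zeta>. p \<xi>) = (\<Sum>\<xi>\<in>Pow \<zeta>. q \<xi>)"
    "(\<Sum>\<xi>\<in>Pow \<eta>. p \<xi>) < \<top>"
  shows "p \<eta> = q \<eta>"
  using assms
proof (induction \<eta> rule: finite_psubset_induct)
  case (psubset \<eta>)
  have fin: "(\<Sum>\<xi>\<in>Pow \<zeta>. p \<xi>) < \<top>" if "\<zeta> \<subseteq> \<eta>" for \<zeta>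
  proof -
    have "(\<Sum>\<xi>\<in>Pow \<zeta>. p \<xi>) \<le> (\<Sum>\<xi>\<in>Pow \<eta>. p \<xi>)"
      using that psubset.hyps by (intro sum_mono2) auto
    then show ?thesis using psubset.prems(2) by (rule le_less_trans)
  qed
  have "p \<zeta> = q \<zeta>" if "\<zeta> \<subset> \<eta>" for \<zeta>
    using that psubset.prems(1) fin by (intro psubset.IH) auto
  then have eq: "(\<Sum>\<xi>\<in>Pow \<eta> - {\<eta>}. p \<xi>) = (\<Sum>\<xi>\<in>Pow \<eta> - {\<eta>}. q \<xi>)"
    by (intro sum.cong) auto
  have sp: "(\<Sum>\<xi>\<in>Pow \<eta>. f \<xi>) = f \<eta> + (\<Sum>\<xi>\<in>Pow \<eta> - {\<eta>}. f \<xi>)" for f :: "'a set \<Rightarrow> ennreal"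
    using psubset.hyps by (intro sum.remove) auto
  have "(\<Sum>\<xi>\<in>Pow \<eta> - {\<eta>}. p \<xi>) + p \<eta> = (\<Sum>\<xi>\<in>Pow \<eta> - {\<eta>}. p \<xi>) + q \<eta>"
    using psubset.prems(1)[OF order_refl] unfolding sp eq by (simp only: add.commute)
  moreover have "(\<Sum>\<xi>\<in>Pow \<eta> - {\<eta>}. p \<xi>) \<noteq> \<top>"
    using psubset.prems(2) unfolding sp by auto
  ultimately show ?case unfolding ennreal_add_left_cancel by simp
qed

context
  fixes W :: "(int ^ 'd::finite) set" and u :: real and Q :: "(int ^ 'd) set measure"
  assumes d: "CARD('d) \<ge> 3" and W: "finite W" and u: "u > 0" and Q: "interlacement_law u Q"
begin

lemma interlacement_measurable: "{I. I \<inter> W = \<eta>} \<in> sets Q" "{I. I \<inter> W \<subseteq> \<eta>} \<in> sets Q"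
proof -
  have sQ: "sets Q = sets config_space" using Q by (simp add: interlacement_law_def)
  have sp: "space config_space = (UNIV :: (int ^ 'd) set set)"
    by (simp add: config_space_def space_measure_of_conv)
  have mem[measurable]: "Measurable.pred config_space (\<lambda>I. v \<in> I)" for v :: "int ^ 'd"
    by (simp add: pred_def config_space_def)
  have m1: "{I \<in> space config_space. \<forall>v\<in>W. v \<in> I \<longleftrightarrow> v \<in> \<eta>} \<in> sets config_space"
    using W by measurable
  have m2: "{I \<in> space config_space. \<forall>v\<in>W - \<eta>. v \<notin> I} \<in> sets config_space"
    using W by measurable
  have "{I. I \<inter> W = \<eta>} = (if \<eta> \<subseteq> W then {I. \<forall>v\<in>W. v \<in> I \<longleftrightarrow> v \<in> \<eta>} else {})"
    by auto
  then show "{I. I \<inter> W = \<eta>} \<in> sets Q" using m1 by (simp add: sQ sp)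
  have "{I. I \<inter> W \<subseteq> \<eta>} = {I. \<forall>v\<in>W - \<eta>. v \<notin> I}" by auto
  then show "{I. I \<inter> W \<subseteq> \<eta>} \<in> sets Q" using m2 by (simp add: sQ sp)
qed

lemma interlacement_subset:
  assumes "\<zeta> \<subseteq> W"
  shows "emeasure Q {I. I \<inter> W \<subseteq> \<zeta>} = soup W u (\<lambda>\<sigma>. of_bool (footprint \<sigma> \<inter> W \<subseteq> \<zeta>))"
proof -
  interpret Q: prob_space Q using Q by (simp add: interlacement_law_def)
  have f: "finite (W - \<zeta>)" using W by simp
  have "{I. I \<inter> W \<subseteq> \<zeta>} = {I. W - \<zeta> \<subseteq> - I}" by auto
  then have "emeasure Q {I. I \<inter> W \<subseteq> \<zeta>} = ennreal (exp (- u * cap (W - \<zeta>)))"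
    using Q f by (simp add: Q.emeasure_eq_measure interlacement_law_def)
  also have "\<dots> = soup W u (\<lambda>\<sigma>. of_bool (footprint \<sigma> \<inter> (W - \<zeta>) = {}))"
    using u by (subst soup_avoid[OF d W]) (auto simp: cap_eq_charge)
  also have "(\<lambda>\<sigma>. of_bool (footprint \<sigma> \<inter> (W - \<zeta>) = {})) = (\<lambda>\<sigma>. of_bool (footprint \<sigma> \<inter> W \<subseteq> \<zeta>) :: ennreal)"
    by (intro ext arg_cong[where f=of_bool]) auto
  finally show ?thesis .
qed

lemma interlacement_eq:
  assumes "\<eta> \<subseteq> W"
  shows "emeasure Q {I. I \<inter> W = \<eta>} = soup W u (\<lambda>\<sigma>. of_bool (footprint \<sigma> \<inter> W = \<eta>))"
proof -
  interpret Q: prob_space Q using Q by (simp add: interlacement_law_def)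
  let ?p = "\<lambda>\<eta>. emeasure Q {I. I \<inter> W = \<eta>}"
  let ?q = "\<lambda>\<eta>. soup W u (\<lambda>\<sigma>. of_bool (footprint \<sigma> \<inter> W = \<eta>))"
  have fP: "finite (Pow \<zeta>)" if "\<zeta> \<subseteq> W" for \<zeta> using finite_subset[OF that W] by simp
  have p: "(\<Sum>\<xi>\<in>Pow \<zeta>. ?p \<xi>) = emeasure Q {I. I \<inter> W \<subseteq> \<zeta>}" if "\<zeta> \<subseteq> W" for \<zeta>
  proof -
    have "(\<Sum>\<xi>\<in>Pow \<zeta>. ?p \<xi>) = emeasure Q (\<Union>\<xi>\<in>Pow \<zeta>. {I. I \<inter> W = \<xi>})"
      by (rule sum_emeasure) (auto simp: disjoint_family_on_def finite_subset[OF that W] interlacement_measurable)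
    also have "(\<Union>\<xi>\<in>Pow \<zeta>. {I. I \<inter> W = \<xi>}) = {I. I \<inter> W \<subseteq> \<zeta>}" by auto
    finally show ?thesis .
  qed
  have q: "(\<Sum>\<xi>\<in>Pow \<zeta>. ?q \<xi>) = soup W u (\<lambda>\<sigma>. of_bool (footprint \<sigma> \<inter> W \<subseteq> \<zeta>))" if "\<zeta> \<subseteq> W" for \<zeta>
  proof -
    have "(\<Sum>\<xi>\<in>Pow \<zeta>. of_bool (X = \<xi>)) = (of_bool (X \<subseteq> \<zeta>) :: ennreal)" for X
      using finite_subset[OF that W] by (simp add: of_bool_def sum.delta')
    then show ?thesis using fP[OF that] by (simp add: soup_sum[symmetric])
  qed
  show ?thesis
  proof (rule eq_on_subsets[where p="?p" and q="?q"])
    show "finite \<eta>" using assms W by (rule finite_subset)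
    show "(\<Sum>\<xi>\<in>Pow \<zeta>. ?p \<xi>) = (\<Sum>\<xi>\<in>Pow \<zeta>. ?q \<xi>)" if "\<zeta> \<subseteq> \<eta>" for \<zeta>
      using that assms p[of \<zeta>] q[of \<zeta>] interlacement_subset[of \<zeta>] by simp
    show "(\<Sum>\<xi>\<in>Pow \<eta>. ?p \<xi>) < \<top>"
      unfolding p[OF assms] by (simp add: Q.emeasure_eq_measure)
  qed
qed

text \<open>The avoidance probabilities determine the law of \<open>I \<inter> W\<close> by
  inclusion-exclusion. So any \<open>Q\<close> that satisfies \<open>interlacement_law\<close> may
  be replaced by the soup for functions of finitely many sites.\<close>

lemma interlacement_integral:
  "(\<integral>\<^sup>+I. \<psi> (I \<inter> W) \<partial>Q) = soup W u (\<lambda>\<sigma>. \<psi> (footprint \<sigma> \<inter> W))"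
proof -
  have f: "finite (Pow W)" using W by simp
  have e: "\<psi> (I \<inter> W) = (\<Sum>\<eta>\<in>Pow W. \<psi> \<eta> * indicator {I. I \<inter> W = \<eta>} I)" for I
  proof -
    have "(\<Sum>\<eta>\<in>Pow W. \<psi> \<eta> * indicator {I. I \<inter> W = \<eta>} I) = (\<Sum>\<eta>\<in>Pow W. if I \<inter> W = \<eta> then \<psi> \<eta> else 0)"
      by (intro sum.cong) auto
    then show ?thesis using f by (simp add: sum.delta')
  qed
  have "(\<integral>\<^sup>+I. \<psi> (I \<inter> W) \<partial>Q) = (\<Sum>\<eta>\<in>Pow W. \<psi> \<eta> * emeasure Q {I. I \<inter> W = \<eta>})"
    unfolding e using interlacement_measurable
    by (subst nn_integral_sum) (auto simp: nn_integral_cmult_indicator)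
  also have "\<dots> = (\<Sum>\<eta>\<in>Pow W. soup W u (\<lambda>\<sigma>. \<psi> \<eta> * of_bool (footprint \<sigma> \<inter> W = \<eta>)))"
    by (intro sum.cong) (auto simp: interlacement_eq soup_cmult)
  also have "\<dots> = soup W u (\<lambda>\<sigma>. \<Sum>\<eta>\<in>Pow W. \<psi> \<eta> * of_bool (footprint \<sigma> \<inter> W = \<eta>))"
    by (rule soup_sum[OF f, symmetric])
  also have "(\<lambda>\<sigma>. \<Sum>\<eta>\<in>Pow W. \<psi> \<eta> * of_bool (footprint \<sigma> \<inter> W = \<eta>)) = (\<lambda>\<sigma>. \<psi> (footprint \<sigma> \<inter> W))"
    unfolding e[of "footprint _"] by (intro ext sum.cong) (auto split: split_indicator)
  finally show ?thesis .
qed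

end

section \<open>Markov property and the probability to stay in a set\<close>

lemma map_pmf_traj_last: "map_pmf last (traj K (Suc n) x) = bind_pmf (map_pmf last (traj K n x)) K"
proof (induction n arbitrary: x)
  case 0
  show ?case by (simp add: bind_return_pmf map_bind_pmf bind_return_pmf')
next
  case (Suc n)
  have c: "map_pmf last (map_pmf (Cons x) (traj K m y)) = map_pmf last (traj K m y)" for m y
  proof -
    have "last (x # \<gamma>) = last \<gamma>" if "\<gamma> \<in> set_pmf (traj K m y)" for \<gamma>
      using set_pmf_traj[OF that] by (cases \<gamma>) auto
    then show ?thesis unfolding map_pmf_comp by (intro map_pmf_cong) auto
  qed
  have eq: "map_pmf last (traj K (Suc m) x) = bind_pmf (K x) (\<lambda>y. map_pmf last (traj K m y))" for m
    by (simp only: traj.simps map_bind_pmf c)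
  show ?case by (subst eq[of "Suc n"], subst eq[of n]) (simp only: bind_assoc_pmf Suc)
qed

lemma traj_split:
  "traj K (s + r) x = bind_pmf (traj K s x) (\<lambda>\<gamma>. map_pmf (\<lambda>\<gamma>'. \<gamma> @ tl \<gamma>') (traj K r (last \<gamma>)))"
proof (induction s arbitrary: x)
  case 0
  have "map_pmf (\<lambda>\<gamma>'. [x] @ tl \<gamma>') (traj K r x) = map_pmf id (traj K r x)"
  proof (rule map_pmf_cong[OF refl])
    fix \<gamma> assume "\<gamma> \<in> set_pmf (traj K r x)"
    then show "[x] @ tl \<gamma> = id \<gamma>" using set_pmf_traj[of \<gamma> K r x] by (cases \<gamma>) auto
  qed
  then show ?case by (simp add: bind_return_pmf)
next
  case (Suc s)
  have "bind_pmf (map_pmf (Cons x) (traj K s y)) (\<lambda>\<gamma>. map_pmf (\<lambda>\<gamma>'. \<gamma> @ tl \<gamma>') (traj K r (last \<gamma>)))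
      = map_pmf (Cons x) (bind_pmf (traj K s y) (\<lambda>\<gamma>. map_pmf (\<lambda>\<gamma>'. \<gamma> @ tl \<gamma>') (traj K r (last \<gamma>))))" for y
  proof -
    have "map_pmf (\<lambda>\<gamma>'. (x # \<gamma>) @ tl \<gamma>') (traj K r (last (x # \<gamma>)))
        = map_pmf (Cons x) (map_pmf (\<lambda>\<gamma>'. \<gamma> @ tl \<gamma>') (traj K r (last \<gamma>)))"
      if "\<gamma> \<in> set_pmf (traj K s y)" for \<gamma>
      using set_pmf_traj[OF that] by (cases \<gamma>) (auto simp: map_pmf_comp)
    then show ?thesis
      unfolding bind_map_pmf map_bind_pmf by (intro bind_pmf_cong) auto
  qed
  then show ?case by (simp add: Suc bind_assoc_pmf)
qed

lemma nn_integral_traj_split: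
  "(\<integral>\<^sup>+\<gamma>. f \<gamma> \<partial>measure_pmf (traj K (s + r) x))
    = (\<integral>\<^sup>+\<gamma>. (\<integral>\<^sup>+\<gamma>'. f (\<gamma> @ tl \<gamma>') \<partial>measure_pmf (traj K r (last \<gamma>))) \<partial>measure_pmf (traj K s x))"
  unfolding traj_split by simp

text \<open>The starting point is exempt, since the path of a trap does not contain the site from
  which it is entered.\<close>

definition stay :: "('a \<Rightarrow> 'a pmf) \<Rightarrow> 'a set \<Rightarrow> nat \<Rightarrow> 'a \<Rightarrow> real" where
  "stay K T r x = measure (measure_pmf (traj K r x)) {\<gamma>. set (tl \<gamma>) \<subseteq> T}"

lemma stay_0: "stay K T 0 x = 1"
  by (simp add: stay_def)

lemma stay_nonneg: "stay K T r x \<ge> 0"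
  by (simp add: stay_def)

lemma stay_Suc_ge:
  assumes "finite Y" "Y \<subseteq> T"
  shows "(\<Sum>y\<in>Y. pmf (K x) y * stay K T r y) \<le> stay K T (Suc r) x"
proof -
  have e: "emeasure (measure_pmf (traj K r y)) {\<gamma>. set \<gamma> \<subseteq> T} = ennreal (stay K T r y)" if "y \<in> T" for y
  proof -
    have "emeasure (measure_pmf (traj K r y)) {\<gamma>. set \<gamma> \<subseteq> T} = emeasure (measure_pmf (traj K r y)) {\<gamma>. set (tl \<gamma>) \<subseteq> T}"
    proof (rule emeasure_eq_AE)
      show "AE \<gamma> in traj K r y. (\<gamma> \<in> {\<gamma>. set \<gamma> \<subseteq> T}) = (\<gamma> \<in> {\<gamma>. set (tl \<gamma>) \<subseteq> T})"
      proof (rule AE_pmfI)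
        fix \<gamma> assume "\<gamma> \<in> set_pmf (traj K r y)"
        then show "(\<gamma> \<in> {\<gamma>. set \<gamma> \<subseteq> T}) = (\<gamma> \<in> {\<gamma>. set (tl \<gamma>) \<subseteq> T})"
          using set_pmf_traj[of \<gamma> K r y] that by (cases \<gamma>) auto
      qed
    qed auto
    then show ?thesis by (simp add: stay_def measure_pmf.emeasure_eq_measure)
  qed
  have "ennreal (\<Sum>y\<in>Y. pmf (K x) y * stay K T r y) = (\<Sum>y\<in>Y. ennreal (stay K T r y) * emeasure (measure_pmf (K x)) {y})"
    by (subst sum_ennreal[symmetric]) (auto simp: stay_nonneg emeasure_pmf_single ennreal_mult' mult.commute)
  also have "\<dots> = (\<integral>\<^sup>+y. (\<Sum>w\<in>Y. ennreal (stay K T r w) * indicator {w} y) \<partial>measure_pmf (K x))"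
    by (subst nn_integral_sum) (auto simp: nn_integral_cmult_indicator)
  also have "\<dots> \<le> (\<integral>\<^sup>+y. emeasure (measure_pmf (traj K r y)) {\<gamma>. set \<gamma> \<subseteq> T} \<partial>measure_pmf (K x))"
  proof (rule nn_integral_mono)
    fix y
    have "(\<Sum>w\<in>Y. ennreal (stay K T r w) * indicator {w} y) = (\<Sum>w\<in>Y. if y = w then ennreal (stay K T r w) else 0)"
      by (intro sum.cong) auto
    then show "(\<Sum>w\<in>Y. ennreal (stay K T r w) * indicator {w} y) \<le> emeasure (measure_pmf (traj K r y)) {\<gamma>. set \<gamma> \<subseteq> T}"
      using assms e[of y] by (auto simp: sum.delta')
  qed
  also have "\<dots> = ennreal (stay K T (Suc r) x)"
    unfolding stay_def measure_pmf.emeasure_eq_measure[symmetric] emeasure_traj_Suc by simp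
  finally show ?thesis by (simp add: stay_nonneg)
qed

section \<open>The biased walk in a fixed environment\<close>

context
  fixes e :: "'d::finite" and \<beta> :: real
  assumes \<beta>: "\<beta> > 1"
begin

lemma conductance_nonneg: "conductance e \<beta> I x y \<ge> 0"
  using \<beta> by (simp add: conductance_def)

lemma conductance_sym: "conductance e \<beta> I x y = conductance e \<beta> I y x"
  by (auto simp: conductance_def max.commute nbr_sym[of x y])

lemma total_conductance_nonneg: "total_conductance e \<beta> I x \<ge> 0"
  unfolding total_conductance_def by (intro sum_nonneg conductance_nonneg)

lemma nbr_coord: "nbr x y \<Longrightarrow> \<bar>x $ i - y $ i\<bar> \<le> 1" for x y :: "int ^ 'd"
  unfolding nbr_iff by (auto simp: axis_def)

lemma conductance_bounds:
  assumes "x \<in> I" "y \<in> I" "nbr x y"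
  shows "\<beta> powi (x $ e) \<le> conductance e \<beta> I x y" "conductance e \<beta> I x y \<le> \<beta> powi (x $ e + 1)"
  using assms \<beta> nbr_coord[OF assms(3), of e]
  by (auto simp: conductance_def intro!: power_int_increasing)

lemma total_conductance_le: "total_conductance e \<beta> I x \<le> deg TYPE(int ^ 'd) * \<beta> powi (x $ e + 1)"
proof -
  have "total_conductance e \<beta> I x \<le> (\<Sum>z | nbr x z. \<beta> powi (x $ e + 1))"
    unfolding total_conductance_def
  proof (rule sum_mono)
    fix z assume "z \<in> {z. nbr x z}"
    then show "conductance e \<beta> I x z \<le> \<beta> powi (x $ e + 1)"
      using conductance_bounds(2)[of x I z] \<beta> by (cases "x \<in> I \<and> z \<in> I") (auto simp: conductance_def)
  qed
  then show ?thesis by (simp add: card_nbr deg_def)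
qed

lemma total_conductance_ge:
  assumes "x \<in> I" "y \<in> I" "nbr x y"
  shows "\<beta> powi (x $ e) \<le> total_conductance e \<beta> I x"
proof -
  have "conductance e \<beta> I x y \<le> total_conductance e \<beta> I x"
    unfolding total_conductance_def using assms finite_nbr[of x]
    by (intro member_le_sum) (auto simp: conductance_nonneg)
  then show ?thesis using conductance_bounds(1)[OF assms] by simp
qed

lemma total_conductance_pos:
  assumes "x \<in> I" "y \<in> I" "nbr x y"
  shows "total_conductance e \<beta> I x > 0"
  using total_conductance_ge[OF assms] \<beta> by (smt (verit) zero_less_power_int)

lemma total_conductance_pos_iff:
  "total_conductance e \<beta> I x > 0 \<longleftrightarrow> (\<exists>y. x \<in> I \<and> y \<in> I \<and> nbr x y)"
proof
  assume "total_conductance e \<beta> I x > 0"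
  then obtain y where "nbr x y" "conductance e \<beta> I x y \<noteq> 0"
    unfolding total_conductance_def by (metis (mono_tags, lifting) mem_Collect_eq order_less_irrefl sum.neutral)
  then show "\<exists>y. x \<in> I \<and> y \<in> I \<and> nbr x y" by (auto simp: conductance_def split: if_splits)
qed (use total_conductance_pos in blast)

lemma pmf_biased_step_nbr:
  assumes "x \<in> I" "y \<in> I" "nbr x y"
  shows "pmf (biased_step e \<beta> I x) y = conductance e \<beta> I x y / total_conductance e \<beta> I x"
  using total_conductance_pos[OF assms] \<beta> by (intro pmf_biased_step) auto

lemma pmf_biased_step_ge:
  assumes "x \<in> I" "y \<in> I" "nbr x y"
  shows "1 / (deg TYPE(int ^ 'd) * \<beta>) \<le> pmf (biased_step e \<beta> I x) y"
proof -
  have pos: "\<beta> powi (x $ e) > 0" using \<beta> by simp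
  have "1 / (deg TYPE(int ^ 'd) * \<beta>) = \<beta> powi (x $ e) / (deg TYPE(int ^ 'd) * \<beta> powi (x $ e + 1))"
    using pos \<beta> by (simp add: power_int_add)
  also have "\<dots> \<le> conductance e \<beta> I x y / total_conductance e \<beta> I x"
    using pos conductance_bounds[OF assms] total_conductance_le[of I x] total_conductance_pos[OF assms]
    by (intro frac_le) auto
  finally show ?thesis by (simp add: pmf_biased_step_nbr[OF assms])
qed

lemma set_pmf_biased_step: "y \<in> set_pmf (biased_step e \<beta> I x) \<Longrightarrow> y = x \<or> (nbr x y \<and> y \<in> I)"
proof (cases "total_conductance e \<beta> I x = 0")
  case False
  assume "y \<in> set_pmf (biased_step e \<beta> I x)"
  then have "conductance e \<beta> I x y \<noteq> 0"
    using pmf_biased_step[of \<beta> e I x y] \<beta> False by (auto simp: set_pmf_iff)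
  then show ?thesis by (auto simp: conductance_def split: if_splits)
qed (auto simp: biased_step_def)

text \<open>Locality of the kernel, the reason why \<open>fresh\<close> refers to the neighbours of
  the visited sites too.\<close>

lemma biased_step_cong:
  assumes "\<And>y. y = x \<or> nbr x y \<Longrightarrow> y \<in> I \<longleftrightarrow> y \<in> I'"
  shows "biased_step e \<beta> I x = biased_step e \<beta> I' x"
proof -
  have c: "conductance e \<beta> I x = conductance e \<beta> I' x"
    using assms by (auto simp: conductance_def fun_eq_iff)
  then have "total_conductance e \<beta> I x = total_conductance e \<beta> I' x"
    by (simp add: total_conductance_def)
  then show ?thesis by (simp add: biased_step_def c)
qed

lemma stay_entry:
  assumes "successively nbr xs" "set xs \<subseteq> I" "set (tl xs) \<subseteq> T" "xs \<noteq> []"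
    and "\<And>r. r \<le> n \<Longrightarrow> h \<le> stay (biased_step e \<beta> I) T r (last xs)" "h \<le> 1" "0 \<le> h" "r \<le> n"
  shows "(1 / (deg TYPE(int ^ 'd) * \<beta>)) ^ (length xs - 1) * h \<le> stay (biased_step e \<beta> I) T r (hd xs)"
  using assms
proof (induction xs arbitrary: r)
  case (Cons x xs)
  let ?p = "1 / (deg TYPE(int ^ 'd) * \<beta>)"
  have p: "0 \<le> ?p" "?p \<le> 1"
  proof -
    have "1 * 1 \<le> deg TYPE(int ^ 'd) * \<beta>" using \<beta> deg_ge[where 'd='d] by (intro mult_mono) auto
    then show "0 \<le> ?p" "?p \<le> 1" by (auto simp: divide_le_eq_1)
  qed
  show ?case
  proof (cases xs)
    case Nil
    then show ?thesis using Cons.prems by simp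
  next
    case (Cons y ys)
    show ?thesis
    proof (cases r)
      case 0
      have "?p ^ (length (x # xs) - 1) * h \<le> 1 * 1"
        using p Cons.prems by (intro mult_mono power_le_one) auto
      then show ?thesis by (simp add: 0 stay_0)
    next
      case (Suc r')
      have xy: "x \<in> I" "y \<in> I" "nbr x y" "y \<in> T" using Cons.prems Cons by auto
      have "?p ^ (length xs - 1) * h \<le> stay (biased_step e \<beta> I) T r' (hd xs)"
        by (rule Cons.IH) (use Cons.prems Cons Suc in \<open>auto dest: order_trans[OF _ Suc_leD]\<close>)
      then have "?p * (?p ^ (length xs - 1) * h) \<le> pmf (biased_step e \<beta> I x) y * stay (biased_step e \<beta> I) T r' y"
        using pmf_biased_step_ge[OF xy(1-3)] p Cons.prems(7) Cons by (intro mult_mono) auto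
      also have "\<dots> \<le> stay (biased_step e \<beta> I) T (Suc r') x"
        using stay_Suc_ge[of "{y}" T "biased_step e \<beta> I" x r'] xy by simp
      finally show ?thesis using Cons Suc by simp
    qed
  qed
qed simp

text \<open>Inside the corridor \<open>\<beta> powi (- j)\<close> is harmonic for the walk except at the dead end \<open>L\<close>.\<close>

lemma stay_corridor:
  fixes c :: "nat \<Rightarrow> int ^ 'd"
  assumes L: "L \<ge> 2" and c: "\<And>j. c j = c 0 + axis e (int j)"
    and I: "\<And>j. j \<le> L \<Longrightarrow> c j \<in> I" and T: "\<And>j. 1 \<le> j \<Longrightarrow> j \<le> L \<Longrightarrow> c j \<in> T"
    and vac: "\<And>j y. 1 \<le> j \<Longrightarrow> j \<le> L \<Longrightarrow> nbr (c j) y \<Longrightarrow> y \<in> I \<Longrightarrow> y = c (j - 1) \<or> (j < L \<and> y = c (j + 1))"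
    and j: "1 \<le> j" "j \<le> L"
  shows "1 - \<beta> powi (- int j) - real r * \<beta> powi (1 - int L) \<le> stay (biased_step e \<beta> I) T r (c j)"
  using j
proof (induction r arbitrary: j)
  case 0
  then show ?case using \<beta> by (simp add: stay_0)
next
  case (Suc r)
  let ?K = "biased_step e \<beta> I"
  let ?H = "\<lambda>r j. 1 - \<beta> powi (- int j) - real r * \<beta> powi (1 - int L)"
  have b0: "\<beta> powi k > 0" for k using \<beta> by simp
  have nb: "nbr (c j) (c (j + 1))" "nbr (c (j + 1)) (c j)" for j
  proof -
    have "c (j + 1) = c j + axis e 1" unfolding c[of "j + 1"] c[of j] by (simp add: vec_eq_iff axis_def)
    then show "nbr (c j) (c (j + 1))" by (auto simp: nbr_iff)
    then show "nbr (c (j + 1)) (c j)" using nbr_sym by blast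
  qed
  have ce: "c j $ e = c 0 $ e + int j" for j by (subst c) (simp add: axis_def)
  have nbj: "nbr (c j) (c (j - 1))" using nb(2)[of "j - 1"] Suc.prems by simp
  have inj: "c i \<noteq> c k" if "i \<noteq> k" for i k using ce[of i] ce[of k] that by auto
  have cond: "conductance e \<beta> I (c j) (c (j - 1)) = \<beta> powi (c j $ e)"
    using nbj I Suc.prems ce[of j] ce[of "j - 1"] by (auto simp: conductance_def max_def)
  show ?case
  proof (cases "j < L")
    case True
    have cond2: "conductance e \<beta> I (c j) (c (j + 1)) = \<beta> powi (c j $ e + 1)"
      using nb(1)[of j] I[of j] I[of "j + 1"] True ce[of j] ce[of "j + 1"]
      by (auto simp: conductance_def max_def ac_simps)
    have "total_conductance e \<beta> I (c j) = (\<Sum>z\<in>{c (j - 1), c (j + 1)}. conductance e \<beta> I (c j) z)"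
      unfolding total_conductance_def
    proof (rule sum.mono_neutral_right)
      show "{c (j - 1), c (j + 1)} \<subseteq> {z. nbr (c j) z}" using nbj nb by auto
      show "\<forall>z\<in>{z. nbr (c j) z} - {c (j - 1), c (j + 1)}. conductance e \<beta> I (c j) z = 0"
        using vac Suc.prems by (auto simp: conductance_def)
    qed (rule finite_nbr)
    also have "\<dots> = \<beta> powi (c j $ e) * (1 + \<beta>)"
    proof -
      have "c (j - 1) \<noteq> c (j + 1)" by (rule inj) simp
      then have "(\<Sum>z\<in>{c (j - 1), c (j + 1)}. conductance e \<beta> I (c j) z)
          = \<beta> powi (c j $ e) + \<beta> powi (c j $ e + 1)"
        by (simp only: sum.insert sum.empty finite.emptyI finite.insertI insert_iff empty_iff simp_thms cond cond2 add_0_right)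
      then show ?thesis using \<beta> by (simp add: power_int_add distrib_left)
    qed
    finally have tot: "total_conductance e \<beta> I (c j) = \<beta> powi (c j $ e) * (1 + \<beta>)" .
    have p1: "pmf (?K (c j)) (c (j - 1)) = 1 / (1 + \<beta>)"
      using pmf_biased_step_nbr[OF I[of j] I[of "j - 1"] nbj] Suc.prems \<beta> unfolding tot cond by simp
    have p2: "pmf (?K (c j)) (c (j + 1)) = \<beta> / (1 + \<beta>)"
      using pmf_biased_step_nbr[OF I[of j] I[of "j + 1"] nb(1)] True b0[of "c j $ e"] \<beta> unfolding tot cond2
      by (simp add: power_int_add)
    have IH2: "?H r (j + 1) \<le> stay ?K T r (c (j + 1))" using True by (intro Suc.IH) auto
    have b: "\<beta> powi (- int (j + 1)) = \<beta> powi (- int j) / \<beta>"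
      "\<beta> powi (- int (j - 1)) = \<beta> powi (- int j) * \<beta>"
      using \<beta> Suc.prems by (simp_all add: power_int_diff power_int_add of_nat_diff)
        (simp_all add: power_int_minus power_int_diff field_simps)
    have harm: "\<beta> / (1 + \<beta>) * ?H r (j + 1) + 1 / (1 + \<beta>) * ?H r (j - 1) = ?H r j"
      unfolding b using \<beta> by (simp add: divide_simps) (simp add: algebra_simps)
    have "?H (Suc r) j \<le> ?H r j" using b0 by (simp add: algebra_simps less_imp_le)
    also have "\<dots> \<le> stay ?K T (Suc r) (c j)"
    proof (cases "j = 1")
      case j1: True
      have "1 / (1 + \<beta>) * ?H r (j - 1) \<le> 0"
        using b0[of "1 - int L"] \<beta> j1 by (auto intro!: mult_nonneg_nonpos divide_nonpos_pos)
      then have "?H r j \<le> \<beta> / (1 + \<beta>) * ?H r (j + 1)" using harm by linarith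
      also have "\<dots> \<le> \<beta> / (1 + \<beta>) * stay ?K T r (c (j + 1))"
        using \<beta> IH2 by (intro mult_left_mono) auto
      also have "\<dots> \<le> stay ?K T (Suc r) (c j)"
        using stay_Suc_ge[of "{c (j + 1)}" T ?K "c j" r] T[of "j + 1"] True p2 by simp
      finally show ?thesis .
    next
      case j1: False
      have IH1: "?H r (j - 1) \<le> stay ?K T r (c (j - 1))" using Suc.prems j1 by (intro Suc.IH) auto
      have "?H r j \<le> \<beta> / (1 + \<beta>) * stay ?K T r (c (j + 1)) + 1 / (1 + \<beta>) * stay ?K T r (c (j - 1))"
        unfolding harm[symmetric] using \<beta> IH1 IH2 by (intro add_mono mult_left_mono) auto
      also have "\<dots> \<le> stay ?K T (Suc r) (c j)"
        using stay_Suc_ge[of "{c (j + 1), c (j - 1)}" T ?K "c j" r] T[of "j + 1"] T[of "j - 1"] True j1 Suc.prems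
          p1 p2 inj[of "j + 1" "j - 1"] by simp
      finally show ?thesis .
    qed
    finally show ?thesis .
  next
    case False
    then have jL: "j = L" using Suc.prems by simp
    have "total_conductance e \<beta> I (c j) = (\<Sum>z\<in>{c (j - 1)}. conductance e \<beta> I (c j) z)"
      unfolding total_conductance_def
    proof (rule sum.mono_neutral_right)
      show "{c (j - 1)} \<subseteq> {z. nbr (c j) z}" using nbj by auto
      show "\<forall>z\<in>{z. nbr (c j) z} - {c (j - 1)}. conductance e \<beta> I (c j) z = 0"
        using vac[of j] Suc.prems jL by (auto simp: conductance_def)
    qed (rule finite_nbr)
    then have "pmf (?K (c j)) (c (j - 1)) = 1"
      using pmf_biased_step_nbr[OF I[of j] I[of "j - 1"] nbj] Suc.prems \<beta> cond by simp
    then have "stay ?K T r (c (j - 1)) \<le> stay ?K T (Suc r) (c j)"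
      using stay_Suc_ge[of "{c (j - 1)}" T ?K "c j" r] T[of "j - 1"] L jL by simp
    moreover have "?H r (j - 1) \<le> stay ?K T r (c (j - 1))" using L jL by (intro Suc.IH) auto
    \<comment> \<open>At the dead end the walk is forced back, where harmonicity fails by at most
      \<open>\<beta> powi (1 - int L)\<close>; this is charged to the extra unit of time.\<close>
    moreover have "?H (Suc r) j \<le> ?H r (j - 1)"
      using L jL b0[of "- int L"] by (simp add: of_nat_diff algebra_simps)
    ultimately show ?thesis by linarith
  qed
qed

text \<open>By reversibility the total conductance is an invariant measure.\<close>

lemma pmf_traj_last_le:
  assumes x: "total_conductance e \<beta> I x > 0"
  shows "total_conductance e \<beta> I x * pmf (map_pmf last (traj (biased_step e \<beta> I) k x)) y \<le> total_conductance e \<beta> I y"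
proof (induction k arbitrary: y)
  case 0
  then show ?case using x total_conductance_nonneg[of I y] by (auto simp: indicator_def)
next
  case (Suc k)
  let ?K = "biased_step e \<beta> I"
  let ?m = "map_pmf last (traj ?K k x)"
  let ?\<pi> = "total_conductance e \<beta> I"
  let ?N = "insert y {z. nbr y z}"
  have fN: "finite ?N" using finite_nbr by simp
  have "ennreal (pmf (map_pmf last (traj ?K (Suc k) x)) y) = (\<integral>\<^sup>+z. ennreal (pmf (?K z) y) \<partial>measure_pmf ?m)"
    unfolding map_pmf_traj_last by (rule ennreal_pmf_bind)
  also have "\<dots> = (\<Sum>z\<in>?N. ennreal (pmf (?K z) y) * ennreal (pmf ?m z))"
  proof (rule nn_integral_measure_pmf_support[OF fN])
    fix z assume "z \<notin> ?N"
    then show "ennreal (pmf (?K z) y) = 0"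
      using set_pmf_biased_step[of y I z] nbr_sym[of y z] by (auto simp: pmf_eq_0_set_pmf)
  qed auto
  also have "\<dots> = ennreal (\<Sum>z\<in>?N. pmf (?K z) y * pmf ?m z)"
    by (subst sum_ennreal[symmetric]) (auto simp: ennreal_mult')
  finally have "pmf (map_pmf last (traj ?K (Suc k) x)) y = (\<Sum>z\<in>?N. pmf (?K z) y * pmf ?m z)"
    by (simp add: sum_nonneg)
  then have "?\<pi> x * pmf (map_pmf last (traj ?K (Suc k) x)) y = (\<Sum>z\<in>?N. pmf (?K z) y * (?\<pi> x * pmf ?m z))"
    by (simp add: sum_distrib_left mult.left_commute)
  also have "\<dots> \<le> (\<Sum>z\<in>?N. pmf (?K z) y * ?\<pi> z)"
    by (intro sum_mono mult_left_mono Suc) auto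
  also have "\<dots> = (\<Sum>z\<in>?N. conductance e \<beta> I y z)"
  proof (intro sum.cong refl)
    fix z
    show "pmf (?K z) y * ?\<pi> z = conductance e \<beta> I y z"
    proof (cases "?\<pi> z = 0")
      case True
      then have "\<not> (z \<in> I \<and> y \<in> I \<and> nbr z y)" using total_conductance_pos[of z I y] by auto
      then show ?thesis using True nbr_sym[of y z] by (auto simp: conductance_def)
    next
      case False
      then show ?thesis using \<beta> by (simp add: pmf_biased_step conductance_sym[of I y])
    qed
  qed
  also have "\<dots> = ?\<pi> y"
    using finite_nbr[of y] by (simp add: total_conductance_def) (simp add: conductance_def)
  finally show ?case .
qed

text \<open>The quotient of the invariant measure at the two sites. If the total conductance at
  \<open>x\<close> vanishes, the walk stays at \<open>x\<close>, where the bound is at least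
  \<open>1\<close>.\<close>

lemma pmf_traj_last_bound:
  "pmf (map_pmf last (traj (biased_step e \<beta> I) k x)) y \<le> deg TYPE(int ^ 'd) * \<beta> powi (y $ e - x $ e + 1)"
proof (cases "total_conductance e \<beta> I x > 0")
  case True
  let ?\<pi> = "total_conductance e \<beta> I"
  obtain w where w: "x \<in> I" "w \<in> I" "nbr x w" using True by (auto simp: total_conductance_pos_iff)
  have pos: "\<beta> powi (x $ e) > 0" using \<beta> by simp
  have "\<beta> powi (x $ e) * pmf (map_pmf last (traj (biased_step e \<beta> I) k x)) y
      \<le> ?\<pi> x * pmf (map_pmf last (traj (biased_step e \<beta> I) k x)) y"
    using total_conductance_ge[OF w] by (intro mult_right_mono) auto
  also have "\<dots> \<le> deg TYPE(int ^ 'd) * \<beta> powi (y $ e + 1)"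
    using pmf_traj_last_le[OF True, of k y] total_conductance_le[of I y] by linarith
  finally have "pmf (map_pmf last (traj (biased_step e \<beta> I) k x)) y
      \<le> deg TYPE(int ^ 'd) * \<beta> powi (y $ e + 1) / \<beta> powi (x $ e)"
    using pos by (simp add: field_simps)
  also have "\<dots> = deg TYPE(int ^ 'd) * \<beta> powi (y $ e - x $ e + 1)"
    using power_int_diff[of \<beta> "y $ e + 1" "x $ e"] \<beta> by (simp add: algebra_simps)
  finally show ?thesis .
next
  case False
  then have "biased_step e \<beta> I x = return_pmf x"
    using total_conductance_nonneg[of I x] by (simp add: biased_step_def)
  then have "map_pmf last (traj (biased_step e \<beta> I) k x) = return_pmf x"
  proof (induction k)
    case (Suc k)
    then show ?case by (simp add: map_pmf_traj_last bind_return_pmf del: traj.simps)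
  qed simp
  moreover have "1 \<le> deg TYPE(int ^ 'd) * \<beta>"
    using deg_ge[where 'd='d] \<beta> mult_mono[of 1 "deg TYPE(int ^ 'd)" 1 \<beta>] by simp
  ultimately show ?thesis
    using \<beta> by (auto simp: indicator_def intro!: mult_nonneg_nonneg less_imp_le[OF deg_pos])
qed

end

section \<open>The geometry of the traps\<close>

definition upd :: "int ^ 'd \<Rightarrow> 'd \<Rightarrow> int \<Rightarrow> int ^ 'd" where
  "upd x i t = (\<chi> j. if j = i then t else x $ j)"

lemma upd_nth [simp]: "upd x i t $ j = (if j = i then t else x $ j)"
  by (simp add: upd_def)

lemma nbr_upd_iff: "nbr x y \<longleftrightarrow> (\<exists>i. y = upd x i (x $ i + 1) \<or> y = upd x i (x $ i - 1))"
  for x y :: "int ^ 'd::finite"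
proof -
  have "x + axis i 1 = upd x i (x $ i + 1)" "x - axis i 1 = upd x i (x $ i - 1)" for i
    by (simp_all add: vec_eq_iff axis_def)
  then show ?thesis unfolding nbr_iff by simp
qed

lemma linked_upd:
  fixes x :: "int ^ 'd::finite"
  assumes "\<And>r. min (x $ i) t \<le> r \<Longrightarrow> r \<le> max (x $ i) t \<Longrightarrow> upd x i r \<in> R"
    and "nat \<bar>t - x $ i\<bar> \<le> l"
  shows "linked R l x (upd x i t)"
proof -
  have xx: "upd x i (x $ i) = x" by (simp add: vec_eq_iff)
  have "linked R (nat \<bar>t - x $ i\<bar>) x (upd x i t)"
    using assms(1)
  proof (induction "nat \<bar>t - x $ i\<bar>" arbitrary: t)
    case 0
    then show ?case by (simp add: xx)
  next
    case (Suc n)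
    define t' where "t' = (if t > x $ i then t - 1 else t + 1)"
    have t': "n = nat \<bar>t' - x $ i\<bar>" using Suc.hyps(2) by (auto simp: t'_def)
    have in_R: "upd x i r \<in> R" if "min (x $ i) t' \<le> r" "r \<le> max (x $ i) t'" for r
      using that Suc.hyps(2) by (intro Suc.prems) (auto simp: t'_def split: if_splits)
    have 1: "linked R (nat \<bar>t' - x $ i\<bar>) x (upd x i t')"
      using Suc.hyps(1)[OF t'] in_R by blast
    have 2: "linked R 1 (upd x i t') (upd x i t)"
    proof (rule linked_step)
      show "upd x i t' \<in> R" by (rule in_R) auto
      show "upd x i t \<in> R" by (rule Suc.prems) auto
      have "upd x i t = upd (upd x i t') i t" by (simp add: vec_eq_iff)
      then show "nbr (upd x i t') (upd x i t)"
        unfolding nbr_upd_iff by (intro exI[of _ i]) (auto simp: t'_def)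
    qed
    show ?case
      using linked_trans[OF 1 2] Suc.hyps(2) t' by (simp add: Suc.hyps(2)[symmetric])
  qed
  then show ?thesis using assms(2) by (rule linked_mono)
qed

text \<open>Level \<open>0\<close> is left out, since the corridor must be accessible from there;
  level \<open>L + 1\<close> closes the dead end.\<close>

definition tube :: "'d \<Rightarrow> nat \<Rightarrow> int ^ 'd \<Rightarrow> (int ^ 'd) set" where
  "tube e L c = {w. 1 \<le> w $ e - c $ e \<and> w $ e - c $ e \<le> int L + 1 \<and> (\<forall>i. i \<noteq> e \<longrightarrow> \<bar>w $ i - c $ i\<bar> \<le> 1)}"

text \<open>The tube is the corridor together with its walls; the rerouted paths walk in the rest of the sleeve.\<close>

definition sleeve :: "'d \<Rightarrow> nat \<Rightarrow> int ^ 'd \<Rightarrow> (int ^ 'd) set" where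
  "sleeve e L c = {w. 0 \<le> w $ e - c $ e \<and> w $ e - c $ e \<le> int L + 2 \<and> (\<forall>i. i \<noteq> e \<longrightarrow> \<bar>w $ i - c $ i\<bar> \<le> 2)}"

lemma tube_subset_sleeve: "tube e L c \<subseteq> sleeve e L c"
  by (fastforce simp: tube_def sleeve_def)

lemma tube_nbr_sleeve:
  fixes v :: "int ^ 'd::finite"
  assumes "v \<in> tube e L c" "nbr v y"
  shows "y \<in> sleeve e L c"
proof -
  have "\<bar>v $ i - y $ i\<bar> \<le> 1" for i
    using assms(2) by (auto simp: nbr_upd_iff)
  note nb = this
  have "0 \<le> y $ e - c $ e" "y $ e - c $ e \<le> int L + 2"
    using assms(1) nb[of e] by (auto simp: tube_def)
  moreover have "\<bar>y $ i - c $ i\<bar> \<le> 2" if "i \<noteq> e" for i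
  proof -
    have "\<bar>v $ i - c $ i\<bar> \<le> 1" using assms(1) that by (auto simp: tube_def)
    then show ?thesis using nb[of i] by linarith
  qed
  ultimately show ?thesis by (auto simp: sleeve_def)
qed

text \<open>The target lies on the face of the sleeve in direction \<open>g\<close>. It is reached
  by at most three moves along coordinate axes, each of length at most \<open>4\<close>, the
  transversal width of a sleeve: this is the origin of the \<open>12\<close>.\<close>

lemma detour_out:
  fixes v y c :: "int ^ 'd::finite"
  assumes g: "g \<noteq> e" "h \<noteq> e" "g \<noteq> h"
    and v: "v \<in> tube e L c" and vy: "nbr v y" and y: "y \<notin> tube e L c"
  shows "linked (sleeve e L c - tube e L c) 12 y (upd v g (c $ g + 2))"
proof -
  let ?R = "sleeve e L c - tube e L c"
  have yD: "y \<in> sleeve e L c" using tube_nbr_sleeve[OF v vy] .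
  obtain i where i: "y = upd v i (v $ i + 1) \<or> y = upd v i (v $ i - 1)"
    using vy by (auto simp: nbr_upd_iff)
  then have yi: "\<bar>y $ i - v $ i\<bar> = 1" and yj: "\<And>j. j \<noteq> i \<Longrightarrow> y $ j = v $ j" by auto
  have vi: "\<And>j. j \<noteq> e \<Longrightarrow> \<bar>v $ j - c $ j\<bar> \<le> 1" "1 \<le> v $ e - c $ e" "v $ e - c $ e \<le> int L + 1"
    using v by (auto simp: tube_def)
  have ydj: "\<And>j. j \<noteq> e \<Longrightarrow> \<bar>y $ j - c $ j\<bar> \<le> 2" "0 \<le> y $ e - c $ e" "y $ e - c $ e \<le> int L + 2"
    using yD by (auto simp: sleeve_def)
  have inR: "w \<in> ?R" if "\<And>j. j \<noteq> e \<Longrightarrow> \<bar>w $ j - c $ j\<bar> \<le> 2" "0 \<le> w $ e - c $ e" "w $ e - c $ e \<le> int L + 2"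
     "k \<noteq> e" "\<bar>w $ k - c $ k\<bar> = 2" for w k
    using that by (auto simp: sleeve_def tube_def intro!: exI[of _ k])
  show ?thesis
  proof (cases "i = g")
    case True
    have yg: "\<bar>y $ g - c $ g\<bar> = 2"
    proof (rule ccontr)
      assume "\<bar>y $ g - c $ g\<bar> \<noteq> 2"
      then have "\<bar>y $ g - c $ g\<bar> \<le> 1" using ydj(1)[OF g(1)] by linarith
      then have "y \<in> tube e L c" using vi yj True g by (auto simp: tube_def) (metis)
      then show False using y by simp
    qed
    show ?thesis
    proof (cases "y $ g - c $ g = 2")
      case gg: True
      have "y = upd v g (c $ g + 2)" using gg yj True by (auto simp: vec_eq_iff)
      then show ?thesis by simp
    next
      case False
      \<comment> \<open>On the opposite face the straight way to the target may be blocked by the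
        tube, so the detour goes round through the face in direction \<open>h\<close>; this takes a
        second transversal coordinate.\<close>
      then have ym: "y $ g = c $ g - 2" using yg by linarith
      define y1 where "y1 = upd y h (c $ h + 2)"
      define y2 where "y2 = upd y1 g (c $ g + 2)"
      have 1: "linked ?R 4 y y1"
        unfolding y1_def
      proof (rule linked_upd)
        fix r assume r: "min (y $ h) (c $ h + 2) \<le> r" "r \<le> max (y $ h) (c $ h + 2)"
        have "\<bar>r - c $ h\<bar> \<le> 2" using r ydj(1)[OF g(2)] by linarith
        then show "upd y h r \<in> ?R" using ydj g ym by (intro inR[where k=g]) auto
      qed (use ydj(1)[OF g(2)] in linarith)
      have 2: "linked ?R 4 y1 y2"
        unfolding y2_def
      proof (rule linked_upd)
        fix r assume r: "min (y1 $ g) (c $ g + 2) \<le> r" "r \<le> max (y1 $ g) (c $ g + 2)"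
        have "y1 $ g = c $ g - 2" using g ym by (simp add: y1_def)
        then have "\<bar>r - c $ g\<bar> \<le> 2" using r by linarith
        then show "upd y1 g r \<in> ?R" using ydj g by (intro inR[where k=h]) (auto simp: y1_def)
      qed (use g ym in \<open>simp add: y1_def\<close>)
      have "linked ?R 4 y2 (upd y2 h (v $ h))"
      proof (rule linked_upd)
        fix r assume r: "min (y2 $ h) (v $ h) \<le> r" "r \<le> max (y2 $ h) (v $ h)"
        have "y2 $ h = c $ h + 2" using g by (simp add: y2_def y1_def)
        then have "\<bar>r - c $ h\<bar> \<le> 2" using r vi(1)[OF g(2)] by linarith
        then show "upd y2 h r \<in> ?R" using ydj g by (intro inR[where k=g]) (auto simp: y2_def y1_def)
      next
        have "y2 $ h = c $ h + 2" using g by (simp add: y2_def y1_def)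
        then show "nat \<bar>v $ h - y2 $ h\<bar> \<le> 4" using vi(1)[OF g(2)] by linarith
      qed
      moreover have "upd y2 h (v $ h) = upd v g (c $ g + 2)"
        using g yj True by (auto simp: vec_eq_iff y2_def y1_def)
      ultimately have "linked ?R ((4 + 4) + 4) y (upd v g (c $ g + 2))"
        using linked_trans[OF linked_trans[OF 1 2]] by metis
      then show ?thesis by simp
    qed
  next
    case False
    \<comment> \<open>Coordinate \<open>i\<close> of \<open>y\<close> alone keeps it out of the
      tube. Hence \<open>g\<close> can be adjusted first, and \<open>i\<close> restored afterwards
      on the face in direction \<open>g\<close>.\<close>
    have out: "w \<notin> tube e L c" if "w $ i = y $ i" for w
    proof
      assume w: "w \<in> tube e L c"
      have "y \<in> tube e L c"
      proof (cases "i = e")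
        case True
        then show ?thesis using w that vi yj by (auto simp: tube_def)
      next
        case ie: False
        have "\<bar>y $ i - c $ i\<bar> \<le> 1" using w that ie by (auto simp: tube_def)
        then show ?thesis using vi yj ie by (auto simp: tube_def) metis
      qed
      then show False using y by simp
    qed
    define y1 where "y1 = upd y g (c $ g + 2)"
    have 1: "linked ?R 4 y y1"
      unfolding y1_def
    proof (rule linked_upd)
      fix r assume r: "min (y $ g) (c $ g + 2) \<le> r" "r \<le> max (y $ g) (c $ g + 2)"
      have "\<bar>r - c $ g\<bar> \<le> 2" using r ydj(1)[OF g(1)] by linarith
      then have "upd y g r \<in> sleeve e L c" using ydj g by (auto simp: sleeve_def)
      then show "upd y g r \<in> ?R" using out[of "upd y g r"] False by simp
    qed (use ydj(1)[OF g(1)] in linarith)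
    have "linked ?R 4 y1 (upd y1 i (v $ i))"
    proof (rule linked_upd)
      fix r assume r: "min (y1 $ i) (v $ i) \<le> r" "r \<le> max (y1 $ i) (v $ i)"
      have y1i: "y1 $ i = y $ i" using False by (simp add: y1_def)
      have "(i = e \<longrightarrow> 0 \<le> r - c $ e \<and> r - c $ e \<le> int L + 2) \<and> (i \<noteq> e \<longrightarrow> \<bar>r - c $ i\<bar> \<le> 2)"
        using r ydj(1)[of i] ydj(2,3) vi(1)[of i] vi(2,3) unfolding y1i by auto
      then show "upd y1 i r \<in> ?R" using ydj g False by (intro inR[where k=g]) (auto simp: y1_def)
    next
      have "y1 $ i = y $ i" using False by (simp add: y1_def)
      then show "nat \<bar>v $ i - y1 $ i\<bar> \<le> 4" using yi by linarith
    qed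
    moreover have "upd y1 i (v $ i) = upd v g (c $ g + 2)"
      using yj False by (auto simp: vec_eq_iff y1_def)
    ultimately have "linked ?R (4 + 4) y (upd v g (c $ g + 2))"
      using linked_trans[OF 1] by metis
    then show ?thesis by (rule linked_mono) simp
  qed
qed

lemma detour_along:
  fixes v y c :: "int ^ 'd::finite"
  assumes g: "g \<noteq> e" and v: "v \<in> tube e L c" and vy: "nbr v y" and y: "y \<in> tube e L c"
  shows "linked (sleeve e L c - tube e L c) 12 (upd y g (c $ g + 2)) (upd v g (c $ g + 2))"
proof -
  let ?R = "sleeve e L c - tube e L c"
  have R: "upd w g (c $ g + 2) \<in> ?R" if "w \<in> tube e L c" for w
  proof -
    have "w \<in> sleeve e L c" using that tube_subset_sleeve by blast
    then show ?thesis using g by (auto simp: sleeve_def tube_def intro!: exI[of _ g])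
  qed
  obtain i where i: "y = upd v i (v $ i + 1) \<or> y = upd v i (v $ i - 1)"
    using vy by (auto simp: nbr_upd_iff)
  show ?thesis
  proof (cases "i = g")
    case True
    then have "upd y g (c $ g + 2) = upd v g (c $ g + 2)" using i by (auto simp: vec_eq_iff)
    then show ?thesis by simp
  next
    case False
    let ?v = "upd v g (c $ g + 2)"
    have "upd y g (c $ g + 2) = upd ?v i (?v $ i + 1) \<or> upd y g (c $ g + 2) = upd ?v i (?v $ i - 1)"
      using i False by (auto simp: vec_eq_iff)
    then have "nbr ?v (upd y g (c $ g + 2))" unfolding nbr_upd_iff by blast
    then have "nbr (upd y g (c $ g + 2)) ?v" using nbr_sym by blast
    then have "linked ?R 1 (upd y g (c $ g + 2)) ?v" using R v y by (intro linked_step) auto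
    then show ?thesis by (rule linked_mono) simp
  qed
qed

text \<open>The direction opposite to the bias is missing: the corridor of such a trap would run
  back over its entrance.\<close>

definition dirs :: "'d \<Rightarrow> (int ^ 'd) set" where
  "dirs e = insert (axis e 1) ((\<lambda>i. axis i 1) ` (- {e}) \<union> (\<lambda>i. - axis i 1) ` (- {e}))"

text \<open>The entrance is longer than the \<open>l1\<close> radius \<open>2 * (CARD('d) - 1)\<close> of a cross section of the sleeve, so
  that a trap whose entrance leads towards \<open>p\<close> lies in a smaller sublevel set of \<open>gauge e p\<close> (below) than
  its starting point.\<close>

definition depth :: "(int ^ 'd) itself \<Rightarrow> nat" where
  "depth _ = 2 * CARD('d)"

definition entry_pt :: "int ^ 'd \<Rightarrow> int ^ 'd \<Rightarrow> nat \<Rightarrow> int ^ 'd" where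
  "entry_pt a f j = a + int j *s f"

definition corridor_pt :: "'d \<Rightarrow> int ^ 'd \<Rightarrow> int ^ 'd \<Rightarrow> nat \<Rightarrow> int ^ 'd" where
  "corridor_pt e a f j = entry_pt a f (depth TYPE(int ^ 'd)) + axis e (int j)"

definition trap_path :: "'d \<Rightarrow> nat \<Rightarrow> int ^ 'd \<Rightarrow> int ^ 'd \<Rightarrow> (int ^ 'd) set" where
  "trap_path e L a f = entry_pt a f ` {1..depth TYPE(int ^ 'd)} \<union> corridor_pt e a f ` {1..L}"

definition trap_wall :: "'d \<Rightarrow> nat \<Rightarrow> int ^ 'd \<Rightarrow> int ^ 'd \<Rightarrow> (int ^ 'd) set" where
  "trap_wall e L a f = tube e L (corridor_pt e a f 0) - corridor_pt e a f ` {1..L}"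

definition trap_sleeve :: "'d \<Rightarrow> nat \<Rightarrow> int ^ 'd \<Rightarrow> int ^ 'd \<Rightarrow> (int ^ 'd) set" where
  "trap_sleeve e L a f = sleeve e L (corridor_pt e a f 0)"

definition trap_zone :: "'d \<Rightarrow> nat \<Rightarrow> int ^ 'd \<Rightarrow> int ^ 'd \<Rightarrow> (int ^ 'd) set" where
  "trap_zone e L a f = trap_sleeve e L a f \<union> entry_pt a f ` {1..depth TYPE(int ^ 'd)}"

text \<open>The sites next to the entrance are left free: walking through it costs a factor that
  does not depend on \<open>L\<close>.\<close>

definition trap :: "'d \<Rightarrow> nat \<Rightarrow> int ^ 'd \<Rightarrow> int ^ 'd \<Rightarrow> (int ^ 'd) set \<Rightarrow> bool" where
  "trap e L a f I \<longleftrightarrow> I \<inter> trap_wall e L a f = {} \<and> trap_path e L a f \<subseteq> I"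

definition trap_list :: "'d \<Rightarrow> nat \<Rightarrow> int ^ 'd \<Rightarrow> int ^ 'd \<Rightarrow> (int ^ 'd) list" where
  "trap_list e L a f = map (entry_pt a f) [0..<Suc (depth TYPE(int ^ 'd))] @ map (corridor_pt e a f) [1..<Suc L]"

lemma dirs_nth:
  assumes "f \<in> dirs e"
  shows "(\<exists>i. (\<forall>j. f $ j = (if j = i then 1 else 0)) \<and> f $ e \<ge> 0)
    \<or> (\<exists>i. i \<noteq> e \<and> (\<forall>j. f $ j = (if j = i then -1 else 0)))"
  using assms by (auto simp: dirs_def axis_def)

lemma corridor_pt_0: "corridor_pt e a f 0 = entry_pt a f (depth TYPE(int ^ 'd))"
  for a :: "int ^ 'd::finite"
  by (simp add: corridor_pt_def vec_eq_iff axis_def)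

lemma corridor_pt_nth:
  "corridor_pt e a f j $ i = corridor_pt e a f 0 $ i + (if i = e then int j else 0)"
  for a :: "int ^ 'd::finite"
  by (simp add: corridor_pt_def axis_def)

lemma nbr_corridor: "nbr (corridor_pt e a f j) (corridor_pt e a f (Suc j))"
  for a :: "int ^ 'd::finite"
  unfolding nbr_upd_iff
  by (rule exI[of _ e]) (auto simp: vec_eq_iff corridor_pt_nth[of e a f j] corridor_pt_nth[of e a f "Suc j"])

lemma nbr_entry:
  fixes a :: "int ^ 'd::finite"
  assumes "f \<in> dirs e"
  shows "nbr (entry_pt a f j) (entry_pt a f (Suc j))"
proof -
  obtain i where "f = axis i 1 \<or> f = - axis i 1" using assms by (auto simp: dirs_def)
  moreover have "entry_pt a f (Suc j) = entry_pt a f j + f"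
    by (simp add: entry_pt_def vec_eq_iff algebra_simps)
  ultimately show ?thesis unfolding nbr_iff by auto
qed

lemma entry_0 [simp]: "entry_pt a f 0 = a"
  by (simp add: entry_pt_def vec_eq_iff)

lemma successively_map_upt:
  assumes "\<And>j. m \<le> j \<Longrightarrow> Suc j < n \<Longrightarrow> P (g j) (g (Suc j))"
  shows "successively P (map g [m..<n])"
  using assms by (auto simp: successively_conv_nth)

lemma successively_trap_list:
  fixes a :: "int ^ 'd::finite"
  assumes "f \<in> dirs e"
  shows "successively nbr (trap_list e L a f)"
proof (cases L)
  case 0
  then show ?thesis
    unfolding trap_list_def using nbr_entry[OF assms] by (auto intro!: successively_map_upt simp del: upt_Suc)
next
  case (Suc L')
  have "last (map (entry_pt a f) [0..<Suc (depth TYPE(int ^ 'd))]) = corridor_pt e a f 0"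
    by (simp add: corridor_pt_0)
  moreover have "hd (map (corridor_pt e a f) [1..<Suc L]) = corridor_pt e a f 1"
    by (simp add: Suc hd_map del: upt_Suc)
  ultimately show ?thesis
    unfolding trap_list_def successively_append_iff
    using nbr_entry[OF assms] nbr_corridor[of e a f] nbr_corridor[of e a f 0]
    by (auto intro!: successively_map_upt simp del: upt_Suc)
qed

lemma set_trap_list: "set (trap_list e L a f) = insert a (trap_path e L a f)"
proof -
  have "{0..<Suc (depth TYPE(int ^ 'd))} = insert 0 {1..depth TYPE(int ^ 'd)}" by auto
  then show ?thesis
    unfolding trap_list_def trap_path_def
    by (auto simp: atLeastLessThanSuc_atLeastAtMost simp del: upt_Suc)
qed

text \<open>There and back, without the final return to \<open>a\<close>: the loop is put in front
  of a path that starts at \<open>a\<close>.\<close>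

definition trap_loop :: "'d \<Rightarrow> nat \<Rightarrow> int ^ 'd \<Rightarrow> int ^ 'd \<Rightarrow> (int ^ 'd) list" where
  "trap_loop e L a f = trap_list e L a f @ butlast (tl (rev (trap_list e L a f)))"

lemma entry_notin_tube:
  fixes a :: "int ^ 'd::finite"
  assumes f: "f \<in> dirs e" and j: "j \<le> depth TYPE(int ^ 'd)"
  shows "entry_pt a f j \<notin> tube e L (corridor_pt e a f 0)"
proof -
  have "f $ e \<ge> 0" using dirs_nth[OF f] by auto
  then have "int j * f $ e \<le> int (depth TYPE(int ^ 'd)) * f $ e" using j by (intro mult_right_mono) auto
  then show ?thesis by (auto simp: tube_def corridor_pt_0 entry_pt_def)
qed

lemma start_notin_zone:
  fixes a :: "int ^ 'd::finite"
  assumes f: "f \<in> dirs e" and d: "CARD('d) \<ge> 2"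
  shows "a \<notin> trap_zone e L a f"
proof
  let ?s = "int (depth TYPE(int ^ 'd))"
  have s: "?s \<ge> 3" using d by (simp add: depth_def)
  assume "a \<in> trap_zone e L a f"
  then consider "a \<in> sleeve e L (entry_pt a f (depth TYPE(int ^ 'd)))" | j where "j \<ge> 1" "a = entry_pt a f j"
    by (auto simp: trap_zone_def trap_sleeve_def corridor_pt_0)
  then show False
  proof cases
    case 1
    then have *: "0 \<le> - (?s * f $ e)" "\<And>i. i \<noteq> e \<Longrightarrow> \<bar>?s * f $ i\<bar> \<le> 2"
      by (auto simp: sleeve_def entry_pt_def)
    show False
      using dirs_nth[OF f]
    proof (elim disjE exE conjE)
      fix i assume i: "\<forall>j. f $ j = (if j = i then 1 else 0)" "f $ e \<ge> 0"
      show False using * i s by (cases "i = e") force+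
    next
      fix i assume i: "i \<noteq> e" "\<forall>j. f $ j = (if j = i then -1 else 0)"
      show False using *(2)[OF i(1)] i s by simp
    qed
  next
    case 2
    then have "int j * f $ i = 0" for i by (auto simp: entry_pt_def vec_eq_iff)
    then have "f $ i = 0" for i using 2 by simp
    then show False using dirs_nth[OF f] by (metis neg_equal_0_iff_equal zero_neq_one)
  qed
qed

lemma trap_loop_props:
  fixes a :: "int ^ 'd::finite" and L :: nat
  assumes f: "f \<in> dirs e"
  defines "p \<equiv> trap_loop e L a f"
  shows "successively nbr (p @ [a])" "hd (p @ [a]) = a" "set p \<subseteq> insert a (trap_path e L a f)"
    "trap_path e L a f \<subseteq> set p" "length p = 2 * (depth TYPE(int ^ 'd) + L)"
proof -
  let ?q = "trap_list e L a f"
  have q0: "?q = a # tl ?q" "hd ?q = a" by (simp_all add: trap_list_def upt_conv_Cons del: upt_Suc)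
  have lq: "length ?q = Suc (depth TYPE(int ^ 'd) + L)" by (simp add: trap_list_def del: upt_Suc)
  have qne: "?q \<noteq> []" using q0 by auto
  have sp: "depth TYPE(int ^ 'd) > 0" by (simp add: depth_def)
  have tne: "tl (rev ?q) \<noteq> []" using lq sp by (metis Nitpick.size_list_simp(2) length_rev length_tl list.size(3) diff_Suc_1 add_is_0 neq0_conv)
  have la: "last (tl (rev ?q)) = a"
    using q0 tne by (metis last_rev last_tl)
  have pa: "p @ [a] = ?q @ tl (rev ?q)"
    unfolding p_def trap_loop_def using tne la by (metis append.assoc append_butlast_last_id)
  have rq: "rev ?q = last ?q # tl (rev ?q)"
    using qne by (metis hd_rev list.collapse rev_is_Nil_conv)
  have sym: "(\<lambda>x y. nbr y x) = (nbr :: int ^ 'd \<Rightarrow> _)" using nbr_sym by blast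
  have "successively nbr (rev ?q)"
    using successively_trap_list[OF f, of L a] unfolding successively_rev sym .
  then have sr: "nbr (last ?q) (hd (tl (rev ?q)))" "successively nbr (tl (rev ?q))"
    using rq tne by (metis successively_Cons list.distinct(1) hd_Cons_tl)+
  show "successively nbr (p @ [a])"
    unfolding pa successively_append_iff using successively_trap_list[OF f] sr by auto
  show "hd (p @ [a]) = a" unfolding pa using q0 qne by simp
  have "set (p @ [a]) \<subseteq> set ?q"
    unfolding pa by (auto dest: list.set_sel(2)[OF tne]) (metis list.set_sel(2) qne rev_is_Nil_conv set_rev)
  then show "set p \<subseteq> insert a (trap_path e L a f)" by (simp add: set_trap_list)
  have "set ?q \<subseteq> set p" by (simp add: p_def trap_loop_def)
  then show "trap_path e L a f \<subseteq> set p" by (simp add: set_trap_list)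
  have "length (p @ [a]) = 2 * (depth TYPE(int ^ 'd) + L) + 1"
    unfolding pa using lq by simp
  then show "length p = 2 * (depth TYPE(int ^ 'd) + L)" by simp
qed

text \<open>Applied with a \<open>W\<close> that contains all neighbours of the sleeve: no path of
  the soup starts or ends in the sleeve, as \<open>pathsum_reroute\<close> requires.\<close>

lemma charge_interior:
  fixes x :: "int ^ 'd::finite"
  assumes "\<And>y. nbr x y \<Longrightarrow> y \<in> W"
  shows "charge W x = 0"
proof -
  have "escape W x = avg (\<lambda>_. 0) x"
    using assms by (subst escape_unfold) (intro avg_cong, auto)
  then show ?thesis by (simp add: avg_const charge_def)
qed

lemma soup_trap:
  fixes a :: "int ^ 'd::finite" and e :: 'd
  assumes d: "CARD('d) \<ge> 3" and f: "f \<in> dirs e"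
    and W: "\<And>x y. x \<in> trap_sleeve e L a f \<Longrightarrow> nbr x y \<Longrightarrow> y \<in> W"
    and \<Psi>: "\<And>I. \<Psi> (I - trap_zone e L a f) = \<Psi> I" "\<And>I. a \<notin> I \<Longrightarrow> \<Psi> I = 0"
  shows "ennreal (step_prob TYPE(int ^ 'd) ^ (2 * (depth TYPE(int ^ 'd) + L))) *
      soup W u (\<lambda>\<sigma>. \<Psi> (footprint \<sigma>) * ennreal ((step_prob TYPE(int ^ 'd) ^ 12) ^ occupation (trap_sleeve e L a f) \<sigma>))
    \<le> soup W u (\<lambda>\<sigma>. \<Psi> (footprint \<sigma>) * of_bool (trap e L a f (footprint \<sigma>)))"
proof -
  have "card (UNIV - {e} :: 'd set) \<ge> 2" using d by simp
  then obtain S :: "'d set" where "S \<subseteq> UNIV - {e}" "card S = 2" by (meson obtain_subset_with_card_n)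
  then obtain g h where g: "g \<noteq> e" "h \<noteq> e" "g \<noteq> h" by (auto simp: card_2_iff)
  define c where "c = corridor_pt e a f 0"
  interpret surgery W "trap_wall e L a f" "tube e L c" "trap_sleeve e L a f" "trap_zone e L a f"
    "trap_path e L a f" a "trap_loop e L a f" "\<lambda>v. upd v g (c $ g + 2)" 12
  proof (unfold_locales)
    show "trap_wall e L a f \<subseteq> tube e L c" by (auto simp: trap_wall_def c_def)
    show "tube e L c \<subseteq> trap_sleeve e L a f"
      unfolding trap_sleeve_def c_def by (rule tube_subset_sleeve)
    show "trap_sleeve e L a f \<subseteq> trap_zone e L a f" by (simp add: trap_zone_def)
    show "charge W x = 0" if "x \<in> trap_sleeve e L a f" for x
      using W[OF that] by (intro charge_interior) auto
    show "y \<in> trap_sleeve e L a f" if "v \<in> tube e L c" "nbr v y" for v y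
      using tube_nbr_sleeve[OF that] by (simp add: trap_sleeve_def c_def)
    show "linked (trap_sleeve e L a f - tube e L c) 12 y (upd v g (c $ g + 2))"
      if "v \<in> tube e L c" "nbr v y" "y \<notin> tube e L c" for v y
      using detour_out[OF g that] by (simp add: trap_sleeve_def c_def)
    show "linked (trap_sleeve e L a f - tube e L c) 12 (upd y g (c $ g + 2)) (upd v g (c $ g + 2))"
      if "v \<in> tube e L c" "nbr v y" "y \<in> tube e L c" for v y
      using detour_along[OF g(1) that] by (simp add: trap_sleeve_def c_def)
    show "(1::nat) \<le> 12" by simp
    show "a \<notin> trap_zone e L a f" using start_notin_zone[OF f] d by simp
    note p = trap_loop_props[OF f, where a=a and L=L]
    show "successively nbr (trap_loop e L a f @ [a])" "hd (trap_loop e L a f @ [a]) = a" by (rule p)+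
    have "corridor_pt e a f j \<in> trap_sleeve e L a f" if "j \<in> {1..L}" for j
      using that by (simp add: trap_sleeve_def sleeve_def corridor_pt_nth[of e a f j])
    then have "trap_path e L a f \<subseteq> trap_zone e L a f"
      by (auto simp: trap_path_def trap_zone_def)
    then show "set (trap_loop e L a f) - trap_zone e L a f \<subseteq> {a}" using p(3) by auto
    have "insert a (trap_path e L a f) \<inter> trap_wall e L a f = {}"
      using entry_notin_tube[OF f, where a=a and L=L] entry_notin_tube[OF f, where a=a and L=L and j=0]
      by (auto simp: trap_path_def trap_wall_def)
    then show "set (trap_loop e L a f) \<inter> trap_wall e L a f = {}" using p(3) by blast
    show "trap_path e L a f \<subseteq> set (trap_loop e L a f)" by (rule p)
  qed
  show ?thesis
    using soup_surgery[where \<Psi>=\<Psi> and u=u, OF \<Psi>]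
    unfolding loop_cost_def reroute_cost_def trap_loop_props(5)[OF f] trap_def .
qed

text \<open>\<open>h\<close> is the bound of \<open>stay_corridor\<close> at \<open>j = 1\<close>
  and time \<open>n\<close>; the remaining factor is the price of the steps that lead through the
  entrance to the first site of the corridor.\<close>

lemma stay_trap:
  fixes a :: "int ^ 'd::finite" and e :: 'd
  assumes \<beta>: "\<beta> > 1" and f: "f \<in> dirs e" and L: "L \<ge> 2" and I: "trap e L a f I" "a \<in> I"
    and h: "h = 1 - 1 / \<beta> - real n * \<beta> powi (1 - int L)" "h \<ge> 0" and r: "r \<le> n"
  shows "(1 / (deg TYPE(int ^ 'd) * \<beta>)) ^ Suc (depth TYPE(int ^ 'd)) * h
    \<le> stay (biased_step e \<beta> I) (trap_path e L a f) r a"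
proof -
  let ?c = "corridor_pt e a f"
  let ?xs = "map (entry_pt a f) [0..<Suc (depth TYPE(int ^ 'd))] @ [?c 1]"
  have path: "trap_path e L a f \<subseteq> I" and wall: "I \<inter> trap_wall e L a f = {}" using I by (auto simp: trap_def)
  have bp: "\<beta> powi (1 - int L) > 0" using \<beta> by simp
  have c0: "?c 0 \<in> trap_path e L a f"
    unfolding corridor_pt_0 trap_path_def by (auto simp: depth_def)
  have cor: "h \<le> stay (biased_step e \<beta> I) (trap_path e L a f) r (?c 1)" if "r \<le> n" for r
  proof -
    have "1 - \<beta> powi (- int 1) - real r * \<beta> powi (1 - int L) \<le> stay (biased_step e \<beta> I) (trap_path e L a f) r (?c 1)"
    proof (rule stay_corridor[OF \<beta> L])
      show "?c j = ?c 0 + axis e (int j)" for j by (simp add: corridor_pt_def vec_eq_iff axis_def)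
      show "?c j \<in> I" if "j \<le> L" for j
        using that path c0 by (cases "j = 0") (auto simp: trap_path_def)
      show "?c j \<in> trap_path e L a f" if "1 \<le> j" "j \<le> L" for j
        using that by (auto simp: trap_path_def)
      show "y = ?c (j - 1) \<or> (j < L \<and> y = ?c (j + 1))" if j: "1 \<le> j" "j \<le> L" and y: "nbr (?c j) y" "y \<in> I" for j y
      proof -
        obtain i where i: "y = upd (?c j) i (?c j $ i + 1) \<or> y = upd (?c j) i (?c j $ i - 1)"
          using y(1) by (auto simp: nbr_upd_iff)
        show ?thesis
        proof (cases "i = e")
          case True
          have "upd (?c j) e (?c j $ e - 1) = ?c (j - 1)" "upd (?c j) e (?c j $ e + 1) = ?c (j + 1)"
            using j by (auto simp: vec_eq_iff corridor_pt_nth[of e a f "j - Suc 0"] corridor_pt_nth[of e a f j]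
                corridor_pt_nth[of e a f "Suc j"] of_nat_diff)
          then have "y = ?c (j + 1) \<or> y = ?c (j - 1)" using i True by auto
          moreover have "?c (L + 1) \<in> trap_wall e L a f"
          proof -
            have "?c (L + 1) \<noteq> ?c k" if "k \<le> L" for k
              using that corridor_pt_nth[of e a f "L + 1" e] corridor_pt_nth[of e a f k e] by auto
            then have "?c (L + 1) \<notin> ?c ` {1..L}" by (metis atLeastAtMost_iff imageE)
            moreover have "?c (L + 1) \<in> tube e L (?c 0)"
              by (simp add: tube_def corridor_pt_nth[of e a f "Suc L"])
            ultimately show ?thesis by (simp add: trap_wall_def)
          qed
          ultimately show ?thesis using j y(2) wall by (metis IntI empty_iff le_neq_implies_less)
        next
          case False
          have "y \<in> tube e L (?c 0)"
            using i False j by (auto simp: tube_def corridor_pt_nth[of e a f j])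
          moreover have "y \<noteq> ?c k" for k
          proof -
            have "y $ i \<noteq> ?c 0 $ i" using i False by (auto simp: corridor_pt_nth[of e a f j])
            then show ?thesis using False corridor_pt_nth[of e a f k i] by auto
          qed
          ultimately have "y \<in> trap_wall e L a f" by (auto simp: trap_wall_def)
          then show ?thesis using y(2) wall by auto
        qed
      qed
    qed (use L in auto)
    moreover have "real r * \<beta> powi (1 - int L) \<le> real n * \<beta> powi (1 - int L)"
      using that bp by (intro mult_right_mono) auto
    moreover have "\<beta> powi (- int 1) = 1 / \<beta>" by (simp add: power_int_minus divide_inverse)
    ultimately show ?thesis unfolding h(1) by linarith
  qed
  have "(1 / (deg TYPE(int ^ 'd) * \<beta>)) ^ (length ?xs - 1) * h
      \<le> stay (biased_step e \<beta> I) (trap_path e L a f) r (hd ?xs)"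
  proof (rule stay_entry[OF \<beta>])
    have "last (map (entry_pt a f) [0..<Suc (depth TYPE(int ^ 'd))]) = ?c 0" by (simp add: corridor_pt_0)
    then show "successively nbr ?xs"
      unfolding successively_append_iff using nbr_entry[OF f] nbr_corridor[of e a f 0]
      by (auto intro!: successively_map_upt simp del: upt_Suc)
    have sx: "set (map (entry_pt a f) [0..<Suc (depth TYPE(int ^ 'd))]) = insert a (entry_pt a f ` {1..depth TYPE(int ^ 'd)})"
    proof -
      have "{0..<Suc (depth TYPE(int ^ 'd))} = insert 0 {1..depth TYPE(int ^ 'd)}" by auto
      then show ?thesis by (simp del: upt_Suc)
    qed
    show "set ?xs \<subseteq> I"
      using sx path I L by (auto simp: trap_path_def simp del: upt_Suc)
    have "tl ?xs = map (entry_pt a f) [1..<Suc (depth TYPE(int ^ 'd))] @ [?c 1]"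
      by (simp add: upt_conv_Cons del: upt_Suc)
    then show "set (tl ?xs) \<subseteq> trap_path e L a f"
      using L by (auto simp: trap_path_def atLeastLessThanSuc_atLeastAtMost simp del: upt_Suc)
    show "h \<le> stay (biased_step e \<beta> I) (trap_path e L a f) r (last ?xs)" if "r \<le> n" for r
      using cor[OF that] by simp
    have "0 \<le> 1 / \<beta>" "0 \<le> real n * \<beta> powi (1 - int L)" using \<beta> bp by simp_all
    then show "h \<le> 1" unfolding h(1) by linarith
  qed (use h r in auto)
  moreover have "hd ?xs = a" by (simp add: upt_conv_Cons del: upt_Suc)
  ultimately show ?thesis by (simp del: upt_Suc)
qed

section \<open>Occupation of several sleeves\<close>

definition dist1 :: "int ^ 'd \<Rightarrow> int ^ 'd \<Rightarrow> int" where
  "dist1 x y = (\<Sum>i\<in>UNIV. \<bar>x $ i - y $ i\<bar>)"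

lemma dist1_nonneg: "dist1 x y \<ge> 0"
  by (simp add: dist1_def sum_nonneg)

lemma dist1_self [simp]: "dist1 x x = 0"
  by (simp add: dist1_def)

lemma dist1_sym: "dist1 x y = dist1 y x"
  by (simp add: dist1_def abs_minus_commute)

lemma dist1_triangle: "dist1 x z \<le> dist1 x y + dist1 y z"
  unfolding dist1_def sum.distrib[symmetric] by (intro sum_mono) linarith

lemma dist1_coord: "\<bar>x $ i - y $ i\<bar> \<le> dist1 x y"
  unfolding dist1_def by (intro member_le_sum) auto

lemma dist1_nbr: "nbr x y \<Longrightarrow> dist1 x y = 1"
  unfolding nbr_upd_iff dist1_def by (auto simp: if_distrib if_distribR cong: if_cong)

lemma iter_eq_0:
  assumes "\<And>y. dist1 x y \<le> int k \<Longrightarrow> f y = 0"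
  shows "iter k f x = 0"
  using assms
proof (induction k arbitrary: x)
  case (Suc k)
  have "avg (iter k f) x = avg (\<lambda>_. 0) x"
  proof (rule avg_cong)
    fix y assume y: "nbr x y"
    show "iter k f y = 0"
    proof (rule Suc.IH)
      fix z assume "dist1 y z \<le> int k"
      then have "dist1 x z \<le> int (Suc k)" using dist1_triangle[of x z y] dist1_nbr[OF y] by simp
      then show "f z = 0" by (rule Suc.prems)
    qed
  qed
  then show ?case by (simp add: avg_const)
qed simp

text \<open>Three coordinates other than \<open>e\<close> take five values each on the sleeve, so
  that it is covered by \<open>125 = 5 ^ 3\<close> subspaces of codimension three, for every
  \<open>L\<close>.\<close>

lemma iter_sleeve_le:
  fixes x c :: "int ^ 'd::finite" and e :: 'd
  assumes d: "CARD('d) \<ge> 4"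
  shows "iter k (indicator (sleeve e L c)) x \<le> ennreal (125 * heat TYPE(int ^ 'd) k)"
proof -
  have "card (UNIV - {e} :: 'd set) \<ge> 3" using d by simp
  then obtain S :: "'d set" where S: "S \<subseteq> UNIV - {e}" "card S = 3" by (meson obtain_subset_with_card_n)
  then obtain i1 i2 i3 where S3: "S = {i1, i2, i3}" and i: "i1 \<noteq> i2" "i2 \<noteq> i3" "i1 \<noteq> i3"
    unfolding card_3_iff by blast
  then have ie: "i1 \<noteq> e" "i2 \<noteq> e" "i3 \<noteq> e" using S by auto
  define A where "A i = {c $ i - 2..c $ i + 2}" for i
  let ?P = "A i1 \<times> A i2 \<times> A i3"
  let ?line = "\<lambda>p. {y :: int ^ 'd. y $ i1 = fst p \<and> y $ i2 = fst (snd p) \<and> y $ i3 = snd (snd p)}"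
  have fP: "finite ?P" and cP: "card ?P = 125" by (simp_all add: A_def card_cartesian_product)
  have "iter k (indicator (sleeve e L c)) x \<le> iter k (\<lambda>y. \<Sum>p\<in>?P. indicator (?line p) y) x"
  proof (rule iter_mono)
    fix y
    show "indicator (sleeve e L c) y \<le> (\<Sum>p\<in>?P. indicator (?line p) y :: ennreal)"
    proof (cases "y \<in> sleeve e L c")
      case True
      then have "\<bar>y $ i1 - c $ i1\<bar> \<le> 2" "\<bar>y $ i2 - c $ i2\<bar> \<le> 2" "\<bar>y $ i3 - c $ i3\<bar> \<le> 2"
        using ie by (auto simp: sleeve_def)
      then have "(y $ i1, y $ i2, y $ i3) \<in> ?P" by (auto simp: A_def)
      then have "indicator (?line (y $ i1, y $ i2, y $ i3)) y \<le> (\<Sum>p\<in>?P. indicator (?line p) y :: ennreal)"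
        using fP by (intro member_le_sum) auto
      then show ?thesis using True by simp
    qed simp
  qed
  also have "\<dots> = (\<Sum>p\<in>?P. iter k (indicator (?line p)) x)" by (rule iter_sum[OF fP])
  also have "\<dots> \<le> (\<Sum>p\<in>?P. ennreal (heat TYPE(int ^ 'd) k))"
    unfolding heat_def by (intro sum_mono iter_line_le i)
  also have "\<dots> = ennreal (125 * heat TYPE(int ^ 'd) k)"
    by (simp only: sum_constant cP) (simp add: ennreal_mult' heat_nonneg)
  finally show ?thesis .
qed

text \<open>It bounds the Green potential of a sleeve at all points of \<open>l1\<close> distance at
  least \<open>n\<close>, from which the walk cannot be in the sleeve before time
  \<open>n\<close>.\<close>

definition sleeve_green :: "(int ^ 'd) itself \<Rightarrow> nat \<Rightarrow> real" where
  "sleeve_green _ n = (\<Sum>k. 125 * heat TYPE(int ^ 'd) (k + n))"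

lemma sleeve_green_nonneg: "sleeve_green TYPE(int ^ 'd::finite) n \<ge> 0"
  unfolding sleeve_green_def using summable_heat[where 'd='d]
  by (intro suminf_nonneg) (auto simp: heat_nonneg summable_mult summable_ignore_initial_segment)

lemma sleeve_green_tendsto: "sleeve_green TYPE(int ^ 'd::finite) \<longlonglongrightarrow> 0"
  unfolding sleeve_green_def using summable_heat[where 'd='d]
  by (intro suminf_exist_split2 summable_mult)

lemma green_sleeve_le:
  fixes x c :: "int ^ 'd::finite" and e :: 'd
  assumes d: "CARD('d) \<ge> 4" and far: "\<And>y. y \<in> sleeve e L c \<Longrightarrow> dist1 x y \<ge> int n"
  shows "green (indicator (sleeve e L c)) x \<le> ennreal (sleeve_green TYPE(int ^ 'd) n)"
proof -
  have "iter k (indicator (sleeve e L c)) x = 0" if "k < n" for k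
    using that far by (intro iter_eq_0) (force split: split_indicator)
  then have "green (indicator (sleeve e L c)) x = (\<Sum>k. iter (k + n) (indicator (sleeve e L c)) x)"
    unfolding green_def by (subst suminf_offset[of _ n]) auto
  also have "\<dots> \<le> ennreal (sleeve_green TYPE(int ^ 'd) n)"
    unfolding sleeve_green_def using summable_heat[where 'd='d]
    by (intro suminf_ennreal_tail_le iter_sleeve_le d) (auto simp: heat_nonneg summable_mult)
  finally show ?thesis .
qed

lemma finite_sleeve: "finite (sleeve e L c)" and card_sleeve_le: "card (sleeve e L c) \<le> (L + 3) * 5 ^ CARD('d)"
  for c :: "int ^ 'd::finite"
proof -
  let ?B = "\<lambda>i. if i = e then {c $ e..c $ e + int L + 2} else {c $ i - 2..c $ i + 2}"
  have sub: "vec_nth ` sleeve e L c \<subseteq> PiE UNIV ?B"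
  proof (rule image_subsetI)
    fix w assume "w \<in> sleeve e L c"
    then have "0 \<le> w $ e - c $ e" "w $ e - c $ e \<le> int L + 2" "\<And>i. i \<noteq> e \<Longrightarrow> \<bar>w $ i - c $ i\<bar> \<le> 2"
      by (auto simp: sleeve_def)
    then show "vec_nth w \<in> PiE UNIV ?B" by (auto simp: abs_le_iff) (smt (verit))+
  qed
  have fB: "finite (PiE UNIV ?B)" by (intro finite_PiE) auto
  have inj: "inj_on vec_nth (sleeve e L c)" by (simp add: inj_on_def vec_nth_inject)
  show "finite (sleeve e L c)" using finite_subset[OF sub fB] inj by (rule finite_imageD)
  have "card (sleeve e L c) = card (vec_nth ` sleeve e L c)" by (simp add: card_image inj)
  also have "\<dots> \<le> card (PiE UNIV ?B)" by (rule card_mono[OF fB sub])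
  also have "\<dots> = (\<Prod>i\<in>UNIV. card (?B i))" by (simp add: card_PiE)
  also have "\<dots> = card (?B e) * (\<Prod>i\<in>UNIV - {e}. card (?B i))" by (rule prod.remove) auto
  also have "(\<Prod>i\<in>UNIV - {e}. card (?B i)) = (\<Prod>i\<in>UNIV - {e}. 5)" by (intro prod.cong) auto
  also have "\<dots> = 5 ^ (CARD('d) - 1)" by simp
  also have "card (?B e) * 5 ^ (CARD('d) - 1) \<le> (L + 3) * 5 ^ CARD('d)"
    by (intro mult_mono power_increasing) auto
  finally show "card (sleeve e L c) \<le> (L + 3) * 5 ^ CARD('d)" .
qed

lemma visits_UN:
  assumes "finite P" "\<And>p q. p \<in> P \<Longrightarrow> q \<in> P \<Longrightarrow> p \<noteq> q \<Longrightarrow> S p \<inter> S q = {}"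
  shows "visits (\<Union>p\<in>P. S p) \<gamma> = (\<Sum>p\<in>P. visits (S p) \<gamma>)"
proof (induction \<gamma>)
  case Nil
  then show ?case by (simp add: visits_def)
next
  case (Cons x \<gamma>)
  have "(\<Sum>p\<in>P. of_bool (x \<in> S p)) = (of_bool (x \<in> (\<Union>p\<in>P. S p)) :: nat)"
  proof (cases "x \<in> (\<Union>p\<in>P. S p)")
    case True
    then obtain p where p: "p \<in> P" "x \<in> S p" by auto
    then have "(\<Sum>q\<in>P. of_bool (x \<in> S q)) = (\<Sum>q\<in>P. if q = p then 1 else (0::nat))"
      using assms(2) by (intro sum.cong) auto
    then show ?thesis using True p assms(1) by simp
  qed auto
  then show ?case by (simp add: visits_Cons sum.distrib Cons del: UN_iff)
qed

lemma occupation_UN: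
  assumes "finite P" "\<And>p q. p \<in> P \<Longrightarrow> q \<in> P \<Longrightarrow> p \<noteq> q \<Longrightarrow> S p \<inter> S q = {}"
  shows "occupation (\<Union>p\<in>P. S p) \<sigma> = (\<Sum>p\<in>P. occupation (S p) \<sigma>)"
  by (induction \<sigma>) (simp_all add: visits_UN[OF assms] sum.distrib)

lemma dist1_sleeve:
  fixes a :: "int ^ 'd::finite" and e :: 'd
  assumes f: "f \<in> dirs e" and w: "w \<in> trap_sleeve e L a f"
  shows "dist1 a w \<le> int (depth TYPE(int ^ 'd) + L + 2 + 2 * CARD('d))"
proof -
  let ?s = "depth TYPE(int ^ 'd)"
  let ?c = "corridor_pt e a f 0"
  have "dist1 a ?c = (\<Sum>i\<in>UNIV. int ?s * \<bar>f $ i\<bar>)"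
    by (simp add: dist1_def corridor_pt_0 entry_pt_def abs_mult)
  also have "\<dots> = int ?s * (\<Sum>i\<in>UNIV. \<bar>f $ i\<bar>)" by (simp add: sum_distrib_left)
  also have "(\<Sum>i\<in>UNIV. \<bar>f $ i\<bar>) = 1"
  proof -
    obtain k where "\<And>j. \<bar>f $ j\<bar> = (if j = k then 1 else 0)"
      using dirs_nth[OF f] by (metis abs_0 abs_1 abs_minus_cancel)
    then show ?thesis by simp
  qed
  finally have 1: "dist1 a ?c = int ?s" by simp
  have "dist1 ?c w = \<bar>?c $ e - w $ e\<bar> + (\<Sum>i\<in>UNIV - {e}. \<bar>?c $ i - w $ i\<bar>)"
    unfolding dist1_def by (rule sum.remove) auto
  also have "\<dots> \<le> (int L + 2) + (\<Sum>i\<in>UNIV - {e}. 2)"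
  proof (intro add_mono sum_mono)
    show "\<bar>?c $ e - w $ e\<bar> \<le> int L + 2" using w by (auto simp: trap_sleeve_def sleeve_def)
    fix i assume "i \<in> UNIV - {e}"
    then have "\<bar>w $ i - ?c $ i\<bar> \<le> 2" using w by (auto simp: trap_sleeve_def sleeve_def)
    then show "\<bar>?c $ i - w $ i\<bar> \<le> 2" by linarith
  qed
  also have "\<dots> \<le> int L + 2 + 2 * int CARD('d)" by (simp add: of_nat_diff)
  finally show ?thesis using 1 dist1_triangle[of a w ?c] by simp
qed

text \<open>A point is close to at most one of the sleeves, so the potential of their union is
  bounded like that of a single sleeve, up to a small error. Hence the rate
  \<open>1 + 1 / (2 * q)\<close> per visit does not deteriorate with the number of sleeves, and the
  bound is as good as for independent occupations.\<close>

lemma soup_sleeves: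
  fixes P :: "((int ^ 'd::finite) \<times> (int ^ 'd)) set" and e :: 'd
  assumes d: "CARD('d) \<ge> 4" and W: "finite W" and u: "u \<ge> 0" and P: "finite P" "snd ` P \<subseteq> dirs e"
    and sep: "\<And>p q. p \<in> P \<Longrightarrow> q \<in> P \<Longrightarrow> p \<noteq> q \<Longrightarrow> dist1 (fst p) (fst q) \<ge> 6 * int R"
    and R: "R \<ge> depth TYPE(int ^ 'd) + L + 2 + 2 * CARD('d)"
    and q: "q \<ge> 1" "sleeve_green TYPE(int ^ 'd) 0 + real (card P) * sleeve_green TYPE(int ^ 'd) R \<le> q"
  shows "soup W u (\<lambda>\<sigma>. of_bool (\<forall>p\<in>P. K \<le> occupation (trap_sleeve e L (fst p) (snd p)) \<sigma>))
    \<le> ennreal (exp (u * real (card P * ((L + 3) * 5 ^ CARD('d)))) / (1 + 1 / (2 * q)) ^ (card P * K))"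
proof -
  define S where "S p = trap_sleeve e L (fst p) (snd p)" for p
  define z where "z = 1 + 1 / (2 * q)"
  have z: "z > 1" using q by (simp add: z_def)
  define D where "D = (\<Union>p\<in>P. S p)"
  have dS: "dist1 (fst p) w \<le> int R" if "p \<in> P" "w \<in> S p" for p w
    using dist1_sleeve[of "snd p" e w L "fst p"] that P(2) R unfolding S_def by force
  have R0: "R \<ge> 1" using R d by simp
  have disj: "S p \<inter> S p' = {}" if "p \<in> P" "p' \<in> P" "p \<noteq> p'" for p p'
  proof (rule ccontr)
    assume "S p \<inter> S p' \<noteq> {}"
    then obtain w where "w \<in> S p" "w \<in> S p'" by auto
    then have "dist1 (fst p) (fst p') \<le> 2 * int R"
      using dS[OF that(1)] dS[OF that(2)] dist1_triangle[of "fst p" "fst p'" w] dist1_sym[of w "fst p'"]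
      by (smt (verit))
    then show False using sep[OF that] R0 by linarith
  qed
  have fD: "finite D"
    unfolding D_def S_def trap_sleeve_def using P by (auto simp: finite_sleeve)
  have cD: "card D \<le> card P * ((L + 3) * 5 ^ CARD('d))"
  proof -
    have "card D \<le> (\<Sum>p\<in>P. card (S p))" unfolding D_def by (rule card_UN_le[OF P(1)])
    also have "\<dots> \<le> (\<Sum>p\<in>P. (L + 3) * 5 ^ CARD('d))"
      unfolding S_def trap_sleeve_def by (intro sum_mono card_sleeve_le)
    finally show ?thesis by simp
  qed
  have G: "green (indicator D) x \<le> ennreal q" for x
  proof -
    let ?near = "{p \<in> P. dist1 x (fst p) < 3 * int R}"
    have near1: "card ?near \<le> 1"
    proof (rule ccontr)
      assume "\<not> card ?near \<le> 1"
      moreover have "finite ?near" using P(1) by simp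
      ultimately have "\<not> (\<forall>p\<in>?near. \<forall>p'\<in>?near. p = p')"
        by (simp only: card_le_Suc0_iff_eq One_nat_def not_False_eq_True)
      then obtain p p' where "p \<in> ?near" "p' \<in> ?near" "p \<noteq> p'" by blast
      then show False
        using sep[of p p'] dist1_triangle[of "fst p" "fst p'" x] dist1_sym[of x "fst p"] by auto
    qed
    have gS: "green (indicator (S p)) x \<le> ennreal (sleeve_green TYPE(int ^ 'd) n)"
      if "\<And>y. y \<in> S p \<Longrightarrow> dist1 x y \<ge> int n" for p n
      using that unfolding S_def trap_sleeve_def by (intro green_sleeve_le d)
    have "green (indicator D) x \<le> green (\<lambda>y. \<Sum>p\<in>P. indicator (S p) y) x"
    proof (rule green_mono)
      fix y
      show "indicator D y \<le> (\<Sum>p\<in>P. indicator (S p) y :: ennreal)"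
      proof (cases "y \<in> D")
        case True
        then obtain p where p: "p \<in> P" "y \<in> S p" by (auto simp: D_def)
        then have "indicator (S p) y \<le> (\<Sum>p\<in>P. indicator (S p) y :: ennreal)"
          using P(1) by (intro member_le_sum) auto
        then show ?thesis using True p by simp
      qed simp
    qed
    also have "\<dots> = (\<Sum>p\<in>P. green (indicator (S p)) x)" by (rule green_sum[OF P(1)])
    also have "\<dots> = (\<Sum>p\<in>?near. green (indicator (S p)) x) + (\<Sum>p\<in>P - ?near. green (indicator (S p)) x)"
      using P(1) by (subst sum.subset_diff[of ?near P]) (auto simp: add.commute)
    also have "\<dots> \<le> (\<Sum>p\<in>?near. ennreal (sleeve_green TYPE(int ^ 'd) 0))
        + (\<Sum>p\<in>P - ?near. ennreal (sleeve_green TYPE(int ^ 'd) R))"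
    proof (intro add_mono sum_mono gS)
      show "int 0 \<le> dist1 x y" for y by (simp add: dist1_nonneg)
      fix p y assume p: "p \<in> P - ?near" and y: "y \<in> S p"
      then show "int R \<le> dist1 x y"
        using dS[of p y] dist1_triangle[of x "fst p" y] dist1_sym[of y "fst p"] by auto
    qed
    also have "\<dots> = ennreal (real (card ?near) * sleeve_green TYPE(int ^ 'd) 0 + real (card (P - ?near)) * sleeve_green TYPE(int ^ 'd) R)"
      by (simp add: ennreal_of_nat_eq_real_of_nat ennreal_mult'[symmetric] sleeve_green_nonneg)
    also have "\<dots> \<le> ennreal q"
    proof (rule ennreal_leI)
      have "real (card ?near) * sleeve_green TYPE(int ^ 'd) 0 \<le> 1 * sleeve_green TYPE(int ^ 'd) 0"
        using near1 sleeve_green_nonneg[where 'd='d] by (intro mult_right_mono) auto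
      moreover have "real (card (P - ?near)) * sleeve_green TYPE(int ^ 'd) R \<le> real (card P) * sleeve_green TYPE(int ^ 'd) R"
        using P(1) sleeve_green_nonneg[where 'd='d] by (intro mult_right_mono) (auto intro: card_mono)
      ultimately show "real (card ?near) * sleeve_green TYPE(int ^ 'd) 0
          + real (card (P - ?near)) * sleeve_green TYPE(int ^ 'd) R \<le> q" using q(2) by linarith
    qed
    finally show ?thesis .
  qed
  have pw: "z ^ (card P * K) > 0" using z by simp
  have "ennreal (z ^ (card P * K)) * soup W u (\<lambda>\<sigma>. of_bool (\<forall>p\<in>P. K \<le> occupation (S p) \<sigma>))
      = soup W u (\<lambda>\<sigma>. ennreal (z ^ (card P * K)) * of_bool (\<forall>p\<in>P. K \<le> occupation (S p) \<sigma>))"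
    by (rule soup_cmult[symmetric])
  also have "\<dots> \<le> soup W u (\<lambda>\<sigma>. ennreal (z ^ occupation D \<sigma>))"
  proof (rule soup_mono)
    fix \<sigma>
    show "ennreal (z ^ (card P * K)) * of_bool (\<forall>p\<in>P. K \<le> occupation (S p) \<sigma>) \<le> ennreal (z ^ occupation D \<sigma>)"
    proof (cases "\<forall>p\<in>P. K \<le> occupation (S p) \<sigma>")
      case True
      then have "(\<Sum>p\<in>P. K) \<le> (\<Sum>p\<in>P. occupation (S p) \<sigma>)" by (intro sum_mono) auto
      then have "card P * K \<le> occupation D \<sigma>"
        unfolding D_def using occupation_UN[where S=S and \<sigma>=\<sigma>, OF P(1) disj] by simp
      then have "z ^ (card P * K) \<le> z ^ occupation D \<sigma>" using z by (intro power_increasing) auto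
      then show ?thesis using True by (simp add: ennreal_leI)
    next
      case False
      then have "of_bool (\<forall>p\<in>P. K \<le> occupation (S p) \<sigma>) = (0::ennreal)" by (simp only: of_bool_eq(1))
      then show ?thesis by (simp only: mult_zero_right zero_le)
    qed
  qed
  also have "\<dots> \<le> ennreal (exp (u * real (card D)))"
    unfolding z_def using d by (intro soup_occupation W fD u q G) auto
  also have "\<dots> \<le> ennreal (exp (u * real (card P * ((L + 3) * 5 ^ CARD('d)))))"
    using cD u by (intro ennreal_leI) (simp add: mult_left_mono del: of_nat_mult)
  finally have le: "ennreal (z ^ (card P * K)) * soup W u (\<lambda>\<sigma>. of_bool (\<forall>p\<in>P. K \<le> occupation (S p) \<sigma>))
      \<le> ennreal (exp (u * real (card P * ((L + 3) * 5 ^ CARD('d)))))" .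
  have "soup W u (\<lambda>\<sigma>. of_bool (\<forall>p\<in>P. K \<le> occupation (S p) \<sigma>))
      = ennreal (1 / z ^ (card P * K)) * (ennreal (z ^ (card P * K)) * soup W u (\<lambda>\<sigma>. of_bool (\<forall>p\<in>P. K \<le> occupation (S p) \<sigma>)))"
    using pw z by (simp add: mult.assoc[symmetric] ennreal_mult'[symmetric])
  also have "\<dots> \<le> ennreal (1 / z ^ (card P * K)) * ennreal (exp (u * real (card P * ((L + 3) * 5 ^ CARD('d)))))"
    by (intro mult_left_mono le) simp
  also have "\<dots> = ennreal (exp (u * real (card P * ((L + 3) * 5 ^ CARD('d)))) / z ^ (card P * K))"
    using pw by (simp add: ennreal_mult'[symmetric])
  finally show ?thesis by (simp add: S_def z_def)
qed

section \<open>Fresh points of a lattice path\<close>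

text \<open>Steps of length zero are allowed, because \<open>biased_step\<close> stays put where the
  total conductance vanishes.\<close>

definition lattice_path :: "(int ^ 'd) list \<Rightarrow> bool" where
  "lattice_path \<gamma> \<longleftrightarrow> (\<forall>i. Suc i < length \<gamma> \<longrightarrow> \<gamma> ! Suc i = \<gamma> ! i \<or> nbr (\<gamma> ! i) (\<gamma> ! Suc i))"

definition backtrack_le :: "'d \<Rightarrow> nat \<Rightarrow> (int ^ 'd) list \<Rightarrow> bool" where
  "backtrack_le e R \<gamma> \<longleftrightarrow> (\<forall>s t. s \<le> t \<and> t < length \<gamma> \<longrightarrow> \<gamma> ! s $ e - int R \<le> \<gamma> ! t $ e)"

definition fresh :: "'d \<Rightarrow> nat \<Rightarrow> (int ^ 'd) list \<Rightarrow> nat \<Rightarrow> int ^ 'd \<Rightarrow> bool" where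
  "fresh e L \<gamma> t f \<longleftrightarrow> f \<in> dirs e \<and>
     (\<forall>s<t. \<forall>w. w = \<gamma> ! s \<or> nbr (\<gamma> ! s) w \<longrightarrow> w \<notin> trap_zone e L (\<gamma> ! t) f)"

text \<open>\<open>gauge e p\<close> does not increase in the direction of the bias, so that a corridor which starts
  inside a sublevel set stays inside.\<close>

definition gauge :: "'d \<Rightarrow> int ^ 'd \<Rightarrow> int ^ 'd \<Rightarrow> int" where
  "gauge e p x = (\<Sum>i\<in>UNIV - {e}. \<bar>x $ i - p $ i\<bar>) + max 0 (p $ e - x $ e)"

lemma dist1_split: "dist1 x y = (\<Sum>i\<in>UNIV - {e}. \<bar>x $ i - y $ i\<bar>) + \<bar>x $ e - y $ e\<bar>"
  unfolding dist1_def by (subst sum.remove[of UNIV e]) auto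

lemma gauge_diff_le: "gauge e p x \<le> gauge e p y + dist1 x y"
proof -
  have "(\<Sum>i\<in>UNIV - {e}. \<bar>x $ i - p $ i\<bar>) \<le> (\<Sum>i\<in>UNIV - {e}. \<bar>x $ i - y $ i\<bar>) + (\<Sum>i\<in>UNIV - {e}. \<bar>y $ i - p $ i\<bar>)"
    unfolding sum.distrib[symmetric] by (intro sum_mono) linarith
  then show ?thesis unfolding gauge_def dist1_split[of x y e] by linarith
qed

lemma gauge_sleeve:
  fixes c :: "int ^ 'd::finite"
  assumes "w \<in> sleeve e L c"
  shows "gauge e p w \<le> gauge e p c + 2 * (int CARD('d) - 1)"
proof -
  have "(\<Sum>i\<in>UNIV - {e}. \<bar>w $ i - p $ i\<bar>) \<le> (\<Sum>i\<in>UNIV - {e}. \<bar>c $ i - p $ i\<bar> + 2)"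
  proof (rule sum_mono)
    fix i assume "i \<in> UNIV - {e}"
    then have "\<bar>w $ i - c $ i\<bar> \<le> 2" using assms by (auto simp: sleeve_def)
    then show "\<bar>w $ i - p $ i\<bar> \<le> \<bar>c $ i - p $ i\<bar> + 2" by linarith
  qed
  also have "\<dots> = (\<Sum>i\<in>UNIV - {e}. \<bar>c $ i - p $ i\<bar>) + 2 * (int CARD('d) - 1)"
    by (simp add: sum.distrib of_nat_diff Suc_leI)
  finally show ?thesis using assms by (auto simp: gauge_def sleeve_def)
qed

text \<open>Pigeonhole: one of the \<open>CARD('d)\<close> terms of the gauge is at least
  \<open>depth\<close>, and an entrance along that coordinate towards \<open>p\<close> lowers the
  gauge by one with each step.\<close>

lemma gauge_zone:
  fixes a p :: "int ^ 'd::finite" and e :: 'd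
  assumes R: "R \<ge> CARD('d) * depth TYPE(int ^ 'd)" and a: "gauge e p a = int R"
  shows "\<exists>f\<in>dirs e. \<forall>w\<in>trap_zone e L a f. gauge e p w \<le> int R - 1"
proof -
  let ?s = "depth TYPE(int ^ 'd)"
  have sd: "int ?s = 2 * int CARD('d)" by (simp add: depth_def)
  have zone: "\<forall>w\<in>trap_zone e L a f. gauge e p w \<le> int R - 1"
    if ent: "\<And>j. j \<le> ?s \<Longrightarrow> gauge e p (entry_pt a f j) = int R - int j" for f
  proof
    fix w assume "w \<in> trap_zone e L a f"
    then consider "w \<in> sleeve e L (entry_pt a f ?s)" | j where "j \<in> {1..?s}" "w = entry_pt a f j"
      by (auto simp: trap_zone_def trap_sleeve_def corridor_pt_0)
    then show "gauge e p w \<le> int R - 1"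
    proof cases
      case 1
      then show ?thesis using gauge_sleeve[OF 1, of p] ent[of ?s] sd by simp
    next
      case 2
      then show ?thesis using ent[of j] by simp
    qed
  qed
  show ?thesis
  proof (cases "p $ e - a $ e \<ge> int ?s")
    case True
    have "gauge e p (entry_pt a (axis e 1) j) = int R - int j" if "j \<le> ?s" for j
    proof -
      have "(\<Sum>i\<in>UNIV - {e}. \<bar>entry_pt a (axis e 1) j $ i - p $ i\<bar>) = (\<Sum>i\<in>UNIV - {e}. \<bar>a $ i - p $ i\<bar>)"
        by (intro sum.cong) (auto simp: entry_pt_def axis_def)
      moreover have "entry_pt a (axis e 1) j $ e = a $ e + int j" by (simp add: entry_pt_def)
      ultimately show ?thesis using True that a by (simp add: gauge_def)
    qed
    then show ?thesis using zone[of "axis e 1"] by (intro bexI[of _ "axis e 1"]) (auto simp: dirs_def)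
  next
    case False
    have "\<exists>i. i \<noteq> e \<and> \<bar>a $ i - p $ i\<bar> \<ge> int ?s"
    proof (rule ccontr)
      assume "\<not> ?thesis"
      then have "\<bar>a $ i - p $ i\<bar> \<le> int ?s" if "i \<in> UNIV - {e}" for i using that by force
      then have "(\<Sum>i\<in>UNIV - {e}. \<bar>a $ i - p $ i\<bar>) \<le> (\<Sum>i\<in>UNIV - {e}. int ?s)" by (intro sum_mono)
      also have "\<dots> = int CARD('d) * int ?s - int ?s"
        by (simp add: of_nat_diff Suc_leI left_diff_distrib)
      finally have "int R < int CARD('d) * int ?s" using a False sd zero_less_card_finite[where 'a='d] unfolding gauge_def by linarith
      then show False using R by (metis of_nat_less_iff of_nat_mult not_le)
    qed
    then obtain i where i: "i \<noteq> e" "\<bar>a $ i - p $ i\<bar> \<ge> int ?s" by auto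
    define f :: "int ^ 'd" where "f = (if a $ i > p $ i then - axis i 1 else axis i 1)"
    have fd: "f \<in> dirs e" using i by (auto simp: f_def dirs_def)
    have "gauge e p (entry_pt a f j) = int R - int j" if "j \<le> ?s" for j
    proof -
      have "(\<Sum>k\<in>UNIV - {e}. \<bar>entry_pt a f j $ k - p $ k\<bar>) = (\<Sum>k\<in>UNIV - {e}. \<bar>a $ k - p $ k\<bar> - (if k = i then int j else 0))"
      proof (rule sum.cong[OF refl])
        fix k
        show "\<bar>entry_pt a f j $ k - p $ k\<bar> = \<bar>a $ k - p $ k\<bar> - (if k = i then int j else 0)"
        proof (cases "k = i")
          case True
          then have "entry_pt a f j $ k = (if a $ i > p $ i then a $ i - int j else a $ i + int j)"
            by (simp add: entry_pt_def f_def axis_def)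
          then show ?thesis using True i(2) that by (auto split: if_splits)
        qed (simp add: entry_pt_def f_def axis_def)
      qed
      also have "\<dots> = (\<Sum>k\<in>UNIV - {e}. \<bar>a $ k - p $ k\<bar>) - int j"
        using i(1) by (simp add: sum_subtractf)
      finally have "(\<Sum>k\<in>UNIV - {e}. \<bar>entry_pt a f j $ k - p $ k\<bar>) = (\<Sum>k\<in>UNIV - {e}. \<bar>a $ k - p $ k\<bar>) - int j" .
      moreover have "entry_pt a f j $ e = a $ e" using i(1) by (simp add: entry_pt_def f_def axis_def)
      ultimately show ?thesis using a by (simp add: gauge_def)
    qed
    then show ?thesis using zone[of f] fd by blast
  qed
qed

lemma lattice_path_dist1:
  assumes "lattice_path \<gamma>" "Suc i < length \<gamma>"
  shows "dist1 (\<gamma> ! i) (\<gamma> ! Suc i) \<le> 1"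
  using assms dist1_nbr[of "\<gamma> ! i" "\<gamma> ! Suc i"] by (auto simp: lattice_path_def)

text \<open>The time \<open>t\<close> is the first at which the gauge centred at
  \<open>\<gamma> ! t0\<close> falls to \<open>R\<close>. All earlier sites have a larger gauge,
  their neighbours one of at least \<open>R\<close>, and the zone from \<open>gauge_zone\<close>
  lies strictly below. The gauge does not see an excess in the direction of the bias; limited
  backtracking bounds this excess and so turns gauge into distance.\<close>

lemma fresh_near:
  fixes \<gamma> :: "(int ^ 'd::finite) list" and e :: 'd
  assumes \<gamma>: "lattice_path \<gamma>" "backtrack_le e R \<gamma>" and R: "R \<ge> CARD('d) * depth TYPE(int ^ 'd)"
    and t0: "t0 < length \<gamma>" and far: "dist1 (\<gamma> ! 0) (\<gamma> ! t0) > 2 * int R"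
  shows "\<exists>t\<le>t0. \<exists>f. fresh e L \<gamma> t f \<and> dist1 (\<gamma> ! t) (\<gamma> ! t0) \<le> 2 * int R"
proof -
  define p where "p = \<gamma> ! t0"
  define g where "g t = gauge e p (\<gamma> ! t)" for t
  have dg: "dist1 (\<gamma> ! t) p \<le> g t + int R" if "t \<le> t0" for t
  proof -
    have "\<gamma> ! t $ e - int R \<le> p $ e"
      using \<gamma>(2) t0 that by (auto simp: backtrack_le_def p_def)
    then show ?thesis unfolding g_def gauge_def dist1_split[of "\<gamma> ! t" p e] by linarith
  qed
  have g0: "g 0 > int R" using dg[of 0] far by (simp add: p_def)
  have gt0: "g t0 \<le> int R" by (simp add: g_def p_def gauge_def)
  define t where "t = (LEAST t. g t \<le> int R)"
  have t: "g t \<le> int R" "t \<le> t0"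
    unfolding t_def using gt0 by (auto intro: LeastI Least_le)
  have before: "g s > int R" if "s < t" for s
    using not_less_Least[OF that[unfolded t_def]] by simp
  have tR: "g t = int R"
  proof -
    have "t \<noteq> 0" using t(1) g0 by (metis not_le)
    then obtain s where s: "t = Suc s" by (cases t) auto
    have "g s \<le> g t + 1"
      using gauge_diff_le[of e p "\<gamma> ! s" "\<gamma> ! t"] lattice_path_dist1[OF \<gamma>(1), of s] t(2) t0 s
      by (simp add: g_def)
    then show ?thesis using before[of s] t(1) s by simp
  qed
  obtain f where f: "f \<in> dirs e" "\<And>w. w \<in> trap_zone e L (\<gamma> ! t) f \<Longrightarrow> gauge e p w \<le> int R - 1"
    using gauge_zone[OF R, of e p "\<gamma> ! t" L] tR by (auto simp: g_def)
  have "fresh e L \<gamma> t f"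
    unfolding fresh_def
  proof (intro conjI f(1) allI impI notI)
    fix s w assume s: "s < t" and w: "w = \<gamma> ! s \<or> nbr (\<gamma> ! s) w" and z: "w \<in> trap_zone e L (\<gamma> ! t) f"
    have "dist1 (\<gamma> ! s) w \<le> 1" using w dist1_nbr by (metis dist1_self order_refl zero_le_one)
    then have "g s \<le> gauge e p w + 1" using gauge_diff_le[of e p "\<gamma> ! s" w] by (simp add: g_def)
    then show False using f(2)[OF z] before[OF s] by linarith
  qed
  moreover have "dist1 (\<gamma> ! t) (\<gamma> ! t0) \<le> 2 * int R"
    using dg[OF t(2)] tR by (simp add: p_def)
  ultimately show ?thesis using t(2) by blast
qed

text \<open>The newest point comes first. It is near some earlier point, which keeps the number of
  chains small, and far from all of them, as \<open>soup_sleeves\<close> demands.\<close>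

fun link_chain :: "'d \<Rightarrow> nat \<Rightarrow> ((int ^ 'd) \<times> (int ^ 'd)) list \<Rightarrow> bool" where
  "link_chain e R [] \<longleftrightarrow> True"
| "link_chain e R (z # zs) \<longleftrightarrow> link_chain e R zs \<and> snd z \<in> dirs e
     \<and> (zs \<noteq> [] \<longrightarrow> (\<exists>q\<in>set zs. dist1 (fst z) (fst q) \<le> 10 * int R))
     \<and> (\<forall>q\<in>set zs. 6 * int R \<le> dist1 (fst z) (fst q))"

lemma link_chain_exists:
  fixes \<gamma> :: "(int ^ 'd::finite) list" and e :: 'd
  assumes \<gamma>: "lattice_path \<gamma>" "backtrack_le e R \<gamma>" and R: "R \<ge> CARD('d) * depth TYPE(int ^ 'd)"
    and t0: "t0 \<le> t1" "t1 < length \<gamma>" and J: "J \<ge> 1"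
    and far: "dist1 (\<gamma> ! 0) (\<gamma> ! t0) \<ge> 30 * int R * int J" "dist1 (\<gamma> ! t0) (\<gamma> ! t1) \<ge> 20 * int R * int J"
  shows "\<exists>zs. length zs = J \<and> link_chain e R zs \<and>
    (\<forall>z\<in>set zs. (\<exists>t\<le>t1. fst z = \<gamma> ! t \<and> fresh e L \<gamma> t (snd z)) \<and> dist1 (\<gamma> ! t0) (fst z) \<le> 10 * int R * int J)"
proof -
  have R1: "R \<ge> 1"
  proof -
    have "CARD('d) * depth TYPE(int ^ 'd) \<ge> 1" by (simp add: depth_def Suc_leI)
    then show ?thesis using R by linarith
  qed
  have "\<exists>zs. length zs = Suc j \<and> link_chain e R zs \<and>
    (\<forall>z\<in>set zs. (\<exists>t\<le>t1. fst z = \<gamma> ! t \<and> fresh e L \<gamma> t (snd z)) \<and> dist1 (\<gamma> ! t0) (fst z) \<le> 10 * int R * int (Suc j))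
    \<and> (\<exists>z\<in>set zs. dist1 (\<gamma> ! t0) (fst z) \<le> 2 * int R)" if "Suc j \<le> J" for j
    using that
  proof (induction j)
    case 0
    have "int R * 1 \<le> int R * int J" using J by (intro mult_left_mono) auto
    then have "dist1 (\<gamma> ! 0) (\<gamma> ! t0) > 2 * int R" using far(1) R1 by linarith
    then obtain t f where tf: "t \<le> t0" "fresh e L \<gamma> t f" "dist1 (\<gamma> ! t) (\<gamma> ! t0) \<le> 2 * int R"
      using fresh_near[OF \<gamma> R, of t0 L] t0 by auto
    have d: "dist1 (\<gamma> ! t0) (\<gamma> ! t) \<le> 2 * int R" using tf(3) by (simp add: dist1_sym)
    have "\<exists>t'\<le>t1. \<gamma> ! t = \<gamma> ! t' \<and> fresh e L \<gamma> t' f" using tf t0 by (intro exI[of _ t]) auto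
    then show ?case
      using tf d by (intro exI[of _ "[(\<gamma> ! t, f)]"]) (auto simp: fresh_def)
  next
    case (Suc j)
    then obtain zs where zs: "length zs = Suc j" "link_chain e R zs"
      "\<And>z. z \<in> set zs \<Longrightarrow> \<exists>t\<le>t1. fst z = \<gamma> ! t \<and> fresh e L \<gamma> t (snd z)"
      "\<And>z. z \<in> set zs \<Longrightarrow> dist1 (\<gamma> ! t0) (fst z) \<le> 10 * int R * int (Suc j)"
      "\<exists>z\<in>set zs. dist1 (\<gamma> ! t0) (fst z) \<le> 2 * int R" by auto
    have jJ: "int R * int (Suc j) + int R \<le> int R * int J"
    proof -
      have "int R * (int (Suc j) + 1) \<le> int R * int J" using Suc.prems by (intro mult_left_mono) auto
      then show ?thesis by (simp only: distrib_left mult_1_right)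
    qed
    \<comment> \<open>Origin of the constants: a fresh point is found within \<open>2 * R\<close> of
      the site where the path first leaves these balls of radius \<open>8 * R\<close>, which gives a
      separation of \<open>6 * R\<close> and a link of at most \<open>10 * R\<close>.\<close>
    define away where "away t \<longleftrightarrow> t0 \<le> t \<and> (\<forall>z\<in>set zs. 8 * int R \<le> dist1 (\<gamma> ! t) (fst z))" for t
    have "away t1"
      unfolding away_def
    proof (intro conjI t0(1) ballI)
      fix z assume z: "z \<in> set zs"
      have "int R * int (Suc j) \<ge> 0" by simp
      then show "8 * int R \<le> dist1 (\<gamma> ! t1) (fst z)"
        using zs(4)[OF z] far(2) dist1_triangle[of "\<gamma> ! t0" "\<gamma> ! t1" "fst z"] dist1_sym[of "\<gamma> ! t1" "fst z"] jJ
        by linarith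
    qed
    define t where "t = (LEAST t. away t)"
    have t: "away t" "t \<le> t1" unfolding t_def using \<open>away t1\<close> by (auto intro: LeastI Least_le)
    have "\<not> away t0" using zs(5) R1 by (force simp: away_def)
    then have "t \<noteq> t0" using t(1) by auto
    then obtain s where s: "t = Suc s" "t0 \<le> s" using t(1) by (cases t) (auto simp: away_def)
    have "\<not> away s" using not_less_Least[of s away] s(1) unfolding t_def[symmetric] by simp
    then obtain z where z: "z \<in> set zs" "dist1 (\<gamma> ! s) (fst z) < 8 * int R" using s(2) by (auto simp: away_def)
    have "dist1 (\<gamma> ! s) (\<gamma> ! t) \<le> 1" using lattice_path_dist1[OF \<gamma>(1), of s] s t t0 by simp
    then have z8: "dist1 (\<gamma> ! t) (fst z) \<le> 8 * int R"
      using z(2) dist1_triangle[of "\<gamma> ! t" "fst z" "\<gamma> ! s"] dist1_sym[of "\<gamma> ! s" "\<gamma> ! t"] by linarith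
    have d0t: "dist1 (\<gamma> ! t0) (\<gamma> ! t) \<le> 10 * int R * int (Suc j) + 8 * int R"
      using dist1_triangle[of "\<gamma> ! t0" "\<gamma> ! t" "fst z"] zs(4)[OF z(1)] z8 dist1_sym[of "\<gamma> ! t" "fst z"] by linarith
    have "int R * int (Suc j) \<ge> 0" by simp
    then have "dist1 (\<gamma> ! 0) (\<gamma> ! t) > 2 * int R"
      using far(1) d0t dist1_triangle[of "\<gamma> ! 0" "\<gamma> ! t0" "\<gamma> ! t"] dist1_sym[of "\<gamma> ! t0" "\<gamma> ! t"] jJ R1 by linarith
    then obtain r f where r: "r \<le> t" "fresh e L \<gamma> r f" "dist1 (\<gamma> ! r) (\<gamma> ! t) \<le> 2 * int R"
      using fresh_near[OF \<gamma> R, of t L] t(2) t0 by auto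
    have n1: "6 * int R \<le> dist1 (\<gamma> ! r) (fst q)" if "q \<in> set zs" for q
    proof -
      have "8 * int R \<le> dist1 (\<gamma> ! t) (fst q)" using t(1) that by (auto simp: away_def)
      then show ?thesis
        using dist1_triangle[of "\<gamma> ! t" "fst q" "\<gamma> ! r"] dist1_sym[of "\<gamma> ! t" "\<gamma> ! r"] r(3) by linarith
    qed
    have n2: "dist1 (\<gamma> ! r) (fst z) \<le> 10 * int R"
      using dist1_triangle[of "\<gamma> ! r" "fst z" "\<gamma> ! t"] r(3) z8 by linarith
    have n3: "dist1 (\<gamma> ! t0) (\<gamma> ! r) \<le> 10 * int R * int (Suc (Suc j))"
    proof -
      have "10 * int R * int (Suc (Suc j)) = 10 * int R * int (Suc j) + 10 * int R" by (simp add: algebra_simps)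
      then show ?thesis
        using d0t dist1_triangle[of "\<gamma> ! t0" "\<gamma> ! r" "\<gamma> ! t"] dist1_sym[of "\<gamma> ! t" "\<gamma> ! r"] r(3) by linarith
    qed
    have n4: "dist1 (\<gamma> ! t0) (fst q) \<le> 10 * int R * int (Suc (Suc j))" if "q \<in> set zs" for q
    proof -
      have "10 * int R * int (Suc j) \<le> 10 * int R * int (Suc (Suc j))" by (intro mult_left_mono) auto
      then show ?thesis using zs(4)[OF that] by linarith
    qed
    have n5: "\<exists>t'\<le>t1. \<gamma> ! r = \<gamma> ! t' \<and> fresh e L \<gamma> t' f" using r t(2) by (intro exI[of _ r]) auto
    show ?case
    proof (intro exI[of _ "(\<gamma> ! r, f) # zs"] conjI)
      show "link_chain e R ((\<gamma> ! r, f) # zs)"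
        using zs(2) n1 n2 z(1) r(2) by (auto simp: fresh_def)
      show "\<exists>z\<in>set ((\<gamma> ! r, f) # zs). dist1 (\<gamma> ! t0) (fst z) \<le> 2 * int R" using zs(5) by auto
      show "\<forall>z\<in>set ((\<gamma> ! r, f) # zs). (\<exists>t\<le>t1. fst z = \<gamma> ! t \<and> fresh e L \<gamma> t (snd z))
          \<and> dist1 (\<gamma> ! t0) (fst z) \<le> 10 * int R * int (Suc (Suc j))"
        using zs(3) n3 n4 n5 by auto
    qed (use zs in auto)
  qed
  from this[of "J - 1"] show ?thesis using J by auto
qed

text \<open>One chain is found in each of the disjoint annuli crossed by the path.\<close>

lemma many_good_fresh:
  fixes \<gamma> :: "(int ^ 'd::finite) list" and e :: 'd
  assumes \<gamma>: "lattice_path \<gamma>" "backtrack_le e R \<gamma>" and R: "R \<ge> CARD('d) * depth TYPE(int ^ 'd)"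
    and T: "T < length \<gamma>" "dist1 (\<gamma> ! 0) (\<gamma> ! T) \<ge> int m" and J: "J \<ge> 1"
    and M: "(M + 1) * (60 * R * J) \<le> m"
    and good: "\<And>zs. length zs = J \<Longrightarrow> link_chain e R zs \<Longrightarrow> (\<forall>z\<in>set zs. dist1 (\<gamma> ! 0) (fst z) \<le> int m)
       \<Longrightarrow> \<exists>z\<in>set zs. good z"
  shows "M \<le> card {(t, f). t < length \<gamma> \<and> fresh e L \<gamma> t f \<and> good (\<gamma> ! t, f)}"
proof -
  let ?S = "{(t, f). t < length \<gamma> \<and> fresh e L \<gamma> t f \<and> good (\<gamma> ! t, f)}"
  \<comment> \<open>Each chain stays within \<open>10 * R * J\<close> of the site at which the path
    reaches the radius, so a spacing of \<open>60 * R * J\<close> separates the annuli and leaves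
    room for the distances required by \<open>link_chain_exists\<close>.\<close>
  define w where "w = 60 * int R * int J"
  define D where "D t = dist1 (\<gamma> ! 0) (\<gamma> ! t)" for t
  have R1: "int R * int J \<ge> 1"
  proof -
    have "CARD('d) * depth TYPE(int ^ 'd) \<ge> 1" by (simp add: depth_def Suc_leI)
    then have "R \<ge> 1" using R by linarith
    then show ?thesis using J by (metis Suc_le_eq One_nat_def int_one_le_iff_zero_less nat_0_less_mult_iff of_nat_mult of_nat_0_less_iff)
  qed
  have wpos: "w \<ge> 60" using R1 by (simp add: w_def)
  have wm: "(int M + 1) * w \<le> int m"
  proof -
    have "int ((M + 1) * (60 * R * J)) \<le> int m" using M by (rule of_nat_mono)
    then show ?thesis by (simp add: w_def algebra_simps)
  qed
  have *: "\<exists>p. p \<in> ?S \<and> \<bar>D (fst p) - int k * w\<bar> \<le> 10 * int R * int J" if k: "k \<in> {1..M}" for k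
  proof -
    have kw: "int k * w + w \<le> int m"
    proof -
      have "(int k + 1) * w \<le> (int M + 1) * w" using k wpos by (intro mult_right_mono) auto
      then show ?thesis using wm by (simp add: distrib_right)
    qed
    have kw1: "w \<le> int k * w" using k wpos mult_right_mono[of 1 "int k" w] by auto
    define t0 where "t0 = (LEAST t. int k * w \<le> D t)"
    have DT: "int k * w \<le> D T" using T(2) kw wpos by (simp add: D_def)
    have t0: "int k * w \<le> D t0" "t0 \<le> T" unfolding t0_def using DT by (auto intro: LeastI Least_le)
    have t0eq: "D t0 = int k * w"
    proof -
      have "t0 \<noteq> 0"
      proof
        assume "t0 = 0"
        then have "D t0 = 0" by (simp add: D_def)
        then show False using t0(1) kw1 wpos by linarith
      qed
      then obtain s where s: "t0 = Suc s" by (cases t0) auto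
      have "D s < int k * w" using not_less_Least[of s "\<lambda>t. int k * w \<le> D t"] s unfolding t0_def[symmetric] by simp
      moreover have "D t0 \<le> D s + 1"
        using dist1_triangle[of "\<gamma> ! 0" "\<gamma> ! t0" "\<gamma> ! s"] lattice_path_dist1[OF \<gamma>(1), of s] s t0(2) T(1)
        by (simp add: D_def)
      ultimately show ?thesis using t0(1) by linarith
    qed
    have far1: "dist1 (\<gamma> ! 0) (\<gamma> ! t0) \<ge> 30 * int R * int J"
    proof -
      have "30 * int R * int J = 30 * (int R * int J)" "w = 60 * (int R * int J)" by (simp_all add: w_def)
      then show ?thesis using t0eq kw1 R1 unfolding D_def by linarith
    qed
    have far2: "dist1 (\<gamma> ! t0) (\<gamma> ! T) \<ge> 20 * int R * int J"
    proof -
      have "int m \<le> D t0 + dist1 (\<gamma> ! t0) (\<gamma> ! T)"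
        using T(2) dist1_triangle[of "\<gamma> ! 0" "\<gamma> ! T" "\<gamma> ! t0"] by (simp add: D_def)
      then have "w \<le> dist1 (\<gamma> ! t0) (\<gamma> ! T)" using t0eq kw by linarith
      then show ?thesis using R1 by (simp add: w_def)
    qed
    obtain zs where zs: "length zs = J" "link_chain e R zs"
      "\<And>z. z \<in> set zs \<Longrightarrow> \<exists>t\<le>T. fst z = \<gamma> ! t \<and> fresh e L \<gamma> t (snd z)"
      "\<And>z. z \<in> set zs \<Longrightarrow> dist1 (\<gamma> ! t0) (fst z) \<le> 10 * int R * int J"
      using link_chain_exists[OF \<gamma> R t0(2) T(1) J far1 far2, of L] by auto
    have near: "\<bar>dist1 (\<gamma> ! 0) (fst z) - int k * w\<bar> \<le> 10 * int R * int J" if "z \<in> set zs" for z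
      using zs(4)[OF that] t0eq dist1_triangle[of "\<gamma> ! 0" "fst z" "\<gamma> ! t0"]
        dist1_triangle[of "\<gamma> ! 0" "\<gamma> ! t0" "fst z"] dist1_sym[of "fst z" "\<gamma> ! t0"] by (simp add: D_def)
    have "\<forall>z\<in>set zs. dist1 (\<gamma> ! 0) (fst z) \<le> int m"
    proof
      fix z assume "z \<in> set zs"
      then show "dist1 (\<gamma> ! 0) (fst z) \<le> int m" using near[of z] kw R1 by (simp add: w_def)
    qed
    then obtain z where z: "z \<in> set zs" "good z" using good[OF zs(1,2)] by blast
    obtain t where t: "t \<le> T" "fst z = \<gamma> ! t" "fresh e L \<gamma> t (snd z)" using zs(3)[OF z(1)] by auto
    have "z = (\<gamma> ! t, snd z)" using t(2) by (simp add: prod_eq_iff)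
    then have "good (\<gamma> ! t, snd z)" using z(2) by simp
    then have "(t, snd z) \<in> ?S" using t(1,3) T(1) by simp
    moreover have "\<bar>D t - int k * w\<bar> \<le> 10 * int R * int J" using near[OF z(1)] t(2) by (simp add: D_def)
    ultimately show ?thesis by (intro exI[of _ "(t, snd z)"]) auto
  qed
  have "\<forall>k\<in>{1..M}. \<exists>p. p \<in> ?S \<and> \<bar>D (fst p) - int k * w\<bar> \<le> 10 * int R * int J"
    by (intro ballI *)
  then have "\<exists>h. \<forall>k\<in>{1..M}. h k \<in> ?S \<and> \<bar>D (fst (h k)) - int k * w\<bar> \<le> 10 * int R * int J"
    by (rule bchoice)
  then obtain h where h': "\<forall>k\<in>{1..M}. h k \<in> ?S \<and> \<bar>D (fst (h k)) - int k * w\<bar> \<le> 10 * int R * int J"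
    by (rule exE)
  have hS: "h k \<in> ?S" and h: "\<bar>D (fst (h k)) - int k * w\<bar> \<le> 10 * int R * int J" if "k \<in> {1..M}" for k
    using bspec[OF h' that] by (rule conjunct1, rule conjunct2)
  have inj: "inj_on h {1..M}"
  proof (rule inj_onI)
    fix k k' assume k: "k \<in> {1..M}" "k' \<in> {1..M}" "h k = h k'"
    then have "\<bar>int k * w - int k' * w\<bar> \<le> 20 * int R * int J" using h[OF k(1)] h[OF k(2)] unfolding k(3) by linarith
    moreover have "\<bar>int k * w - int k' * w\<bar> = \<bar>int k - int k'\<bar> * w"
      using wpos by (simp add: left_diff_distrib[symmetric] abs_mult)
    moreover have "20 * int R * int J = 20 * (int R * int J)" "w = 60 * (int R * int J)" by (simp_all add: w_def)
    ultimately have "\<bar>int k - int k'\<bar> * w < w" using R1 by linarith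
    moreover have "w \<le> \<bar>int k - int k'\<bar> * w" if "1 \<le> \<bar>int k - int k'\<bar>"
      using mult_right_mono[OF that, of w] wpos by simp
    ultimately have "\<not> 1 \<le> \<bar>int k - int k'\<bar>" by linarith
    then show "k = k'" by simp
  qed
  have fin: "finite ?S"
  proof (rule finite_subset)
    show "?S \<subseteq> {..<length \<gamma>} \<times> dirs e" by (auto simp: fresh_def)
    show "finite ({..<length \<gamma>} \<times> dirs e)" by (simp add: dirs_def)
  qed
  have "M = card (h ` {1..M})" unfolding card_image[OF inj] by simp
  also have "\<dots> \<le> card ?S" by (intro card_mono[OF fin] image_subsetI hS)
  finally show ?thesis .
qed

lemma card_dirs_le: "card (dirs e) \<le> 2 * CARD('d)" and finite_dirs: "finite (dirs e)" for e :: "'d::finite"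
proof -
  have "card (dirs e) \<le> Suc (card ((\<lambda>i. axis i (1::int)) ` (- {e}) \<union> (\<lambda>i. - axis i 1) ` (- {e})))"
    unfolding dirs_def by (rule card_insert_le_m1) auto
  also have "\<dots> \<le> Suc (card ((\<lambda>i. axis i (1::int)) ` (- {e})) + card ((\<lambda>i. - axis i (1::int)) ` (- {e})))"
    by (simp add: card_Un_le)
  also have "\<dots> \<le> Suc (card (- {e}) + card (- {e}))"
    by (intro Suc_le_mono[THEN iffD2] add_mono card_image_le) auto
  also have "card (- {e}) = CARD('d) - 1" by (simp add: Compl_eq_Diff_UNIV card_Diff_singleton)
  also have "Suc (CARD('d) - 1 + (CARD('d) - 1)) \<le> 2 * CARD('d)"
    using zero_less_card_finite[where 'a='d] by linarith
  finally show "card (dirs e) \<le> 2 * CARD('d)" .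
  show "finite (dirs e)" by (simp add: dirs_def)
qed

text \<open>A path trapped at two fresh times visits the later starting point in the earlier trap.\<close>

lemma card_trapped_le:
  fixes \<gamma> :: "(int ^ 'd::finite) list" and e :: 'd
  shows "card {(t, f). t < length \<gamma> \<and> fresh e L \<gamma> t f \<and> (\<forall>s. t < s \<and> s < length \<gamma> \<longrightarrow> \<gamma> ! s \<in> trap_path e L (\<gamma> ! t) f)}
    \<le> (1 + depth TYPE(int ^ 'd) + L) * (2 * CARD('d))" (is "card ?S \<le> _")
proof (cases "?S = {}")
  case False
  let ?s = "depth TYPE(int ^ 'd)"
  define t0 where "t0 = (LEAST t. \<exists>f. (t, f) \<in> ?S)"
  have ex: "\<exists>t f. (t, f) \<in> ?S" using False by auto
  have "\<exists>f. (t0, f) \<in> ?S" unfolding t0_def by (rule LeastI_ex[OF ex])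
  then obtain f0 where f0: "(t0, f0) \<in> ?S" by auto
  have t0_le: "t0 \<le> t" if "(t, f) \<in> ?S" for t f
    unfolding t0_def using that by (intro Least_le) auto
  let ?A = "insert (\<gamma> ! t0) (trap_path e L (\<gamma> ! t0) f0)"
  have fin: "finite (trap_path e L (\<gamma> ! t0) f0)" by (simp add: trap_path_def)
  have "card (trap_path e L (\<gamma> ! t0) f0) \<le> ?s + L"
    unfolding trap_path_def
    by (rule order_trans[OF card_Un_le]) (intro add_mono order_trans[OF card_image_le], auto)
  then have cA: "card ?A \<le> 1 + ?s + L" using fin by (simp add: card_insert_if)
  \<comment> \<open>A fresh starting point has not been visited before: otherwise the first site of
    its entrance would be next to the past of the path.\<close>
  have first: "\<gamma> ! s \<noteq> \<gamma> ! t" if "fresh e L \<gamma> t f" "s < t" for s t f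
  proof
    assume eq: "\<gamma> ! s = \<gamma> ! t"
    have "nbr (\<gamma> ! t) (entry_pt (\<gamma> ! t) f 1)" using nbr_entry[of f e "\<gamma> ! t" 0] that(1) by (simp add: fresh_def)
    moreover have "entry_pt (\<gamma> ! t) f 1 \<in> trap_zone e L (\<gamma> ! t) f"
      by (auto simp: trap_zone_def depth_def)
    ultimately show False using that eq unfolding fresh_def by metis
  qed
  let ?g = "\<lambda>(t, f). (\<gamma> ! t, f)"
  have inj: "inj_on ?g ?S"
  proof (rule inj_onI)
    fix p p' assume p: "p \<in> ?S" "p' \<in> ?S" "?g p = ?g p'"
    obtain t f t' f' where tf: "p = (t, f)" "p' = (t', f')" by (cases p, cases p') auto
    then have "fresh e L \<gamma> t f" "fresh e L \<gamma> t' f'" "\<gamma> ! t = \<gamma> ! t'" "f = f'" using p by auto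
    moreover from this have "t = t'" using first[of t f t'] first[of t' f' t] by (metis nat_neq_iff)
    ultimately show "p = p'" using tf by simp
  qed
  have sub: "?g ` ?S \<subseteq> ?A \<times> dirs e"
  proof (rule image_subsetI)
    fix p assume p: "p \<in> ?S"
    obtain t f where tf: "p = (t, f)" by (cases p) auto
    then have "t0 \<le> t" using t0_le[of t f] p by simp
    then have "\<gamma> ! t \<in> ?A" using f0 p tf by (cases "t = t0") auto
    moreover have "f \<in> dirs e" using p tf by (simp add: fresh_def)
    ultimately show "?g p \<in> ?A \<times> dirs e" using tf by simp
  qed
  have "card ?S = card (?g ` ?S)" by (simp add: card_image[OF inj])
  also have "\<dots> \<le> card (?A \<times> dirs e)"
    using fin finite_dirs[of e] by (intro card_mono sub) auto
  also have "\<dots> = card ?A * card (dirs e)" by (rule card_cartesian_product)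
  also have "\<dots> \<le> (1 + ?s + L) * (2 * CARD('d))"
    using cA card_dirs_le[of e] by (intro mult_mono) auto
  finally show ?thesis .
next
  case True
  then show ?thesis by (simp only: card.empty zero_le)
qed

section \<open>Counting chains\<close>

lemma sum_ennreal_const: "b \<ge> 0 \<Longrightarrow> (\<Sum>x\<in>A. ennreal b) = ennreal (real (card A) * b)"
  by (simp add: ennreal_mult'' ennreal_of_nat_eq_real_of_nat)

lemma
  fixes c :: "int ^ 'd::finite"
  shows finite_ball1: "finite {x. dist1 c x \<le> int r}"
    and card_ball1_le: "card {x. dist1 c x \<le> int r} \<le> (2 * r + 1) ^ CARD('d)"
proof -
  let ?B = "\<lambda>i. {c $ i - int r..c $ i + int r}"
  have sub: "vec_nth ` {x. dist1 c x \<le> int r} \<subseteq> PiE UNIV ?B"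
  proof (rule image_subsetI)
    fix w assume "w \<in> {x. dist1 c x \<le> int r}"
    then have "\<bar>c $ i - w $ i\<bar> \<le> int r" for i using dist1_coord[of c i w] by auto
    then show "vec_nth w \<in> PiE UNIV ?B" by (auto simp: abs_le_iff) (smt (verit))+
  qed
  have fB: "finite (PiE UNIV ?B)" by (intro finite_PiE) auto
  have inj: "inj_on vec_nth {x. dist1 c x \<le> int r}" by (simp add: inj_on_def vec_nth_inject)
  show "finite {x. dist1 c x \<le> int r}" using finite_subset[OF sub fB] inj by (rule finite_imageD)
  have "card {x. dist1 c x \<le> int r} = card (vec_nth ` {x. dist1 c x \<le> int r})" by (simp add: card_image inj)
  also have "\<dots> \<le> card (PiE UNIV ?B)" by (rule card_mono[OF fB sub])
  also have "\<dots> = (\<Prod>i\<in>(UNIV::'d set). 2 * r + 1)"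
  proof -
    have "card {c $ i - int r..c $ i + int r} = 2 * r + 1" for i
    proof -
      have "c $ i + int r + 1 - (c $ i - int r) = int (2 * r + 1)" by simp
      then show ?thesis by (simp only: card_atLeastAtMost_int nat_int)
    qed
    then show ?thesis by (simp only: card_PiE finite)
  qed
  also have "\<dots> = (2 * r + 1) ^ CARD('d)" by simp
  finally show "card {x. dist1 c x \<le> int r} \<le> (2 * r + 1) ^ CARD('d)" .
qed

definition link_chains :: "'d \<Rightarrow> nat \<Rightarrow> nat \<Rightarrow> nat \<Rightarrow> ((int ^ 'd) \<times> (int ^ 'd)) list set" where
  "link_chains e R m j = {zs. length zs = j \<and> link_chain e R zs \<and> (\<forall>z\<in>set zs. dist1 0 (fst z) \<le> int m)}"

lemma link_chain_sep:
  assumes "link_chain e R zs" "p \<in> set zs" "q \<in> set zs" "p \<noteq> q"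
  shows "6 * int R \<le> dist1 (fst p) (fst q)"
  using assms by (induction zs) (auto simp: dist1_sym)

lemma link_chain_dirs: "link_chain e R zs \<Longrightarrow> snd ` set zs \<subseteq> dirs e"
  by (induction zs) auto

lemma link_chain_distinct: "link_chain e R zs \<Longrightarrow> R \<ge> 1 \<Longrightarrow> distinct zs"
proof (induction zs)
  case (Cons z zs)
  have "z \<notin> set zs"
  proof
    assume "z \<in> set zs"
    then have "6 * int R \<le> dist1 (fst z) (fst z)" using Cons.prems by auto
    then show False using Cons.prems by simp
  qed
  then show ?case using Cons by simp
qed simp

text \<open>The first point is free in a ball of radius \<open>m\<close>; each further one lies
  within \<open>10 * R\<close> of one of at most \<open>J\<close> points. Every point carries one of
  at most \<open>2 * CARD('d)\<close> directions.\<close>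

lemma chains_card:
  fixes e :: "'d::finite"
  assumes R: "R \<ge> 1" and j: "j \<ge> 1" "j \<le> J"
  shows "finite (link_chains e R m j) \<and> card (link_chains e R m j)
    \<le> ((2 * m + 1) ^ CARD('d) * (2 * CARD('d))) * (J * (20 * R + 1) ^ CARD('d) * (2 * CARD('d))) ^ (j - 1)"
  using j
proof (induction j rule: dec_induct)
  case base
  let ?B = "{x :: int ^ 'd. dist1 0 x \<le> int m} \<times> dirs e"
  have "link_chains e R m 1 \<subseteq> (\<lambda>z. [z]) ` ?B"
    by (auto simp: link_chains_def length_Suc_conv)
  moreover have f: "finite ?B" using finite_ball1 finite_dirs by blast
  ultimately have "finite (link_chains e R m 1)" "card (link_chains e R m 1) \<le> card ?B"
    by (auto intro: finite_subset) (meson card_image_le card_mono finite_imageI le_trans)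
  moreover have "card ?B \<le> (2 * m + 1) ^ CARD('d) * (2 * CARD('d))"
    unfolding card_cartesian_product by (intro mult_mono card_ball1_le card_dirs_le) auto
  ultimately show ?case by simp
next
  case (step j)
  let ?C = "(20 * R + 1) ^ CARD('d) * (2 * CARD('d))"
  let ?N = "\<lambda>zs. \<Union>q\<in>set zs. {x :: int ^ 'd. dist1 (fst q) x \<le> int (10 * R)} \<times> dirs e"
  have fin: "finite (link_chains e R m j)" using step by simp
  have sub: "link_chains e R m (Suc j) \<subseteq> (\<Union>zs\<in>link_chains e R m j. (\<lambda>z. z # zs) ` ?N zs)"
  proof
    fix ys assume ys: "ys \<in> link_chains e R m (Suc j)"
    then obtain z zs where z: "ys = z # zs" by (auto simp: link_chains_def length_Suc_conv)
    have zs: "zs \<in> link_chains e R m j" using ys z by (auto simp: link_chains_def)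
    then have "zs \<noteq> []" using step.hyps by (auto simp: link_chains_def)
    then obtain q where q: "q \<in> set zs" "dist1 (fst z) (fst q) \<le> 10 * int R" "snd z \<in> dirs e"
      using ys z by (auto simp: link_chains_def)
    then have "z \<in> ?N zs" by (cases z) (auto simp: dist1_sym)
    then show "ys \<in> (\<Union>zs\<in>link_chains e R m j. (\<lambda>z. z # zs) ` ?N zs)" using zs z by blast
  qed
  have fN: "finite (?N zs)" for zs using finite_ball1 finite_dirs by blast
  have cN: "card (?N zs) \<le> J * ?C" if "zs \<in> link_chains e R m j" for zs
  proof -
    have "card (?N zs) \<le> (\<Sum>q\<in>set zs. card ({x :: int ^ 'd. dist1 (fst q) x \<le> int (10 * R)} \<times> dirs e))"
      by (rule card_UN_le) simp
    also have "\<dots> \<le> (\<Sum>q\<in>set zs. ?C)"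
    proof (rule sum_mono)
      fix q :: "(int ^ 'd) \<times> (int ^ 'd)"
      have "card {x :: int ^ 'd. dist1 (fst q) x \<le> int (10 * R)} \<le> (20 * R + 1) ^ CARD('d)"
        using card_ball1_le[of "fst q" "10 * R"] by simp
      then show "card ({x :: int ^ 'd. dist1 (fst q) x \<le> int (10 * R)} \<times> dirs e) \<le> ?C"
        unfolding card_cartesian_product using card_dirs_le[of e] by (intro mult_mono) auto
    qed
    also have "\<dots> = card (set zs) * ?C" by simp
    also have "\<dots> \<le> J * ?C"
      using that step card_length[of zs] by (intro mult_right_mono) (auto simp: link_chains_def)
    finally show ?thesis .
  qed
  have "finite (link_chains e R m (Suc j))"
    using fin fN by (intro finite_subset[OF sub]) auto
  moreover have "card (link_chains e R m (Suc j)) \<le> card (link_chains e R m j) * (J * ?C)"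
  proof -
    have "card (link_chains e R m (Suc j)) \<le> card (\<Union>zs\<in>link_chains e R m j. (\<lambda>z. z # zs) ` ?N zs)"
      using fin fN by (intro card_mono sub) auto
    also have "\<dots> \<le> (\<Sum>zs\<in>link_chains e R m j. card ((\<lambda>z. z # zs) ` ?N zs))"
      by (rule card_UN_le[OF fin])
    also have "\<dots> \<le> (\<Sum>zs\<in>link_chains e R m j. J * ?C)"
      by (intro sum_mono order_trans[OF card_image_le[OF fN] cN])
    finally show ?thesis by simp
  qed
  moreover have "card (link_chains e R m j) * (J * ?C)
     \<le> ((2 * m + 1) ^ CARD('d) * (2 * CARD('d))) * (J * (20 * R + 1) ^ CARD('d) * (2 * CARD('d))) ^ (j - 1) * (J * ?C)"
    using step by (intro mult_right_mono) auto
  moreover have "\<dots> = ((2 * m + 1) ^ CARD('d) * (2 * CARD('d))) * (J * (20 * R + 1) ^ CARD('d) * (2 * CARD('d))) ^ (Suc j - 1)"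
  proof -
    obtain i where "j = Suc i" using step.hyps by (cases j) auto
    then show ?thesis by (simp add: mult.assoc mult.commute mult.left_commute)
  qed
  ultimately show ?case by linarith
qed

lemma soup_chains:
  fixes W :: "(int ^ 'd::finite) set" and e :: 'd
  assumes d: "CARD('d) \<ge> 4" and W: "finite W" and u: "u \<ge> 0" and J: "J \<ge> 1"
    and R: "R \<ge> depth TYPE(int ^ 'd) + L + 2 + 2 * CARD('d)"
    and q: "q \<ge> 1" "sleeve_green TYPE(int ^ 'd) 0 + real J * sleeve_green TYPE(int ^ 'd) R \<le> q"
  shows "soup W u (\<lambda>\<sigma>. of_bool (\<exists>zs\<in>link_chains e R m J. \<forall>p\<in>set zs. K \<le> occupation (trap_sleeve e L (fst p) (snd p)) \<sigma>))
    \<le> ennreal (real (((2 * m + 1) ^ CARD('d) * (2 * CARD('d))) * (J * (20 * R + 1) ^ CARD('d) * (2 * CARD('d))) ^ (J - 1))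
      * (exp (u * real (J * ((L + 3) * 5 ^ CARD('d)))) / (1 + 1 / (2 * q)) ^ (J * K)))"
proof -
  have R1: "R \<ge> 1" using R d by simp
  let ?E = "\<lambda>zs \<sigma>. \<forall>p\<in>set zs. K \<le> occupation (trap_sleeve e L (fst p) (snd p)) \<sigma>"
  let ?b = "exp (u * real (J * ((L + 3) * 5 ^ CARD('d)))) / (1 + 1 / (2 * q)) ^ (J * K)"
  have b0: "?b \<ge> 0" using q by (intro divide_nonneg_nonneg) auto
  have fin: "finite (link_chains e R m J)" using chains_card[OF R1 J order_refl] by blast
  have "soup W u (\<lambda>\<sigma>. of_bool (\<exists>zs\<in>link_chains e R m J. ?E zs \<sigma>))
      \<le> soup W u (\<lambda>\<sigma>. \<Sum>zs\<in>link_chains e R m J. of_bool (?E zs \<sigma>))"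
  proof (rule soup_mono)
    fix \<sigma>
    show "of_bool (\<exists>zs\<in>link_chains e R m J. ?E zs \<sigma>) \<le> (\<Sum>zs\<in>link_chains e R m J. of_bool (?E zs \<sigma>) :: ennreal)"
    proof (cases "\<exists>zs\<in>link_chains e R m J. ?E zs \<sigma>")
      case True
      then obtain zs where zs: "zs \<in> link_chains e R m J" "?E zs \<sigma>" by blast
      have "of_bool (?E zs \<sigma>) \<le> (\<Sum>zs\<in>link_chains e R m J. of_bool (?E zs \<sigma>) :: ennreal)"
        using zs fin by (intro member_le_sum) auto
      then show ?thesis using zs True by simp
    next
      case False
      then have "of_bool (\<exists>zs\<in>link_chains e R m J. ?E zs \<sigma>) = (0::ennreal)" by (simp only: of_bool_eq(1))
      then show ?thesis by (simp only: zero_le)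
    qed
  qed
  also have "\<dots> = (\<Sum>zs\<in>link_chains e R m J. soup W u (\<lambda>\<sigma>. of_bool (?E zs \<sigma>)))"
    by (rule soup_sum[OF fin])
  also have "\<dots> \<le> (\<Sum>zs\<in>link_chains e R m J. ennreal ?b)"
  proof (rule sum_mono)
    fix zs assume zs: "zs \<in> link_chains e R m J"
    then have lc: "link_chain e R zs" and "length zs = J" by (auto simp: link_chains_def)
    then have cJ: "card (set zs) = J" using link_chain_distinct[OF lc R1] by (simp add: distinct_card)
    have "soup W u (\<lambda>\<sigma>. of_bool (?E zs \<sigma>))
        \<le> ennreal (exp (u * real (card (set zs) * ((L + 3) * 5 ^ CARD('d)))) / (1 + 1 / (2 * q)) ^ (card (set zs) * K))"
      by (rule soup_sleeves[OF d W u _ link_chain_dirs[OF lc] link_chain_sep[OF lc] R q(1)]) (auto simp: cJ q(2))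
    then show "soup W u (\<lambda>\<sigma>. of_bool (?E zs \<sigma>)) \<le> ennreal ?b" by (simp only: cJ)
  qed
  also have "\<dots> = ennreal (real (card (link_chains e R m J)) * ?b)"
    by (rule sum_ennreal_const[OF b0])
  also have "\<dots> \<le> ennreal (real (((2 * m + 1) ^ CARD('d) * (2 * CARD('d))) * (J * (20 * R + 1) ^ CARD('d) * (2 * CARD('d))) ^ (J - 1)) * ?b)"
    using chains_card[OF R1 J order_refl, of e m] b0
    by (intro ennreal_leI mult_right_mono of_nat_mono) auto
  finally show ?thesis .
qed

section \<open>Trajectories of the biased walk\<close>

lemma lattice_path_dist:
  assumes "lattice_path \<gamma>" "i < length \<gamma>"
  shows "dist1 (\<gamma> ! 0) (\<gamma> ! i) \<le> int i"
  using assms(2)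
proof (induction i)
  case (Suc i)
  then show ?case
    using dist1_triangle[of "\<gamma> ! 0" "\<gamma> ! Suc i" "\<gamma> ! i"] lattice_path_dist1[OF assms(1), of i] by simp
qed simp

definition paths_from :: "nat \<Rightarrow> int ^ 'd \<Rightarrow> (int ^ 'd) list set" where
  "paths_from n x = {\<gamma>. length \<gamma> = Suc n \<and> \<gamma> ! 0 = x \<and> lattice_path \<gamma>}"

lemma finite_paths_from: "finite (paths_from n x)" for x :: "int ^ 'd::finite"
proof (rule finite_subset)
  show "paths_from n x \<subseteq> {\<gamma>. set \<gamma> \<subseteq> {y. dist1 x y \<le> int n} \<and> length \<gamma> = Suc n}"
  proof (clarsimp simp: paths_from_def)
    fix \<gamma> :: "(int ^ 'd) list" and y
    assume \<gamma>: "length \<gamma> = Suc n" "lattice_path \<gamma>" "y \<in> set \<gamma>"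
    then obtain i where "i < Suc n" "y = \<gamma> ! i" by (metis in_set_conv_nth)
    then show "dist1 (\<gamma> ! 0) y \<le> int n" using lattice_path_dist[OF \<gamma>(2), of i] \<gamma>(1) by simp
  qed
  show "finite {\<gamma>. set \<gamma> \<subseteq> {y. dist1 x y \<le> int n} \<and> length \<gamma> = Suc n}"
    by (intro finite_lists_length_eq finite_ball1)
qed

lemma last_nth: "length \<gamma> = Suc n \<Longrightarrow> last \<gamma> = \<gamma> ! n"
  by (cases \<gamma>) (auto simp: last_conv_nth)

context
  fixes e :: "'d::finite" and \<beta> :: real
  assumes \<beta>: "\<beta> > 1"
begin

abbreviation bt :: "(int ^ 'd) set \<Rightarrow> nat \<Rightarrow> int ^ 'd \<Rightarrow> (int ^ 'd) list pmf" where
  "bt I \<equiv> traj (biased_step e \<beta> I)"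

lemma set_pmf_bt:
  assumes "\<gamma> \<in> set_pmf (bt I n x)"
  shows "\<gamma> \<in> paths_from n x" "\<And>i. i \<le> n \<Longrightarrow> x \<in> I \<Longrightarrow> \<gamma> ! i \<in> I"
proof -
  have p: "pmf (bt I n x) \<gamma> \<noteq> 0" using assms by (simp add: set_pmf_iff)
  then have l: "length \<gamma> = Suc n" "\<gamma> ! 0 = x" and "(\<Prod>i<n. pmf (biased_step e \<beta> I (\<gamma> ! i)) (\<gamma> ! Suc i)) \<noteq> 0"
    unfolding pmf_traj by (auto split: if_splits)
  then have "pmf (biased_step e \<beta> I (\<gamma> ! i)) (\<gamma> ! Suc i) \<noteq> 0" if "i < n" for i
    using that by simp
  then have st: "\<gamma> ! Suc i = \<gamma> ! i \<or> (nbr (\<gamma> ! i) (\<gamma> ! Suc i) \<and> \<gamma> ! Suc i \<in> I)" if "i < n" for i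
    using that set_pmf_biased_step[OF \<beta>] by (metis set_pmf_iff)
  then show "\<gamma> \<in> paths_from n x" using l by (auto simp: paths_from_def lattice_path_def)
  show "\<gamma> ! i \<in> I" if "i \<le> n" "x \<in> I" for i
    using that(1)
  proof (induction i)
    case (Suc i)
    then show ?case using st[of i] by auto
  qed (use l that in simp)
qed

lemma pmf_bt_cong:
  assumes "\<And>i y. i < n \<Longrightarrow> y = \<gamma> ! i \<or> nbr (\<gamma> ! i) y \<Longrightarrow> y \<in> I \<longleftrightarrow> y \<in> I'"
  shows "pmf (bt I n x) \<gamma> = pmf (bt I' n x) \<gamma>"
proof -
  have "biased_step e \<beta> I (\<gamma> ! i) = biased_step e \<beta> I' (\<gamma> ! i)" if "i < n" for i
    using assms[OF that] by (intro biased_step_cong[OF \<beta>]) blast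
  then show ?thesis unfolding pmf_traj by (auto intro!: prod.cong)
qed

text \<open>In \<open>n\<close> steps the kernel is consulted only at sites within distance
  \<open>n - 1\<close>, and so it depends only on sites within distance \<open>n\<close>.\<close>

lemma bt_restrict:
  assumes "{y. dist1 x y \<le> int n} \<subseteq> W"
  shows "bt I n x = bt (I \<inter> W) n x"
proof (rule pmf_eqI)
  fix \<gamma>
  show "pmf (bt I n x) \<gamma> = pmf (bt (I \<inter> W) n x) \<gamma>"
  proof (cases "\<gamma> \<in> paths_from n x")
    case True
    show ?thesis
    proof (rule pmf_bt_cong)
      fix i y assume i: "i < n" and y: "y = \<gamma> ! i \<or> nbr (\<gamma> ! i) y"
      have "dist1 (\<gamma> ! i) y \<le> 1" using y dist1_nbr[of "\<gamma> ! i" y] by auto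
      moreover have "dist1 x (\<gamma> ! i) \<le> int i"
        using True lattice_path_dist[of \<gamma> i] i by (auto simp: paths_from_def)
      ultimately have "dist1 x y \<le> int n" using dist1_triangle[of x y "\<gamma> ! i"] i by linarith
      then show "y \<in> I \<longleftrightarrow> y \<in> I \<inter> W" using assms by auto
    qed
  next
    case False
    then have "\<gamma> \<notin> set_pmf (bt I n x)" "\<gamma> \<notin> set_pmf (bt (I \<inter> W) n x)" using set_pmf_bt by blast+
    then show ?thesis by (simp add: set_pmf_iff)
  qed
qed

lemma nn_integral_bt_sum:
  "(\<integral>\<^sup>+\<gamma>. g \<gamma> \<partial>measure_pmf (bt I n x)) = (\<Sum>\<gamma>\<in>paths_from n x. g \<gamma> * ennreal (pmf (bt I n x) \<gamma>))"
  using set_pmf_bt by (intro nn_integral_measure_pmf_support finite_paths_from) auto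

lemma nn_integral_traj_take:
  assumes "t \<le> n"
  shows "(\<integral>\<^sup>+\<gamma>. g (take (Suc t) \<gamma>) \<partial>measure_pmf (traj K n x)) = (\<integral>\<^sup>+\<gamma>. g \<gamma> \<partial>measure_pmf (traj K t x))"
proof -
  have "(\<integral>\<^sup>+\<gamma>. g (take (Suc t) \<gamma>) \<partial>measure_pmf (traj K n x))
      = (\<integral>\<^sup>+\<gamma>. (\<integral>\<^sup>+\<gamma>'. g (take (Suc t) (\<gamma> @ tl \<gamma>')) \<partial>measure_pmf (traj K (n - t) (last \<gamma>))) \<partial>measure_pmf (traj K t x))"
    using nn_integral_traj_split[where s=t and r="n - t" and f="\<lambda>\<gamma>. g (take (Suc t) \<gamma>)"] assms by simp
  also have "\<dots> = (\<integral>\<^sup>+\<gamma>. g \<gamma> \<partial>measure_pmf (traj K t x))"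
  proof (rule nn_integral_cong_AE, rule AE_pmfI)
    fix \<gamma> assume "\<gamma> \<in> set_pmf (traj K t x)"
    then have "length \<gamma> = Suc t" using set_pmf_traj by metis
    then show "(\<integral>\<^sup>+\<gamma>'. g (take (Suc t) (\<gamma> @ tl \<gamma>')) \<partial>measure_pmf (traj K (n - t) (last \<gamma>))) = g \<gamma>"
      by (simp add: measure_pmf.emeasure_space_1[simplified])
  qed
  finally show ?thesis .
qed

lemma backtrack_once:
  "(\<integral>\<^sup>+\<gamma>. of_bool (last \<gamma> $ e < x $ e - int R) \<partial>measure_pmf (bt I r x))
    \<le> ennreal (real ((2 * r + 1) ^ CARD('d)) * (deg TYPE(int ^ 'd) * \<beta> powi (- int R)))"
proof -
  let ?B = "{y. dist1 x y \<le> int r}"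
  let ?m = "map_pmf last (bt I r x)"
  let ?b = "deg TYPE(int ^ 'd) * \<beta> powi (- int R)"
  have b0: "?b \<ge> 0" using \<beta> deg_pos[where 'd='d] by (intro mult_nonneg_nonneg) (auto intro: less_imp_le)
  have "(\<integral>\<^sup>+\<gamma>. of_bool (last \<gamma> $ e < x $ e - int R) \<partial>measure_pmf (bt I r x))
      = (\<integral>\<^sup>+y. of_bool (y $ e < x $ e - int R) \<partial>measure_pmf ?m)" by simp
  also have "\<dots> = (\<Sum>y\<in>?B. of_bool (y $ e < x $ e - int R) * ennreal (pmf ?m y))"
  proof (rule nn_integral_measure_pmf_support[OF finite_ball1])
    fix y assume y: "y \<in> set_pmf ?m" "y \<notin> ?B"
    then obtain \<gamma> where \<gamma>: "\<gamma> \<in> set_pmf (bt I r x)" "y = last \<gamma>" by auto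
    have "\<gamma> \<in> paths_from r x" using set_pmf_bt \<gamma> by blast
    then have "dist1 x y \<le> int r" using lattice_path_dist[of \<gamma> r] \<gamma>(2) by (auto simp: paths_from_def last_nth)
    then show "of_bool (y $ e < x $ e - int R) = (0::ennreal)" using y by simp
  qed auto
  also have "\<dots> \<le> (\<Sum>y\<in>?B. ennreal ?b)"
  proof (rule sum_mono)
    fix y
    show "of_bool (y $ e < x $ e - int R) * ennreal (pmf ?m y) \<le> ennreal ?b"
    proof (cases "y $ e < x $ e - int R")
      case True
      have "\<beta> powi (y $ e - x $ e + 1) \<le> \<beta> powi (- int R)"
        using True \<beta> by (intro power_int_increasing) auto
      then have "pmf ?m y \<le> ?b"
        using pmf_traj_last_bound[OF \<beta>, of e I r x y] deg_pos[where 'd='d]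
        by (meson mult_left_mono order_trans less_imp_le)
      then show ?thesis using True by (simp add: ennreal_leI)
    qed simp
  qed
  also have "\<dots> = ennreal (real (card ?B) * ?b)"
    by (rule sum_ennreal_const[OF b0])
  also have "\<dots> \<le> ennreal (real ((2 * r + 1) ^ CARD('d)) * ?b)"
    using b0 card_ball1_le[of x r] by (intro ennreal_leI mult_right_mono of_nat_mono) auto
  finally show ?thesis .
qed

text \<open>Union bound over all pairs of times. The polynomial prefactor is harmless, as
  \<open>R\<close> will be a power of \<open>n\<close>.\<close>

lemma backtrack_bound:
  "(\<integral>\<^sup>+\<gamma>. of_bool (\<not> backtrack_le e R \<gamma>) \<partial>measure_pmf (bt I n x))
    \<le> ennreal (real ((n + 1) * (n + 1) * (2 * n + 1) ^ CARD('d)) * (deg TYPE(int ^ 'd) * \<beta> powi (- int R)))"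
proof -
  let ?b = "deg TYPE(int ^ 'd) * \<beta> powi (- int R)"
  have b0: "?b \<ge> 0" using \<beta> deg_pos[where 'd='d] by (intro mult_nonneg_nonneg) (auto intro: less_imp_le)
  let ?I = "{(s, t). s \<le> t \<and> t \<le> n}"
  let ?ev = "\<lambda>s t \<gamma>. \<gamma> ! t $ e < \<gamma> ! s $ e - int R"
  have sub: "?I \<subseteq> {..n} \<times> {..n}" by auto
  have fI: "finite ?I" by (rule finite_subset[OF sub]) simp
  have cI: "card ?I \<le> (n + 1) * (n + 1)"
    using card_mono[OF _ sub] by (simp add: card_cartesian_product)
  have one: "(\<integral>\<^sup>+\<gamma>. of_bool (?ev s t \<gamma>) \<partial>measure_pmf (bt I n x)) \<le> ennreal (real ((2 * n + 1) ^ CARD('d)) * ?b)"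
    if st: "s \<le> t" "t \<le> n" for s t
  proof -
    have "(\<integral>\<^sup>+\<gamma>. of_bool (?ev s t \<gamma>) \<partial>measure_pmf (bt I n x))
        = (\<integral>\<^sup>+\<gamma>. of_bool (?ev s t (take (Suc t) \<gamma>)) \<partial>measure_pmf (bt I n x))"
      using st by simp
    also have "\<dots> = (\<integral>\<^sup>+\<gamma>. of_bool (?ev s t \<gamma>) \<partial>measure_pmf (bt I (s + (t - s)) x))"
      using st nn_integral_traj_take[OF st(2), where g="\<lambda>\<gamma>. of_bool (?ev s t \<gamma>)" and K="biased_step e \<beta> I" and x=x] by simp
    also have "\<dots> = (\<integral>\<^sup>+\<gamma>. (\<integral>\<^sup>+\<gamma>'. of_bool (?ev s t (\<gamma> @ tl \<gamma>')) \<partial>measure_pmf (bt I (t - s) (last \<gamma>))) \<partial>measure_pmf (bt I s x))"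
      by (rule nn_integral_traj_split)
    also have "\<dots> \<le> (\<integral>\<^sup>+\<gamma>. ennreal (real ((2 * n + 1) ^ CARD('d)) * ?b) \<partial>measure_pmf (bt I s x))"
    proof (rule nn_integral_mono_AE, rule AE_pmfI)
      fix \<gamma> assume "\<gamma> \<in> set_pmf (bt I s x)"
      then have l: "length \<gamma> = Suc s" using set_pmf_traj by metis
      have "(\<integral>\<^sup>+\<gamma>'. of_bool (?ev s t (\<gamma> @ tl \<gamma>')) \<partial>measure_pmf (bt I (t - s) (last \<gamma>)))
          = (\<integral>\<^sup>+\<gamma>'. of_bool (last \<gamma>' $ e < last \<gamma> $ e - int R) \<partial>measure_pmf (bt I (t - s) (last \<gamma>)))"
      proof (rule nn_integral_cong_AE, rule AE_pmfI)
        fix \<gamma>' assume "\<gamma>' \<in> set_pmf (bt I (t - s) (last \<gamma>))"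
        then have g: "length \<gamma>' = Suc (t - s)" "hd \<gamma>' = last \<gamma>" using set_pmf_traj by metis+
        have "(\<gamma> @ tl \<gamma>') ! s = last \<gamma>" using l by (simp add: nth_append last_nth)
        moreover have "(\<gamma> @ tl \<gamma>') ! t = last \<gamma>'"
        proof (cases "t = s")
          case True
          then show ?thesis using g \<open>(\<gamma> @ tl \<gamma>') ! s = last \<gamma>\<close> by (cases \<gamma>') auto
        next
          case False
          then have "(\<gamma> @ tl \<gamma>') ! t = \<gamma>' ! Suc (t - Suc s)" using l st g by (simp add: nth_append nth_tl)
          then show ?thesis using False st g by (simp add: last_nth Suc_diff_Suc)
        qed
        ultimately show "of_bool (?ev s t (\<gamma> @ tl \<gamma>')) = (of_bool (last \<gamma>' $ e < last \<gamma> $ e - int R) :: ennreal)" by simp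
      qed
      also have "\<dots> \<le> ennreal (real ((2 * (t - s) + 1) ^ CARD('d)) * ?b)" by (rule backtrack_once)
      also have "\<dots> \<le> ennreal (real ((2 * n + 1) ^ CARD('d)) * ?b)"
        using b0 st by (intro ennreal_leI mult_right_mono of_nat_mono power_mono) auto
      finally show "(\<integral>\<^sup>+\<gamma>'. of_bool (?ev s t (\<gamma> @ tl \<gamma>')) \<partial>measure_pmf (bt I (t - s) (last \<gamma>)))
        \<le> ennreal (real ((2 * n + 1) ^ CARD('d)) * ?b)" .
    qed
    also have "\<dots> = ennreal (real ((2 * n + 1) ^ CARD('d)) * ?b)"
      by (simp add: measure_pmf.emeasure_space_1[simplified])
    finally show ?thesis .
  qed
  have "(\<integral>\<^sup>+\<gamma>. of_bool (\<not> backtrack_le e R \<gamma>) \<partial>measure_pmf (bt I n x))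
      \<le> (\<integral>\<^sup>+\<gamma>. (\<Sum>(s, t)\<in>?I. of_bool (?ev s t \<gamma>)) \<partial>measure_pmf (bt I n x))"
  proof (rule nn_integral_mono_AE, rule AE_pmfI)
    fix \<gamma> assume "\<gamma> \<in> set_pmf (bt I n x)"
    then have l: "length \<gamma> = Suc n" using set_pmf_traj by metis
    show "of_bool (\<not> backtrack_le e R \<gamma>) \<le> (\<Sum>(s, t)\<in>?I. of_bool (?ev s t \<gamma>) :: ennreal)"
    proof (cases "backtrack_le e R \<gamma>")
      case False
      then obtain s t where st: "s \<le> t" "t < length \<gamma>" "?ev s t \<gamma>" by (auto simp: backtrack_le_def not_le)
      have "(case (s, t) of (s, t) \<Rightarrow> of_bool (?ev s t \<gamma>)) \<le> (\<Sum>(s, t)\<in>?I. of_bool (?ev s t \<gamma>) :: ennreal)"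
        using st l fI by (intro member_le_sum) auto
      then show ?thesis using st False by simp
    qed simp
  qed
  also have "\<dots> = (\<Sum>(s, t)\<in>?I. (\<integral>\<^sup>+\<gamma>. of_bool (?ev s t \<gamma>) \<partial>measure_pmf (bt I n x)))"
    by (subst nn_integral_sum) (auto simp: case_prod_beta)
  also have "\<dots> \<le> (\<Sum>p\<in>?I. ennreal (real ((2 * n + 1) ^ CARD('d)) * ?b))"
    using one by (intro sum_mono) auto
  also have "\<dots> = ennreal (real (card ?I) * (real ((2 * n + 1) ^ CARD('d)) * ?b))"
    by (rule sum_ennreal_const) (intro mult_nonneg_nonneg[OF _ b0], simp)
  also have "\<dots> \<le> ennreal (real ((n + 1) * (n + 1)) * (real ((2 * n + 1) ^ CARD('d)) * ?b))"
    using b0 cI by (intro ennreal_leI mult_right_mono of_nat_mono) auto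
  finally show ?thesis by (simp only: of_nat_mult mult.assoc)
qed

end

section \<open>The probability to travel far\<close>

text \<open>\<open>m\<close> is the displacement, \<open>R\<close> the scale of the spacing between
  attempts, \<open>J\<close> the length and \<open>M\<close> the number of the chains,
  \<open>K\<close> the threshold for the occupation, and \<open>q\<close> the bound for the Green
  potentials. The assumption \<open>h\<close> makes a corridor hold the walk with probability at
  least \<open>1 / 4\<close>. The values are chosen in \<open>far_decay\<close>.\<close>

context
  fixes e :: "'d::finite" and \<beta> u q :: real and W :: "(int ^ 'd) set" and n m L R J M K :: nat
  assumes d: "CARD('d) \<ge> 4" and \<beta>: "\<beta> > 1" and u: "u \<ge> 0" and L: "L \<ge> 2" and J: "J \<ge> 1" and M: "M \<ge> 1"
    and W: "finite W" "{y. dist1 0 y \<le> int (n + R + 1)} \<subseteq> W"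
    and R: "R \<ge> CARD('d) * depth TYPE(int ^ 'd)" "R \<ge> depth TYPE(int ^ 'd) + L + 2 + 2 * CARD('d)"
    and MJ: "(M + 1) * (60 * R * J) \<le> m"
    and q: "q \<ge> 1" "sleeve_green TYPE(int ^ 'd) 0 + real J * sleeve_green TYPE(int ^ 'd) R \<le> q"
    and h: "1 / 4 \<le> 1 - 1 / \<beta> - real n * \<beta> powi (1 - int L)"
begin

abbreviation walk :: "(int ^ 'd) set \<Rightarrow> nat \<Rightarrow> int ^ 'd \<Rightarrow> (int ^ 'd) list pmf" where
  "walk I \<equiv> traj (biased_step e \<beta> I)"

definition hold :: real where
  "hold = (1 / (deg TYPE(int ^ 'd) * \<beta>)) ^ Suc (depth TYPE(int ^ 'd)) * (1 / 4)"

definition reroute :: real where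
  "reroute = step_prob TYPE(int ^ 'd) ^ 12"

definition loop_in :: real where
  "loop_in = step_prob TYPE(int ^ 'd) ^ (2 * (depth TYPE(int ^ 'd) + L))"

lemma pos: "hold > 0" "reroute > 0" "reroute \<le> 1" "loop_in > 0"
  using \<beta> deg_ge[where 'd='d] by (auto simp: hold_def reroute_def loop_in_def intro!: zero_less_power power_le_one)

abbreviation occ :: "int ^ 'd \<Rightarrow> int ^ 'd \<Rightarrow> (int ^ 'd) list list \<Rightarrow> nat" where
  "occ a f \<equiv> occupation (trap_sleeve e L a f)"

definition trapped :: "(int ^ 'd) list \<Rightarrow> nat \<Rightarrow> int ^ 'd \<Rightarrow> bool" where
  "trapped \<gamma> t f \<longleftrightarrow> fresh e L \<gamma> t f \<and> (\<forall>s. t < s \<and> s < length \<gamma> \<longrightarrow> \<gamma> ! s \<in> trap_path e L (\<gamma> ! t) f)"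

lemma fresh_take:
  assumes "t < length \<gamma>"
  shows "fresh e L (take (Suc t) \<gamma>) t f \<longleftrightarrow> fresh e L \<gamma> t f"
  using assms by (auto simp: fresh_def)

text \<open>One attempt: along a fixed prefix the environment is modified inside the fresh zone.\<close>

lemma attempt_prefix:
  assumes \<gamma>: "\<gamma> \<in> paths_from t 0" and t: "t \<le> n" and f: "fresh e L \<gamma> t f"
  shows "ennreal (loop_in * hold) * soup W u (\<lambda>\<sigma>. of_bool (0 \<in> footprint \<sigma>) * ennreal (pmf (walk (footprint \<sigma>) t 0) \<gamma>)
        * ennreal (reroute ^ occ (last \<gamma>) f \<sigma>))
    \<le> soup W u (\<lambda>\<sigma>. of_bool (0 \<in> footprint \<sigma>) * ennreal (pmf (walk (footprint \<sigma>) t 0) \<gamma>)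
        * ennreal (stay (biased_step e \<beta> (footprint \<sigma>)) (trap_path e L (last \<gamma>) f) (n - t) (last \<gamma>)))"
proof -
  let ?a = "last \<gamma>" and ?Z = "trap_zone e L (last \<gamma>) f"
  have l: "length \<gamma> = Suc t" "\<gamma> ! 0 = 0" "lattice_path \<gamma>" using \<gamma> by (auto simp: paths_from_def)
  have a: "?a = \<gamma> ! t" using l by (simp add: last_nth)
  have fd: "f \<in> dirs e" using f by (simp add: fresh_def)
  have aZ: "?a \<notin> ?Z" using start_notin_zone[OF fd] d by simp
  have fr: "w \<notin> ?Z" if "s < t" "w = \<gamma> ! s \<or> nbr (\<gamma> ! s) w" for s w
    using f that unfolding fresh_def a by blast
  have 0: "0 \<notin> ?Z"
  proof (cases "t = 0")
    case True
    then show ?thesis using aZ a l by simp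
  next
    case False
    then show ?thesis using fr[of 0 0] l by simp
  qed
  \<comment> \<open>The condition that \<open>?a\<close> belongs to \<open>I\<close> is what
    \<open>soup_trap\<close> asks for. It is automatic where the weight is positive, since a walk
    started in \<open>I\<close> stays there.\<close>
  define \<Psi> :: "(int ^ 'd) set \<Rightarrow> ennreal" where
    "\<Psi> I = of_bool (0 \<in> I \<and> ?a \<in> I) * ennreal (pmf (walk I t 0) \<gamma>)" for I
  have \<Psi>_eq: "\<Psi> I = of_bool (0 \<in> I) * ennreal (pmf (walk I t 0) \<gamma>)" for I
  proof (cases "0 \<in> I \<and> pmf (walk I t 0) \<gamma> \<noteq> 0")
    case True
    then have "\<gamma> ! t \<in> I" using set_pmf_bt(2)[OF \<beta>, of \<gamma> e I t 0 t] by (simp add: set_pmf_iff)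
    then show ?thesis using True a by (simp add: \<Psi>_def)
  next
    case False
    then show ?thesis by (auto simp: \<Psi>_def)
  qed
  \<comment> \<open>The prefix consults the environment only at its sites before time
    \<open>t\<close> and at their neighbours, all of which freshness keeps out of the zone.\<close>
  have \<Psi>1: "\<Psi> (I - ?Z) = \<Psi> I" for I
  proof -
    have "pmf (walk (I - ?Z) t 0) \<gamma> = pmf (walk I t 0) \<gamma>"
      by (rule pmf_bt_cong[OF \<beta>]) (use fr in blast)
    then show ?thesis using 0 aZ by (simp add: \<Psi>_def)
  qed
  have \<Psi>2: "\<Psi> I = 0" if "?a \<notin> I" for I using that by (simp add: \<Psi>_def)
  have da: "dist1 0 ?a \<le> int n" using lattice_path_dist[OF l(3), of t] l(1,2) t a by simp
  have inW: "y \<in> W" if x: "x \<in> trap_sleeve e L ?a f" and xy: "nbr x y" for x y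
  proof -
    have "dist1 ?a x \<le> int R" using dist1_sleeve[OF fd x] R(2) by linarith
    then have "dist1 0 y \<le> int (n + R + 1)"
      using da dist1_triangle[of 0 y x] dist1_triangle[of 0 x ?a] dist1_nbr[OF xy] by simp
    then show ?thesis using W(2) by blast
  qed
  have "ennreal loop_in * soup W u (\<lambda>\<sigma>. \<Psi> (footprint \<sigma>) * ennreal (reroute ^ occ ?a f \<sigma>))
      \<le> soup W u (\<lambda>\<sigma>. \<Psi> (footprint \<sigma>) * of_bool (trap e L ?a f (footprint \<sigma>)))"
    unfolding loop_in_def reroute_def
    using d by (intro soup_trap[where \<Psi>=\<Psi>] fd inW \<Psi>1 \<Psi>2) auto
  then have "ennreal hold * (ennreal loop_in * soup W u (\<lambda>\<sigma>. \<Psi> (footprint \<sigma>) * ennreal (reroute ^ occ ?a f \<sigma>)))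
      \<le> ennreal hold * soup W u (\<lambda>\<sigma>. \<Psi> (footprint \<sigma>) * of_bool (trap e L ?a f (footprint \<sigma>)))"
    by (intro mult_left_mono) auto
  also have "\<dots> = soup W u (\<lambda>\<sigma>. ennreal hold * (\<Psi> (footprint \<sigma>) * of_bool (trap e L ?a f (footprint \<sigma>))))"
    by (rule soup_cmult[symmetric])
  also have "\<dots> \<le> soup W u (\<lambda>\<sigma>. \<Psi> (footprint \<sigma>)
      * ennreal (stay (biased_step e \<beta> (footprint \<sigma>)) (trap_path e L ?a f) (n - t) ?a))"
  proof (rule soup_mono)
    fix \<sigma> :: "(int ^ 'd) list list"
    let ?I = "footprint \<sigma>"
    show "ennreal hold * (\<Psi> ?I * of_bool (trap e L ?a f ?I))
      \<le> \<Psi> ?I * ennreal (stay (biased_step e \<beta> ?I) (trap_path e L ?a f) (n - t) ?a)"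
    proof (cases "trap e L ?a f ?I \<and> ?a \<in> ?I")
      case True
      define p where "p = (1 / (deg TYPE(int ^ 'd) * \<beta>)) ^ Suc (depth TYPE(int ^ 'd))"
      have p: "p \<ge> 0" using \<beta> deg_ge[where 'd='d] by (simp add: p_def)
      have "hold \<le> p * (1 - 1 / \<beta> - real n * \<beta> powi (1 - int L))"
        unfolding hold_def p_def[symmetric] using h p by (intro mult_left_mono) auto
      also have "\<dots> \<le> stay (biased_step e \<beta> ?I) (trap_path e L ?a f) (n - t) ?a"
        unfolding p_def using True h by (intro stay_trap[OF \<beta> fd L _ _ refl, where n=n]) auto
      finally show ?thesis using True by (simp add: mult.commute[of "ennreal hold"] mult_left_mono ennreal_leI)
    next
      case False
      then have "\<Psi> ?I * of_bool (trap e L ?a f ?I) = 0" using \<Psi>2[of ?I] by auto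
      then show ?thesis by (simp only: mult_zero_right zero_le)
    qed
  qed
  finally show ?thesis
    unfolding \<Psi>_eq using pos by (simp add: ennreal_mult' mult.assoc mult.left_commute)
qed

text \<open>Freshness at time \<open>t\<close> is decided by the first \<open>t\<close> steps. So
  both sides split over the prefixes, and the Markov property at time \<open>t\<close> reduces the
  claim to \<open>attempt_prefix\<close>.\<close>

lemma attempt:
  assumes t: "t \<le> n" and f: "f \<in> dirs e"
  shows "ennreal (loop_in * hold) * soup W u (\<lambda>\<sigma>. of_bool (0 \<in> footprint \<sigma>) *
        (\<integral>\<^sup>+\<gamma>. of_bool (fresh e L \<gamma> t f) * ennreal (reroute ^ occ (\<gamma> ! t) f \<sigma>) \<partial>measure_pmf (walk (footprint \<sigma>) n 0)))
    \<le> soup W u (\<lambda>\<sigma>. of_bool (0 \<in> footprint \<sigma>) *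
        (\<integral>\<^sup>+\<gamma>. of_bool (trapped \<gamma> t f) \<partial>measure_pmf (walk (footprint \<sigma>) n 0)))"
proof -
  let ?G = "{\<gamma> \<in> paths_from t 0. fresh e L \<gamma> t f}"
  have fG: "finite ?G" by (rule finite_subset[OF _ finite_paths_from[of t 0]]) auto
  have lhs: "(\<integral>\<^sup>+\<gamma>. of_bool (fresh e L \<gamma> t f) * ennreal (reroute ^ occ (\<gamma> ! t) f \<sigma>) \<partial>measure_pmf (walk I n 0))
      = (\<Sum>\<gamma>\<in>?G. ennreal (pmf (walk I t 0) \<gamma>) * ennreal (reroute ^ occ (last \<gamma>) f \<sigma>))" for I \<sigma>
  proof -
    let ?g = "\<lambda>\<gamma>. of_bool (fresh e L \<gamma> t f) * ennreal (reroute ^ occ (\<gamma> ! t) f \<sigma>)"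
    have "(\<integral>\<^sup>+\<gamma>. ?g \<gamma> \<partial>measure_pmf (walk I n 0)) = (\<integral>\<^sup>+\<gamma>. ?g (take (Suc t) \<gamma>) \<partial>measure_pmf (walk I n 0))"
    proof (rule nn_integral_cong_AE, rule AE_pmfI)
      fix \<gamma> assume "\<gamma> \<in> set_pmf (walk I n 0)"
      then have "length \<gamma> = Suc n" using set_pmf_traj by metis
      then show "?g \<gamma> = ?g (take (Suc t) \<gamma>)" using t by (simp add: fresh_take)
    qed
    also have "\<dots> = (\<integral>\<^sup>+\<gamma>. ?g \<gamma> \<partial>measure_pmf (walk I t 0))"
      by (rule nn_integral_traj_take[OF \<beta> t])
    also have "\<dots> = (\<Sum>\<gamma>\<in>paths_from t 0. ?g \<gamma> * ennreal (pmf (walk I t 0) \<gamma>))"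
      by (rule nn_integral_bt_sum[OF \<beta>])
    also have "\<dots> = (\<Sum>\<gamma>\<in>?G. ?g \<gamma> * ennreal (pmf (walk I t 0) \<gamma>))"
      by (intro sum.mono_neutral_right finite_paths_from) auto
    also have "\<dots> = (\<Sum>\<gamma>\<in>?G. ennreal (pmf (walk I t 0) \<gamma>) * ennreal (reroute ^ occ (last \<gamma>) f \<sigma>))"
      by (intro sum.cong) (auto simp: paths_from_def last_nth mult.commute)
    finally show ?thesis .
  qed
  have rhs: "(\<integral>\<^sup>+\<gamma>. of_bool (trapped \<gamma> t f) \<partial>measure_pmf (walk I n 0))
      = (\<Sum>\<gamma>\<in>?G. ennreal (pmf (walk I t 0) \<gamma>) * ennreal (stay (biased_step e \<beta> I) (trap_path e L (last \<gamma>) f) (n - t) (last \<gamma>)))" for I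
  proof -
    let ?st = "\<lambda>\<gamma>. ennreal (stay (biased_step e \<beta> I) (trap_path e L (last \<gamma>) f) (n - t) (last \<gamma>))"
    have "(\<integral>\<^sup>+\<gamma>. of_bool (trapped \<gamma> t f) \<partial>measure_pmf (walk I n 0))
        = (\<integral>\<^sup>+\<gamma>. (\<integral>\<^sup>+\<gamma>'. of_bool (trapped (\<gamma> @ tl \<gamma>') t f) \<partial>measure_pmf (walk I (n - t) (last \<gamma>))) \<partial>measure_pmf (walk I t 0))"
      using nn_integral_traj_split[where s=t and r="n - t" and f="\<lambda>\<gamma>. of_bool (trapped \<gamma> t f)"] t by simp
    also have "\<dots> = (\<integral>\<^sup>+\<gamma>. of_bool (fresh e L \<gamma> t f) * ?st \<gamma> \<partial>measure_pmf (walk I t 0))"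
    proof (rule nn_integral_cong_AE, rule AE_pmfI)
      fix \<gamma> assume "\<gamma> \<in> set_pmf (walk I t 0)"
      then have l: "length \<gamma> = Suc t" using set_pmf_traj by metis
      have tr: "trapped (\<gamma> @ tl \<gamma>') t f \<longleftrightarrow> fresh e L \<gamma> t f \<and> set (tl \<gamma>') \<subseteq> trap_path e L (last \<gamma>) f" for \<gamma>'
      proof -
        have "fresh e L (\<gamma> @ tl \<gamma>') t f \<longleftrightarrow> fresh e L \<gamma> t f"
          using fresh_take[of t "\<gamma> @ tl \<gamma>'" f] l by simp
        moreover have "(\<forall>s. t < s \<and> s < length (\<gamma> @ tl \<gamma>') \<longrightarrow> (\<gamma> @ tl \<gamma>') ! s \<in> T) \<longleftrightarrow> set (tl \<gamma>') \<subseteq> T" for T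
        proof
          assume *: "\<forall>s. t < s \<and> s < length (\<gamma> @ tl \<gamma>') \<longrightarrow> (\<gamma> @ tl \<gamma>') ! s \<in> T"
          show "set (tl \<gamma>') \<subseteq> T"
          proof
            fix x assume "x \<in> set (tl \<gamma>')"
            then obtain i where "i < length (tl \<gamma>')" "x = tl \<gamma>' ! i" by (metis in_set_conv_nth)
            then show "x \<in> T" using spec[OF *, of "Suc t + i"] l by (simp add: nth_append)
          qed
        next
          assume "set (tl \<gamma>') \<subseteq> T"
          then show "\<forall>s. t < s \<and> s < length (\<gamma> @ tl \<gamma>') \<longrightarrow> (\<gamma> @ tl \<gamma>') ! s \<in> T"
            using l by (auto simp: nth_append subset_iff)
        qed
        moreover have "(\<gamma> @ tl \<gamma>') ! t = last \<gamma>" using l by (simp add: nth_append last_nth)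
        ultimately show ?thesis unfolding trapped_def by simp
      qed
      have "(\<integral>\<^sup>+\<gamma>'. of_bool (trapped (\<gamma> @ tl \<gamma>') t f) \<partial>measure_pmf (walk I (n - t) (last \<gamma>)))
          = (\<integral>\<^sup>+\<gamma>'. of_bool (fresh e L \<gamma> t f) * indicator {\<gamma>'. set (tl \<gamma>') \<subseteq> trap_path e L (last \<gamma>) f} \<gamma>' \<partial>measure_pmf (walk I (n - t) (last \<gamma>)))"
        unfolding tr by (intro nn_integral_cong) (auto split: split_indicator)
      also have "\<dots> = of_bool (fresh e L \<gamma> t f) * ?st \<gamma>"
        by (subst nn_integral_cmult_indicator) (auto simp: stay_def measure_pmf.emeasure_eq_measure)
      finally show "(\<integral>\<^sup>+\<gamma>'. of_bool (trapped (\<gamma> @ tl \<gamma>') t f) \<partial>measure_pmf (walk I (n - t) (last \<gamma>)))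
          = of_bool (fresh e L \<gamma> t f) * ?st \<gamma>" .
    qed
    also have "\<dots> = (\<Sum>\<gamma>\<in>paths_from t 0. of_bool (fresh e L \<gamma> t f) * ?st \<gamma> * ennreal (pmf (walk I t 0) \<gamma>))"
      by (rule nn_integral_bt_sum[OF \<beta>])
    also have "\<dots> = (\<Sum>\<gamma>\<in>?G. of_bool (fresh e L \<gamma> t f) * ?st \<gamma> * ennreal (pmf (walk I t 0) \<gamma>))"
      by (intro sum.mono_neutral_right finite_paths_from) auto
    also have "\<dots> = (\<Sum>\<gamma>\<in>?G. ennreal (pmf (walk I t 0) \<gamma>) * ?st \<gamma>)"
      by (intro sum.cong) (auto simp: mult.commute)
    finally show ?thesis .
  qed
  have "ennreal (loop_in * hold) * soup W u (\<lambda>\<sigma>. of_bool (0 \<in> footprint \<sigma>) *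
        (\<integral>\<^sup>+\<gamma>. of_bool (fresh e L \<gamma> t f) * ennreal (reroute ^ occ (\<gamma> ! t) f \<sigma>) \<partial>measure_pmf (walk (footprint \<sigma>) n 0)))
     = (\<Sum>\<gamma>\<in>?G. ennreal (loop_in * hold) * soup W u (\<lambda>\<sigma>. of_bool (0 \<in> footprint \<sigma>) * ennreal (pmf (walk (footprint \<sigma>) t 0) \<gamma>)
        * ennreal (reroute ^ occ (last \<gamma>) f \<sigma>)))"
    unfolding lhs sum_distrib_left[symmetric] soup_sum[OF fG, symmetric] by (simp only: sum_distrib_left mult.assoc)
  also have "\<dots> \<le> (\<Sum>\<gamma>\<in>?G. soup W u (\<lambda>\<sigma>. of_bool (0 \<in> footprint \<sigma>) * ennreal (pmf (walk (footprint \<sigma>) t 0) \<gamma>)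
        * ennreal (stay (biased_step e \<beta> (footprint \<sigma>)) (trap_path e L (last \<gamma>) f) (n - t) (last \<gamma>))))"
    by (intro sum_mono attempt_prefix[OF _ t]) auto
  also have "\<dots> = soup W u (\<lambda>\<sigma>. of_bool (0 \<in> footprint \<sigma>) *
        (\<integral>\<^sup>+\<gamma>. of_bool (trapped \<gamma> t f) \<partial>measure_pmf (walk (footprint \<sigma>) n 0)))"
    unfolding rhs soup_sum[OF fG, symmetric] by (simp only: sum_distrib_left mult.assoc)
  finally show ?thesis .
qed

text \<open>However dependent the attempts are, a single trajectory is \<open>trapped\<close> for at
  most a fixed number of pairs by \<open>card_trapped_le\<close>, so the probabilities of being
  trapped add up to at most this number.\<close>

lemma all_attempts:
  "ennreal (loop_in * hold) * soup W u (\<lambda>\<sigma>. of_bool (0 \<in> footprint \<sigma>) *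
      (\<integral>\<^sup>+\<gamma>. (\<Sum>(t, f)\<in>{..n} \<times> dirs e. of_bool (fresh e L \<gamma> t f) * ennreal (reroute ^ occ (\<gamma> ! t) f \<sigma>))
        \<partial>measure_pmf (walk (footprint \<sigma>) n 0)))
    \<le> ennreal (real ((1 + depth TYPE(int ^ 'd) + L) * (2 * CARD('d))))" (is "?c * soup W u ?A \<le> _")
proof -
  let ?B = "{..n} \<times> dirs e"
  let ?N = "(1 + depth TYPE(int ^ 'd) + L) * (2 * CARD('d))"
  have fB: "finite ?B" by (simp add: finite_dirs)
  let ?F = "\<lambda>p \<sigma>. of_bool (0 \<in> footprint \<sigma>) *
        (\<integral>\<^sup>+\<gamma>. of_bool (fresh e L \<gamma> (fst p) (snd p)) * ennreal (reroute ^ occ (\<gamma> ! fst p) (snd p) \<sigma>) \<partial>measure_pmf (walk (footprint \<sigma>) n 0)) :: ennreal"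
  let ?T = "\<lambda>p \<sigma>. of_bool (0 \<in> footprint \<sigma>) *
        (\<integral>\<^sup>+\<gamma>. of_bool (trapped \<gamma> (fst p) (snd p)) \<partial>measure_pmf (walk (footprint \<sigma>) n 0)) :: ennreal"
  have A: "?A = (\<lambda>\<sigma>. \<Sum>p\<in>?B. ?F p \<sigma>)"
    by (simp add: case_prod_beta nn_integral_sum sum_distrib_left)
  have "?c * soup W u ?A = (\<Sum>p\<in>?B. ?c * soup W u (?F p))"
    unfolding A soup_sum[OF fB] by (rule sum_distrib_left)
  also have "\<dots> \<le> (\<Sum>p\<in>?B. soup W u (?T p))"
    by (intro sum_mono attempt) auto
  also have "\<dots> = soup W u (\<lambda>\<sigma>. \<Sum>p\<in>?B. ?T p \<sigma>)" by (rule soup_sum[OF fB, symmetric])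
  also have "\<dots> \<le> soup W u (\<lambda>\<sigma>. ennreal (real ?N) * 1)"
  proof (rule soup_mono)
    fix \<sigma>
    have "(\<Sum>p\<in>?B. ?T p \<sigma>) \<le> (\<Sum>p\<in>?B. \<integral>\<^sup>+\<gamma>. of_bool (trapped \<gamma> (fst p) (snd p)) \<partial>measure_pmf (walk (footprint \<sigma>) n 0))"
      by (intro sum_mono) auto
    also have "\<dots> = (\<integral>\<^sup>+\<gamma>. (\<Sum>p\<in>?B. of_bool (trapped \<gamma> (fst p) (snd p))) \<partial>measure_pmf (walk (footprint \<sigma>) n 0))"
      by (rule nn_integral_sum[symmetric]) simp
    also have "\<dots> \<le> (\<integral>\<^sup>+\<gamma>. ennreal (real ?N) \<partial>measure_pmf (walk (footprint \<sigma>) n 0))"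
    proof (rule nn_integral_mono_AE, rule AE_pmfI)
      fix \<gamma> assume "\<gamma> \<in> set_pmf (walk (footprint \<sigma>) n 0)"
      then have l: "length \<gamma> = Suc n" using set_pmf_traj by metis
      let ?S = "{(t, f). t < length \<gamma> \<and> fresh e L \<gamma> t f \<and> (\<forall>s. t < s \<and> s < length \<gamma> \<longrightarrow> \<gamma> ! s \<in> trap_path e L (\<gamma> ! t) f)}"
      have "(\<Sum>p\<in>?B. of_bool (trapped \<gamma> (fst p) (snd p))) = (\<Sum>p\<in>{p \<in> ?B. trapped \<gamma> (fst p) (snd p)}. (1::ennreal))"
        using fB by (intro sum.mono_neutral_cong_right) auto
      also have "{p \<in> ?B. trapped \<gamma> (fst p) (snd p)} = ?S"
        using l by (auto simp: trapped_def fresh_def)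
      also have "(\<Sum>p\<in>?S. (1::ennreal)) = ennreal (real (card ?S))"
        by (simp only: sum_constant mult_1_right ennreal_of_nat_eq_real_of_nat)
      also have "\<dots> \<le> ennreal (real ?N)"
        by (intro ennreal_leI of_nat_mono card_trapped_le)
      finally show "(\<Sum>p\<in>?B. of_bool (trapped \<gamma> (fst p) (snd p))) \<le> ennreal (real ?N)" .
    qed
    also have "\<dots> = ennreal (real ?N) * 1" by (simp add: measure_pmf.emeasure_space_1[simplified])
    finally show "(\<Sum>p\<in>?B. ?T p \<sigma>) \<le> ennreal (real ?N) * 1" .
  qed
  also have "\<dots> = ennreal (real ?N)"
    unfolding soup_cmult using d W(1) u by (simp add: soup_1)
  finally show ?thesis .
qed

definition chain_term :: real where
  "chain_term = real (((2 * m + 1) ^ CARD('d) * (2 * CARD('d))) * (J * (20 * R + 1) ^ CARD('d) * (2 * CARD('d))) ^ (J - 1))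
      * (exp (u * real (J * ((L + 3) * 5 ^ CARD('d)))) / (1 + 1 / (2 * q)) ^ (J * K))"

definition backtrack_term :: real where
  "backtrack_term = real ((n + 1) * (n + 1) * (2 * n + 1) ^ CARD('d)) * (deg TYPE(int ^ 'd) * \<beta> powi (- int R))"

definition trap_term :: real where
  "trap_term = real ((1 + depth TYPE(int ^ 'd) + L) * (2 * CARD('d))) / (loop_in * hold * (real M * reroute ^ K))"

text \<open>Markov's inequality: a far trajectory with little backtracking, in a soup without bad
  chains, makes \<open>M\<close> fresh attempts of occupation below \<open>K\<close>, so that the
  sum in \<open>all_attempts\<close> is at least \<open>M * reroute ^ K\<close>.\<close>

lemma far_bound:
  "soup W u (\<lambda>\<sigma>. of_bool (0 \<in> footprint \<sigma>) *
      (\<integral>\<^sup>+\<gamma>. of_bool (\<exists>t\<le>n. int m \<le> dist1 0 (\<gamma> ! t)) \<partial>measure_pmf (walk (footprint \<sigma>) n 0)))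
    \<le> ennreal (backtrack_term + chain_term + trap_term)"
proof -
  let ?far = "\<lambda>\<gamma>. \<exists>t\<le>n. int m \<le> dist1 0 (\<gamma> ! t)"
  let ?bad = "\<lambda>\<sigma>. \<exists>zs\<in>link_chains e R m J. \<forall>p\<in>set zs. K \<le> occ (fst p) (snd p) \<sigma>"
  let ?B = "{..n} \<times> dirs e"
  let ?S = "\<lambda>\<gamma> \<sigma>. \<Sum>(t, f)\<in>?B. of_bool (fresh e L \<gamma> t f) * ennreal (reroute ^ occ (\<gamma> ! t) f \<sigma>)"
  let ?A = "\<lambda>\<sigma>. of_bool (0 \<in> footprint \<sigma>) * (\<integral>\<^sup>+\<gamma>. ?S \<gamma> \<sigma> \<partial>measure_pmf (walk (footprint \<sigma>) n 0))"
  define D where "D = real M * reroute ^ K"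
  have D: "D > 0" using M pos by (simp add: D_def)
  have fB: "finite ?B" by (simp add: finite_dirs)
  have key: "of_bool (?far \<gamma>) \<le> of_bool (\<not> backtrack_le e R \<gamma>) + (of_bool (?bad \<sigma>) + ennreal (1 / D) * ?S \<gamma> \<sigma>)"
    if \<gamma>: "\<gamma> \<in> paths_from n 0" for \<gamma> \<sigma>
  proof (cases "?far \<gamma> \<and> backtrack_le e R \<gamma> \<and> \<not> ?bad \<sigma>")
    case False
    then consider "\<not> ?far \<gamma>" | "\<not> backtrack_le e R \<gamma>" | "?bad \<sigma>" by blast
    then show ?thesis
    proof cases
      case 1
      then have "of_bool (?far \<gamma>) = (0::ennreal)" by (simp only: of_bool_eq(1))
      then show ?thesis by (simp only: zero_le)
    next
      case 2
      have "of_bool (?far \<gamma>) \<le> (1::ennreal)" by simp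
      also have "(1::ennreal) = of_bool (\<not> backtrack_le e R \<gamma>)" using 2 by simp
      finally show ?thesis by (rule order_trans[OF _ add_increasing2[OF zero_le order_refl]])
    next
      case 3
      have "of_bool (?far \<gamma>) \<le> (1::ennreal)" by simp
      also have "(1::ennreal) = of_bool (?bad \<sigma>)" using 3 by (simp only: of_bool_eq(2))
      also have "\<dots> \<le> of_bool (?bad \<sigma>) + ennreal (1 / D) * ?S \<gamma> \<sigma>" by (rule add_increasing2[OF zero_le order_refl])
      also have "\<dots> \<le> of_bool (\<not> backtrack_le e R \<gamma>) + (of_bool (?bad \<sigma>) + ennreal (1 / D) * ?S \<gamma> \<sigma>)"
        by (rule add_increasing[OF zero_le order_refl])
      finally show ?thesis .
    qed
  next
    case True
    have l: "length \<gamma> = Suc n" "\<gamma> ! 0 = 0" "lattice_path \<gamma>" using \<gamma> by (auto simp: paths_from_def)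
    obtain T where T: "T \<le> n" "int m \<le> dist1 0 (\<gamma> ! T)" using True by blast
    let ?good = "\<lambda>p. occ (fst p) (snd p) \<sigma> < K"
    let ?G = "{(t, f). t < length \<gamma> \<and> fresh e L \<gamma> t f \<and> ?good (\<gamma> ! t, f)}"
    have "M \<le> card ?G"
    proof (rule many_good_fresh[OF l(3) _ R(1), where T=T and m=m and J=J])
      show "backtrack_le e R \<gamma>" using True by blast
      show "T < length \<gamma>" "dist1 (\<gamma> ! 0) (\<gamma> ! T) \<ge> int m" using T l by auto
      fix zs assume "length zs = J" "link_chain e R zs" "\<forall>z\<in>set zs. dist1 (\<gamma> ! 0) (fst z) \<le> int m"
      then have "zs \<in> link_chains e R m J" using l by (simp add: link_chains_def)
      then show "\<exists>z\<in>set zs. ?good z" using True by (meson not_le)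
    qed (use J MJ in auto)
    have GB: "?G \<subseteq> ?B" using l by (auto simp: fresh_def)
    have fG: "finite ?G" by (rule finite_subset[OF GB fB])
    have "ennreal D \<le> ennreal (real (card ?G) * reroute ^ K)"
      unfolding D_def using \<open>M \<le> card ?G\<close> pos by (intro ennreal_leI mult_right_mono) auto
    also have "\<dots> = (\<Sum>p\<in>?G. ennreal (reroute ^ K))"
      using pos by (intro sum_ennreal_const[symmetric]) auto
    also have "\<dots> \<le> (\<Sum>(t, f)\<in>?G. of_bool (fresh e L \<gamma> t f) * ennreal (reroute ^ occ (\<gamma> ! t) f \<sigma>))"
    proof (rule sum_mono)
      fix p assume "p \<in> ?G"
      then obtain t f where p: "p = (t, f)" "fresh e L \<gamma> t f" "occ (\<gamma> ! t) f \<sigma> < K" by auto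
      have "reroute ^ K \<le> reroute ^ occ (\<gamma> ! t) f \<sigma>" using p pos by (intro power_decreasing) auto
      then show "ennreal (reroute ^ K) \<le> (case p of (t, f) \<Rightarrow> of_bool (fresh e L \<gamma> t f) * ennreal (reroute ^ occ (\<gamma> ! t) f \<sigma>))"
        using p by (simp add: ennreal_leI)
    qed
    also have "\<dots> \<le> ?S \<gamma> \<sigma>" by (rule sum_mono2[OF fB GB]) auto
    finally have "ennreal (1 / D) * ennreal D \<le> ennreal (1 / D) * ?S \<gamma> \<sigma>" by (intro mult_left_mono) auto
    moreover have "ennreal (1 / D) * ennreal D = 1" using D by (simp add: ennreal_mult'[symmetric])
    ultimately have "1 \<le> ennreal (1 / D) * ?S \<gamma> \<sigma>" by simp
    then have "of_bool (?far \<gamma>) \<le> ennreal (1 / D) * ?S \<gamma> \<sigma>" by (rule order_trans[rotated]) simp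
    then show ?thesis by (simp only: add_increasing[OF zero_le] add_increasing)
  qed
  have int: "of_bool (0 \<in> footprint \<sigma>) * (\<integral>\<^sup>+\<gamma>. of_bool (?far \<gamma>) \<partial>measure_pmf (walk (footprint \<sigma>) n 0))
    \<le> ennreal backtrack_term + (of_bool (?bad \<sigma>) + ennreal (1 / D) * ?A \<sigma>)" for \<sigma>
  proof (cases "0 \<in> footprint \<sigma>")
    case True
    let ?w = "walk (footprint \<sigma>) n 0"
    have "(\<integral>\<^sup>+\<gamma>. of_bool (?far \<gamma>) \<partial>measure_pmf ?w)
       \<le> (\<integral>\<^sup>+\<gamma>. of_bool (\<not> backtrack_le e R \<gamma>) + (of_bool (?bad \<sigma>) + ennreal (1 / D) * ?S \<gamma> \<sigma>) \<partial>measure_pmf ?w)"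
      using key set_pmf_bt(1)[OF \<beta>] by (intro nn_integral_mono_AE AE_pmfI) blast
    also have "\<dots> = (\<integral>\<^sup>+\<gamma>. of_bool (\<not> backtrack_le e R \<gamma>) \<partial>measure_pmf ?w)
        + (of_bool (?bad \<sigma>) + ennreal (1 / D) * (\<integral>\<^sup>+\<gamma>. ?S \<gamma> \<sigma> \<partial>measure_pmf ?w))"
    proof -
      have "(\<integral>\<^sup>+\<gamma>. of_bool (?bad \<sigma>) \<partial>measure_pmf ?w) = (of_bool (?bad \<sigma>) :: ennreal)"
        by (simp only: nn_integral_const measure_pmf.emeasure_space_1 mult_1_right)
      then show ?thesis by (subst nn_integral_add, simp, simp, subst nn_integral_add, simp, simp, subst nn_integral_cmult, simp, simp only:)
    qed
    also have "\<dots> \<le> ennreal backtrack_term + (of_bool (?bad \<sigma>) + ennreal (1 / D) * (\<integral>\<^sup>+\<gamma>. ?S \<gamma> \<sigma> \<partial>measure_pmf ?w))"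
      unfolding backtrack_term_def by (intro add_right_mono backtrack_bound[OF \<beta>])
    finally show ?thesis using True by (simp only: of_bool_eq(2) mult_1_left simp_thms)
  next
    case False
    then show ?thesis by (simp only: of_bool_eq(1) mult_zero_left zero_le simp_thms)
  qed
  have "soup W u (\<lambda>\<sigma>. of_bool (0 \<in> footprint \<sigma>) * (\<integral>\<^sup>+\<gamma>. of_bool (?far \<gamma>) \<partial>measure_pmf (walk (footprint \<sigma>) n 0)))
      \<le> soup W u (\<lambda>\<sigma>. ennreal backtrack_term * 1 + (of_bool (?bad \<sigma>) + ennreal (1 / D) * ?A \<sigma>))"
    by (rule soup_mono) (use int in simp)
  also have "\<dots> = ennreal backtrack_term + (soup W u (\<lambda>\<sigma>. of_bool (?bad \<sigma>)) + ennreal (1 / D) * soup W u ?A)"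
    unfolding soup_add soup_cmult using d W(1) u by (simp add: soup_1)
  also have "\<dots> \<le> ennreal backtrack_term + (ennreal chain_term + ennreal trap_term)"
  proof (intro add_left_mono add_mono)
    show "soup W u (\<lambda>\<sigma>. of_bool (?bad \<sigma>)) \<le> ennreal chain_term"
      unfolding chain_term_def by (rule soup_chains[OF d W(1) u J R(2) q])
    define c where "c = loop_in * hold"
    have c: "c > 0" using pos by (simp add: c_def)
    have "ennreal (1 / D) * soup W u ?A = ennreal (1 / D) * (ennreal (1 / c) * ennreal c) * soup W u ?A"
      using c by (simp add: ennreal_mult'[symmetric])
    also have "\<dots> = ennreal (1 / D) * ennreal (1 / c) * (ennreal c * soup W u ?A)" by (simp only: mult.assoc)
    also have "\<dots> \<le> ennreal (1 / D) * ennreal (1 / c) * ennreal (real ((1 + depth TYPE(int ^ 'd) + L) * (2 * CARD('d))))"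
      unfolding c_def by (intro mult_left_mono all_attempts) simp
    also have "\<dots> = ennreal trap_term"
      using c D unfolding trap_term_def c_def[symmetric] D_def[symmetric]
      by (simp add: ennreal_mult'[symmetric] mult.commute del: of_nat_mult of_nat_add of_nat_Suc)
    finally show "ennreal (1 / D) * soup W u ?A \<le> ennreal trap_term" .
  qed
  also have "\<dots> = ennreal (backtrack_term + chain_term + trap_term)"
  proof -
    have "backtrack_term \<ge> 0" using \<beta> deg_ge[where 'd='d] by (simp add: backtrack_term_def)
    moreover have "chain_term \<ge> 0" using q by (simp add: chain_term_def)
    moreover have "trap_term \<ge> 0" using pos by (simp add: trap_term_def less_imp_le)
    ultimately show ?thesis by (simp add: add.assoc)
  qed
  finally show ?thesis .
qed

end

section \<open>Choice of the parameters\<close>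

text \<open>All factors are measured as powers of \<open>exp l\<close>, the order of the
  displacement. To the exponent the first point contributes \<open>D\<close>, the links
  \<open>J * \<eta> / 4\<close>, the volume of the sleeves \<open>J * \<eta> / 4\<close>, and the
  occupation \<open>- J * \<eta>\<close>; the choice of \<open>J\<close> leaves at most
  \<open>- 1\<close>.\<close>

lemma chain_term_decay:
  fixes D J m L R K :: nat and u z \<delta> \<eta> \<kappa> a l :: real
  assumes D: "D \<ge> 1" and l: "l \<ge> 0" and u: "u > 0" and z: "z > 1" and \<eta>: "\<eta> = \<delta> * ln z" "\<eta> > 0"
    and \<kappa>: "\<kappa> * real D \<le> \<eta> / 4" "\<kappa> > 0" and a: "u * 5 ^ D * a \<le> \<eta> / 4" and J: "real J * \<eta> / 2 \<ge> real D + 1" "J \<ge> 1"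
    and m: "real m \<le> 2 * exp l" and R: "real R \<le> 2 * exp (\<kappa> * l)" and L: "real L \<le> a * l" and K: "\<delta> * l \<le> real K"
  shows "real (((2 * m + 1) ^ D * (2 * D)) * (J * (20 * R + 1) ^ D * (2 * D)) ^ (J - 1))
      * (exp (u * real (J * ((L + 3) * 5 ^ D))) / z ^ (J * K))
    \<le> (5 ^ D * (2 * real D) * (real J * 41 ^ D * (2 * real D)) ^ (J - 1) * exp (3 * u * real J * 5 ^ D)) * exp (- l)"
proof -
  have el: "exp l \<ge> 1" "exp (\<kappa> * l) \<ge> 1" using l \<kappa> by auto
  have 1: "real (2 * m + 1) ^ D \<le> 5 ^ D * exp (real D * l)"
  proof -
    have "real (2 * m + 1) = 2 * real m + 1" by simp
    then have "real (2 * m + 1) \<le> 5 * exp l" using m el by linarith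
    then have "real (2 * m + 1) ^ D \<le> (5 * exp l) ^ D" by (intro power_mono) auto
    then show ?thesis by (simp add: power_mult_distrib exp_of_nat_mult)
  qed
  have 2: "real (J * (20 * R + 1) ^ D * (2 * D)) ^ (J - 1)
      \<le> (real J * 41 ^ D * (2 * real D)) ^ (J - 1) * exp (real J * \<eta> / 4 * l)"
  proof -
    have "real (20 * R + 1) = 20 * real R + 1" by simp
    then have "real (20 * R + 1) \<le> 41 * exp (\<kappa> * l)" using R el by linarith
    then have "real (20 * R + 1) ^ D \<le> (41 * exp (\<kappa> * l)) ^ D" by (intro power_mono) auto
    also have "\<dots> = 41 ^ D * exp (\<kappa> * real D * l)" by (simp add: power_mult_distrib exp_of_nat_mult[symmetric] ac_simps)
    also have "\<dots> \<le> 41 ^ D * exp (\<eta> / 4 * l)" 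
      by (intro mult_left_mono iffD2[OF exp_le_cancel_iff] mult_right_mono \<kappa>(1) l) simp
    finally have "real J * real (20 * R + 1) ^ D * (2 * real D) \<le> real J * (41 ^ D * exp (\<eta> / 4 * l)) * (2 * real D)"
      by (intro mult_right_mono mult_left_mono) auto
    then have "(real J * real (20 * R + 1) ^ D * (2 * real D)) ^ (J - 1)
        \<le> (real J * (41 ^ D * exp (\<eta> / 4 * l)) * (2 * real D)) ^ (J - 1)"
      by (intro power_mono) auto
    also have "\<dots> = (real J * 41 ^ D * (2 * real D)) ^ (J - 1) * exp (\<eta> / 4 * l) ^ (J - 1)"
      by (simp add: power_mult_distrib[symmetric] ac_simps)
    also have "exp (\<eta> / 4 * l) ^ (J - 1) \<le> exp (\<eta> / 4 * l) ^ J"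
      using \<eta> l by (intro power_increasing) auto
    also have "\<dots> = exp (real J * \<eta> / 4 * l)" by (simp add: exp_of_nat_mult[symmetric])
    finally show ?thesis by (simp add: mult_left_mono)
  qed
  have 3: "exp (u * real (J * ((L + 3) * 5 ^ D))) \<le> exp (3 * u * real J * 5 ^ D) * exp (real J * \<eta> / 4 * l)"
  proof -
    have "u * 5 ^ D * real L \<le> u * 5 ^ D * (a * l)" using L u by (intro mult_left_mono) auto
    also have "\<dots> = u * 5 ^ D * a * l" by simp
    also have "\<dots> \<le> \<eta> / 4 * l" using a l by (intro mult_right_mono) auto
    finally have "real J * (u * 5 ^ D * real L) \<le> real J * (\<eta> / 4 * l)" by (intro mult_left_mono) auto
    then have "u * real (J * ((L + 3) * 5 ^ D)) \<le> 3 * u * real J * 5 ^ D + real J * \<eta> / 4 * l"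
      by (simp add: algebra_simps)
    then show ?thesis by (simp add: exp_add[symmetric])
  qed
  have 4: "exp (real J * \<eta> * l) \<le> z ^ (J * K)"
  proof -
    have "\<eta> * l \<le> ln z * real K" using K z unfolding \<eta>(1) by (simp add: mult.commute mult.left_commute mult_left_mono)
    then have "real J * (\<eta> * l) \<le> real J * (ln z * real K)" by (intro mult_left_mono) auto
    then have "exp (real J * \<eta> * l) \<le> exp (real (J * K) * ln z)" by (simp add: ac_simps)
    also have "\<dots> = z ^ (J * K)" using z by (simp only: exp_of_nat_mult exp_ln)
    finally show ?thesis .
  qed
  have "real (((2 * m + 1) ^ D * (2 * D)) * (J * (20 * R + 1) ^ D * (2 * D)) ^ (J - 1))
      * (exp (u * real (J * ((L + 3) * 5 ^ D))) / z ^ (J * K))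
    = (real (2 * m + 1) ^ D * (2 * real D)) * real (J * (20 * R + 1) ^ D * (2 * D)) ^ (J - 1)
      * (exp (u * real (J * ((L + 3) * 5 ^ D))) / z ^ (J * K))"
    by (simp only: of_nat_mult of_nat_power of_nat_numeral)
  also have "\<dots> \<le> (5 ^ D * exp (real D * l) * (2 * real D)) * ((real J * 41 ^ D * (2 * real D)) ^ (J - 1) * exp (real J * \<eta> / 4 * l))
      * ((exp (3 * u * real J * 5 ^ D) * exp (real J * \<eta> / 4 * l)) / exp (real J * \<eta> * l))"
    using 1 2 3 4 z by (intro mult_mono frac_le) auto
  also have "\<dots> = (5 ^ D * (2 * real D) * (real J * 41 ^ D * (2 * real D)) ^ (J - 1) * exp (3 * u * real J * 5 ^ D))
      * exp (real D * l + real J * \<eta> / 4 * l + real J * \<eta> / 4 * l - real J * \<eta> * l)"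
    by (simp only: exp_add exp_diff times_divide_eq_left times_divide_eq_right ac_simps)
  also have "\<dots> \<le> (5 ^ D * (2 * real D) * (real J * 41 ^ D * (2 * real D)) ^ (J - 1) * exp (3 * u * real J * 5 ^ D)) * exp (- l)"
  proof (intro mult_left_mono)
    have "(real D + 1) * l \<le> real J * \<eta> / 2 * l" using J l by (intro mult_right_mono) auto
    then show "exp (real D * l + real J * \<eta> / 4 * l + real J * \<eta> / 4 * l - real J * \<eta> * l) \<le> exp (- l)"
      by (simp add: algebra_simps)
  qed auto
  finally show ?thesis .
qed

text \<open>The exponents of \<open>exp l\<close> are \<open>3 / 4\<close> for the number
  \<open>M\<close> of chains, against \<open>1 / 4\<close> for \<open>r ^ K\<close>,
  \<open>1 / 8\<close> for the loop and \<open>1 / 8\<close> for the factor that is linear in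
  \<open>L\<close>; a quarter remains.\<close>

lemma trap_term_decay:
  fixes D J m L R K M s :: nat and \<delta> \<kappa> a l g r hold :: real
  assumes l: "l \<ge> 0" and r: "0 < r" "r < 1" "\<delta> * ln (1 / r) = 1 / 4" and g: "g > 1" "2 * a * ln g \<le> 1 / 8" and a: "0 < a" "a \<le> 1"
    and \<kappa>: "\<kappa> \<le> 1 / 4" and hold: "hold > 0" and J: "J \<ge> 1" and D: "D \<ge> 1"
    and L: "real L \<le> a * l" and K: "real K \<le> \<delta> * l + 1" and M: "real M \<ge> exp (3 / 4 * l) / (240 * real J)"
  shows "real ((1 + s + L) * (2 * D)) / ((1 / g) ^ (2 * (s + L)) * hold * (real M * r ^ K))
    \<le> ((1 + real s) * 8 * (2 * real D) * g ^ (2 * s) / hold * (240 * real J) / r) * exp (- l / 4)"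
proof -
  have 1: "real ((1 + s + L) * (2 * D)) \<le> (1 + real s) * 8 * exp (l / 8) * (2 * real D)"
  proof -
    have "1 + l / 8 \<le> exp (l / 8)" by (rule exp_ge_add_one_self)
    then have "1 + l \<le> 8 * exp (l / 8)" by linarith
    moreover have "real L \<le> l" using L a l mult_right_mono[of a 1 l] by simp
    ultimately have "1 + real L \<le> 8 * exp (l / 8)" by linarith
    then have "(1 + real s) * (1 + real L) \<le> (1 + real s) * (8 * exp (l / 8))" by (intro mult_left_mono) auto
    moreover have "1 + real s + real L \<le> (1 + real s) * (1 + real L)" by (simp add: algebra_simps)
    ultimately have "1 + real s + real L \<le> (1 + real s) * (8 * exp (l / 8))" by linarith
    then have "(1 + real s + real L) * (2 * real D) \<le> (1 + real s) * (8 * exp (l / 8)) * (2 * real D)"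
      by (intro mult_right_mono) auto
    then show ?thesis
      by (simp only: of_nat_mult of_nat_add of_nat_1 of_nat_numeral mult.assoc)
  qed
  have 2: "exp (- (l / 8)) / g ^ (2 * s) \<le> (1 / g) ^ (2 * (s + L))"
  proof -
    have "2 * real L * ln g \<le> 2 * (a * l) * ln g" using L g by (intro mult_right_mono) auto
    also have "\<dots> = (2 * a * ln g) * l" by simp
    also have "\<dots> \<le> 1 / 8 * l" using g l by (intro mult_right_mono) auto
    finally have "exp (real (2 * L) * ln g) \<le> exp (l / 8)" by simp
    then have "g ^ (2 * L) \<le> exp (l / 8)" using g by (simp only: exp_of_nat_mult exp_ln)
    then have "1 / (g ^ (2 * s) * exp (l / 8)) \<le> 1 / (g ^ (2 * s) * g ^ (2 * L))"
      using g by (intro divide_left_mono mult_left_mono mult_pos_pos) auto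
    also have "\<dots> = (1 / g) ^ (2 * (s + L))" by (simp add: power_one_over power_add distrib_left)
    finally show ?thesis by (simp add: exp_minus field_simps)
  qed
  have 3: "r * exp (- (l / 4)) \<le> r ^ K"
  proof -
    have "real K * ln (1 / r) \<le> (\<delta> * l + 1) * ln (1 / r)" using K r by (intro mult_right_mono) auto
    also have "\<dots> = l * (\<delta> * ln (1 / r)) + ln (1 / r)" by (simp add: algebra_simps)
    also have "\<dots> = l / 4 + ln (1 / r)" unfolding r(3) by simp
    finally have "- (l / 4) + ln r \<le> real K * ln r" using r by (simp add: ln_div)
    then have "exp (- (l / 4) + ln r) \<le> exp (real K * ln r)" by (simp only: exp_le_cancel_iff)
    then have "exp (- (l / 4)) * r \<le> r ^ K" using r(1) by (simp only: exp_add exp_of_nat_mult exp_ln)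
    then show ?thesis by (simp only: mult.commute)
  qed
  have "real ((1 + s + L) * (2 * D)) / ((1 / g) ^ (2 * (s + L)) * hold * (real M * r ^ K))
    \<le> ((1 + real s) * 8 * exp (l / 8) * (2 * real D))
      / ((exp (- (l / 8)) / g ^ (2 * s)) * hold * ((exp (3 / 4 * l) / (240 * real J)) * (r * exp (- (l / 4)))))"
    using 1 2 3 M hold r g J by (intro frac_le mult_mono mult_pos_pos divide_pos_pos mult_right_mono) auto
  also have "\<dots> = ((1 + real s) * 8 * (2 * real D) * g ^ (2 * s) / hold * (240 * real J) / r)
      * (exp (l / 8) / (exp (- (l / 8)) * (exp (3 / 4 * l) * exp (- (l / 4)))))"
    using g hold r J by (simp add: field_simps)
  also have "exp (l / 8) / (exp (- (l / 8)) * (exp (3 / 4 * l) * exp (- (l / 4)))) = exp (- l / 4)"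
  proof -
    have "exp (- (l / 8)) * (exp (3 / 4 * l) * exp (- (l / 4))) = exp (- (l / 8) + (3 / 4 * l + - (l / 4)))"
      by (simp only: exp_add)
    then have "exp (l / 8) / (exp (- (l / 8)) * (exp (3 / 4 * l) * exp (- (l / 4))))
        = exp (l / 8 - (- (l / 8) + (3 / 4 * l + - (l / 4))))" by (simp only: exp_diff)
    also have "l / 8 - (- (l / 8) + (3 / 4 * l + - (l / 4))) = - l / 4" by simp
    finally show ?thesis .
  qed
  finally show ?thesis .
qed

lemma backtrack_term_decay:
  fixes D :: nat and \<kappa> \<epsilon> b :: real
  assumes "\<kappa> > 0" "\<epsilon> > 0" "b > 0"
  shows "\<forall>\<^sub>F n in sequentially. real ((n + 1) * (n + 1) * (2 * n + 1) ^ D) * exp (- (b * real n powr \<kappa>)) \<le> real n powr - (\<epsilon> / 8)"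
  using assms by real_asymp

text \<open>The exponent is half of \<open>\<epsilon>\<close>; the other half absorbs the passage
  from dyadic to arbitrary times in \<open>limsup_log_growth\<close>.\<close>

definition reach :: "real \<Rightarrow> nat \<Rightarrow> nat" where
  "reach \<epsilon> n = nat \<lceil>real n powr (\<epsilon> / 2)\<rceil>"

definition far_prob :: "'d::finite \<Rightarrow> real \<Rightarrow> real \<Rightarrow> nat \<Rightarrow> (int ^ 'd) set \<Rightarrow> ennreal" where
  "far_prob e \<beta> \<epsilon> n I = of_bool (0 \<in> I) *
     (\<integral>\<^sup>+\<gamma>. of_bool (\<exists>t\<le>n. int (reach \<epsilon> n) \<le> dist1 0 (\<gamma> ! t)) \<partial>measure_pmf (traj (biased_step e \<beta> I) n 0))"

text \<open>The constants from \<open>r\<close> to \<open>J\<close> depend on the dimension and on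
  \<open>u\<close> only. The exponent \<open>\<epsilon>\<close> enters through
  \<open>\<beta>0\<close> and through \<open>l = \<epsilon> / 2 * ln n\<close>; then
  \<open>L\<close> and \<open>K\<close> are multiples of \<open>l\<close>, whereas \<open>m\<close>
  and \<open>R\<close> are exponentials.\<close>

lemma far_decay:
  fixes e :: "'d::finite" and u \<epsilon> :: real
  assumes d: "CARD('d) \<ge> 4" and u: "u > 0" and \<epsilon>: "\<epsilon> > 0"
  shows "\<exists>\<beta>0>1. \<forall>\<beta>\<ge>\<beta>0. \<exists>C\<ge>0. \<forall>\<^sub>F n in sequentially. \<forall>Q. interlacement_law u Q \<longrightarrow>
    (\<integral>\<^sup>+I. far_prob e \<beta> \<epsilon> n I \<partial>Q) \<le> ennreal (C * real n powr - (\<epsilon> / 8))"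
proof -
  define D where "D = CARD('d)"
  define g where "g = deg TYPE(int ^ 'd)"
  define s where "s = depth TYPE(int ^ 'd)"
  define r where "r = (1 / g) ^ 12"
  \<comment> \<open>With \<open>K\<close> about \<open>\<delta> * l\<close> the cost
    \<open>r ^ K\<close> is about \<open>exp (- l / 4)\<close>. The constant \<open>\<eta>\<close>
    below is the exponent gained from one sleeve.\<close>
  define \<delta> where "\<delta> = 1 / (4 * ln (1 / r))"
  \<comment> \<open>The summand \<open>1\<close> makes room for the contribution of the distant
    sleeves, so that \<open>q\<close>, and with it \<open>z\<close> and \<open>\<eta>\<close>, can
    be fixed before \<open>J\<close>.\<close>
  define q where "q = sleeve_green TYPE(int ^ 'd) 0 + 1"
  define z where "z = 1 + 1 / (2 * q)"
  define \<eta> where "\<eta> = \<delta> * ln z"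
  define \<kappa> where "\<kappa> = min (1 / 4) (\<eta> / (4 * real D))"
  define a where "a = min 1 (min (\<eta> / (4 * u * 5 ^ D)) (1 / (16 * ln g)))"
  define J where "J = nat \<lceil>2 * (real D + 1) / \<eta>\<rceil> + 1"
  have D: "D \<ge> 1" "D \<ge> 4" using d by (auto simp: D_def)
  have g: "g > 1" using deg_ge[where 'd='d] by (simp add: g_def)
  have r: "0 < r" "r < 1" using g by (auto simp: r_def intro: power_less_one_iff[THEN iffD2] zero_less_power)
  have lr: "ln (1 / r) > 0" using r by (intro ln_gt_zero) auto
  have \<delta>: "\<delta> > 0" "\<delta> * ln (1 / r) = 1 / 4" using lr by (auto simp: \<delta>_def)
  have q: "q \<ge> 1" using sleeve_green_nonneg[where 'd='d, of 0] by (simp add: q_def)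
  have z: "z > 1" using q by (simp add: z_def)
  have \<eta>: "\<eta> > 0" using \<delta> z by (simp add: \<eta>_def)
  have \<kappa>: "\<kappa> > 0" "\<kappa> \<le> 1 / 4" "\<kappa> * real D \<le> \<eta> / 4"
  proof -
    show "\<kappa> > 0" "\<kappa> \<le> 1 / 4" using \<eta> D by (auto simp: \<kappa>_def)
    have "\<kappa> * real D \<le> \<eta> / (4 * real D) * real D" unfolding \<kappa>_def by (intro mult_right_mono) auto
    then show "\<kappa> * real D \<le> \<eta> / 4" using D by simp
  qed
  have a: "a > 0" "a \<le> 1" "2 * a * ln g \<le> 1 / 8" "u * 5 ^ D * a \<le> \<eta> / 4"
  proof -
    show "a > 0" "a \<le> 1" using \<eta> u g by (auto simp: a_def)
    have "a * ln g \<le> 1 / (16 * ln g) * ln g" unfolding a_def using g by (intro mult_right_mono) auto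
    then show "2 * a * ln g \<le> 1 / 8" using g by simp
    have "u * 5 ^ D * a \<le> u * 5 ^ D * (\<eta> / (4 * u * 5 ^ D))" unfolding a_def using u by (intro mult_left_mono) auto
    then show "u * 5 ^ D * a \<le> \<eta> / 4" using u by simp
  qed
  have J: "J \<ge> 1" "real J * \<eta> / 2 \<ge> real D + 1"
  proof -
    show "J \<ge> 1" by (simp add: J_def)
    have "2 * (real D + 1) / \<eta> \<le> real J" unfolding J_def by linarith
    then show "real J * \<eta> / 2 \<ge> real D + 1" using \<eta> by (simp add: field_simps)
  qed
  \<comment> \<open>The threshold yields \<open>a * l * ln \<beta> \<ge> 2 * ln n\<close>, so that
    \<open>n * \<beta> powi (1 - int L)\<close> is at most
    \<open>\<beta>\<^sup>2 / n\<close>.\<close>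
  define \<beta>0 where "\<beta>0 = max 2 (exp (4 / (a * \<epsilon>)))"
  have "\<forall>\<^sub>F R in sequentially. sleeve_green TYPE(int ^ 'd) R < 1 / real J"
    using sleeve_green_tendsto[where 'd='d] J by (intro order_tendstoD(2)) auto
  then obtain R0 where R0: "\<And>R. R \<ge> R0 \<Longrightarrow> sleeve_green TYPE(int ^ 'd) R < 1 / real J"
    by (auto simp: eventually_sequentially)
  show ?thesis
  proof (rule exI[of _ \<beta>0], intro conjI allI impI)
    show "\<beta>0 > 1" by (simp add: \<beta>0_def)
    fix \<beta> assume \<beta>0: "\<beta> \<ge> \<beta>0"
    then have \<beta>: "\<beta> \<ge> 2" "\<beta> > 1" "\<beta> \<ge> exp (4 / (a * \<epsilon>))" by (auto simp: \<beta>0_def)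
    then have "exp (4 / (a * \<epsilon>)) \<le> exp (ln \<beta>)" by simp
    then have "4 / (a * \<epsilon>) \<le> ln \<beta>" by (simp only: exp_le_cancel_iff)
    then have ln\<beta>: "4 \<le> ln \<beta> * (a * \<epsilon>)" using a \<epsilon> by (simp add: divide_le_eq)
    define p0 where "p0 = (1 / (g * \<beta>)) ^ Suc s * (1 / 4)"
    have p0: "p0 > 0" using g \<beta> by (auto simp: p0_def intro!: zero_less_power)
    define c1 where "c1 = 5 ^ D * (2 * real D) * (real J * 41 ^ D * (2 * real D)) ^ (J - 1) * exp (3 * u * real J * 5 ^ D)"
    define c2 where "c2 = (1 + real s) * 8 * (2 * real D) * g ^ (2 * s) / p0 * (240 * real J) / r"
    have c12: "c1 \<ge> 0" "c2 \<ge> 0" using g p0 r by (auto simp: c1_def c2_def)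
    define ll where "ll n = \<epsilon> / 2 * ln (real n)" for n :: nat
    have ll_top: "filterlim ll at_top sequentially" unfolding ll_def using \<epsilon> by real_asymp
    have ev: "\<forall>\<^sub>F x in at_top. 0 \<le> x \<and> 2 \<le> a * x \<and> real (D * s) \<le> exp (\<kappa> * x)
        \<and> real s + a * x + 2 + 2 * real D \<le> exp (\<kappa> * x) \<and> real R0 \<le> exp (\<kappa> * x) \<and> 480 * real J \<le> exp (3 / 4 * x)"
    proof (intro eventually_conj)
      show "\<forall>\<^sub>F x in at_top. 0 \<le> (x::real)" by (rule eventually_ge_at_top)
      show "\<forall>\<^sub>F x in at_top. 2 \<le> a * x" using a(1) by real_asymp
      show "\<forall>\<^sub>F x in at_top. real (D * s) \<le> exp (\<kappa> * x)" using \<kappa>(1) by real_asymp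
      show "\<forall>\<^sub>F x in at_top. real s + a * x + 2 + 2 * real D \<le> exp (\<kappa> * x)" using \<kappa>(1) a(1) by real_asymp
      show "\<forall>\<^sub>F x in at_top. real R0 \<le> exp (\<kappa> * x)" using \<kappa>(1) by real_asymp
      show "\<forall>\<^sub>F x in at_top. 480 * real J \<le> exp (3 / 4 * x)" by real_asymp
    qed
    have ev1: "\<forall>\<^sub>F n in sequentially. 0 \<le> ll n \<and> 2 \<le> a * ll n \<and> real (D * s) \<le> exp (\<kappa> * ll n)
        \<and> real s + a * ll n + 2 + 2 * real D \<le> exp (\<kappa> * ll n) \<and> real R0 \<le> exp (\<kappa> * ll n) \<and> 480 * real J \<le> exp (3 / 4 * ll n)"
      by (rule eventually_compose_filterlim[OF ev ll_top])
    have "\<kappa> * (\<epsilon> / 2) > 0" "ln (2::real) > 0" using \<kappa> \<epsilon> by auto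
    note ev2 = backtrack_term_decay[OF this(1) \<epsilon> this(2), of D]
    have ev3: "\<forall>\<^sub>F n in sequentially. 4 * \<beta>\<^sup>2 \<le> real n" by real_asymp
    show "\<exists>C\<ge>0. \<forall>\<^sub>F n in sequentially. \<forall>Q. interlacement_law u Q \<longrightarrow>
        (\<integral>\<^sup>+I. far_prob e \<beta> \<epsilon> n I \<partial>Q) \<le> ennreal (C * real n powr - (\<epsilon> / 8))"
    proof (rule exI[of _ "g + c1 + c2"], intro conjI)
      show "0 \<le> g + c1 + c2" using g c12 by simp
      show "\<forall>\<^sub>F n in sequentially. \<forall>Q. interlacement_law u Q \<longrightarrow>
        (\<integral>\<^sup>+I. far_prob e \<beta> \<epsilon> n I \<partial>Q) \<le> ennreal ((g + c1 + c2) * real n powr - (\<epsilon> / 8))"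
        using ev1 ev2 ev3
      proof eventually_elim
        case (elim n)
        define l where "l = ll n"
        have l: "0 \<le> l" "2 \<le> a * l" "real (D * s) \<le> exp (\<kappa> * l)" "real s + a * l + 2 + 2 * real D \<le> exp (\<kappa> * l)"
          "real R0 \<le> exp (\<kappa> * l)" "480 * real J \<le> exp (3 / 4 * l)" using elim(1) by (auto simp: l_def)
        have n0: "real n > 0"
        proof -
          have "0 < 4 * \<beta>\<^sup>2" using \<beta> by simp
          then show ?thesis using elim(3) by linarith
        qed
        have npow: "real n powr x = exp (x * ln (real n))" for x using n0 by (simp add: powr_def)
        define m where "m = reach \<epsilon> n"
        define R where "R = nat \<lceil>exp (\<kappa> * l)\<rceil>"
        define L where "L = nat \<lfloor>a * l\<rfloor>"
        define K where "K = nat \<lceil>\<delta> * l\<rceil>"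
        define M where "M = m div (60 * R * J) - 1"
        have el: "exp l \<ge> 1" "exp (\<kappa> * l) \<ge> 1" using l \<kappa> by auto
        have m: "exp l \<le> real m" "real m \<le> 2 * exp l"
        proof -
          have "real n powr (\<epsilon> / 2) = exp l" by (simp add: npow l_def ll_def)
          then have "m = nat \<lceil>exp l\<rceil>" by (simp add: m_def reach_def)
          then show "exp l \<le> real m" "real m \<le> 2 * exp l" using el by linarith+
        qed
        have R: "exp (\<kappa> * l) \<le> real R" "real R \<le> 2 * exp (\<kappa> * l)" "R \<ge> 1"
          using el unfolding R_def by linarith+
        have L: "real L \<le> a * l" "a * l - 1 \<le> real L" "L \<ge> 2"
          using l(2) unfolding L_def by linarith+
        have K: "\<delta> * l \<le> real K" "real K \<le> \<delta> * l + 1"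
          using \<delta>(1) l(1) mult_nonneg_nonneg[of \<delta> l] unfolding K_def by linarith+
        have R1: "D * s \<le> R" using l(3) R(1) by linarith
        have R2: "s + L + 2 + 2 * D \<le> R" using l(4) R(1) L(1) by linarith
        have RR0: "R0 \<le> R" using l(5) R(1) by linarith
        define cc where "cc = 60 * R * J"
        have cc: "cc \<ge> 1" using R(3) J(1) by (simp add: cc_def Suc_le_eq)
        have Mlow: "exp (3 / 4 * l) / (240 * real J) \<le> real M" and M1: "M \<ge> 1" and MJ: "(M + 1) * cc \<le> m"
        proof -
          have "exp (3 / 4 * l) / (120 * real J) \<le> real m / real cc"
          proof -
            have "exp (3 / 4 * l) * exp (\<kappa> * l) \<le> exp l"
            proof -
              have "\<kappa> * l \<le> 1 / 4 * l" using \<kappa>(2) l(1) by (intro mult_right_mono) auto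
              then show ?thesis by (simp add: exp_add[symmetric])
            qed
            then have "exp (3 / 4 * l) * real cc \<le> 120 * real J * real m"
            proof -
              have "exp (3 / 4 * l) * real cc = 60 * real J * (exp (3 / 4 * l) * real R)" by (simp add: cc_def)
              also have "\<dots> \<le> 60 * real J * (exp (3 / 4 * l) * (2 * exp (\<kappa> * l)))"
                using R(2) by (intro mult_left_mono) auto
              also have "\<dots> = 120 * real J * (exp (3 / 4 * l) * exp (\<kappa> * l))" by simp
              also have "\<dots> \<le> 120 * real J * real m"
                using \<open>exp (3 / 4 * l) * exp (\<kappa> * l) \<le> exp l\<close> m(1) by (intro mult_left_mono) auto
              finally show ?thesis .
            qed
            then show ?thesis using cc J(1) by (simp add: field_simps)
          qed
          moreover have "real m / real cc - 1 \<le> real (m div cc)"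
          proof -
            have "m < (m div cc + 1) * cc" using cc dividend_less_times_div[of cc m] by (simp add: algebra_simps)
            then have "real m < (real (m div cc) + 1) * real cc" by (metis of_nat_1 of_nat_add of_nat_less_iff of_nat_mult)
            then have "real m / real cc < real (m div cc) + 1" using cc by (simp add: divide_less_eq)
            then show ?thesis by simp
          qed
          moreover have "real (m div cc) - 1 \<le> real M" unfolding M_def cc_def[symmetric] by linarith
          moreover have "2 \<le> exp (3 / 4 * l) / (240 * real J)" using l(6) J(1) by (simp add: field_simps)
          moreover have "exp (3 / 4 * l) / (120 * real J) = 2 * (exp (3 / 4 * l) / (240 * real J))" by simp
          ultimately show M1': "exp (3 / 4 * l) / (240 * real J) \<le> real M" by linarith
          have "2 \<le> real M" using M1' \<open>2 \<le> exp (3 / 4 * l) / (240 * real J)\<close> by linarith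
          then show "M \<ge> 1" by linarith
          then have "M + 1 = m div cc" by (simp add: M_def cc_def)
          then show "(M + 1) * cc \<le> m" by simp
        qed
        have sg: "sleeve_green TYPE(int ^ 'd) 0 + real J * sleeve_green TYPE(int ^ 'd) R \<le> q"
          using R0[OF RR0] J(1) by (simp add: q_def field_simps)
        have b1: "\<beta> powi k = exp (real_of_int k * ln \<beta>)" for k
          using \<beta> powr_real_of_int'[of \<beta> k] by (simp add: powr_def)
        have h: "1 / 4 \<le> 1 - 1 / \<beta> - real n * \<beta> powi (1 - int L)"
        proof -
          have "\<beta> powi (1 - int L) \<le> exp ((2 - a * l) * ln \<beta>)"
            unfolding b1 exp_le_cancel_iff using L(2) \<beta> by (intro mult_right_mono) auto
          also have "\<dots> \<le> exp (2 * ln \<beta> - 2 * ln (real n))"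
          proof -
            have "ln (real n) \<ge> 0" using l(1) \<epsilon> by (simp add: l_def ll_def zero_le_mult_iff)
            then have "4 * ln (real n) \<le> ln \<beta> * (a * \<epsilon>) * ln (real n)" using ln\<beta> by (intro mult_right_mono)
            then have "2 * ln (real n) \<le> a * l * ln \<beta>" by (simp add: l_def ll_def algebra_simps)
            then show ?thesis by (simp add: algebra_simps)
          qed
          also have "\<dots> = \<beta>\<^sup>2 / (real n)\<^sup>2"
          proof -
            have "exp (2 * ln x) = x\<^sup>2" if "x > 0" for x :: real
              using exp_of_nat_mult[of 2 "ln x"] that by simp
            then show ?thesis using \<beta> n0 by (simp add: exp_diff)
          qed
          finally have "real n * \<beta> powi (1 - int L) \<le> real n * (\<beta>\<^sup>2 / (real n)\<^sup>2)" using n0 by (intro mult_left_mono) auto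
          also have "\<dots> = \<beta>\<^sup>2 / real n" using n0 by (simp add: power2_eq_square)
          also have "\<dots> \<le> 1 / 4" using elim(3) n0 by (simp add: field_simps)
          finally have "real n * \<beta> powi (1 - int L) \<le> 1 / 4" .
          moreover have "1 / \<beta> \<le> 1 / 2" using \<beta> by (simp add: field_simps)
          ultimately show ?thesis by linarith
        qed
        \<comment> \<open>The radius allows for a sleeve, and the neighbours of its sites, around
          every site that is reached in \<open>n\<close> steps.\<close>
        define W :: "(int ^ 'd) set" where "W = {y. dist1 0 y \<le> int (n + R + 1)}"
        have W: "finite W" unfolding W_def by (rule finite_ball1)
        note conds = d \<beta>(2) less_imp_le[OF u] L(3) J(1) M1 W eq_refl[OF W_def[symmetric]]
          R1[unfolded D_def s_def] R2[unfolded D_def s_def] MJ[unfolded cc_def] q sg h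
        have far: "soup W u (\<lambda>\<sigma>. far_prob e \<beta> \<epsilon> n (footprint \<sigma>))
          \<le> ennreal (backtrack_term TYPE('d) \<beta> n R + chain_term TYPE('d) u q m L R J K + trap_term TYPE('d) \<beta> L M K)"
          unfolding far_prob_def m_def[symmetric] by (rule far_bound[OF conds])
        have t1: "backtrack_term TYPE('d) \<beta> n R \<le> g * real n powr - (\<epsilon> / 8)"
        proof -
          have "\<beta> powi (- int R) \<le> exp (- (ln 2 * real n powr (\<kappa> * (\<epsilon> / 2))))"
          proof -
            have "real n powr (\<kappa> * (\<epsilon> / 2)) = exp (\<kappa> * l)" by (simp add: npow l_def ll_def ac_simps)
            then have "ln 2 * real n powr (\<kappa> * (\<epsilon> / 2)) \<le> ln \<beta> * real R"
              using R(1) \<beta> by (simp only:) (intro mult_mono, auto)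
            then show ?thesis unfolding b1 by (simp add: mult.commute)
          qed
          then have "backtrack_term TYPE('d) \<beta> n R \<le> real ((n + 1) * (n + 1) * (2 * n + 1) ^ D)
              * (g * exp (- (ln 2 * real n powr (\<kappa> * (\<epsilon> / 2)))))"
            unfolding backtrack_term_def[OF conds] D_def[symmetric] g_def[symmetric]
            using g by (intro mult_left_mono) auto
          also have "\<dots> = g * (real ((n + 1) * (n + 1) * (2 * n + 1) ^ D) * exp (- (ln 2 * real n powr (\<kappa> * (\<epsilon> / 2)))))"
            by (simp only: mult.left_commute)
          also have "\<dots> \<le> g * real n powr - (\<epsilon> / 8)" using elim(2) g by (intro mult_left_mono) auto
          finally show ?thesis .
        qed
        have el4: "exp (- l / 4) = real n powr - (\<epsilon> / 8)" by (simp add: npow l_def ll_def)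
        have t2: "chain_term TYPE('d) u q m L R J K \<le> c1 * real n powr - (\<epsilon> / 8)"
        proof -
          have "chain_term TYPE('d) u q m L R J K \<le> c1 * exp (- l)"
            unfolding chain_term_def[OF conds] D_def[symmetric] z_def[symmetric] c1_def
            by (rule chain_term_decay[OF D(1) l(1) u z \<eta>_def \<eta> \<kappa>(3,1) a(4) J(2,1) m(2) R(2) L(1) K(1)])
          also have "\<dots> \<le> c1 * exp (- l / 4)" using c12 l(1) by (intro mult_left_mono) auto
          finally show ?thesis by (simp only: el4)
        qed
        have t3: "trap_term TYPE('d) \<beta> L M K \<le> c2 * real n powr - (\<epsilon> / 8)"
        proof -
          have "trap_term TYPE('d) \<beta> L M K = real ((1 + s + L) * (2 * D)) / ((1 / g) ^ (2 * (s + L)) * p0 * (real M * r ^ K))"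
            unfolding trap_term_def[OF conds] loop_in_def[OF conds] p0_def reroute_def[OF conds]
              hold_def[OF conds] D_def s_def g_def r_def ..
          also have "\<dots> \<le> c2 * exp (- l / 4)"
            unfolding c2_def
            by (rule trap_term_decay[OF l(1) r \<delta>(2) g a(3,1,2) \<kappa>(2) p0 J(1) D(1) L(1) K(2) Mlow])
          finally show ?thesis by (simp only: el4)
        qed
        have tot: "soup W u (\<lambda>\<sigma>. far_prob e \<beta> \<epsilon> n (footprint \<sigma>)) \<le> ennreal ((g + c1 + c2) * real n powr - (\<epsilon> / 8))"
          using t1 t2 t3 by (intro order_trans[OF far] ennreal_leI) (simp add: distrib_right)
        show ?case
        proof (intro allI impI)
          fix Q :: "(int ^ 'd) set measure" assume Q: "interlacement_law u Q"
          have sub: "{y. dist1 0 y \<le> int n} \<subseteq> W" by (auto simp: W_def)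
          then have "0 \<in> W" by auto
          then have fp: "far_prob e \<beta> \<epsilon> n I = far_prob e \<beta> \<epsilon> n (I \<inter> W)" for I
            unfolding far_prob_def bt_restrict[OF \<beta>(2) sub, of e I] by simp
          have "(\<integral>\<^sup>+I. far_prob e \<beta> \<epsilon> n I \<partial>Q) = (\<integral>\<^sup>+I. far_prob e \<beta> \<epsilon> n (I \<inter> W) \<partial>Q)"
            by (rule nn_integral_cong) (rule fp)
          also have "\<dots> = soup W u (\<lambda>\<sigma>. far_prob e \<beta> \<epsilon> n (footprint \<sigma> \<inter> W))"
            using d by (intro interlacement_integral W u Q) auto
          also have "\<dots> = soup W u (\<lambda>\<sigma>. far_prob e \<beta> \<epsilon> n (footprint \<sigma>))" by (simp only: fp[symmetric])
          finally show "(\<integral>\<^sup>+I. far_prob e \<beta> \<epsilon> n I \<partial>Q) \<le> ennreal ((g + c1 + c2) * real n powr - (\<epsilon> / 8))"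
            using tot by simp
        qed
      qed
    qed
  qed
qed

section \<open>From the soup to the annealed law and the limsup\<close>

lemma euclid_norm_le_dist1: "euclid_norm x \<le> real_of_int (dist1 0 x)"
  unfolding euclid_norm_def dist1_def using norm_le_l1_cart[of "\<chi> i. real_of_int (x $ i)"] by simp

lemma measurable_far:
  "{X :: nat \<Rightarrow> int ^ 'd. \<exists>t\<le>n. m \<le> dist1 0 (X t)} \<in> sets (PiM UNIV (\<lambda>_. count_space UNIV))"
proof -
  let ?P = "PiM UNIV (\<lambda>_. count_space UNIV) :: (nat \<Rightarrow> int ^ 'd) measure"
  have "(\<lambda>X. X t) -` {y. m \<le> dist1 0 y} \<inter> space ?P \<in> sets ?P" for t
    by (rule measurable_sets[OF measurable_component_singleton]) auto
  then have "(\<Union>t\<in>{..n}. (\<lambda>X. X t) -` {y. m \<le> dist1 0 y} \<inter> space ?P) \<in> sets ?P" by blast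
  also have "(\<Union>t\<in>{..n}. (\<lambda>X. X t) -` {y. m \<le> dist1 0 y} \<inter> space ?P) = {X. \<exists>t\<le>n. m \<le> dist1 0 (X t)}"
    by (auto simp: space_PiM)
  finally show ?thesis .
qed

lemma emeasure_quenched_far:
  fixes e :: "'d::finite"
  shows "emeasure (quenched_law e \<beta> I 0) {X. \<exists>t\<le>n. int (reach \<epsilon> n) \<le> dist1 0 (X t)} * indicator {I. 0 \<in> I} I
    = far_prob e \<beta> \<epsilon> n I"
proof -
  have "map X [0..<Suc n] ! t = X t" if "t \<le> n" for X :: "nat \<Rightarrow> int ^ 'd" and t
    using that by (subst nth_map) (simp_all del: upt_Suc)
  then have "{X :: nat \<Rightarrow> int ^ 'd. \<exists>t\<le>n. int (reach \<epsilon> n) \<le> dist1 0 (X t)} =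
      {X. \<exists>t\<le>n. int (reach \<epsilon> n) \<le> dist1 0 (map X [0..<Suc n] ! t)}"
    by (auto simp del: upt_Suc)
  then have "emeasure (quenched_law e \<beta> I 0) {X. \<exists>t\<le>n. int (reach \<epsilon> n) \<le> dist1 0 (X t)} =
      emeasure (measure_pmf (traj (biased_step e \<beta> I) n 0)) {\<gamma>. \<exists>t\<le>n. int (reach \<epsilon> n) \<le> dist1 0 (\<gamma> ! t)}"
    unfolding quenched_law_def using emeasure_markov_law_prefix[of "biased_step e \<beta> I" 0
      "\<lambda>\<gamma>. \<exists>t\<le>n. int (reach \<epsilon> n) \<le> dist1 0 (\<gamma> ! t)" n] by (simp only:)
  also have "\<dots> = (\<integral>\<^sup>+\<gamma>. of_bool (\<exists>t\<le>n. int (reach \<epsilon> n) \<le> dist1 0 (\<gamma> ! t)) \<partial>measure_pmf (traj (biased_step e \<beta> I) n 0))"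
    using nn_integral_indicator[of "{\<gamma>. \<exists>t\<le>n. int (reach \<epsilon> n) \<le> dist1 0 (\<gamma> ! t)}"
      "measure_pmf (traj (biased_step e \<beta> I) n 0)"] by (simp add: indicator_def of_bool_def)
  finally show ?thesis by (simp add: far_prob_def split: split_indicator)
qed

lemma annealed_far:
  fixes e :: "'d::finite"
  assumes \<beta>: "\<beta> > 0" and Q: "interlacement_law u Q"
    and C: "C \<ge> 0" "(\<integral>\<^sup>+I. far_prob e \<beta> \<epsilon> n I \<partial>Q) \<le> ennreal C"
  shows "emeasure (annealed_law e \<beta> Q) {X. \<exists>t\<le>n. int (reach \<epsilon> n) \<le> dist1 0 (X t)}
    \<le> ennreal (C / measure Q {I. 0 \<in> I})"
proof -
  let ?S = "{I :: (int ^ 'd) set. 0 \<in> I}" and ?B = "{X :: nat \<Rightarrow> int ^ 'd. \<exists>t\<le>n. int (reach \<epsilon> n) \<le> dist1 0 (X t)}"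
  interpret prob_space Q using Q by (simp add: interlacement_law_def)
  have sQ: "sets Q = sets config_space" using Q by (simp add: interlacement_law_def)
  have S: "?S \<in> sets Q" unfolding sQ by (auto simp: config_space_def)
  have f: "(\<lambda>I. emeasure (quenched_law e \<beta> I 0) ?B) \<in> borel_measurable Q"
    using measurable_emeasure_kernel[OF measurable_prob_algebraD[OF measurable_quenched_law[OF \<beta>]] measurable_far]
    by (subst measurable_cong_sets[OF sQ refl])
  have "emeasure (annealed_law e \<beta> Q) ?B = (\<integral>\<^sup>+I. far_prob e \<beta> \<epsilon> n I \<partial>Q) / emeasure Q ?S"
    unfolding emeasure_annealed_law[OF \<beta> sQ measurable_far] nn_integral_uniform_measure[OF f S]
      emeasure_quenched_far ..
  also have "\<dots> \<le> ennreal (C / measure Q ?S)"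
  proof (cases "measure Q ?S = 0")
    \<comment> \<open>Division by zero gives \<open>0\<close> on the right-hand side, and on the
      left the integral itself vanishes.\<close>
    case True
    have "(\<integral>\<^sup>+I. far_prob e \<beta> \<epsilon> n I \<partial>Q) \<le> (\<integral>\<^sup>+I. indicator ?S I \<partial>Q)"
    proof (rule nn_integral_mono)
      fix I :: "(int ^ 'd) set"
      have "prob_space (quenched_law e \<beta> I 0)" by (simp add: quenched_law_def prob_space_markov_law)
      then have "emeasure (quenched_law e \<beta> I 0) ?B * indicator ?S I \<le> 1 * indicator ?S I"
        by (intro mult_right_mono prob_space.measure_le_1) auto
      then show "far_prob e \<beta> \<epsilon> n I \<le> indicator ?S I" unfolding emeasure_quenched_far by simp
    qed
    also have "\<dots> = 0" using S True by (simp add: emeasure_eq_measure)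
    finally show ?thesis by simp
  next
    case False
    then have "measure Q ?S > 0" by (simp add: zero_less_measure_iff)
    then show ?thesis
      using C divide_right_mono_ennreal[OF C(2), of "emeasure Q ?S"] by (simp add: emeasure_eq_measure divide_ennreal)
  qed
  finally show ?thesis .
qed

text \<open>For \<open>2 ^ j \<le> n < 2 ^ (j + 1)\<close> the event at \<open>j + 1\<close>
  controls time \<open>n\<close>, and \<open>\<epsilon> / 2 * ln (2 * n)\<close> is at most
  \<open>\<epsilon> * ln n\<close>.\<close>

lemma limsup_log_growth:
  fixes X :: "nat \<Rightarrow> int ^ 'd"
  assumes \<epsilon>: "\<epsilon> > 0" and ev: "\<forall>\<^sub>F j in sequentially. \<not> (\<exists>t\<le>2 ^ j. int (reach \<epsilon> (2 ^ j)) \<le> dist1 0 (X t))"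
  shows "limsup (\<lambda>n. ereal (ln (euclid_norm (X n)) / ln (real n))) \<le> ereal \<epsilon>"
proof (rule Limsup_bounded)
  obtain j0 where j0: "\<And>j t. j \<ge> j0 \<Longrightarrow> t \<le> 2 ^ j \<Longrightarrow> dist1 0 (X t) < int (reach \<epsilon> (2 ^ j))"
    using ev unfolding eventually_sequentially not_le[symmetric] by blast
  show "\<forall>\<^sub>F n in sequentially. ereal (ln (euclid_norm (X n)) / ln (real n)) \<le> ereal \<epsilon>"
    using eventually_ge_at_top[of "max 2 (2 ^ j0)"]
  proof eventually_elim
    case (elim n)
    then have n: "n \<ge> 2" "n \<ge> 2 ^ j0" by auto
    obtain j where j: "2 ^ j \<le> n" "n < 2 ^ (j + 1)" using ex_power_ivl1[of 2 n] n(1) by auto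
    have "(2::nat) ^ j0 < 2 ^ (j + 1)" using n(2) j(2) by linarith
    then have "j0 \<le> j + 1" using power_less_imp_less_exp[of "2::nat" j0 "j + 1"] by simp
    then have "dist1 0 (X n) < int (reach \<epsilon> (2 ^ (j + 1)))" using j by (intro j0) auto
    then have "real_of_int (dist1 0 (X n)) \<le> real (2 ^ (j + 1)) powr (\<epsilon> / 2)"
    proof -
      have "real_of_int k \<le> y" if "k < int (nat \<lceil>y\<rceil>)" "0 \<le> y" for k y
        using that by (simp add: less_ceiling_iff)
      then show ?thesis using \<open>dist1 0 (X n) < _\<close> unfolding reach_def by (metis powr_ge_zero)
    qed
    also have "\<dots> \<le> (2 * real n) powr (\<epsilon> / 2)"
    proof (rule powr_mono2)
      have "2 ^ (j + 1) \<le> 2 * n" using j(1) by simp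
      then show "real (2 ^ (j + 1)) \<le> 2 * real n" by (metis of_nat_le_iff of_nat_mult of_nat_numeral)
    qed (use \<epsilon> in auto)
    finally have le: "euclid_norm (X n) \<le> (2 * real n) powr (\<epsilon> / 2)"
      using euclid_norm_le_dist1 order_trans by blast
    have ln2: "ln 2 \<le> ln (real n)" "ln (real n) > 0" using n(1) by auto
    have "ln (euclid_norm (X n)) \<le> \<epsilon> / 2 * ln (2 * real n)"
    proof (cases "euclid_norm (X n) = 0")
      case True
      then show ?thesis using \<epsilon> n(1) by simp
    next
      case False
      then have "euclid_norm (X n) > 0" by (simp add: euclid_norm_def)
      then have "ln (euclid_norm (X n)) \<le> ln ((2 * real n) powr (\<epsilon> / 2))" using le by (intro ln_mono)
      also have "\<dots> = \<epsilon> / 2 * ln (2 * real n)" by (rule ln_powr)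
      finally show ?thesis .
    qed
    also have "ln (2 * real n) = ln 2 + ln (real n)" using n(1) by (simp add: ln_mult)
    also have "\<epsilon> / 2 * (ln 2 + ln (real n)) \<le> \<epsilon> / 2 * (2 * ln (real n))"
      using \<epsilon> ln2(1) by (intro mult_left_mono) auto
    finally show ?case using ln2(2) by (simp add: divide_le_eq)
  qed
qed

theorem theorem1p4:
  fixes e :: "'d::finite" and u \<epsilon> :: real
  assumes "CARD('d) \<ge> 4" and "u > 0" and "\<epsilon> > 0"
  shows "\<exists>\<beta>0>1. \<forall>\<beta>\<ge>\<beta>0. \<forall>Q :: (int ^ 'd) set measure. interlacement_law u Q \<longrightarrow>
    (AE X in annealed_law e \<beta> Q.
      limsup (\<lambda>n. ereal (ln (euclid_norm (X n)) / ln (real n))) \<le> ereal \<epsilon>)"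
proof -
  obtain \<beta>0 where \<beta>0: "\<beta>0 > 1" and *: "\<forall>\<beta>\<ge>\<beta>0. \<exists>C\<ge>0. \<forall>\<^sub>F n in sequentially. \<forall>Q. interlacement_law u Q \<longrightarrow>
      (\<integral>\<^sup>+I. far_prob e \<beta> \<epsilon> n I \<partial>Q) \<le> ennreal (C * real n powr - (\<epsilon> / 8))"
    using far_decay[OF assms, of e] by blast
  show ?thesis
  proof (rule exI[of _ \<beta>0], intro conjI allI impI)
    fix \<beta> and Q :: "(int ^ 'd) set measure" assume \<beta>: "\<beta> \<ge> \<beta>0" and Q: "interlacement_law u Q"
    obtain C n0 where C: "C \<ge> 0" and n0: "\<And>n. n \<ge> n0 \<Longrightarrow>
        (\<integral>\<^sup>+I. far_prob e \<beta> \<epsilon> n I \<partial>Q) \<le> ennreal (C * real n powr - (\<epsilon> / 8))"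
      using * \<beta> Q unfolding eventually_sequentially by blast
    let ?A = "annealed_law e \<beta> Q"
    define B where "B j = {X :: nat \<Rightarrow> int ^ 'd. \<exists>t\<le>2 ^ j. int (reach \<epsilon> (2 ^ j)) \<le> dist1 0 (X t)}" for j
    define c where "c = C / measure Q {I. 0 \<in> I}"
    \<comment> \<open>Along dyadic times the polynomial bound becomes geometric and hence summable;
      along all \<open>n\<close> the power \<open>\<epsilon> / 8\<close> would be too small unless
      \<open>\<epsilon> > 8\<close>.\<close>
    define \<rho> :: real where "\<rho> = 2 powr - (\<epsilon> / 8)"
    have \<rho>: "0 \<le> \<rho>" "\<rho> < 1"
      using assms(3) powr_less_mono[of "- (\<epsilon> / 8)" 0 "2::real"] by (auto simp: \<rho>_def)
    have c: "c \<ge> 0" using C by (simp add: c_def)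
    have bound: "emeasure ?A (B j) \<le> ennreal (c * \<rho> ^ j)" if "j \<ge> n0" for j
    proof -
      have "j < 2 ^ j" by (rule less_exp)
      then have "n0 \<le> 2 ^ j" using that by linarith
      then have "emeasure ?A (B j) \<le> ennreal (C * real (2 ^ j) powr - (\<epsilon> / 8) / measure Q {I. 0 \<in> I})"
        unfolding B_def using \<beta> \<beta>0 C by (intro annealed_far[OF _ Q] n0) auto
      also have "real (2 ^ j) powr - (\<epsilon> / 8) = \<rho> ^ j"
        by (simp add: \<rho>_def powr_realpow[symmetric] powr_powr mult.commute)
      finally show ?thesis by (simp add: c_def)
    qed
    have "AE X in ?A. \<forall>\<^sub>F j in sequentially. X \<in> space ?A - B (j + n0)"
    proof (rule borel_cantelli_AE1)
      have sets: "sets ?A = sets (PiM UNIV (\<lambda>_. count_space UNIV))"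
      proof -
        have sQ: "sets Q = sets config_space" using Q by (simp add: interlacement_law_def)
        then have "space Q = UNIV" using sets_eq_imp_space_eq[OF sQ] by (simp add: config_space_def space_measure_of_conv)
        then show ?thesis unfolding annealed_law_def
          by (intro sets_bind) (auto simp: quenched_law_def sets_markov_law)
      qed
      show "B (j + n0) \<in> sets ?A" for j unfolding sets B_def by (rule measurable_far)
      show "emeasure ?A (B (j + n0)) < \<infinity>" for j using bound[of "j + n0"] by (simp add: le_less_trans)
      have "measure ?A (B (j + n0)) \<le> c * \<rho> ^ n0 * \<rho> ^ j" for j
      proof -
        have "measure ?A (B (j + n0)) \<le> c * \<rho> ^ (j + n0)"
          unfolding measure_def using c \<rho>(1) by (intro enn2real_leI bound mult_nonneg_nonneg) auto
        then show ?thesis by (simp only: power_add mult.assoc mult.commute[of "\<rho> ^ j"])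
      qed
      then have "norm (measure ?A (B (j + n0))) \<le> c * \<rho> ^ n0 * \<rho> ^ j" for j by simp
      moreover have "summable (\<lambda>j. c * \<rho> ^ n0 * \<rho> ^ j)" using \<rho> by (intro summable_mult summable_geometric) auto
      ultimately show "summable (\<lambda>j. measure ?A (B (j + n0)))"
        by (rule summable_comparison_test'[where N = 0, rotated])
    qed
    then show "AE X in ?A. limsup (\<lambda>n. ereal (ln (euclid_norm (X n)) / ln (real n))) \<le> ereal \<epsilon>"
    proof eventually_elim
      case (elim X)
      then have "\<forall>\<^sub>F j in sequentially. X \<notin> B (j + n0)" by (rule eventually_mono) simp
      then have "\<forall>\<^sub>F j in sequentially. X \<notin> B j"
        using eventually_sequentially_seg[of "\<lambda>j. X \<notin> B j" n0] by simp
      then show ?case unfolding B_def by (intro limsup_log_growth assms(3)) simp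
    qed
  qed (rule \<beta>0)
qed

end
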